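(* Let $A$ be an affinoid algebra over $\mathbf{C}_p$, let $X=\mathrm{Spm}\,A$ be the associated affinoid space, and let $X^{ad}$ and $X^{an}$ be the associated Huber adic space and Berkovich analytic space. Then: (1) the finite intersections of subsets of $X^{ad}\times X^{ad}$ of the form $(X^{ad}\times U)\cup((X^{ad}\setminus U)\times X^{ad})$, where $U$ runs through the rational domains in $X^{ad}$, generate (as a filter) the coarsest quasi-uniformity compatible with the topology of $X^{ad}$; (2) this quasi-uniformity is complete; (3) the canonical continuous map $X^{ad}\to X^{an}$ is (quasi-)uniformly continuous, where $X^{ad}$ carries the quasi-uniformity of (1) and the compact Hausdorff space $X^{an}$ carries its unique compatible uniformity. In particular, the quasi-uniformity on $X$ induced by that of $X^{ad}$ (via the inclusion $X\subset X^{ad}$), denoted $X_{(ad)}$, is precompact.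
   Context: Affinoid and adic spaces: an affinoid algebra $A$ over $\mathbf{C}_p$ is a quotient of a Tate algebra of convergent power series on a closed unit polydisk; $\mathrm{Spm}\,A$ is its maximal spectrum. $X^{an}$ is the Berkovich space of $A$: bounded (equivalently, continuous) multiplicative semi-norms of rank $1$ (real-valued), with its usual compact Hausdorff topology. $X^{ad}=\mathrm{Spa}(A,A^{\circ})$ is the Huber space of $A$: equivalence classes of continuous multiplicative semi-norms (valuations) of arbitrary rank which are $\le 1$ on the power-bounded elements $A^\circ$, with the topology generated by the rational domains. A rational domain is a subset $\{x : |f_i(x)|\le |g(x)|,\ i=1,\dots,n\}$ where $f_1,\dots,f_n,g\in A$ and $A=\sum_i A f_i$. The natural inclusion $X^{an}\to X^{ad}$ (not continuous in general) admits a canonical continuous retraction $X^{ad}\to X^{an}$, which makes $X^{an}$ the maximal Hausdorff quotient of $X^{ad}$. $X$ is regarded as a subset of $X^{an}$ and of $X^{ad}$. Quasi-uniformities: a quasi-uniformity on a set $Y$ is a filter $\mathcal{U}$ on $Y\times Y$ such that every $E\in\mathcal{U}$ contains the diagonal and for every $E\in\mathcal{U}$ there is $E'\in\mathcal{U}$ with $E'\circ E'\subset E$ (a uniformity is a quasi-uniformity that is moreover symmetric: $E\in\mathcal{U}$ iff $E^{-1}\in\mathcal{U}$). For $E\in\mathcal U$ and $x\in Y$, $E(x)=\{y\in Y : (x,y)\in E\}$, and for $Z\subset Y$, $E(Z)=\bigcup_{x\in Z}E(x)$. The induced topology on $Y$ is the one for which the $E(x)$, $E\in\mathcal{U}$,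 form a basis of neighborhoods of $x$; a quasi-uniformity is compatible with a given topology if it induces it. "Coarsest" means smallest as a filter. A map $f:Y\to Y'$ is (quasi-)uniformly continuous if $(f,f)^{-1}(E)$ is in the quasi-uniformity of $Y$ for every $E$ in that of $Y'$. A filter $\mathcal{F}$ on $Y$ is Cauchy if for all $E\in\mathcal{U}$ there is $x\in Y$ with $E(x)\in\mathcal{F}$; $Y$ is complete if every Cauchy filter has a cluster point; $Y$ is precompact if for every $E\in\mathcal{U}$ there is a finite $Z\subset Y$ with $Y=E(Z)$. *)

theory Defs
  imports
    "HOL-Analysis.Analysis"
    "HOL-Algebra.QuotRing"
    "HOL-Algebra.Generated_Groups"
    "HOL-Computational_Algebra.Polynomial"
    "HOL-Computational_Algebra.Primes"
    "HOL-Library.Poly_Mapping"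
begin

section \<open>Quasi-uniformities\<close>

text \<open>
  A filter on a set S is a library filter below \<open>principal S\<close>.  In the library order
  \<open>F \<le> G\<close> means that every member of G is a member of F, so the coarsest (smallest)
  filter of a family is its greatest element for \<open>\<le>\<close>.
\<close>

definition entourages :: "'y set \<Rightarrow> ('y \<times> 'y) filter \<Rightarrow> ('y \<times> 'y) set set" where
  "entourages Y U = {E. E \<subseteq> Y \<times> Y \<and> (\<forall>\<^sub>F z in U. z \<in> E)}"

definition quasi_uniformity_on :: "'y set \<Rightarrow> ('y \<times> 'y) filter \<Rightarrow> bool" where
  "quasi_uniformity_on Y U \<longleftrightarrow>
     U \<le> principal (Y \<times> Y) \<and>
     (\<forall>E\<in>entourages Y U. Id_on Y \<subseteq> E) \<and>
     (\<forall>E\<in>entourages Y U. \<exists>E'\<in>entourages Y U. E' O E' \<subseteq> E)"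

definition is_uniformity_on :: "'y set \<Rightarrow> ('y \<times> 'y) filter \<Rightarrow> bool" where
  "is_uniformity_on Y U \<longleftrightarrow>
     quasi_uniformity_on Y U \<and> (\<forall>E. E \<in> entourages Y U \<longleftrightarrow> E\<inverse> \<in> entourages Y U)"

text \<open>The set written \<open>E(x)\<close> is \<open>E `` {x}\<close>, and \<open>E(Z)\<close> is \<open>E `` Z\<close>.\<close>

definition compatible_with :: "'y topology \<Rightarrow> ('y \<times> 'y) filter \<Rightarrow> bool" where
  "compatible_with T U \<longleftrightarrow>
     (\<forall>x\<in>topspace T. \<forall>N\<subseteq>topspace T.
        (\<exists>V. openin T V \<and> x \<in> V \<and> V \<subseteq> N) \<longleftrightarrow>
        (\<exists>E\<in>entourages (topspace T) U. E `` {x} \<subseteq> N))"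

definition coarsest_compatible_quasi_uniformity ::
    "'y topology \<Rightarrow> ('y \<times> 'y) filter \<Rightarrow> bool" where
  "coarsest_compatible_quasi_uniformity T U \<longleftrightarrow>
     quasi_uniformity_on (topspace T) U \<and> compatible_with T U \<and>
     (\<forall>U'. quasi_uniformity_on (topspace T) U' \<and> compatible_with T U' \<longrightarrow> U' \<le> U)"

definition quasi_uniformly_continuous ::
    "'y set \<Rightarrow> ('y \<times> 'y) filter \<Rightarrow> 'z set \<Rightarrow> ('z \<times> 'z) filter \<Rightarrow> ('y \<Rightarrow> 'z) \<Rightarrow> bool" where
  "quasi_uniformly_continuous Y U Z W f \<longleftrightarrow>
     f \<in> Y \<rightarrow> Z \<and>
     (\<forall>E\<in>entourages Z W. {(x, y). x \<in> Y \<and> y \<in> Y \<and> (f x, f y) \<in> E} \<in> entourages Y U)"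

definition cauchy_filter_on :: "'y set \<Rightarrow> ('y \<times> 'y) filter \<Rightarrow> 'y filter \<Rightarrow> bool" where
  "cauchy_filter_on Y U F \<longleftrightarrow>
     F \<noteq> bot \<and> F \<le> principal Y \<and>
     (\<forall>E\<in>entourages Y U. \<exists>x\<in>Y. \<forall>\<^sub>F y in F. y \<in> E `` {x})"

definition complete_on :: "'y set \<Rightarrow> ('y \<times> 'y) filter \<Rightarrow> bool" where
  "complete_on Y U \<longleftrightarrow>
     (\<forall>F. cauchy_filter_on Y U F \<longrightarrow>
        (\<exists>x\<in>Y. \<forall>E\<in>entourages Y U. \<exists>\<^sub>F y in F. y \<in> E `` {x}))"

definition precompact_on :: "'y set \<Rightarrow> ('y \<times> 'y) filter \<Rightarrow> bool" where
  "precompact_on Y U \<longleftrightarrow> (\<forall>E\<in>entourages Y U. \<exists>Z\<subseteq>Y. finite Z \<and> E `` Z = Y)"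

text \<open>The filter on \<open>X \<times> X\<close> generated by the inverse images of the members of U under \<open>i \<times> i\<close>.\<close>

definition induced_quasi_uniformity ::
    "'x set \<Rightarrow> ('x \<Rightarrow> 'y) \<Rightarrow> ('y \<times> 'y) filter \<Rightarrow> ('x \<times> 'x) filter" where
  "induced_quasi_uniformity X i U = inf (filtercomap (map_prod i i) U) (principal (X \<times> X))"


section \<open>The field of \<open>p\<close>-adic complex numbers\<close>

definition nonarch_absolute_value :: "('k::field \<Rightarrow> real) \<Rightarrow> bool" where
  "nonarch_absolute_value av \<longleftrightarrow>
     (\<forall>x. 0 \<le> av x) \<and> (\<forall>x. av x = 0 \<longleftrightarrow> x = 0) \<and>
     (\<forall>x y. av (x * y) = av x * av y) \<and> (\<forall>x y. av (x + y) \<le> max (av x) (av y))"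

abbreviation av_topology :: "('k::field \<Rightarrow> real) \<Rightarrow> 'k topology" where
  "av_topology av \<equiv> Metric_space.mtopology UNIV (\<lambda>x y. av (x - y))"

text \<open>
  If \<open>|p| = 1/p\<close>, then \<open>|l| = 1\<close> for the other primes (by Bezout), so the absolute value
  restricts to the \<open>p\<close>-adic one on the rationals.  In a complete field the closure of the
  rationals is then the completion of the rationals at \<open>p\<close>.
\<close>

definition Qp_of :: "('k::field_char_0 \<Rightarrow> real) \<Rightarrow> 'k set" where
  "Qp_of av = av_topology av closure_of \<rat>"

definition Qp_bar_of :: "('k::field_char_0 \<Rightarrow> real) \<Rightarrow> 'k set" where
  "Qp_bar_of av = {x. \<exists>P. P \<noteq> 0 \<and> (\<forall>i. coeff P i \<in> Qp_of av) \<and> poly P x = 0}"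

text \<open>
  The field with its absolute value is a completion of an algebraic closure of a completion
  of the rationals at \<open>p\<close>; this determines it up to isometric isomorphism.
\<close>

definition is_Cp :: "nat \<Rightarrow> ('k::field_char_0 \<Rightarrow> real) \<Rightarrow> bool" where
  "is_Cp p av \<longleftrightarrow>
     nonarch_absolute_value av \<and>
     av (of_nat p) = 1 / real p \<and>
     Metric_space.mcomplete UNIV (\<lambda>x y. av (x - y)) \<and>
     (\<forall>P. (\<forall>i. coeff P i \<in> Qp_bar_of av) \<and> degree P > 0 \<longrightarrow> (\<exists>x\<in>Qp_bar_of av. poly P x = 0)) \<and>
     av_topology av closure_of Qp_bar_of av = UNIV"


section \<open>Tate algebras and affinoid algebras\<close>

text \<open>
  An element of the Tate algebra in \<open>n\<close> variables is given by its coefficients, indexed by the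
  multi-indices supported on \<open>{..<n}\<close>; they have to tend to zero.
\<close>

definition tate_algebra ::
    "('k::field \<Rightarrow> real) \<Rightarrow> nat \<Rightarrow> ((nat \<Rightarrow>\<^sub>0 nat) \<Rightarrow> 'k) ring" where
  "tate_algebra av n =
     \<lparr> carrier = {a. (\<forall>m. \<not> Poly_Mapping.keys m \<subseteq> {..<n} \<longrightarrow> a m = 0) \<and>
                     (\<forall>e>0. finite {m. e \<le> av (a m)})},
       mult = (\<lambda>a b m. \<Sum>(i, j)\<in>{(i, j). i + j = m}. a i * b j),
       one = (\<lambda>m. if m = 0 then 1 else 0),
       zero = (\<lambda>m. 0),
       add = (\<lambda>a b m. a m + b m) \<rparr>"

definition gauss_norm :: "('k::field \<Rightarrow> real) \<Rightarrow> ((nat \<Rightarrow>\<^sub>0 nat) \<Rightarrow> 'k) \<Rightarrow> real" where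
  "gauss_norm av a = (SUP m. av (a m))"

text \<open>The elements of a quotient ring are cosets, and the residue norm of a coset is the
  infimum of the Gauss norms of its elements.\<close>

definition residue_norm :: "('k::field \<Rightarrow> real) \<Rightarrow> ((nat \<Rightarrow>\<^sub>0 nat) \<Rightarrow> 'k) set \<Rightarrow> real" where
  "residue_norm av f = (INF a\<in>f. gauss_norm av a)"

definition affinoid_algebra ::
    "('k::field \<Rightarrow> real) \<Rightarrow> nat \<Rightarrow> ((nat \<Rightarrow>\<^sub>0 nat) \<Rightarrow> 'k) set \<Rightarrow> ((nat \<Rightarrow>\<^sub>0 nat) \<Rightarrow> 'k) set ring" where
  "affinoid_algebra av n I = tate_algebra av n Quot I"

definition affinoid_const ::
    "('k::field \<Rightarrow> real) \<Rightarrow> nat \<Rightarrow> ((nat \<Rightarrow>\<^sub>0 nat) \<Rightarrow> 'k) set \<Rightarrow> 'k \<Rightarrow> ((nat \<Rightarrow>\<^sub>0 nat) \<Rightarrow> 'k) set" where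
  "affinoid_const av n I c = I +>\<^bsub>tate_algebra av n\<^esub> (\<lambda>m. if m = 0 then c else 0)"


lemma finite_multi_index_splits: "finite {(i, j). i + j = (m :: nat \<Rightarrow>\<^sub>0 nat)}"
proof -
  have "finite {f. \<forall>x. (x \<in> Poly_Mapping.keys m \<longrightarrow> f x \<in> {..(\<Sum>k\<in>Poly_Mapping.keys m. Poly_Mapping.lookup m k)}) \<and>
                       (x \<notin> Poly_Mapping.keys m \<longrightarrow> f x = (0::nat))}" (is "finite ?S")
    by (rule finite_set_of_finite_funs) auto
  moreover have "Poly_Mapping.lookup ` {i. \<exists>j. i + j = m} \<subseteq> ?S"
  proof clarsimp
    fix i j x assume "m = i + j"
    have le: "Poly_Mapping.lookup i x \<le> Poly_Mapping.lookup (i + j) x" by (simp add: lookup_add)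
    moreover have "Poly_Mapping.lookup (i + j) x \<le> (\<Sum>k\<in>Poly_Mapping.keys (i+j). Poly_Mapping.lookup (i+j) k)"
      if "x \<in> Poly_Mapping.keys (i + j)"
      using that by (intro member_le_sum) auto
    ultimately show "(x \<in> Poly_Mapping.keys (i + j) \<longrightarrow> Poly_Mapping.lookup i x \<le> (\<Sum>k\<in>Poly_Mapping.keys (i+j). Poly_Mapping.lookup (i+j) k)) \<and>
        (x \<notin> Poly_Mapping.keys (i + j) \<longrightarrow> Poly_Mapping.lookup i x = 0)"
      by (metis (no_types, lifting) le_trans in_keys_iff le_zero_eq)
  qed
  ultimately have "finite (Poly_Mapping.lookup ` {i. \<exists>j. i + j = m})"
    using finite_subset by blast
  then have "finite {i. \<exists>j. i + j = m}"
    by (rule finite_imageD) (auto intro: inj_onI poly_mapping_eqI)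
  moreover have "fst ` {(i, j). i + j = m} = {i. \<exists>j. i + j = m}" by force
  ultimately have "finite (fst ` {(i, j). i + j = m})" by simp
  moreover have "inj_on fst {(i, j). i + j = m}" by (auto simp: inj_on_def)
  ultimately show ?thesis by (rule finite_imageD)
qed

lemma nonarch_sum_ge:
  assumes "nonarch_absolute_value av" "finite S" "e \<le> av (\<Sum>x\<in>S. h x)" "0 < e"
  shows "\<exists>x\<in>S. e \<le> av (h x)"
  using assms(2,3)
proof (induction S rule: finite_induct)
  case empty
  moreover have "av 0 = 0" using assms(1) unfolding nonarch_absolute_value_def by blast
  ultimately show ?case using assms(4) by simp
next
  case (insert x S)
  have "av (h x + sum h S) \<le> max (av (h x)) (av (sum h S))"
    using assms(1) unfolding nonarch_absolute_value_def by blast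
  then show ?case using insert by (force simp: max_def split: if_splits)
qed

lemma cring_tate_algebra:
  assumes av: "nonarch_absolute_value av"
  shows "cring (tate_algebra av n)"
proof -
  let ?T = "tate_algebra av n"
  let ?m = "\<lambda>a b m. \<Sum>(i, j)\<in>{(i, j). i + j = m}. a i * b j"
  have nn: "0 \<le> av x" and eq0: "av x = 0 \<longleftrightarrow> x = 0" and mul: "av (x * y) = av x * av y"
    and ultra: "av (x + y) \<le> max (av x) (av y)" for x y
    using av unfolding nonarch_absolute_value_def by blast+
  have "av (-1) * av (-1) = av 1" "av 1 * av 1 = av 1"
    using mul[of "-1" "-1"] mul[of 1 1] by simp_all
  moreover have "av 1 \<noteq> 0" by (simp add: eq0)
  ultimately have "av (-1) = 1"
    by (metis abs_of_nonneg mult_cancel_left2 nn one_power2 power2_eq_square real_sqrt_abs real_sqrt_one)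
  then have neg: "av (- x) = av x" for x using mul[of "-1" x] by simp
  have add_cl: "(\<lambda>m. a m + b m) \<in> carrier ?T" if a: "a \<in> carrier ?T" and b: "b \<in> carrier ?T" for a b
  proof -
    have "finite {m. e \<le> av (a m + b m)}" if "e > 0" for e
    proof (rule finite_subset)
      show "{m. e \<le> av (a m + b m)} \<subseteq> {m. e \<le> av (a m)} \<union> {m. e \<le> av (b m)}"
        using ultra le_max_iff_disj order_trans by fastforce
      show "finite ({m. e \<le> av (a m)} \<union> {m. e \<le> av (b m)})"
        using a b that by (auto simp: tate_algebra_def)
    qed
    then show ?thesis using a b by (auto simp: tate_algebra_def)
  qed
  have bdd: "\<exists>B>0. \<forall>m. av (a m) \<le> B" if a: "a \<in> carrier ?T" for a
  proof -
    have f: "finite {m. 1 \<le> av (a m)}" using a by (auto simp: tate_algebra_def)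
    show ?thesis
    proof (intro exI conjI allI)
      show "0 < (\<Sum>m\<in>{m. 1 \<le> av (a m)}. av (a m)) + 1" using nn by (simp add: add_nonneg_pos sum_nonneg)
      fix m
      show "av (a m) \<le> (\<Sum>m\<in>{m. 1 \<le> av (a m)}. av (a m)) + 1"
      proof (cases "1 \<le> av (a m)")
        case True
        then have "av (a m) \<le> (\<Sum>m\<in>{m. 1 \<le> av (a m)}. av (a m))"
          using f nn by (intro member_le_sum) auto
        then show ?thesis by simp
      next
        case False
        moreover have "0 \<le> (\<Sum>m\<in>{m. 1 \<le> av (a m)}. av (a m))" using nn by (simp add: sum_nonneg)
        ultimately show ?thesis by simp
      qed
    qed
  qed
  have mul_cl: "?m a b \<in> carrier ?T" if a: "a \<in> carrier ?T" and b: "b \<in> carrier ?T" for a b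
  proof -
    obtain M N where M: "M > 0" "\<And>m. av (a m) \<le> M" and N: "N > 0" "\<And>m. av (b m) \<le> N"
      using bdd[OF a] bdd[OF b] by blast
    have "finite {m. e \<le> av (?m a b m)}" if e: "e > 0" for e
    proof (rule finite_subset)
      let ?P = "{i. e / N \<le> av (a i)}" and ?Q = "{j. e / M \<le> av (b j)}"
      have "finite ?P" "finite ?Q" using a b e M N by (auto simp: tate_algebra_def)
      then show "finite ((\<lambda>(i, j). i + j) ` (?P \<times> ?Q))" by blast
      show "{m. e \<le> av (?m a b m)} \<subseteq> (\<lambda>(i, j). i + j) ` (?P \<times> ?Q)"
      proof
        fix m assume "m \<in> {m. e \<le> av (?m a b m)}"
        then obtain i j where ij: "i + j = m" "e \<le> av (a i) * av (b j)"
          using nonarch_sum_ge[OF av finite_multi_index_splits[of m], of e "\<lambda>(i,j). a i * b j"] e mul by auto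
        have "av (a i) * av (b j) \<le> av (a i) * N" "av (a i) * av (b j) \<le> M * av (b j)"
          using M N nn by (auto intro: mult_mono)
        then have "i \<in> ?P" "j \<in> ?Q" using ij M N by (auto simp: field_simps)
        then show "m \<in> (\<lambda>(i, j). i + j) ` (?P \<times> ?Q)" using ij by force
      qed
    qed
    moreover have "?m a b m = 0" if m: "\<not> Poly_Mapping.keys m \<subseteq> {..<n}" for m
    proof (rule sum.neutral, clarify)
      fix i j assume "m = i + j"
      then have "\<not> Poly_Mapping.keys i \<subseteq> {..<n} \<or> \<not> Poly_Mapping.keys j \<subseteq> {..<n}"
        using m Poly_Mapping.keys_add[of i j] by blast
      then show "a i * b j = 0" using a b by (auto simp: tate_algebra_def)
    qed
    ultimately show ?thesis by (auto simp: tate_algebra_def)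
  qed
  have one_cl: "(\<lambda>m. if m = 0 then 1 else 0) \<in> carrier ?T"
  proof -
    have "{m::nat \<Rightarrow>\<^sub>0 nat. e \<le> av (if m = 0 then 1 else 0)} \<subseteq> {0}" if "e > 0" for e
      using that eq0[of 0] by (auto split: if_splits)
    then have "finite {m::nat \<Rightarrow>\<^sub>0 nat. e \<le> av (if m = 0 then 1 else 0)}" if "e > 0" for e
      using that finite_subset by blast
    then show ?thesis by (auto simp: tate_algebra_def)
  qed
  have comm: "?m a b = ?m b a" for a b :: "(nat \<Rightarrow>\<^sub>0 nat) \<Rightarrow> 'a"
    by (rule ext, rule sum.reindex_bij_witness[of _ prod.swap prod.swap])
      (auto simp: add.commute mult.commute)
  have assoc: "?m (?m a b) c = ?m a (?m b c)" for a b c :: "(nat \<Rightarrow>\<^sub>0 nat) \<Rightarrow> 'a"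
  proof
    fix m
    have "?m (?m a b) c m =
        (\<Sum>q\<in>(SIGMA x:{(i, j). i + j = m}. {(k, l). k + l = fst x}). (case q of ((i, j), (k, l)) \<Rightarrow> a k * b l * c j))"
      by (subst sum.Sigma[symmetric])
        (auto simp: finite_multi_index_splits sum_distrib_right case_prod_beta intro!: sum.cong)
    also have "\<dots> = (\<Sum>q\<in>(SIGMA x:{(i, j). i + j = m}. {(k, l). k + l = snd x}). (case q of ((i, j), (k, l)) \<Rightarrow> a i * (b k * c l)))"
      by (rule sum.reindex_bij_witness[of _ "\<lambda>((i, j), (k, l)). ((i + k, l), (i, k))" "\<lambda>((i, j), (k, l)). ((k, l + j), (l, j))"])
        (auto simp: algebra_simps)
    also have "\<dots> = ?m a (?m b c) m"
      by (subst sum.Sigma[symmetric])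
        (auto simp: finite_multi_index_splits sum_distrib_left case_prod_beta intro!: sum.cong)
    finally show "?m (?m a b) c m = ?m a (?m b c) m" .
  qed
  have l_one: "?m (\<lambda>m. if m = 0 then 1 else 0) a = a" for a :: "(nat \<Rightarrow>\<^sub>0 nat) \<Rightarrow> 'a"
  proof
    fix m
    have "(\<Sum>(i, j)\<in>{(0 :: nat \<Rightarrow>\<^sub>0 nat, m)}. (if i = 0 then 1 else 0) * a j) = ?m (\<lambda>m. if m = 0 then 1 else 0) a m"
      by (rule sum.mono_neutral_left[OF finite_multi_index_splits]) (auto split: if_splits)
    then show "?m (\<lambda>m. if m = 0 then 1 else 0) a m = a m" by simp
  qed
  have distr: "?m (\<lambda>m. a m + b m) c = (\<lambda>m. ?m a c m + ?m b c m)" for a b c :: "(nat \<Rightarrow>\<^sub>0 nat) \<Rightarrow> 'a"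
    by (rule ext) (simp add: algebra_simps sum.distrib case_prod_beta)
  note T = tate_algebra_def
  show ?thesis
  proof (rule cringI)
    show "abelian_group ?T"
    proof (rule abelian_groupI)
      fix x assume x: "x \<in> carrier ?T"
      show "\<exists>y\<in>carrier ?T. y \<oplus>\<^bsub>?T\<^esub> x = \<zero>\<^bsub>?T\<^esub>"
        by (rule bexI[of _ "\<lambda>m. - x m"]) (use x in \<open>auto simp: T neg\<close>)
    next
      show "\<zero>\<^bsub>?T\<^esub> \<in> carrier ?T" using eq0[of 0] by (auto simp: T)
    qed (use add_cl in \<open>auto simp: T algebra_simps\<close>)
    show "Group.comm_monoid ?T"
    proof (rule comm_monoidI)
      show "x \<otimes>\<^bsub>?T\<^esub> y \<in> carrier ?T" if "x \<in> carrier ?T" "y \<in> carrier ?T" for x y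
        using mul_cl[OF that] by (simp add: T)
      show "\<one>\<^bsub>?T\<^esub> \<in> carrier ?T" using one_cl by (simp add: T)
      show "(x \<otimes>\<^bsub>?T\<^esub> y) \<otimes>\<^bsub>?T\<^esub> z = x \<otimes>\<^bsub>?T\<^esub> (y \<otimes>\<^bsub>?T\<^esub> z)" for x y z
        using assoc by (simp add: T)
      show "\<one>\<^bsub>?T\<^esub> \<otimes>\<^bsub>?T\<^esub> x = x" for x
        using l_one by (simp add: T)
      show "x \<otimes>\<^bsub>?T\<^esub> y = y \<otimes>\<^bsub>?T\<^esub> x" for x y
        using comm by (simp add: T)
    qed
    show "(x \<oplus>\<^bsub>?T\<^esub> y) \<otimes>\<^bsub>?T\<^esub> z = x \<otimes>\<^bsub>?T\<^esub> z \<oplus>\<^bsub>?T\<^esub> y \<otimes>\<^bsub>?T\<^esub> z" for x y z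
      using distr by (simp add: T)
  qed
qed

lemma cring_affinoid_algebra:
  assumes "nonarch_absolute_value av" "ideal I (tate_algebra av n)"
  shows "cring (affinoid_algebra av n I)"
  unfolding affinoid_algebra_def
  by (rule ideal.quotient_is_cring[OF assms(2) cring_tate_algebra[OF assms(1)]])


section \<open>Valuations of arbitrary rank\<close>

record 'g ordered_group = "'g monoid" +
  group_le :: "'g \<Rightarrow> 'g \<Rightarrow> bool"

locale ordered_abelian_group = comm_group G for G :: "'g ordered_group" (structure) +
  assumes group_le_antisym:
      "\<lbrakk>x \<in> carrier G; y \<in> carrier G; group_le G x y; group_le G y x\<rbrakk> \<Longrightarrow> x = y"
    and group_le_trans:
      "\<lbrakk>x \<in> carrier G; y \<in> carrier G; z \<in> carrier G; group_le G x y; group_le G y z\<rbrakk>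
        \<Longrightarrow> group_le G x z"
    and group_le_total:
      "\<lbrakk>x \<in> carrier G; y \<in> carrier G\<rbrakk> \<Longrightarrow> group_le G x y \<or> group_le G y x"
    and group_le_mult:
      "\<lbrakk>x \<in> carrier G; y \<in> carrier G; z \<in> carrier G; group_le G x y\<rbrakk>
        \<Longrightarrow> group_le G (x \<otimes> z) (y \<otimes> z)"

text \<open>The ordered monoid \<open>G \<union> {0}\<close>, with \<open>None\<close> in the role of \<open>0\<close>.\<close>

fun val_le :: "'g ordered_group \<Rightarrow> 'g option \<Rightarrow> 'g option \<Rightarrow> bool" where
  "val_le G None _ = True"
| "val_le G (Some x) None = False"
| "val_le G (Some x) (Some y) = group_le G x y"

fun val_mult :: "'g ordered_group \<Rightarrow> 'g option \<Rightarrow> 'g option \<Rightarrow> 'g option" where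
  "val_mult G (Some x) (Some y) = Some (x \<otimes>\<^bsub>G\<^esub> y)"
| "val_mult G _ _ = None"

definition is_valuation :: "'a ring \<Rightarrow> 'g ordered_group \<Rightarrow> ('a \<Rightarrow> 'g option) \<Rightarrow> bool" where
  "is_valuation A G v \<longleftrightarrow>
     ordered_abelian_group G \<and>
     v \<in> carrier A \<rightarrow> insert None (Some ` carrier G) \<and>
     v \<zero>\<^bsub>A\<^esub> = None \<and> v \<one>\<^bsub>A\<^esub> = Some \<one>\<^bsub>G\<^esub> \<and>
     (\<forall>f\<in>carrier A. \<forall>g\<in>carrier A. v (f \<otimes>\<^bsub>A\<^esub> g) = val_mult G (v f) (v g)) \<and>
     (\<forall>f\<in>carrier A. \<forall>g\<in>carrier A.
        val_le G (v (f \<oplus>\<^bsub>A\<^esub> g)) (v f) \<or> val_le G (v (f \<oplus>\<^bsub>A\<^esub> g)) (v g))"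

text \<open>The value group is generated by the nonzero values; it may be smaller than G.\<close>

definition value_group :: "'a ring \<Rightarrow> 'g ordered_group \<Rightarrow> ('a \<Rightarrow> 'g option) \<Rightarrow> 'g set" where
  "value_group A G v = generate G {x. \<exists>f\<in>carrier A. v f = Some x}"

definition norm_open :: "'a ring \<Rightarrow> ('a \<Rightarrow> real) \<Rightarrow> 'a set \<Rightarrow> bool" where
  "norm_open A N S \<longleftrightarrow>
     S \<subseteq> carrier A \<and> (\<forall>f\<in>S. \<exists>e>0. \<forall>g\<in>carrier A. N (g \<ominus>\<^bsub>A\<^esub> f) < e \<longrightarrow> g \<in> S)"

definition continuous_valuation ::
    "'a ring \<Rightarrow> ('a \<Rightarrow> real) \<Rightarrow> 'g ordered_group \<Rightarrow> ('a \<Rightarrow> 'g option) \<Rightarrow> bool" where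
  "continuous_valuation A N G v \<longleftrightarrow>
     is_valuation A G v \<and>
     (\<forall>x\<in>value_group A G v. norm_open A N {f\<in>carrier A. \<not> val_le G (Some x) (v f)})"

definition power_bounded :: "'a ring \<Rightarrow> ('a \<Rightarrow> real) \<Rightarrow> 'a set" where
  "power_bounded A N = {f\<in>carrier A. \<exists>C. \<forall>k::nat. N (f [^]\<^bsub>A\<^esub> k) \<le> C}"


section \<open>The Huber space\<close>

text \<open>
  The equivalence classes below consist of valuations whose values lie in one fixed type.  No
  point is lost: the element x of a value group can be replaced by the set of the
  pairs \<open>(f, g)\<close> with \<open>v f = x * v g \<noteq> 0\<close> (lemma \<open>huber_valuation_any_type\<close> below).
\<close>

type_synonym 'a valuation = "('a \<times> 'a) set ordered_group \<times> ('a \<Rightarrow> ('a \<times> 'a) set option)"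

definition huber_valuations :: "'a ring \<Rightarrow> ('a \<Rightarrow> real) \<Rightarrow> 'a valuation set" where
  "huber_valuations A N =
     {(G, v). continuous_valuation A N G v \<and>
              (\<forall>f\<in>power_bounded A N. val_le G (v f) (Some \<one>\<^bsub>G\<^esub>))}"

definition huber_equiv :: "'a ring \<Rightarrow> ('a \<Rightarrow> real) \<Rightarrow> ('a valuation \<times> 'a valuation) set" where
  "huber_equiv A N =
     {((G, v), (H, w)). (G, v) \<in> huber_valuations A N \<and> (H, w) \<in> huber_valuations A N \<and>
        (\<forall>f\<in>carrier A. \<forall>g\<in>carrier A. val_le G (v f) (v g) \<longleftrightarrow> val_le H (w f) (w g))}"

definition adic_space :: "'a ring \<Rightarrow> ('a \<Rightarrow> real) \<Rightarrow> 'a valuation set set" where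
  "adic_space A N = huber_valuations A N // huber_equiv A N"

lemma huber_valuation_any_type:
  fixes G :: "'g ordered_group"
  assumes A: "ring A" and cv: "continuous_valuation A N G v"
    and pb: "\<forall>f\<in>power_bounded A N. val_le G (v f) (Some \<one>\<^bsub>G\<^esub>)"
  shows "{(H, w) \<in> huber_valuations A N.
            \<forall>f\<in>carrier A. \<forall>g\<in>carrier A. val_le H (w f) (w g) \<longleftrightarrow> val_le G (v f) (v g)}
          \<in> adic_space A N"
proof -
  interpret A: ring A by fact
  have "ordered_abelian_group G"
    and v_cl: "v \<in> carrier A \<rightarrow> insert None (Some ` carrier G)"
    and v0: "v \<zero>\<^bsub>A\<^esub> = None" and v1: "v \<one>\<^bsub>A\<^esub> = Some \<one>\<^bsub>G\<^esub>"
    and vm: "\<And>f g. f \<in> carrier A \<Longrightarrow> g \<in> carrier A \<Longrightarrow> v (f \<otimes>\<^bsub>A\<^esub> g) = val_mult G (v f) (v g)"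
    and va: "\<And>f g. f \<in> carrier A \<Longrightarrow> g \<in> carrier A \<Longrightarrow>
        val_le G (v (f \<oplus>\<^bsub>A\<^esub> g)) (v f) \<or> val_le G (v (f \<oplus>\<^bsub>A\<^esub> g)) (v g)"
    using cv by (simp_all add: continuous_valuation_def is_valuation_def)
  interpret G: ordered_abelian_group G by fact
  define S where "S = value_group A G v"
  have val_G: "x \<in> carrier G" if "f \<in> carrier A" "v f = Some x" for f x
    using v_cl that by (force simp: Pi_iff)
  have "subgroup S G"
    unfolding S_def value_group_def using val_G by (intro G.generate_is_subgroup) auto
  then interpret S: subgroup S G .
  have v_S: "v f \<in> insert None (Some ` S)" if "f \<in> carrier A" for f
    using that by (cases "v f") (auto simp: S_def value_group_def intro: generate.incl)
  have ex: "\<exists>f\<in>carrier A. \<exists>g\<in>carrier A. \<exists>b\<in>carrier G. v g = Some b \<and> v f = Some (x \<otimes>\<^bsub>G\<^esub> b)"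
    if "x \<in> S" for x
    using that unfolding S_def value_group_def
  proof (induction rule: generate.induct)
    case one
    show ?case
      by (intro bexI[of _ "\<one>\<^bsub>A\<^esub>"] bexI[of _ "\<one>\<^bsub>G\<^esub>"]) (auto simp: v1)
  next
    case (incl h)
    then obtain f where f: "f \<in> carrier A" "v f = Some h" by auto
    then show ?case
      by (intro bexI[of _ f] bexI[of _ "\<one>\<^bsub>A\<^esub>"] bexI[of _ "\<one>\<^bsub>G\<^esub>"]) (auto simp: v1 val_G)
  next
    case (inv h)
    then obtain f where f: "f \<in> carrier A" "v f = Some h" by auto
    then show ?case
      by (intro bexI[of _ f] bexI[of _ "\<one>\<^bsub>A\<^esub>"] bexI[of _ h]) (auto simp: v1 val_G)
  next
    case (eng h1 h2)
    from eng.IH(1) obtain f1 g1 b1 where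
      1: "f1 \<in> carrier A" "g1 \<in> carrier A" "b1 \<in> carrier G" "v g1 = Some b1" "v f1 = Some (h1 \<otimes>\<^bsub>G\<^esub> b1)"
      by blast
    from eng.IH(2) obtain f2 g2 b2 where
      2: "f2 \<in> carrier A" "g2 \<in> carrier A" "b2 \<in> carrier G" "v g2 = Some b2" "v f2 = Some (h2 \<otimes>\<^bsub>G\<^esub> b2)"
      by blast
    have "h1 \<in> S" "h2 \<in> S"
      using eng.hyps unfolding S_def value_group_def by blast+
    then have h: "h1 \<in> carrier G" "h2 \<in> carrier G" using S.mem_carrier by blast+
    have "v (f1 \<otimes>\<^bsub>A\<^esub> f2) = Some (h1 \<otimes>\<^bsub>G\<^esub> h2 \<otimes>\<^bsub>G\<^esub> (b1 \<otimes>\<^bsub>G\<^esub> b2))"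
      using 1 2 h by (simp add: vm G.m_ac)
    moreover have "v (g1 \<otimes>\<^bsub>A\<^esub> g2) = Some (b1 \<otimes>\<^bsub>G\<^esub> b2)"
      using 1 2 by (simp add: vm)
    ultimately show ?case using 1 2 A.m_closed G.m_closed by blast
  qed
  define \<phi> where "\<phi> x = {(f, g). f \<in> carrier A \<and> g \<in> carrier A \<and>
      (\<exists>b\<in>carrier G. v g = Some b \<and> v f = Some (x \<otimes>\<^bsub>G\<^esub> b))}" for x
  have inj: "inj_on \<phi> S"
  proof (rule inj_onI)
    fix x y assume xy: "x \<in> S" "y \<in> S" "\<phi> x = \<phi> y"
    obtain f g b where fg: "f \<in> carrier A" "g \<in> carrier A" "b \<in> carrier G" "v g = Some b" "v f = Some (x \<otimes>\<^bsub>G\<^esub> b)"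
      using ex[OF xy(1)] by blast
    then have "(f, g) \<in> \<phi> y" unfolding xy(3)[symmetric] by (auto simp: \<phi>_def)
    then have "x \<otimes>\<^bsub>G\<^esub> b = y \<otimes>\<^bsub>G\<^esub> b" using fg by (auto simp: \<phi>_def)
    then show "x = y" using fg xy by (simp add: S.mem_carrier)
  qed
  define \<psi> where "\<psi> = the_inv_into S \<phi>"
  have \<psi>\<phi>: "\<psi> (\<phi> x) = x" if "x \<in> S" for x
    unfolding \<psi>_def using the_inv_into_f_f[OF inj that] .
  define H :: "('a \<times> 'a) set ordered_group" where
    "H = \<lparr> carrier = \<phi> ` S, mult = (\<lambda>x y. \<phi> (\<psi> x \<otimes>\<^bsub>G\<^esub> \<psi> y)), one = \<phi> \<one>\<^bsub>G\<^esub>,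
           group_le = (\<lambda>x y. group_le G (\<psi> x) (\<psi> y)) \<rparr>"
  define w where "w f = map_option \<phi> (v f)" for f
  have "Group.comm_group H"
  proof (rule comm_groupI)
    show "\<exists>y\<in>carrier H. y \<otimes>\<^bsub>H\<^esub> x = \<one>\<^bsub>H\<^esub>" if x: "x \<in> carrier H" for x
    proof -
      obtain s where s: "s \<in> S" "x = \<phi> s" using x unfolding H_def by auto
      then show ?thesis
        by (intro bexI[of _ "\<phi> (inv\<^bsub>G\<^esub> s)"]) (auto simp: H_def \<psi>\<phi> S.mem_carrier)
    qed
  qed (auto simp: H_def \<psi>\<phi> S.mem_carrier G.m_ac)
  then have oH: "ordered_abelian_group H"
  proof (rule ordered_abelian_group.intro)
    show "ordered_abelian_group_axioms H"
    proof
      fix x y z assume "x \<in> carrier H" "y \<in> carrier H" "z \<in> carrier H" "group_le H x y" "group_le H y z"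
      then show "group_le H x z"
        using G.group_le_trans[of "\<psi> x" "\<psi> y" "\<psi> z"] by (auto simp: H_def \<psi>\<phi> S.mem_carrier)
    next
      fix x y assume "x \<in> carrier H" "y \<in> carrier H" "group_le H x y" "group_le H y x"
      then show "x = y"
        using G.group_le_antisym[of "\<psi> x" "\<psi> y"] by (auto simp: H_def \<psi>\<phi> S.mem_carrier)
    next
      fix x y assume "x \<in> carrier H" "y \<in> carrier H"
      then show "group_le H x y \<or> group_le H y x"
        using G.group_le_total[of "\<psi> x" "\<psi> y"] by (auto simp: H_def \<psi>\<phi> S.mem_carrier)
    next
      fix x y z assume "x \<in> carrier H" "y \<in> carrier H" "z \<in> carrier H" "group_le H x y"
      then show "group_le H (x \<otimes>\<^bsub>H\<^esub> z) (y \<otimes>\<^bsub>H\<^esub> z)"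
        using G.group_le_mult[of "\<psi> x" "\<psi> y" "\<psi> z"] by (auto simp: H_def \<psi>\<phi> S.mem_carrier)
    qed
  qed
  interpret H: ordered_abelian_group H by fact
  have le: "val_le H (map_option \<phi> s) (map_option \<phi> t) \<longleftrightarrow> val_le G s t"
    if "s \<in> insert None (Some ` S)" "t \<in> insert None (Some ` S)" for s t
    using that by (auto simp: H_def \<psi>\<phi>)
  have mult: "val_mult H (map_option \<phi> s) (map_option \<phi> t) = map_option \<phi> (val_mult G s t)"
    if "s \<in> insert None (Some ` S)" "t \<in> insert None (Some ` S)" for s t
    using that by (auto simp: H_def \<psi>\<phi>)
  have w_cl: "w f \<in> insert None (Some ` carrier H)" if "f \<in> carrier A" for f
    using v_S[OF that] by (auto simp: w_def H_def)
  have le_w: "val_le H (w f) (w g) \<longleftrightarrow> val_le G (v f) (v g)"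
    if "f \<in> carrier A" "g \<in> carrier A" for f g
    unfolding w_def by (rule le[OF v_S[OF that(1)] v_S[OF that(2)]])
  have "is_valuation A H w"
    unfolding is_valuation_def
  proof (intro conjI ballI)
    show "w (f \<otimes>\<^bsub>A\<^esub> g) = val_mult H (w f) (w g)" if "f \<in> carrier A" "g \<in> carrier A" for f g
      unfolding w_def by (simp only: vm[OF that] mult[OF v_S[OF that(1)] v_S[OF that(2)]])
    show "val_le H (w (f \<oplus>\<^bsub>A\<^esub> g)) (w f) \<or> val_le H (w (f \<oplus>\<^bsub>A\<^esub> g)) (w g)"
      if "f \<in> carrier A" "g \<in> carrier A" for f g
      using va[OF that] that by (simp only: le_w A.add.m_closed)
  qed (use oH w_cl in \<open>auto simp: w_def v0 v1 H_def\<close>)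
  moreover have "norm_open A N {f \<in> carrier A. \<not> val_le H (Some x) (w f)}"
    if x: "x \<in> value_group A H w" for x
  proof -
    have "value_group A H w \<subseteq> carrier H"
      unfolding value_group_def by (intro H.generate_incl) (auto dest: w_cl)
    then obtain s where s: "s \<in> S" "x = \<phi> s" using x unfolding H_def by auto
    have "val_le H (Some x) (w f) \<longleftrightarrow> val_le G (Some s) (v f)" if "f \<in> carrier A" for f
      unfolding w_def using le[of "Some s" "v f"] v_S[OF that] s by simp
    then have "{f \<in> carrier A. \<not> val_le H (Some x) (w f)} = {f \<in> carrier A. \<not> val_le G (Some s) (v f)}"
      by auto
    then show ?thesis using cv s by (simp add: continuous_valuation_def S_def)
  qed
  ultimately have "continuous_valuation A N H w" by (simp add: continuous_valuation_def)
  moreover have "val_le H (w f) (Some \<one>\<^bsub>H\<^esub>)" if "f \<in> power_bounded A N" for f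
    using le_w[of f "\<one>\<^bsub>A\<^esub>"] pb that v1 by (auto simp: power_bounded_def w_def H_def)
  ultimately have Hw: "(H, w) \<in> huber_valuations A N" by (simp add: huber_valuations_def)
  then have "huber_equiv A N `` {(H, w)} = {(H, w) \<in> huber_valuations A N.
            \<forall>f\<in>carrier A. \<forall>g\<in>carrier A. val_le H (w f) (w g) \<longleftrightarrow> val_le G (v f) (v g)}"
    using le_w by (auto simp: huber_equiv_def)
  then show ?thesis
    using Hw unfolding adic_space_def by (metis (no_types, lifting) quotientI)
qed

text \<open>\<open>ad_le x f g\<close> stands for \<open>|f(x)| \<le> |g(x)|\<close>; it does not depend on the representative.\<close>

definition ad_le :: "'a valuation set \<Rightarrow> 'a \<Rightarrow> 'a \<Rightarrow> bool" where
  "ad_le x f g \<longleftrightarrow> (\<exists>(G, v)\<in>x. val_le G (v f) (v g))"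

definition rational_domains :: "'a ring \<Rightarrow> ('a \<Rightarrow> real) \<Rightarrow> 'a valuation set set set" where
  "rational_domains A N =
     {{x \<in> adic_space A N. \<forall>f\<in>F. ad_le x f g} | F g.
        finite F \<and> F \<subseteq> carrier A \<and> g \<in> carrier A \<and> Idl\<^bsub>A\<^esub> F = carrier A}"

definition adic_topology :: "'a ring \<Rightarrow> ('a \<Rightarrow> real) \<Rightarrow> 'a valuation set topology" where
  "adic_topology A N = topology_generated_by (rational_domains A N)"

lemma adic_space_rational:
  assumes "ring A"
  shows "adic_space A N \<in> rational_domains A N"
proof -
  interpret ring A by fact
  have "ad_le x \<one>\<^bsub>A\<^esub> \<one>\<^bsub>A\<^esub>" if x: "x \<in> adic_space A N" for x
  proof -
    obtain q where q: "q \<in> huber_valuations A N" "x = huber_equiv A N `` {q}"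
      using x unfolding adic_space_def by (rule quotientE)
    obtain G v where "q = (G, v)" by (cases q)
    with q have Gv: "(G, v) \<in> huber_valuations A N" "x = huber_equiv A N `` {(G, v)}" by simp_all
    then have "(G, v) \<in> x" by (auto simp: huber_equiv_def)
    have "ordered_abelian_group G" "v \<one>\<^bsub>A\<^esub> = Some \<one>\<^bsub>G\<^esub>"
      using Gv by (auto simp: huber_valuations_def continuous_valuation_def is_valuation_def)
    moreover from this(1) interpret ordered_abelian_group G .
    have "group_le G \<one>\<^bsub>G\<^esub> \<one>\<^bsub>G\<^esub>" using group_le_total by blast
    ultimately have "val_le G (v \<one>\<^bsub>A\<^esub>) (v \<one>\<^bsub>A\<^esub>)" by simp
    with \<open>(G, v) \<in> x\<close> show ?thesis unfolding ad_le_def by blast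
  qed
  then have "adic_space A N = {x \<in> adic_space A N. \<forall>f\<in>{\<one>\<^bsub>A\<^esub>}. ad_le x f \<one>\<^bsub>A\<^esub>}" by auto
  moreover have "Idl\<^bsub>A\<^esub> {\<one>\<^bsub>A\<^esub>} = carrier A" using genideal_one .
  ultimately show ?thesis unfolding rational_domains_def
    by (intro CollectI exI[of _ "{\<one>\<^bsub>A\<^esub>}"] exI[of _ "\<one>\<^bsub>A\<^esub>"] conjI) auto
qed

lemma topspace_adic_topology:
  assumes "ring A"
  shows "topspace (adic_topology A N) = adic_space A N"
proof -
  have "\<Union> (rational_domains A N) \<subseteq> adic_space A N" by (auto simp: rational_domains_def)
  then show ?thesis using adic_space_rational[OF assms, of N]
    by (auto simp: adic_topology_def topology_generated_by_topspace)
qed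

definition rational_entourage ::
    "'a ring \<Rightarrow> ('a \<Rightarrow> real) \<Rightarrow> 'a valuation set set \<Rightarrow> ('a valuation set \<times> 'a valuation set) set" where
  "rational_entourage A N U =
     adic_space A N \<times> U \<union> (adic_space A N - U) \<times> adic_space A N"

text \<open>The infimum of these principal filters is the filter generated by the finite
  intersections of the sets in question.\<close>

definition adic_quasi_uniformity ::
    "'a ring \<Rightarrow> ('a \<Rightarrow> real) \<Rightarrow> ('a valuation set \<times> 'a valuation set) filter" where
  "adic_quasi_uniformity A N =
     (INF U\<in>rational_domains A N. principal (rational_entourage A N U))"


lemma entourages_adic_quasi_uniformity:
  "entourages (adic_space A N) (adic_quasi_uniformity A N) =
     {E. E \<subseteq> adic_space A N \<times> adic_space A N \<and>
         (\<exists>\<U>\<subseteq>rational_domains A N. finite \<U> \<and> (\<Inter>U\<in>\<U>. rational_entourage A N U) \<subseteq> E)}"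
proof -
  have *: "(\<forall>\<^sub>F z in INF U\<in>\<U>. principal (rational_entourage A N U). z \<in> E) \<longleftrightarrow>
          (\<Inter>U\<in>\<U>. rational_entourage A N U) \<subseteq> E" if "finite \<U>" for \<U> E
    unfolding INF_principal_finite[OF that] eventually_principal subset_eq ..
  have "(\<forall>\<^sub>F z in adic_quasi_uniformity A N. z \<in> E) \<longleftrightarrow>
      (\<exists>\<U>\<subseteq>rational_domains A N. finite \<U> \<and> (\<Inter>U\<in>\<U>. rational_entourage A N U) \<subseteq> E)" for E
    unfolding adic_quasi_uniformity_def by (subst eventually_INF) (simp only: * cong: conj_cong)
  then show ?thesis by (simp only: entourages_def)
qed


section \<open>The Berkovich space\<close>

definition berkovich_space :: "'a ring \<Rightarrow> ('a \<Rightarrow> real) \<Rightarrow> ('a \<Rightarrow> real) set" where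
  "berkovich_space A N =
     {y \<in> extensional (carrier A).
        (\<forall>f\<in>carrier A. 0 \<le> y f) \<and> y \<zero>\<^bsub>A\<^esub> = 0 \<and> y \<one>\<^bsub>A\<^esub> = 1 \<and>
        (\<forall>f\<in>carrier A. \<forall>g\<in>carrier A. y (f \<otimes>\<^bsub>A\<^esub> g) = y f * y g) \<and>
        (\<forall>f\<in>carrier A. \<forall>g\<in>carrier A. y (f \<oplus>\<^bsub>A\<^esub> g) \<le> max (y f) (y g)) \<and>
        (\<exists>C. \<forall>f\<in>carrier A. y f \<le> C * N f)}"

text \<open>The coarsest topology making the evaluations at the elements of A continuous.\<close>

definition berkovich_topology :: "'a ring \<Rightarrow> ('a \<Rightarrow> real) \<Rightarrow> ('a \<Rightarrow> real) topology" where
  "berkovich_topology A N =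
     subtopology (product_topology (\<lambda>_. euclideanreal) (carrier A)) (berkovich_space A N)"

lemma topspace_berkovich_topology:
  "topspace (berkovich_topology A N) = berkovich_space A N"
  by (auto simp: berkovich_topology_def berkovich_space_def PiE_def)


section \<open>The maps between the three spaces\<close>

definition an_to_ad :: "'a ring \<Rightarrow> ('a \<Rightarrow> real) \<Rightarrow> ('a \<Rightarrow> real) \<Rightarrow> 'a valuation set" where
  "an_to_ad A N y =
     {(G, v) \<in> huber_valuations A N.
        \<forall>f\<in>carrier A. \<forall>g\<in>carrier A. val_le G (v f) (v g) \<longleftrightarrow> y f \<le> y g}"

text \<open>
  Here \<open>\<kappa>\<close> is the structure map from the ground field to A.  The retraction sends a valuation
  to its rank one generization, normalised to extend the absolute value of the ground field;
  as the values of the ground field are dense in the positive reals, the value of f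
  is the infimum of the \<open>|c|\<close> with \<open>|f(x)| \<le> |c(x)|\<close>.
\<close>

definition ad_to_an ::
    "'a ring \<Rightarrow> ('k \<Rightarrow> real) \<Rightarrow> ('k \<Rightarrow> 'a) \<Rightarrow> 'a valuation set \<Rightarrow> 'a \<Rightarrow> real" where
  "ad_to_an A av \<kappa> x = (\<lambda>f\<in>carrier A. INF c\<in>{c. ad_le x f (\<kappa> c)}. av c)"

definition Spm :: "'a ring \<Rightarrow> 'a set set" where
  "Spm A = {M. maximalideal M A}"

text \<open>
  By the Nullstellensatz, and since the ground field is algebraically closed, it maps
  isomorphically onto \<open>A/M\<close>.  So \<open>f(M)\<close> is the unique c with \<open>f - \<kappa> c \<in> M\<close>.
\<close>

definition spm_eval :: "'a ring \<Rightarrow> ('k \<Rightarrow> 'a) \<Rightarrow> 'a \<Rightarrow> 'a set \<Rightarrow> 'k" where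
  "spm_eval A \<kappa> f M = (THE c. f \<ominus>\<^bsub>A\<^esub> \<kappa> c \<in> M)"

definition spm_to_an :: "'a ring \<Rightarrow> ('k \<Rightarrow> real) \<Rightarrow> ('k \<Rightarrow> 'a) \<Rightarrow> 'a set \<Rightarrow> 'a \<Rightarrow> real" where
  "spm_to_an A av \<kappa> M = (\<lambda>f\<in>carrier A. av (spm_eval A \<kappa> f M))"

definition spm_to_ad ::
    "'a ring \<Rightarrow> ('a \<Rightarrow> real) \<Rightarrow> ('k \<Rightarrow> real) \<Rightarrow> ('k \<Rightarrow> 'a) \<Rightarrow> 'a set \<Rightarrow> 'a valuation set" where
  "spm_to_ad A N av \<kappa> M = an_to_ad A N (spm_to_an A av \<kappa> M)"

end

theory Submission
  imports Defs
begin

text \<open>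
For a rational domain \<open>U\<close> of \<open>X\<^sup>a\<^sup>d\<close> the set \<open>(X\<^sup>a\<^sup>d \<times> U) \<union> ((X\<^sup>a\<^sup>d - U) \<times> X\<^sup>a\<^sup>d)\<close> consists of the pairs
\<open>(x, y)\<close> such that \<open>x \<in> U\<close> implies \<open>y \<in> U\<close>.  It is a preorder, so these sets generate a quasi-uniformity
(the Pervin quasi-uniformity of the family of rational domains), and its topology is the one generated by
the rational domains.  Everything else in the first three parts is a consequence of compactness.
If \<open>U\<close> is open and quasi-compact, then every compatible quasi-uniformity contains the
entourage of \<open>U\<close>, by the argument of the Lebesgue number lemma (\<open>compactin_square_entourage\<close>); this gives the
coarsest one.  In a quasi-compact space every filter has a cluster point, and a continuous map
from a quasi-compact space to a uniform space is uniformly continuous.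

Rational domains are quasi-compact for the following reason (\<open>compactin_rational_domain\<close>).  A point of \<open>X\<^sup>a\<^sup>d\<close>
is the same as a preorder \<open>|f| \<le> |g|\<close> on \<open>A\<close>.  The preorders which come from valuations with \<open>|f| \<le> 1\<close> for power-bounded
\<open>f\<close> and \<open>|\<pi>| < 1\<close> for a fixed small constant \<open>\<pi>\<close> form a closed subset of the compact space \<open>2\<^bsup>A \<times> A\<^esup>\<close>.  They need not
be continuous, because powers of \<open>\<pi>\<close> need not become arbitrarily small.  Replacing by zero all values that are smaller than every power
of \<open>\<pi>\<close> makes them continuous.  This operation does not change the rational
inequalities \<open>|f\<^sub>1|, \<dots>, |f\<^sub>n| \<le> |g|\<close>, where the \<open>f\<^sub>i\<close> generate the unit ideal, as these bound \<open>|g|\<close> from below.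
So each rational domain is a continuous image of a compact set.

The Berkovich space is compact by Tychonoff's theorem, and its uniformity is that of pointwise
convergence.  The retraction sends a point \<open>x\<close> to the function \<open>f \<mapsto> inf {|c| : |f(x)| \<le> |c|}\<close>.  It is continuous
since its sub- and superlevel sets are unions of the rational domains \<open>|f| \<le> |c|\<close> and \<open>|c| \<le> |f|\<close>; here the
absolute values of constants have to be dense in the positive reals.

Precompactness of the maximal spectrum is formal once its points are known to lie in \<open>X\<^sup>a\<^sup>d\<close>, that is, once
\<open>A/M\<close> is the ground field for each maximal ideal \<open>M\<close>.  This is the Nullstellensatz for Tate algebras
(\<open>tate_nullstellensatz\<close>).  It is proved without Weierstrass division.  The field \<open>K = A/M\<close> is complete and the unit ball is generated, modulo
some constant of absolute value less than one, by polynomials in elements \<open>t\<^sub>1, \<dots>, t\<^sub>d\<close> and finitely many module generators.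
By successive approximation \<open>K\<close> is finite over a ring \<open>S\<close> of limits of polynomials, so \<open>S\<close> is a field (\<open>subring_inverse_if_finite\<close>).
If \<open>d > 0\<close>, the inverse of \<open>t\<^sub>1\<close> in \<open>S\<close> yields a polynomial with largest coefficient of absolute value one which
is small at \<open>t\<close>.  Nagata's substitution makes it monic in one variable up to small terms, and this
variable can be eliminated (\<open>elimination_of_variable\<close>).  When no variable is left, \<open>K\<close> is finite over the ground field,
which is algebraically closed as the completion of an algebraically closed field.
\<close>

section \<open>Pervin quasi-uniformities and compactness\<close>

definition implication_entourage :: "'y set \<Rightarrow> 'y set \<Rightarrow> ('y \<times> 'y) set" where
  "implication_entourage Y U = Y \<times> U \<union> (Y - U) \<times> Y"

text \<open>
The generators are preorders, hence equal to their own squares under composition.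
\<close>

definition pervin :: "'y set \<Rightarrow> 'y set set \<Rightarrow> ('y \<times> 'y) filter" where
  "pervin Y \<R> = (INF U\<in>\<R>. principal (implication_entourage Y U))"

lemma implication_entourage_iff:
  "U \<subseteq> Y \<Longrightarrow> (x, y) \<in> implication_entourage Y U \<longleftrightarrow> x \<in> Y \<and> y \<in> Y \<and> (x \<in> U \<longrightarrow> y \<in> U)"
  by (auto simp: implication_entourage_def)

lemma eventually_pervin:
  "(\<forall>\<^sub>F z in pervin Y \<R>. z \<in> E) \<longleftrightarrow>
     (\<exists>\<U>\<subseteq>\<R>. finite \<U> \<and> (\<Inter>U\<in>\<U>. implication_entourage Y U) \<subseteq> E)"
proof -
  have *: "(\<forall>\<^sub>F z in INF U\<in>\<U>. principal (implication_entourage Y U). z \<in> E) \<longleftrightarrow>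
          (\<Inter>U\<in>\<U>. implication_entourage Y U) \<subseteq> E" if "finite \<U>" for \<U>
    unfolding INF_principal_finite[OF that] eventually_principal subset_eq ..
  show ?thesis unfolding pervin_def by (subst eventually_INF) (simp only: * cong: conj_cong)
qed

lemma entourages_pervin:
  "E \<in> entourages Y (pervin Y \<R>) \<longleftrightarrow> E \<subseteq> Y \<times> Y \<and>
     (\<exists>\<U>\<subseteq>\<R>. finite \<U> \<and> (\<Inter>U\<in>\<U>. implication_entourage Y U) \<subseteq> E)"
  unfolding entourages_def mem_Collect_eq eventually_pervin ..

lemma implication_entourage_in_pervin:
  assumes "U \<in> \<R>" "U \<subseteq> Y"
  shows "implication_entourage Y U \<in> entourages Y (pervin Y \<R>)"
  unfolding entourages_pervin
proof (intro conjI exI[of _ "{U}"])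
  show "implication_entourage Y U \<subseteq> Y \<times> Y"
    using assms by (auto simp: implication_entourage_def)
qed (use assms in simp_all)

lemma finite_Inter_in_pervin:
  assumes "Y \<in> \<R>" "\<U> \<subseteq> \<R>" "finite \<U>"
  shows "Y \<times> Y \<inter> (\<Inter>U\<in>\<U>. implication_entourage Y U) \<in> entourages Y (pervin Y \<R>)"
proof -
  have "implication_entourage Y Y = Y \<times> Y" by (auto simp: implication_entourage_def)
  \<comment> \<open>The empty family has the whole type as its intersection, so \<open>Y\<close> is added to it.\<close>
  then have "(\<Inter>U\<in>insert Y \<U>. implication_entourage Y U) = Y \<times> Y \<inter> (\<Inter>U\<in>\<U>. implication_entourage Y U)"
    by simp
  moreover have "insert Y \<U> \<subseteq> \<R>" "finite (insert Y \<U>)" using assms by simp_all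
  ultimately show ?thesis unfolding entourages_pervin by (metis Int_lower1 order_refl)
qed

lemma entourages_finite_Int:
  assumes "finite J" "\<And>j. j \<in> J \<Longrightarrow> E j \<in> entourages Y U" "Y \<times> Y \<in> entourages Y U"
  shows "Y \<times> Y \<inter> (\<Inter>j\<in>J. E j) \<in> entourages Y U"
proof -
  have "\<forall>\<^sub>F z in U. \<forall>j\<in>J. z \<in> E j"
    using assms(1,2) by (intro eventually_ball_finite) (simp_all add: entourages_def)
  moreover have "\<forall>\<^sub>F z in U. z \<in> Y \<times> Y" using assms(3) by (simp add: entourages_def)
  ultimately have "\<forall>\<^sub>F z in U. z \<in> Y \<times> Y \<inter> (\<Inter>j\<in>J. E j)"
    by eventually_elim blast
  then show ?thesis by (simp add: entourages_def Int_lower1)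
qed

lemma entourages_whole:
  assumes "U \<le> principal (Y \<times> Y)"
  shows "Y \<times> Y \<in> entourages Y U"
  using assms by (auto simp: entourages_def le_principal)

lemma entourages_mono:
  assumes "E \<in> entourages Y U" "E \<subseteq> E'" "E' \<subseteq> Y \<times> Y"
  shows "E' \<in> entourages Y U"
  using assms by (auto simp: entourages_def elim: eventually_mono)

lemma quasi_uniformity_on_pervin:
  assumes Y: "Y \<in> \<R>" and sub: "\<And>U. U \<in> \<R> \<Longrightarrow> U \<subseteq> Y"
  shows "quasi_uniformity_on Y (pervin Y \<R>)"
  unfolding quasi_uniformity_on_def
proof (intro conjI ballI)
  have "implication_entourage Y Y = Y \<times> Y" by (auto simp: implication_entourage_def)
  then have "\<forall>\<^sub>F z in pervin Y \<R>. z \<in> Y \<times> Y"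
    using implication_entourage_in_pervin[OF Y order_refl] by (simp add: entourages_def)
  then show "pervin Y \<R> \<le> principal (Y \<times> Y)" by (simp add: le_principal)
next
  fix E assume "E \<in> entourages Y (pervin Y \<R>)"
  then obtain \<U> where \<U>: "\<U> \<subseteq> \<R>" "finite \<U>" "(\<Inter>U\<in>\<U>. implication_entourage Y U) \<subseteq> E"
    and EY: "E \<subseteq> Y \<times> Y" unfolding entourages_pervin by blast
  have "(x, x) \<in> (\<Inter>U\<in>\<U>. implication_entourage Y U)" if "x \<in> Y" for x
    using that \<U>(1) sub by (auto simp: implication_entourage_def)
  then show "Id_on Y \<subseteq> E" using \<U>(3) by auto
  let ?E = "Y \<times> Y \<inter> (\<Inter>U\<in>\<U>. implication_entourage Y U)"
  have "?E \<in> entourages Y (pervin Y \<R>)" using Y \<U> by (intro finite_Inter_in_pervin)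
  moreover have "?E O ?E \<subseteq> (\<Inter>U\<in>\<U>. implication_entourage Y U)"
    by (auto simp: implication_entourage_def)
  ultimately show "\<exists>E'\<in>entourages Y (pervin Y \<R>). E' O E' \<subseteq> E"
    using order_trans[OF _ \<U>(3)] by (intro bexI[of _ ?E])
qed

lemma generated_nbhd:
  assumes Y: "Y \<in> \<R>" and sub: "\<And>U. U \<in> \<R> \<Longrightarrow> U \<subseteq> Y"
    and V: "openin (topology_generated_by \<R>) V" "x \<in> V"
  obtains \<U> where "\<U> \<subseteq> \<R>" "finite \<U>" "x \<in> \<Inter>\<U>" "Y \<inter> \<Inter>\<U> \<subseteq> V"
proof -
  have "generate_topology_on \<R> V" using V(1) by (simp add: openin_topology_generated_by_iff)
  then have "\<exists>\<U>\<subseteq>\<R>. finite \<U> \<and> x \<in> \<Inter>\<U> \<and> Y \<inter> \<Inter>\<U> \<subseteq> V"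
    using V(2)
  proof (induction rule: generate_topology_on.induct)
    case Empty
    then show ?case by simp
  next
    case (Int a b)
    obtain \<U> \<V> where "\<U>\<subseteq>\<R>" "finite \<U>" "x \<in> \<Inter>\<U>" "Y \<inter> \<Inter>\<U> \<subseteq> a" "\<V>\<subseteq>\<R>" "finite \<V>" "x \<in> \<Inter>\<V>" "Y \<inter> \<Inter>\<V> \<subseteq> b"
      using Int by (metis IntE)
    then show ?case by (intro exI[of _ "\<U> \<union> \<V>"]) auto
  next
    case (UN K)
    then show ?case by (meson UnionE Union_upper order_trans)
  next
    case (Basis s)
    then show ?case by (intro exI[of _ "{s}"]) auto
  qed
  then show thesis using that by blast
qed

lemma finite_Inter_openin:
  assumes "finite \<U>" "\<And>U. U \<in> \<U> \<Longrightarrow> openin T U"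
  shows "openin T (topspace T \<inter> \<Inter>\<U>)"
  using assms by (induction \<U> rule: finite_induct) (auto simp: Int_left_commute intro: openin_Int)

lemma compatible_with_pervin:
  assumes Y: "Y \<in> \<R>" and sub: "\<And>U. U \<in> \<R> \<Longrightarrow> U \<subseteq> Y"
  shows "compatible_with (topology_generated_by \<R>) (pervin Y \<R>)"
proof -
  have top: "topspace (topology_generated_by \<R>) = Y"
    using assms by (auto simp: topology_generated_by_topspace)
  show ?thesis
    unfolding compatible_with_def top
  proof (intro ballI allI impI iffI)
    fix x N assume x: "x \<in> Y" and N: "N \<subseteq> Y"
      and "\<exists>V. openin (topology_generated_by \<R>) V \<and> x \<in> V \<and> V \<subseteq> N"
    then obtain V where V: "openin (topology_generated_by \<R>) V" "x \<in> V" "V \<subseteq> N" by blast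
    obtain \<U> where \<U>: "\<U> \<subseteq> \<R>" "finite \<U>" "x \<in> \<Inter>\<U>" "Y \<inter> \<Inter>\<U> \<subseteq> V"
      using generated_nbhd[OF Y sub V(1,2)] by blast
    let ?E = "Y \<times> Y \<inter> (\<Inter>U\<in>\<U>. implication_entourage Y U)"
    have "?E \<in> entourages Y (pervin Y \<R>)" using Y \<U> by (intro finite_Inter_in_pervin)
    moreover have "?E `` {x} \<subseteq> Y \<inter> \<Inter>\<U>"
      using \<U>(3) by (auto simp: implication_entourage_def)
    ultimately show "\<exists>E\<in>entourages Y (pervin Y \<R>). E `` {x} \<subseteq> N"
      using V(3) \<U>(4) by (intro bexI[of _ ?E] order_trans[OF _ V(3)] order_trans[OF _ \<U>(4)])
  next
    fix x N assume x: "x \<in> Y" and N: "N \<subseteq> Y"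
      and "\<exists>E\<in>entourages Y (pervin Y \<R>). E `` {x} \<subseteq> N"
    then obtain E where E: "E \<in> entourages Y (pervin Y \<R>)" "E `` {x} \<subseteq> N" by blast
    then obtain \<U> where
      \<U>: "\<U> \<subseteq> \<R>" "finite \<U>" "(\<Inter>U\<in>\<U>. implication_entourage Y U) \<subseteq> E"
      unfolding entourages_pervin by blast
    let ?V = "Y \<inter> \<Inter>{U\<in>\<U>. x \<in> U}"
    have "openin (topology_generated_by \<R>) ?V"
      using finite_Inter_openin[of "{U\<in>\<U>. x \<in> U}" "topology_generated_by \<R>"] \<U>
      unfolding top by (auto intro: topology_generated_by_Basis)
    moreover have "?V \<subseteq> E `` {x}"
    proof
      fix y assume "y \<in> ?V"
      then have "(x, y) \<in> (\<Inter>U\<in>\<U>. implication_entourage Y U)"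
        using x \<U>(1) sub by (auto simp: implication_entourage_def)
      then show "y \<in> E `` {x}" using \<U>(3) by blast
    qed
    ultimately show "\<exists>V. openin (topology_generated_by \<R>) V \<and> x \<in> V \<and> V \<subseteq> N"
      using x E(2) by (intro exI[of _ ?V]) auto
  qed
qed

lemma compatible_with_interior:
  assumes U: "quasi_uniformity_on (topspace T) U" "compatible_with T U"
    and x: "x \<in> topspace T" and E: "E \<in> entourages (topspace T) U"
  obtains V where "openin T V" "x \<in> V" "V \<subseteq> E `` {x}"
proof -
  have "E `` {x} \<subseteq> topspace T" using E by (auto simp: entourages_def)
  then show thesis using U(2) x E that unfolding compatible_with_def by blast
qed

lemma compatible_with_openin:
  assumes "compatible_with T U" "openin T V" "x \<in> V"
  obtains E where "E \<in> entourages (topspace T) U" "E `` {x} \<subseteq> V"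
proof -
  have "V \<subseteq> topspace T" using assms(2) by (rule openin_subset)
  then show thesis using assms that unfolding compatible_with_def by blast
qed

text \<open>
The Lebesgue number lemma for quasi-uniformities: entourages chosen at the points of a compact set can be
replaced by a single one.  Halve each of them, and take the finite intersection that belongs to a finite
subcover.
\<close>

lemma compactin_square_entourage:
  assumes U: "quasi_uniformity_on (topspace T) U" "compatible_with T U"
    and K: "compactin T K"
    and E: "\<And>x. x \<in> K \<Longrightarrow> E x \<in> entourages (topspace T) U"
  obtains D where "D \<in> entourages (topspace T) U"
    "\<And>a b. a \<in> K \<Longrightarrow> (a, b) \<in> D \<Longrightarrow> \<exists>x\<in>K. (x, a) \<in> E x \<and> (x, b) \<in> E x"
proof -
  let ?Y = "topspace T"
  have "\<forall>x\<in>K. \<exists>E'\<in>entourages ?Y U. E' O E' \<subseteq> E x"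
    using U(1) E unfolding quasi_uniformity_on_def by blast
  then obtain E' where E': "\<And>x. x \<in> K \<Longrightarrow> E' x \<in> entourages ?Y U" "\<And>x. x \<in> K \<Longrightarrow> E' x O E' x \<subseteq> E x"
    by metis
  have KY: "K \<subseteq> ?Y" using K by (rule compactin_subset_topspace)
  have "\<forall>x\<in>K. \<exists>V. openin T V \<and> x \<in> V \<and> V \<subseteq> E' x `` {x}"
    using compatible_with_interior[OF U] E'(1) KY by (metis subsetD)
  then obtain V where V: "\<And>x. x \<in> K \<Longrightarrow> openin T (V x)" "\<And>x. x \<in> K \<Longrightarrow> x \<in> V x"
    "\<And>x. x \<in> K \<Longrightarrow> V x \<subseteq> E' x `` {x}" by metis
  have "(\<forall>U\<in>V ` K. openin T U) \<and> K \<subseteq> \<Union> (V ` K)"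
    using V(1,2) by blast
  then have "\<exists>\<F>. finite \<F> \<and> \<F> \<subseteq> V ` K \<and> K \<subseteq> \<Union>\<F>"
    using K unfolding compactin_def by blast
  then obtain J where J: "finite J" "J \<subseteq> K" "K \<subseteq> (\<Union>x\<in>J. V x)"
    by (metis finite_subset_image)
  let ?D = "?Y \<times> ?Y \<inter> (\<Inter>x\<in>J. E' x)"
  have "?Y \<times> ?Y \<in> entourages ?Y U"
    using U(1) by (intro entourages_whole) (simp add: quasi_uniformity_on_def)
  then have "?D \<in> entourages ?Y U"
    using J E'(1) by (intro entourages_finite_Int) auto
  moreover have "\<exists>x\<in>K. (x, a) \<in> E x \<and> (x, b) \<in> E x" if a: "a \<in> K" and ab: "(a, b) \<in> ?D" for a b
  proof -
    obtain x where x: "x \<in> J" "a \<in> V x" using J(3) a by blast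
    then have xK: "x \<in> K" using J(2) by blast
    have xa: "(x, a) \<in> E' x" using V(3)[OF xK] x(2) by blast
    moreover have "(a, b) \<in> E' x" using ab x(1) by blast
    ultimately have "(x, b) \<in> E x" using E'(2)[OF xK] by blast
    moreover have "(a, a) \<in> E' x"
      using U(1) E'(1)[OF xK] a KY unfolding quasi_uniformity_on_def by blast
    then have "(x, a) \<in> E x" using xa E'(2)[OF xK] by blast
    ultimately show ?thesis using xK by blast
  qed
  ultimately show thesis using that by blast
qed

text \<open>
The entourage of a compact open set \<open>U\<close> belongs to every compatible \<open>U'\<close>: each point \<open>x\<close> of \<open>U\<close> has an entourage
\<open>E x\<close> of \<open>U'\<close> whose section at \<open>x\<close> lies in \<open>U\<close>, and compactness makes this uniform in \<open>x\<close>.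
\<close>

theorem pervin_coarsest_compatible:
  assumes Y: "Y \<in> \<R>" and sub: "\<And>U. U \<in> \<R> \<Longrightarrow> U \<subseteq> Y"
    and cpt: "\<And>U. U \<in> \<R> \<Longrightarrow> compactin (topology_generated_by \<R>) U"
  shows "coarsest_compatible_quasi_uniformity (topology_generated_by \<R>) (pervin Y \<R>)"
proof -
  let ?T = "topology_generated_by \<R>"
  have top: "topspace ?T = Y"
    using Y sub by (auto simp: topology_generated_by_topspace)
  show ?thesis
    unfolding coarsest_compatible_quasi_uniformity_def top
  proof (intro conjI allI impI)
    show "quasi_uniformity_on Y (pervin Y \<R>)" using Y sub by (rule quasi_uniformity_on_pervin)
    show "compatible_with ?T (pervin Y \<R>)" using Y sub by (rule compatible_with_pervin)
    fix U' assume "quasi_uniformity_on Y U' \<and> compatible_with ?T U'"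
    then have U': "quasi_uniformity_on (topspace ?T) U'" "compatible_with ?T U'" unfolding top by blast+
    show "U' \<le> pervin Y \<R>"
      unfolding pervin_def
    proof (rule INF_greatest)
      fix U assume U: "U \<in> \<R>"
      have "\<forall>x\<in>U. \<exists>E\<in>entourages Y U'. E `` {x} \<subseteq> U"
        using U'(2) sub[OF U] topology_generated_by_Basis[OF U] unfolding compatible_with_def top
        by blast
      then obtain E where E: "\<And>x. x \<in> U \<Longrightarrow> E x \<in> entourages (topspace ?T) U'" "\<And>x. x \<in> U \<Longrightarrow> E x `` {x} \<subseteq> U"
        unfolding top by metis
      obtain D where D: "D \<in> entourages (topspace ?T) U'"
        "\<And>a b. a \<in> U \<Longrightarrow> (a, b) \<in> D \<Longrightarrow> \<exists>x\<in>U. (x, a) \<in> E x \<and> (x, b) \<in> E x"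
        using compactin_square_entourage[where E = E, OF U' cpt[OF U] E(1)] by blast
      have "D \<subseteq> implication_entourage Y U"
      proof clarify
        fix a b assume ab: "(a, b) \<in> D"
        then have "a \<in> Y" "b \<in> Y" using D(1) unfolding top entourages_def by blast+
        moreover have "b \<in> U" if "a \<in> U" using D(2)[OF that ab] E(2) by blast
        ultimately show "(a, b) \<in> implication_entourage Y U"
          using implication_entourage_iff[OF sub[OF U]] by blast
      qed
      then have "\<forall>\<^sub>F z in U'. z \<in> implication_entourage Y U"
        using D(1) by (auto simp: entourages_def elim: eventually_mono)
      then show "U' \<le> principal (implication_entourage Y U)" by (simp add: le_principal)
    qed
  qed
qed

text \<open>
If no point is a cluster point, then each point has a neighbourhood that the filter avoids, and finitely
many of these cover the space.
\<close>

lemma compatible_with_compact_complete: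
  assumes U: "quasi_uniformity_on (topspace T) U" "compatible_with T U" and T: "compact_space T"
  shows "complete_on (topspace T) U"
  unfolding complete_on_def
proof (intro allI impI, rule ccontr)
  fix F assume F: "cauchy_filter_on (topspace T) U F"
    and "\<not> (\<exists>x\<in>topspace T. \<forall>E\<in>entourages (topspace T) U. \<exists>\<^sub>F y in F. y \<in> E `` {x})"
  then have "\<forall>x\<in>topspace T. \<exists>E\<in>entourages (topspace T) U. \<forall>\<^sub>F y in F. y \<notin> E `` {x}"
    by (auto simp: frequently_def)
  then obtain E where E: "\<And>x. x \<in> topspace T \<Longrightarrow> E x \<in> entourages (topspace T) U"
    "\<And>x. x \<in> topspace T \<Longrightarrow> \<forall>\<^sub>F y in F. y \<notin> E x `` {x}" by metis
  have "\<forall>x\<in>topspace T. \<exists>V. openin T V \<and> x \<in> V \<and> V \<subseteq> E x `` {x}"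
    using compatible_with_interior[OF U] E(1) by metis
  then obtain V where V: "\<And>x. x \<in> topspace T \<Longrightarrow> openin T (V x)" "\<And>x. x \<in> topspace T \<Longrightarrow> x \<in> V x"
    "\<And>x. x \<in> topspace T \<Longrightarrow> V x \<subseteq> E x `` {x}" by metis
  have "(\<forall>U\<in>V ` topspace T. openin T U) \<and> topspace T \<subseteq> \<Union> (V ` topspace T)"
    using V(1,2) by blast
  then have "\<exists>\<F>. finite \<F> \<and> \<F> \<subseteq> V ` topspace T \<and> topspace T \<subseteq> \<Union>\<F>"
    using T unfolding compact_space_alt by blast
  then obtain J where J: "finite J" "J \<subseteq> topspace T" "topspace T \<subseteq> (\<Union>x\<in>J. V x)"
    by (metis finite_subset_image)
  have "\<forall>\<^sub>F y in F. \<forall>x\<in>J. y \<notin> E x `` {x}"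
    using J E(2) by (intro eventually_ball_finite) auto
  moreover have "\<forall>\<^sub>F y in F. y \<in> topspace T"
    using F by (simp add: cauchy_filter_on_def le_principal)
  ultimately have "\<forall>\<^sub>F y in F. False"
    by eventually_elim (use J V(3) in blast)
  then show False using F by (simp add: cauchy_filter_on_def eventually_False)
qed

text \<open>
Two points close to a common \<open>x\<close> have images close to \<open>f x\<close>, and the symmetry of the target makes these
images close to each other.
\<close>

lemma continuous_map_quasi_uniformly_continuous:
  assumes U: "quasi_uniformity_on (topspace S) U" "compatible_with S U" and S: "compact_space S"
    and W: "is_uniformity_on (topspace T) W" "compatible_with T W"
    and f: "continuous_map S T f"
  shows "quasi_uniformly_continuous (topspace S) U (topspace T) W f"
  unfolding quasi_uniformly_continuous_def
proof (intro conjI ballI)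
  show fST: "f \<in> topspace S \<rightarrow> topspace T" using f by (rule continuous_map_funspace)
  have W': "quasi_uniformity_on (topspace T) W" using W(1) by (simp add: is_uniformity_on_def)
  fix E assume "E \<in> entourages (topspace T) W"
  then obtain E1 where E1: "E1 \<in> entourages (topspace T) W" "E1 O E1 \<subseteq> E"
    using W' unfolding quasi_uniformity_on_def by blast
  let ?E = "E1 \<inter> E1\<inverse>"
  have "E1\<inverse> \<in> entourages (topspace T) W" using W(1) E1(1) by (simp add: is_uniformity_on_def)
  then have E2: "?E \<in> entourages (topspace T) W"
    using E1(1) by (auto simp: entourages_def eventually_conj_iff)
  have "\<forall>x\<in>topspace S. \<exists>D. D \<in> entourages (topspace S) U \<and> D `` {x} \<subseteq> {y \<in> topspace S. (f x, f y) \<in> ?E}"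
  proof
    fix x assume x: "x \<in> topspace S"
    obtain V where V: "openin T V" "f x \<in> V" "V \<subseteq> ?E `` {f x}"
      using compatible_with_interior[OF W' W(2) _ E2, of "f x"] fST x by blast
    then have "openin S {y \<in> topspace S. f y \<in> V}" using f by (auto simp: continuous_map_def)
    then obtain D where "D \<in> entourages (topspace S) U" "D `` {x} \<subseteq> {y \<in> topspace S. f y \<in> V}"
      using compatible_with_openin[OF U(2), of _ x] V(2) x by (metis (mono_tags, lifting) mem_Collect_eq)
    moreover have "{y \<in> topspace S. f y \<in> V} \<subseteq> {y \<in> topspace S. (f x, f y) \<in> ?E}"
      using V(3) by blast
    ultimately show "\<exists>D. D \<in> entourages (topspace S) U \<and> D `` {x} \<subseteq> {y \<in> topspace S. (f x, f y) \<in> ?E}"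
      by (meson order_trans)
  qed
  from bchoice[OF this] obtain D where D0: "\<forall>x\<in>topspace S. D x \<in> entourages (topspace S) U \<and>
      D x `` {x} \<subseteq> {y \<in> topspace S. (f x, f y) \<in> ?E}" ..
  have D: "D x \<in> entourages (topspace S) U" "D x `` {x} \<subseteq> {y \<in> topspace S. (f x, f y) \<in> ?E}"
    if "x \<in> topspace S" for x
    using D0 that by simp_all
  obtain D' where D': "D' \<in> entourages (topspace S) U"
    "\<And>a b. a \<in> topspace S \<Longrightarrow> (a, b) \<in> D' \<Longrightarrow> \<exists>x\<in>topspace S. (x, a) \<in> D x \<and> (x, b) \<in> D x"
    using compactin_square_entourage[OF U, of "topspace S" D] S D(1) by (auto simp: compact_space_def)
  have "D' \<subseteq> {(x, y). x \<in> topspace S \<and> y \<in> topspace S \<and> (f x, f y) \<in> E}"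
  proof clarify
    fix a b assume ab: "(a, b) \<in> D'"
    then have abS: "a \<in> topspace S" "b \<in> topspace S" using D'(1) by (auto simp: entourages_def)
    then obtain x where x: "x \<in> topspace S" "(x, a) \<in> D x" "(x, b) \<in> D x" using D'(2) ab by blast
    then have "(f x, f a) \<in> ?E" "(f x, f b) \<in> ?E" using D(2)[of x] by blast+
    then have "(f a, f b) \<in> E" using E1(2) by blast
    with abS show "a \<in> topspace S \<and> b \<in> topspace S \<and> (f a, f b) \<in> E" by blast
  qed
  then show "{(x, y). x \<in> topspace S \<and> y \<in> topspace S \<and> (f x, f y) \<in> E} \<in> entourages (topspace S) U"
    by (rule entourages_mono[OF D'(1)]) auto
qed

text \<open>
The identity is quasi-uniformly continuous in both directions.
\<close>

lemma compact_uniformity_unique: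
  assumes T: "compact_space T"
    and U: "is_uniformity_on (topspace T) U" "compatible_with T U"
    and W: "is_uniformity_on (topspace T) W" "compatible_with T W"
  shows "U = W"
proof -
  have *: "U \<le> W" if "is_uniformity_on (topspace T) U" "compatible_with T U"
    and W: "is_uniformity_on (topspace T) W" "compatible_with T W" for U W
  proof (rule filter_leI)
    fix P assume P: "eventually P W"
    let ?E = "{z \<in> topspace T \<times> topspace T. P z}"
    have q: "quasi_uniformly_continuous (topspace T) U (topspace T) W id"
      using that T by (intro continuous_map_quasi_uniformly_continuous) (auto simp: is_uniformity_on_def)
    have "W \<le> principal (topspace T \<times> topspace T)"
      using W by (auto simp: is_uniformity_on_def quasi_uniformity_on_def)
    then have "\<forall>\<^sub>F z in W. z \<in> topspace T \<times> topspace T" by (simp add: le_principal)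
    with P have "\<forall>\<^sub>F z in W. z \<in> ?E" by eventually_elim auto
    then have "?E \<in> entourages (topspace T) W" by (auto simp: entourages_def)
    then have "{(x, y). x \<in> topspace T \<and> y \<in> topspace T \<and> (id x, id y) \<in> ?E} \<in> entourages (topspace T) U"
      using q unfolding quasi_uniformly_continuous_def by blast
    then show "eventually P U" by (auto simp: entourages_def elim: eventually_mono)
  qed
  show ?thesis using *[OF U W] *[OF W U] by (rule antisym)
qed

text \<open>
An entourage involves finitely many sets, and points that belong to the same ones among these are close.
So one point for each occurring membership pattern suffices.
\<close>

lemma precompact_on_induced_pervin:
  assumes i: "i \<in> X \<rightarrow> Y"
  shows "precompact_on X (induced_quasi_uniformity X i (pervin Y \<R>))"
  unfolding precompact_on_def
proof
  fix E assume E: "E \<in> entourages X (induced_quasi_uniformity X i (pervin Y \<R>))"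
  then have EX: "E \<subseteq> X \<times> X" and "\<forall>\<^sub>F z in inf (filtercomap (map_prod i i) (pervin Y \<R>)) (principal (X \<times> X)). z \<in> E"
    unfolding entourages_def induced_quasi_uniformity_def by blast+
  then have "\<forall>\<^sub>F z in filtercomap (map_prod i i) (pervin Y \<R>). z \<in> X \<times> X \<longrightarrow> z \<in> E"
    by (simp add: eventually_inf_principal)
  then obtain Q where Q: "eventually Q (pervin Y \<R>)" "\<And>z. Q (map_prod i i z) \<Longrightarrow> z \<in> X \<times> X \<longrightarrow> z \<in> E"
    unfolding eventually_filtercomap by blast
  then have "\<forall>\<^sub>F z in pervin Y \<R>. z \<in> {z. Q z}" by simp
  then obtain \<U> where \<U>: "finite \<U>" "(\<Inter>U\<in>\<U>. implication_entourage Y U) \<subseteq> {z. Q z}"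
    unfolding eventually_pervin by blast
  define a where "a x = {U\<in>\<U>. i x \<in> U}" for x
  have "finite (a ` X)"
    by (rule finite_subset[of _ "Pow \<U>"]) (use \<U>(1) in \<open>auto simp: a_def\<close>)
  then obtain Z where Z: "Z \<subseteq> X" "finite Z" "a ` X = a ` Z"
    by (metis finite_subset_image order_refl)
  have "x \<in> E `` Z" if x: "x \<in> X" for x
  proof -
    obtain z where z: "z \<in> Z" "a z = a x" using Z(3) x by (metis imageE imageI)
    have "i x \<in> Y" "i z \<in> Y" using i x z Z by auto
    moreover have "i z \<in> U \<longleftrightarrow> i x \<in> U" if "U \<in> \<U>" for U
      using that z(2) unfolding a_def by blast
    ultimately have "(i z, i x) \<in> (\<Inter>U\<in>\<U>. implication_entourage Y U)"
      by (auto simp: implication_entourage_def)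
    then have "Q (i z, i x)" using \<U>(2) by blast
    moreover have "z \<in> X" using z Z by blast
    ultimately have "(z, x) \<in> E" using Q(2)[of "(z, x)"] x by simp
    then show ?thesis using z by blast
  qed
  then show "\<exists>Z\<subseteq>X. finite Z \<and> E `` Z = X" using Z EX by (intro exI[of _ Z]) blast
qed

text \<open>
Gaussian elimination.  The scalars form a subfield given as a set; it will be the closure of the rationals
or the whole field.
\<close>

section \<open>Linear systems, digits, and non-archimedean absolute values\<close>

lemma homogeneous_system_nontrivial_solution:
  fixes c :: "'i \<Rightarrow> 'e \<Rightarrow> 'k::field"
  assumes "finite E" "finite I" "card E < card I"
    and F: "\<And>x y. x \<in> F \<Longrightarrow> y \<in> F \<Longrightarrow> x + y \<in> F" "\<And>x y. x \<in> F \<Longrightarrow> y \<in> F \<Longrightarrow> x * y \<in> F"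
      "\<And>x. x \<in> F \<Longrightarrow> - x \<in> F" "\<And>x. x \<in> F \<Longrightarrow> inverse x \<in> F" "0 \<in> F" "1 \<in> F"
    and c: "\<And>i e. i \<in> I \<Longrightarrow> e \<in> E \<Longrightarrow> c i e \<in> F"
  shows "\<exists>x. (\<forall>i. x i \<in> F) \<and> (\<exists>i\<in>I. x i \<noteq> 0) \<and> (\<forall>e\<in>E. (\<Sum>i\<in>I. x i * c i e) = 0)"
  using assms(1,2,3) c
proof (induction E arbitrary: I c rule: finite_induct)
  case empty
  then obtain i where "i \<in> I" by fastforce
  then show ?case using F by (intro exI[of _ "\<lambda>_. 1"]) auto
next
  case (insert e0 E)
  have sumF: "(\<Sum>i\<in>J. f i) \<in> F" if "\<And>i. i \<in> J \<Longrightarrow> f i \<in> F" for J :: "'i set" and f :: "'i \<Rightarrow> 'k"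
    using that by (induction J rule: infinite_finite_induct) (auto simp: F)
  show ?case
  proof (cases "\<forall>i\<in>I. c i e0 = 0")
    case True
    have "card E < card I" using insert by simp
    then have "\<exists>x. (\<forall>i. x i \<in> F) \<and> (\<exists>i\<in>I. x i \<noteq> 0) \<and> (\<forall>e\<in>E. (\<Sum>i\<in>I. x i * c i e) = 0)"
      by (intro insert.IH) (simp_all add: insert.prems)
    then obtain x where "\<forall>i. x i \<in> F" "\<exists>i\<in>I. x i \<noteq> 0" "\<forall>e\<in>E. (\<Sum>i\<in>I. x i * c i e) = 0"
      by blast
    then show ?thesis using True by (intro exI[of _ x]) auto
  next
    case False
    then obtain p where p: "p \<in> I" "c p e0 \<noteq> 0" by blast
    let ?I = "I - {p}"
    define c' where "c' i e = c i e + - (c i e0 * inverse (c p e0) * c p e)" for i e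
    have I: "finite ?I" "card E < card ?I" using insert p by auto
    have "c' i e \<in> F" if "i \<in> ?I" "e \<in> E" for i e
      using that insert.prems(3) p unfolding c'_def by (intro F) auto
    then obtain x where x: "\<forall>i. x i \<in> F" "\<exists>i\<in>?I. x i \<noteq> 0" "\<And>e. e \<in> E \<Longrightarrow> (\<Sum>i\<in>?I. x i * c' i e) = 0"
      using insert.IH[where c = c', OF I] by blast
    define y where "y = - ((\<Sum>i\<in>?I. x i * c i e0) * inverse (c p e0))"
    have yF: "y \<in> F" unfolding y_def using x(1) insert.prems(3) p by (intro F sumF) auto
    have sum_eq: "(\<Sum>i\<in>I. (x(p := y)) i * c i e) = y * c p e + (\<Sum>i\<in>?I. x i * c i e)" for e
      using insert.prems(1) p by (subst sum.remove[of _ p]) (auto intro!: sum.cong)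
    have "(\<Sum>i\<in>I. (x(p := y)) i * c i e) = 0" if "e \<in> insert e0 E" for e
    proof (cases "e = e0")
      case True
      then show ?thesis unfolding sum_eq unfolding y_def using p by simp
    next
      case False
      then have "(\<Sum>i\<in>?I. x i * c' i e) = 0" using that x(3) by blast
      also have "(\<Sum>i\<in>?I. x i * c' i e) = (\<Sum>i\<in>?I. x i * c i e) - (\<Sum>i\<in>?I. x i * c i e0) * (inverse (c p e0) * c p e)"
        unfolding c'_def sum_distrib_right sum_subtractf[symmetric]
        by (intro sum.cong) (simp_all add: algebra_simps)
      finally show ?thesis unfolding sum_eq unfolding y_def by (simp add: algebra_simps)
    qed
    moreover have "\<exists>i\<in>I. (x(p := y)) i \<noteq> 0" using x(2) by auto
    moreover have "\<forall>i. (x(p := y)) i \<in> F" using x(1) yF by simp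
    ultimately show ?thesis by blast
  qed
qed

text \<open>
This makes the leading terms distinct after Nagata's substitution, which replaces the exponents of a
monomial by their digit sum in a large base.
\<close>

lemma digit_sum_inj:
  fixes m m' :: "nat \<Rightarrow> nat"
  assumes "\<And>i. i < d \<Longrightarrow> m i < b" "\<And>i. i < d \<Longrightarrow> m' i < b"
    and "(\<Sum>i<d. m i * b ^ i) = (\<Sum>i<d. m' i * b ^ i)" and "j < d"
  shows "m j = m' j"
  using assms
proof (induction d arbitrary: m m' j)
  case (Suc d)
  have b: "b > 0" using Suc.prems(1)[of 0] by simp
  have split: "(\<Sum>i<Suc d. m i * b ^ i) = m 0 + b * (\<Sum>i<d. m (Suc i) * b ^ i)" for m :: "nat \<Rightarrow> nat"
    by (subst sum.lessThan_Suc_shift) (simp add: sum_distrib_left algebra_simps)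
  have eq: "m 0 + b * (\<Sum>i<d. m (Suc i) * b ^ i) = m' 0 + b * (\<Sum>i<d. m' (Suc i) * b ^ i)"
    using Suc.prems(3) unfolding split .
  have "m 0 < b" "m' 0 < b" using Suc.prems by auto
  then have 0: "m 0 = m' 0" using arg_cong[OF eq, of "\<lambda>x. x mod b"] by simp
  then have "(\<Sum>i<d. m (Suc i) * b ^ i) = (\<Sum>i<d. m' (Suc i) * b ^ i)" using eq b by simp
  then have "m (Suc i) = m' (Suc i)" if "i < d" for i
    using Suc.IH[of "\<lambda>i. m (Suc i)" "\<lambda>i. m' (Suc i)" i] Suc.prems(1,2) that by simp
  then show ?case using 0 Suc.prems(4) by (cases j) auto
qed simp

context
  fixes av :: "'k::field \<Rightarrow> real"
  assumes av: "nonarch_absolute_value av"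
begin

lemma av_nonneg: "0 \<le> av x" and av_eq_0: "av x = 0 \<longleftrightarrow> x = 0" and av_mult: "av (x * y) = av x * av y"
  and av_ultra: "av (x + y) \<le> max (av x) (av y)"
  using av unfolding nonarch_absolute_value_def by blast+

lemma av_0: "av 0 = 0" by (simp add: av_eq_0)

lemma av_pos: "x \<noteq> 0 \<Longrightarrow> 0 < av x"
  using av_nonneg[of x] av_eq_0[of x] by linarith

lemma av_1: "av 1 = 1"
  using av_mult[of 1 1] av_pos[of 1] by simp

lemma av_minus: "av (- x) = av x"
proof -
  have "av (-1) * av (-1) = 1" using av_mult[of "-1" "-1"] av_1 by simp
  then have "av (-1) = 1"
    using av_nonneg[of "-1"] by (metis abs_of_nonneg abs_square_eq_1 power2_eq_square)
  then show ?thesis using av_mult[of "-1" x] by simp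
qed

lemma av_diff: "av (x - y) \<le> max (av x) (av y)"
  using av_ultra[of x "- y"] by (simp add: av_minus)

lemma av_power: "av (x ^ n) = av x ^ n"
  by (induction n) (simp_all add: av_1 av_mult)

lemma av_inverse: "av (inverse x) = inverse (av x)"
proof (cases "x = 0")
  case False
  then have "av x * av (inverse x) = 1" using av_mult[of x "inverse x"] av_1 by simp
  then show ?thesis using inverse_unique by metis
qed (simp add: av_0)

lemma av_divide: "av (x / y) = av x / av y"
  by (simp add: divide_inverse av_mult av_inverse)

lemma av_sum_le:
  assumes "\<And>i. i \<in> I \<Longrightarrow> av (f i) \<le> e" "0 \<le> e"
  shows "av (\<Sum>i\<in>I. f i) \<le> e"
  using assms
proof (induction I rule: infinite_finite_induct)
  case (insert i I)
  then show ?case using av_ultra[of "f i" "sum f I"] by force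
qed (simp_all add: av_0)

lemma av_diff_commute: "av (x - y) = av (y - x)"
  using av_minus[of "x - y"] by simp

lemma av_dominant:
  assumes "av y < av x" shows "av (x + y) = av x"
proof -
  have "av (x + y) \<le> av x" using av_ultra[of x y] assms by simp
  moreover have "av x \<le> max (av (x + y)) (av y)" using av_diff[of "x + y" y] by simp
  ultimately show ?thesis using assms by simp
qed

end

text \<open>
\<open>B\<close> is the unit ball of a complete algebra over the field \<open>'k\<close>, the algebra being the union of the multiples
\<open>\<kappa> c * B\<close>, and \<open>M\<close> is a maximal ideal of this algebra.  The quotient field \<open>K\<close> is not formed: an equation in \<open>K\<close>
is a congruence modulo \<open>M\<close>, and all sets of elements of \<open>K\<close> are represented by their preimages.
\<close>

section \<open>Residue fields of complete algebras\<close>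

locale residue_field_of_complete_algebra =
  fixes av :: "'k::field \<Rightarrow> real" and \<kappa> :: "'k \<Rightarrow> 'a::comm_ring_1" and B M :: "'a set"
  assumes av: "nonarch_absolute_value av"
    and \<kappa>_add: "\<And>c d. \<kappa> (c + d) = \<kappa> c + \<kappa> d" and \<kappa>_mult: "\<And>c d. \<kappa> (c * d) = \<kappa> c * \<kappa> d" and \<kappa>_1: "\<kappa> 1 = 1"
    and B_const: "\<And>c. av c \<le> 1 \<Longrightarrow> \<kappa> c \<in> B"
    and B_add: "\<And>x y. x \<in> B \<Longrightarrow> y \<in> B \<Longrightarrow> x + y \<in> B"
    and B_mult: "\<And>x y. x \<in> B \<Longrightarrow> y \<in> B \<Longrightarrow> x * y \<in> B"
    and M_0: "0 \<in> M" and M_add: "\<And>x y. x \<in> M \<Longrightarrow> y \<in> M \<Longrightarrow> x + y \<in> M"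
    and M_mult: "\<And>c b m. b \<in> B \<Longrightarrow> m \<in> M \<Longrightarrow> \<kappa> c * b * m \<in> M"
    and M_sub: "\<And>m. m \<in> M \<Longrightarrow> \<exists>c. \<exists>b\<in>B. m = \<kappa> c * b"
    and M_maximal: "\<And>c b. b \<in> B \<Longrightarrow> \<kappa> c * b \<notin> M \<Longrightarrow> \<exists>d. \<exists>b'\<in>B. \<kappa> c * b * (\<kappa> d * b') - 1 \<in> M"
    and complete: "\<And>w r. 0 < av w \<Longrightarrow> av w < 1 \<Longrightarrow> (\<And>i::nat. r i \<in> B) \<Longrightarrow>
        \<exists>f\<in>B. \<forall>i. \<exists>b\<in>B. f - (\<Sum>j<i. \<kappa> w ^ j * r j) = \<kappa> w ^ i * b"
    and separated: "\<And>c b. av c < 1 \<Longrightarrow> b \<in> B \<Longrightarrow> 1 - \<kappa> c * b \<notin> M"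
begin

lemmas av_nonneg = av_nonneg[OF av] and av_eq_0 = av_eq_0[OF av] and av_mult = av_mult[OF av]
  and av_ultra = av_ultra[OF av] and av_0 = av_0[OF av] and av_pos = av_pos[OF av] and av_1 = av_1[OF av]
  and av_minus = av_minus[OF av] and av_diff = av_diff[OF av] and av_power = av_power[OF av]
  and av_inverse = av_inverse[OF av] and av_divide = av_divide[OF av]

lemma \<kappa>_0: "\<kappa> 0 = 0" using \<kappa>_add[of 0 0] by simp
lemma \<kappa>_minus: "\<kappa> (- c) = - \<kappa> c" using \<kappa>_add[of c "- c"] by (simp add: \<kappa>_0 eq_neg_iff_add_eq_0 add.commute)
lemma \<kappa>_diff: "\<kappa> (c - d) = \<kappa> c - \<kappa> d" using \<kappa>_add[of c "- d"] by (simp add: \<kappa>_minus)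
lemma \<kappa>_power: "\<kappa> (c ^ n) = \<kappa> c ^ n" by (induction n) (simp_all add: \<kappa>_1 \<kappa>_mult)
lemma \<kappa>_sum: "\<kappa> (\<Sum>i\<in>I. f i) = (\<Sum>i\<in>I. \<kappa> (f i))"
  by (induction I rule: infinite_finite_induct) (simp_all add: \<kappa>_0 \<kappa>_add)
lemma \<kappa>_inverse: "c \<noteq> 0 \<Longrightarrow> \<kappa> c * \<kappa> (inverse c) = 1" by (simp add: \<kappa>_mult[symmetric] \<kappa>_1)

lemmas \<kappa>_simps = \<kappa>_add \<kappa>_mult \<kappa>_1 \<kappa>_0 \<kappa>_minus \<kappa>_diff \<kappa>_power \<kappa>_sum

text \<open>
The preimage of the ball of radius \<open>|c|\<close> of \<open>K\<close>.
\<close>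

definition disc :: "'k \<Rightarrow> 'a set" where "disc c = {\<kappa> c * b + m | b m. b \<in> B \<and> m \<in> M}"

lemma B_1: "1 \<in> B" using B_const[of 1] by (simp add: av_1 \<kappa>_1)
lemma B_0: "0 \<in> B" using B_const[of 0] by (simp add: av_0 \<kappa>_0)

lemma B_scale: "av c \<le> 1 \<Longrightarrow> b \<in> B \<Longrightarrow> \<kappa> c * b \<in> B" using B_const B_mult by blast

lemma M_scale: "m \<in> M \<Longrightarrow> \<kappa> c * m \<in> M" using M_mult[OF B_1, of m c] by simp

lemma M_minus: "m \<in> M \<Longrightarrow> - m \<in> M" using M_scale[of m "- 1"] by (simp add: \<kappa>_simps)

lemma M_diff: "x \<in> M \<Longrightarrow> y \<in> M \<Longrightarrow> x - y \<in> M" using M_add[of x "- y"] M_minus[of y] by simp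

lemma M_sum: "(\<And>i. i \<in> I \<Longrightarrow> f i \<in> M) \<Longrightarrow> (\<Sum>i\<in>I. f i) \<in> M"
  by (induction I rule: infinite_finite_induct) (auto simp: M_0 M_add)

lemma M_disc: "m \<in> M \<Longrightarrow> m \<in> disc c"
  unfolding disc_def using B_0 by force

lemma disc_0: "0 \<in> disc c" using M_disc[OF M_0] .

lemma discI: "b \<in> B \<Longrightarrow> \<kappa> c * b \<in> disc c"
  unfolding disc_def using M_0 by force

lemma B_disc: "b \<in> B \<Longrightarrow> b \<in> disc 1" using discI[of b 1] by (simp add: \<kappa>_1)

lemma disc_const: "\<kappa> c \<in> disc c" using discI[OF B_1] by simp

lemma disc_mono:
  assumes "av c \<le> av d" "x \<in> disc c" shows "x \<in> disc d"
proof -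
  obtain b m where x: "x = \<kappa> c * b + m" "b \<in> B" "m \<in> M" using assms(2) unfolding disc_def by blast
  have "av (c / d) \<le> 1"
    using assms(1) av_nonneg[of c] av_nonneg[of d] by (auto simp: av_divide divide_le_eq_1)
  moreover have "\<kappa> c = \<kappa> d * \<kappa> (c / d)"
  proof (cases "d = 0")
    case True
    then have "c = 0" using assms(1) av_pos[of c] av_0 by (metis leD)
    then show ?thesis using True by (simp add: \<kappa>_mult[symmetric])
  qed (simp add: \<kappa>_mult[symmetric])
  ultimately have "\<kappa> c * b = \<kappa> d * (\<kappa> (c / d) * b)" "\<kappa> (c / d) * b \<in> B"
    using x(2) B_scale by (simp_all add: mult.assoc)
  then have "x = \<kappa> d * (\<kappa> (c / d) * b) + m" by (simp add: x(1))
  with \<open>\<kappa> (c / d) * b \<in> B\<close> x(3) show ?thesis unfolding disc_def by blast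
qed

lemma disc_add: "x \<in> disc c \<Longrightarrow> y \<in> disc c \<Longrightarrow> x + y \<in> disc c"
proof -
  assume "x \<in> disc c" "y \<in> disc c"
  then obtain b m b' m' where *: "x = \<kappa> c * b + m" "b \<in> B" "m \<in> M" "y = \<kappa> c * b' + m'" "b' \<in> B" "m' \<in> M"
    unfolding disc_def by blast
  then have "x + y = \<kappa> c * (b + b') + (m + m')" by (simp add: algebra_simps)
  then show ?thesis unfolding disc_def using * B_add M_add by blast
qed

lemma disc_mult: "x \<in> disc c \<Longrightarrow> y \<in> disc d \<Longrightarrow> x * y \<in> disc (c * d)"
proof -
  assume "x \<in> disc c" "y \<in> disc d"
  then obtain b m b' m' where *: "x = \<kappa> c * b + m" "b \<in> B" "m \<in> M" "y = \<kappa> d * b' + m'" "b' \<in> B" "m' \<in> M"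
    unfolding disc_def by blast
  obtain e b'' where m: "m = \<kappa> e * b''" "b'' \<in> B" using M_sub[OF *(3)] by blast
  have "x * y = \<kappa> (c * d) * (b * b') + (\<kappa> c * b * m' + (\<kappa> d * b' * m + m * m'))"
    by (simp add: *(1,4) algebra_simps \<kappa>_simps)
  then have "x * y = \<kappa> (c * d) * (b * b') + (\<kappa> c * b * m' + (\<kappa> d * b' * m + \<kappa> e * b'' * m'))"
    using m(1) by simp
  moreover have "\<kappa> c * b * m' + (\<kappa> d * b' * m + \<kappa> e * b'' * m') \<in> M"
    using * m(2) by (intro M_add M_mult)
  ultimately show ?thesis unfolding disc_def using * B_mult by blast
qed

lemma disc_scale: "x \<in> disc d \<Longrightarrow> \<kappa> c * x \<in> disc (c * d)"
  using disc_mult[OF disc_const] .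

lemma disc_scale1: "av c \<le> 1 \<Longrightarrow> x \<in> disc d \<Longrightarrow> \<kappa> c * x \<in> disc d"
  using disc_scale[of x d c] disc_mono[of "c * d" d] by (simp add: av_mult av_nonneg mult_left_le_one_le)

lemma disc_mult1: "x \<in> disc 1 \<Longrightarrow> y \<in> disc d \<Longrightarrow> x * y \<in> disc d"
  using disc_mult[of x 1 y d] by simp

lemma disc_minus: "x \<in> disc c \<Longrightarrow> - x \<in> disc c"
  using disc_scale1[of "- 1" x c] by (simp add: av_minus av_1 \<kappa>_simps)

lemma disc_diff: "x \<in> disc c \<Longrightarrow> y \<in> disc c \<Longrightarrow> x - y \<in> disc c"
  using disc_add[of x c "- y"] disc_minus[of y] by simp

lemma disc_sum: "(\<And>i. i \<in> I \<Longrightarrow> f i \<in> disc c) \<Longrightarrow> (\<Sum>i\<in>I. f i) \<in> disc c"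
  by (induction I rule: infinite_finite_induct) (auto simp: disc_0 disc_add)

lemma disc_power: "x \<in> disc 1 \<Longrightarrow> x ^ n \<in> disc 1"
  by (induction n) (auto simp: B_disc B_1 disc_mult1)

lemma disc_prod: "(\<And>i. i \<in> I \<Longrightarrow> f i \<in> disc 1) \<Longrightarrow> (\<Prod>i\<in>I. f i) \<in> disc 1"
  by (induction I rule: infinite_finite_induct) (auto simp: B_disc B_1 disc_mult1)

text \<open>
The nontrivial direction is the axiom \<open>separated\<close>: otherwise 1 would be small in \<open>K\<close>.
\<close>

lemma const_in_disc_iff: "\<kappa> d \<in> disc c \<longleftrightarrow> av d \<le> av c"
proof
  assume "av d \<le> av c" then show "\<kappa> d \<in> disc c" using disc_mono disc_const by blast
next
  assume d: "\<kappa> d \<in> disc c"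
  show "av d \<le> av c"
  proof (rule ccontr)
    assume "\<not> av d \<le> av c"
    then have less: "av c < av d" by simp
    then have "d \<noteq> 0" using av_nonneg[of c] by (auto simp: av_0)
    obtain b m where bm: "\<kappa> d = \<kappa> c * b + m" "b \<in> B" "m \<in> M" using d unfolding disc_def by blast
    have "1 - \<kappa> (c / d) * b = \<kappa> (inverse d) * m"
      using arg_cong[OF bm(1), of "\<lambda>x. \<kappa> (inverse d) * x"] \<kappa>_inverse[OF \<open>d \<noteq> 0\<close>]
      by (simp add: divide_inverse \<kappa>_mult algebra_simps)
    then have "1 - \<kappa> (c / d) * b \<in> M" using M_scale[OF bm(3)] by simp
    moreover have "av (c / d) < 1" using less av_pos[OF \<open>d \<noteq> 0\<close>] by (simp add: av_divide)
    ultimately show False using separated bm(2) by blast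
  qed
qed

lemma one_not_M: "1 \<notin> M" using separated[of 0 0] B_0 by (simp add: av_0 \<kappa>_0)

lemma power_small: "av w < 1 \<Longrightarrow> c \<noteq> 0 \<Longrightarrow> \<exists>i::nat. av (w ^ i) < av c"
  using real_arch_pow_inv[of "av c" "av w"] av_pos by (auto simp: av_power)

lemma inverse_mod_M:
  assumes "x \<in> disc c" "x \<notin> M"
  obtains y d where "y \<in> disc d" "x * y - 1 \<in> M"
proof -
  obtain b m where x: "x = \<kappa> c * b + m" "b \<in> B" "m \<in> M" using assms(1) unfolding disc_def by blast
  then have "\<kappa> c * b \<notin> M" using assms(2) M_add by blast
  then obtain d b' where y: "b' \<in> B" "\<kappa> c * b * (\<kappa> d * b') - 1 \<in> M" using M_maximal x(2) by blast
  have "x * (\<kappa> d * b') - 1 = (\<kappa> c * b * (\<kappa> d * b') - 1) + \<kappa> d * b' * m" by (simp add: x(1) algebra_simps)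
  also have "\<dots> \<in> M" using y M_mult x(3) M_add by blast
  finally show thesis using that discI[OF y(1)] by blast
qed

text \<open>
A nonzero element of a field has an inverse, which lies in some disc; so if the element were arbitrarily
small, then so would be 1.
\<close>

lemma separated_discs:
  assumes w: "av w < 1" and f: "\<And>i::nat. f \<in> disc (w ^ i)"
  shows "f \<in> M"
proof (rule ccontr)
  assume "f \<notin> M"
  then obtain g d where g: "g \<in> disc d" "f * g - 1 \<in> M" using inverse_mod_M[OF f[of 0]] by blast
  have "\<exists>i. av (w ^ i * d) < 1"
  proof (cases "d = 0")
    case False
    then obtain i where "av (w ^ i) < av (inverse d)" using power_small[OF w, of "inverse d"] by auto
    then have "av (w ^ i) * av d < inverse (av d) * av d"
      using av_pos[OF False] by (intro mult_strict_right_mono) (simp_all add: av_inverse)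
    then show ?thesis using av_pos[OF False] by (intro exI[of _ i]) (simp add: av_mult)
  qed (simp add: av_0)
  then obtain i where i: "av (w ^ i * d) < 1" by blast
  have "f * g \<in> disc (w ^ i * d)" using disc_mult[OF f g(1)] .
  then have "f * g - (f * g - 1) \<in> disc (w ^ i * d)" using disc_diff M_disc[OF g(2)] by blast
  then have "\<kappa> 1 \<in> disc (w ^ i * d)" by (simp add: \<kappa>_1)
  then show False using i unfolding const_in_disc_iff av_1 by simp
qed

text \<open>
Lift the terms of the series to the unit ball \<open>B\<close> and sum them there.
\<close>

lemma complete_disc:
  assumes w: "0 < av w" "av w < 1" and r: "\<And>i::nat. r i \<in> disc 1"
  shows "\<exists>f\<in>disc 1. \<forall>i. f - (\<Sum>j<i. \<kappa> w ^ j * r j) \<in> disc (w ^ i)"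
proof -
  have "\<exists>b\<in>B. r i - b \<in> M" for i
  proof -
    obtain b m where "r i = \<kappa> 1 * b + m" "b \<in> B" "m \<in> M" using r[of i] unfolding disc_def by blast
    then show ?thesis by (intro bexI[of _ b]) (simp_all add: \<kappa>_1)
  qed
  then obtain b where b: "\<And>i. b i \<in> B" "\<And>i. r i - b i \<in> M" by metis
  obtain f where f: "f \<in> B" "\<And>i. \<exists>b'\<in>B. f - (\<Sum>j<i. \<kappa> w ^ j * b j) = \<kappa> w ^ i * b'"
    using complete[where r = b, OF w b(1)] by blast
  have "f - (\<Sum>j<i. \<kappa> w ^ j * r j) \<in> disc (w ^ i)" for i
  proof -
    have eq: "f - (\<Sum>j<i. \<kappa> w ^ j * r j) = (f - (\<Sum>j<i. \<kappa> w ^ j * b j)) - (\<Sum>j<i. \<kappa> w ^ j * (r j - b j))"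
      by (simp add: right_diff_distrib sum_subtractf)
    have "f - (\<Sum>j<i. \<kappa> w ^ j * b j) \<in> disc (w ^ i)"
      using f(2)[of i] discI[of _ "w ^ i"] by (auto simp: \<kappa>_simps)
    moreover have "(\<Sum>j<i. \<kappa> w ^ j * (r j - b j)) \<in> disc (w ^ i)"
      using b(2) M_scale by (intro M_disc M_sum) (simp add: \<kappa>_power[symmetric])
    ultimately show ?thesis unfolding eq by (rule disc_diff)
  qed
  then show ?thesis using B_disc[OF f(1)] by blast
qed

text \<open>
The span over the valuation ring, which is not a type; so the scalars are restricted by a condition.
\<close>

inductive_set int_span :: "'a set \<Rightarrow> 'a set" for G where
  int_span_zero: "0 \<in> int_span G"
| int_span_step: "x \<in> int_span G \<Longrightarrow> av c \<le> 1 \<Longrightarrow> g \<in> G \<Longrightarrow> \<kappa> c * g + x \<in> int_span G"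

lemma int_span_base: "g \<in> G \<Longrightarrow> g \<in> int_span G"
  using int_span_step[OF int_span_zero, of 1 g G] by (simp add: av_1 \<kappa>_1)

lemma int_span_add: "x \<in> int_span G \<Longrightarrow> y \<in> int_span G \<Longrightarrow> x + y \<in> int_span G"
  by (induction rule: int_span.induct) (auto simp: add.assoc intro: int_span_step)

lemma int_span_scale: "x \<in> int_span G \<Longrightarrow> av c \<le> 1 \<Longrightarrow> \<kappa> c * x \<in> int_span G"
proof (induction rule: int_span.induct)
  case (int_span_step x d g)
  have "\<kappa> (c * d) * g + \<kappa> c * x \<in> int_span G"
    using int_span_step by (intro int_span.int_span_step) (auto simp: av_mult av_nonneg mult_le_one)
  then show ?case by (simp add: \<kappa>_mult algebra_simps)
qed (simp add: int_span_zero)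

lemma int_span_sum: "(\<And>i. i \<in> I \<Longrightarrow> f i \<in> int_span G) \<Longrightarrow> (\<Sum>i\<in>I. f i) \<in> int_span G"
  by (induction I rule: infinite_finite_induct) (auto simp: int_span_zero int_span_add)

text \<open>
Induction for the closure properties that the applications have.
\<close>

lemma int_span_least:
  assumes "x \<in> int_span G" "0 \<in> Q" "\<And>x y. x \<in> Q \<Longrightarrow> y \<in> Q \<Longrightarrow> x + y \<in> Q"
    "\<And>c x. av c \<le> 1 \<Longrightarrow> x \<in> Q \<Longrightarrow> \<kappa> c * x \<in> Q" "G \<subseteq> Q"
  shows "x \<in> Q"
  using assms by (induction rule: int_span.induct) auto

lemma int_span_mono: "x \<in> int_span G \<Longrightarrow> G \<subseteq> int_span H \<Longrightarrow> x \<in> int_span H"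
  by (erule int_span_least) (auto intro: int_span_zero int_span_add int_span_scale)

lemma int_span_mult:
  assumes x: "x \<in> int_span G" and y: "y \<in> int_span H" and GH: "\<And>g h. g \<in> G \<Longrightarrow> h \<in> H \<Longrightarrow> g * h \<in> int_span L"
  shows "x * y \<in> int_span L"
proof -
  have "g * y \<in> int_span L" if g: "g \<in> G" for g
  proof -
    have "y \<in> {y. g * y \<in> int_span L}"
      using y
    proof (rule int_span_least)
      show "\<kappa> c * z \<in> {y. g * y \<in> int_span L}" if "av c \<le> 1" "z \<in> {y. g * y \<in> int_span L}" for c z
        using int_span_scale[OF _ that(1), of "g * z" L] that(2) by (simp add: mult.left_commute)
    qed (auto simp: int_span_zero distrib_left GH[OF g] intro: int_span_add)
    then show ?thesis by simp
  qed
  then have G: "G \<subseteq> {x. x * y \<in> int_span L}" by blast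
  have "x \<in> {x. x * y \<in> int_span L}"
    using x
  proof (rule int_span_least)
    show "\<kappa> c * z \<in> {x. x * y \<in> int_span L}" if "av c \<le> 1" "z \<in> {x. x * y \<in> int_span L}" for c z
      using int_span_scale[OF _ that(1), of "z * y" L] that(2) by (simp add: mult.assoc)
  qed (use G in \<open>auto simp: int_span_zero distrib_right intro: int_span_add\<close>)
  then show ?thesis by simp
qed

lemma int_span_disc: "x \<in> int_span G \<Longrightarrow> G \<subseteq> disc c \<Longrightarrow> x \<in> disc c"
  by (erule int_span_least) (auto intro: disc_0 disc_add disc_scale1)

text \<open>
Collects equal terms: the index determines the coefficient, even if \<open>g\<close> is not injective.  The comparison
of a polynomial with its value depends on this.
\<close>

lemma int_span_image_repr:
  assumes "x \<in> int_span (g ` X)"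
  shows "\<exists>F a. finite F \<and> F \<subseteq> X \<and> (\<forall>m. av (a m) \<le> 1) \<and> x = (\<Sum>m\<in>F. \<kappa> (a m) * g m)"
  using assms
proof (induction rule: int_span.induct)
  case int_span_zero
  show ?case by (intro exI[of _ "{}"] exI[of _ "\<lambda>_. 0"]) (simp add: av_0)
next
  case (int_span_step x c y)
  then obtain F a m where F: "finite F" "F \<subseteq> X" "\<And>m. av (a m) \<le> 1" "x = (\<Sum>m\<in>F. \<kappa> (a m) * g m)"
    and m: "m \<in> X" "y = g m" by blast
  define a' where "a' = (if m \<in> F then a else a(m := 0))"
  have a': "av (a' m) \<le> 1" for m using F(3) by (simp add: a'_def av_0)
  have "x = (\<Sum>m\<in>insert m F. \<kappa> (a' m) * g m)"
    using F(1) by (auto simp: F(4) a'_def insert_absorb \<kappa>_0 intro!: sum.cong)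
  also have "\<dots> = \<kappa> (a' m) * g m + (\<Sum>m\<in>F - {m}. \<kappa> (a' m) * g m)"
    using F(1) by (simp add: sum.insert_remove)
  finally have "\<kappa> c * y + x = \<kappa> (c + a' m) * g m + (\<Sum>m\<in>F - {m}. \<kappa> (a' m) * g m)"
    by (simp add: m \<kappa>_add algebra_simps)
  also have "\<dots> = (\<Sum>i\<in>insert m F. \<kappa> ((a'(m := c + a' m)) i) * g i)"
    using F(1) by (auto simp: sum.insert_remove intro!: sum.cong)
  finally have "\<kappa> c * y + x = (\<Sum>i\<in>insert m F. \<kappa> ((a'(m := c + a' m)) i) * g i)" .
  moreover have "av ((a'(m := c + a' m)) i) \<le> 1" for i
    using a' int_span_step.hyps(2) av_ultra[of c "a' m"] by (smt (verit) fun_upd_apply)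
  ultimately show ?case using F m by (intro exI[of _ "insert m F"] exI[of _ "a'(m := c + a' m)"]) auto
qed

end

context residue_field_of_complete_algebra
begin

definition alg :: "'a set" where "alg = (\<Union>c. disc c)"

lemma alg_disc: "x \<in> disc c \<Longrightarrow> x \<in> alg" unfolding alg_def by blast

lemma alg_M: "m \<in> M \<Longrightarrow> m \<in> alg" using alg_disc M_disc by blast

lemma alg_add: "x \<in> alg \<Longrightarrow> y \<in> alg \<Longrightarrow> x + y \<in> alg"
proof -
  assume "x \<in> alg" "y \<in> alg"
  then obtain c d where cd: "x \<in> disc c" "y \<in> disc d" unfolding alg_def by blast
  show ?thesis
  proof (cases "av c \<le> av d")
    case True
    then show ?thesis using cd disc_mono disc_add alg_disc by metis
  next
    case False
    then have "av d \<le> av c" by simp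
    then show ?thesis using cd disc_mono disc_add alg_disc by metis
  qed
qed

lemma alg_mult: "x \<in> alg \<Longrightarrow> y \<in> alg \<Longrightarrow> x * y \<in> alg"
  unfolding alg_def using disc_mult by blast

lemma alg_const: "\<kappa> c \<in> alg" using alg_disc disc_const by blast

lemma alg_minus: "x \<in> alg \<Longrightarrow> - x \<in> alg"
  unfolding alg_def using disc_minus by blast

lemma alg_diff: "x \<in> alg \<Longrightarrow> y \<in> alg \<Longrightarrow> x - y \<in> alg"
  using alg_add[of x "- y"] alg_minus by simp

lemma alg_sum: "(\<And>i. i \<in> I \<Longrightarrow> f i \<in> alg) \<Longrightarrow> (\<Sum>i\<in>I. f i) \<in> alg"
  by (induction I rule: infinite_finite_induct) (auto simp: alg_M M_0 alg_add)

lemma alg_power: "x \<in> alg \<Longrightarrow> x ^ n \<in> alg"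
  by (induction n) (auto simp: alg_mult alg_const[of 1, unfolded \<kappa>_1])

lemma M_alg: "x \<in> alg \<Longrightarrow> m \<in> M \<Longrightarrow> x * m \<in> M"
proof -
  assume "x \<in> alg" and m: "m \<in> M"
  then obtain c b m' where x: "x = \<kappa> c * b + m'" "b \<in> B" "m' \<in> M" unfolding alg_def disc_def by blast
  obtain e b' where "m' = \<kappa> e * b'" "b' \<in> B" using M_sub[OF x(3)] by blast
  then show ?thesis using M_mult[of b m c] M_mult[of b' m e] M_add x m by (simp add: distrib_right)
qed

lemma alg_inverse:
  assumes "x \<in> alg" "x \<notin> M"
  obtains y where "y \<in> alg" "x * y - 1 \<in> M"
proof -
  obtain c where "x \<in> disc c" using assms(1) unfolding alg_def by blast
  then show thesis using inverse_mod_M[OF _ assms(2)] alg_disc that by metis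
qed

lemma alg_normalise:
  assumes "x \<in> alg"
  obtains c where "c \<noteq> 0" "\<kappa> c * x \<in> disc 1"
proof -
  obtain c where c: "x \<in> disc c" using assms unfolding alg_def by blast
  show thesis
  proof (cases "c = 0")
    case True
    then have "x \<in> disc 1" using disc_mono[OF _ c, of 1] by (simp add: av_0 av_1)
    then show thesis using that[of 1] by (simp add: \<kappa>_1)
  next
    case False
    then show thesis using that[of "inverse c"] disc_scale[OF c, of "inverse c"] by simp
  qed
qed

text \<open>
If the field \<open>K\<close> is finite over a subring \<open>S\<close>, then \<open>S\<close> is a field.  Take a generating family of minimal size and express
\<open>e0/s\<close>, for a generator \<open>e0\<close>, as \<open>\<Sum> c e * e\<close>.  If \<open>s * c e0\<close> is not 1, then the relation \<open>(s * c e0 - 1) * e0 + \<dots> = 0\<close>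
shows that \<open>(s * c e0 - 1) * K\<close>, which is \<open>K\<close>, is generated by the other members of the family.
\<close>

lemma subring_inverse_if_finite:
  assumes S: "\<And>x y. x \<in> S \<Longrightarrow> y \<in> S \<Longrightarrow> x + y \<in> S" "\<And>x y. x \<in> S \<Longrightarrow> y \<in> S \<Longrightarrow> x * y \<in> S"
      "\<And>x. x \<in> S \<Longrightarrow> - x \<in> S" "1 \<in> S" "S \<subseteq> alg"
    and "finite E" "E \<subseteq> alg" "\<And>f. f \<in> alg \<Longrightarrow> \<exists>c. (\<forall>e. c e \<in> S) \<and> f - (\<Sum>e\<in>E. c e * e) \<in> M"
    and s: "s \<in> S" "s \<notin> M"
  shows "\<exists>s'\<in>S. s * s' - 1 \<in> M"
  using assms(6,7,8)
proof (induction "card E" arbitrary: E rule: less_induct)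
  case less
  note gen = less.prems(3)
  have one: "1 \<in> alg" using S(4,5) by blast
  obtain c1 where "1 - (\<Sum>e\<in>E. c1 e * e) \<in> M" using gen[OF one] by blast
  then have "E \<noteq> {}" using one_not_M by auto
  then obtain e0 where e0: "e0 \<in> E" by blast
  then have e0A: "e0 \<in> alg" using less.prems by blast
  have sA: "s \<in> alg" using s S(5) by blast
  obtain u where u: "u \<in> alg" "s * u - 1 \<in> M" using alg_inverse[OF sA s(2)] .
  obtain c where c: "\<And>e. c e \<in> S" "u * e0 - (\<Sum>e\<in>E. c e * e) \<in> M"
    using gen[OF alg_mult[OF u(1) e0A]] by blast
  let ?E = "E - {e0}"
  have split: "(\<Sum>e\<in>E. g e * e) = g e0 * e0 + (\<Sum>e\<in>?E. g e * e)" for g :: "'a \<Rightarrow> 'a"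
    using less.prems(1) e0 by (rule sum.remove)
  define a where "a = s * c e0 + - 1"
  have aS: "a \<in> S" unfolding a_def by (intro S s c)
  show ?case
  proof (cases "a \<in> M")
    case True
    then show ?thesis using c(1) by (auto simp: a_def)
  next
    case False
    have aA: "a \<in> alg" using aS S(5) by blast
    obtain a' where a': "a' \<in> alg" "a * a' - 1 \<in> M" using alg_inverse[OF aA False] .
    have rel: "a * e0 + s * (\<Sum>e\<in>?E. c e * e) \<in> M"
    proof -
      have "a * e0 + s * (\<Sum>e\<in>?E. c e * e) = e0 * (s * u - 1) - s * (u * e0 - (\<Sum>e\<in>E. c e * e))"
        unfolding split a_def by (simp add: algebra_simps)
      then show ?thesis using M_diff M_alg[OF e0A u(2)] M_alg[OF sA c(2)] by simp
    qed
    have "\<exists>c. (\<forall>e. c e \<in> S) \<and> f - (\<Sum>e\<in>?E. c e * e) \<in> M" if f: "f \<in> alg" for f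
    proof -
      obtain d where d: "\<And>e. d e \<in> S" "a' * f - (\<Sum>e\<in>E. d e * e) \<in> M"
        using gen[OF alg_mult[OF a'(1) f]] by blast
      define h where "h e = a * d e + - (d e0 * s * c e)" for e
      have hsum: "(\<Sum>e\<in>?E. h e * e) = a * (\<Sum>e\<in>?E. d e * e) - d e0 * (s * (\<Sum>e\<in>?E. c e * e))"
        unfolding h_def sum_distrib_left sum_subtractf[symmetric] by (intro sum.cong) (simp_all add: algebra_simps)
      have "f - (\<Sum>e\<in>?E. h e * e) = a * (a' * f - (\<Sum>e\<in>E. d e * e)) - f * (a * a' - 1)
          + d e0 * (a * e0 + s * (\<Sum>e\<in>?E. c e * e))"
        unfolding hsum split by (simp add: algebra_simps)
      also have "\<dots> \<in> M"
        using M_alg[OF aA d(2)] M_alg[OF f a'(2)] M_alg[OF _ rel, of "d e0"] d(1) S(5) M_diff M_add by blast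
      finally have "f - (\<Sum>e\<in>?E. h e * e) \<in> M" .
      moreover have "h e \<in> S" for e unfolding h_def by (intro S aS d c s)
      ultimately show ?thesis by blast
    qed
    moreover have "card ?E < card E" using less.prems(1) e0 by (meson card_Diff1_less)
    ultimately show ?thesis using less.prems(1,2) by (intro less.hyps[of ?E]) auto
  qed
qed

definition mon :: "(nat \<Rightarrow> 'a) \<Rightarrow> nat \<Rightarrow> (nat \<Rightarrow> nat) \<Rightarrow> 'a" where
  "mon t d m = (\<Prod>i<d. t i ^ m i)"

lemma mon_mult: "mon t d m * mon t d m' = mon t d (\<lambda>i. m i + m' i)"
  by (simp add: mon_def prod.distrib power_add)

lemma mon_0: "mon t d (\<lambda>_. 0) = 1"
  by (simp add: mon_def)

lemma mon_disc: "(\<And>i. i < d \<Longrightarrow> t i \<in> disc 1) \<Longrightarrow> mon t d m \<in> disc 1"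
  unfolding mon_def by (intro disc_prod disc_power) auto

abbreviation pol :: "(nat \<Rightarrow> 'a) \<Rightarrow> nat \<Rightarrow> 'a set" where "pol t d \<equiv> int_span (range (mon t d))"

lemma pol_mult: "x \<in> pol t d \<Longrightarrow> y \<in> pol t d \<Longrightarrow> x * y \<in> pol t d"
  by (erule int_span_mult) (auto simp: mon_mult intro: int_span_base)

lemma pol_mon: "mon t d m \<in> pol t d" by (intro int_span_base) simp

lemma pol_1: "1 \<in> pol t d" using pol_mon[of t d "\<lambda>_. 0"] by (simp add: mon_0)

lemma pol_disc: "x \<in> pol t d \<Longrightarrow> (\<And>i. i < d \<Longrightarrow> t i \<in> disc 1) \<Longrightarrow> x \<in> disc 1"
  by (rule int_span_disc) (auto intro: mon_disc)

text \<open>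
The closure in the unit disc of the ring of polynomials in \<open>t\<close> with integral coefficients.  As convergence is measured by powers of \<open>w\<close>,
power series are not needed.
\<close>

definition pol_closure :: "(nat \<Rightarrow> 'a) \<Rightarrow> nat \<Rightarrow> 'k \<Rightarrow> 'a set" where
  "pol_closure t d w = {f \<in> disc 1. \<forall>i::nat. \<exists>c\<in>pol t d. f - c \<in> disc (w ^ i)}"

text \<open>
The ring of the multiples of elements of this closure by arbitrary constants: limits of polynomials in \<open>t\<close>.
\<close>

definition frac :: "(nat \<Rightarrow> 'a) \<Rightarrow> nat \<Rightarrow> 'k \<Rightarrow> 'a set" where
  "frac t d w = {s. \<exists>c. c \<noteq> 0 \<and> av c \<le> 1 \<and> \<kappa> c * s \<in> pol_closure t d w}"

text \<open>
The unit ball of \<open>K\<close> is generated by \<open>E\<close>, up to elements of size \<open>|w|\<close>, over the integral polynomials in \<open>t\<close>.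
\<close>

definition generates :: "(nat \<Rightarrow> 'a) \<Rightarrow> nat \<Rightarrow> 'k \<Rightarrow> 'a set \<Rightarrow> bool" where
  "generates t d w E \<longleftrightarrow> (\<forall>x\<in>disc 1. \<exists>y\<in>int_span {mon t d m * e | m e. e \<in> E}. x - y \<in> disc w)"

context
  fixes t :: "nat \<Rightarrow> 'a" and d :: nat and w :: 'k
  assumes t: "\<And>i. i < d \<Longrightarrow> t i \<in> disc 1" and w: "0 < av w" "av w < 1"
begin

lemma pol_closure_pol: "x \<in> pol t d \<Longrightarrow> x \<in> pol_closure t d w"
  unfolding pol_closure_def using pol_disc[OF _ t] disc_0 by force

lemma pol_closure_add: "x \<in> pol_closure t d w \<Longrightarrow> y \<in> pol_closure t d w \<Longrightarrow> x + y \<in> pol_closure t d w"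
  unfolding pol_closure_def
proof (intro CollectI conjI allI)
  fix i assume "x \<in> {f \<in> disc 1. \<forall>i::nat. \<exists>c\<in>pol t d. f - c \<in> disc (w ^ i)}"
    "y \<in> {f \<in> disc 1. \<forall>i::nat. \<exists>c\<in>pol t d. f - c \<in> disc (w ^ i)}"
  then obtain c c' where "c \<in> pol t d" "x - c \<in> disc (w ^ i)" "c' \<in> pol t d" "y - c' \<in> disc (w ^ i)" by blast
  then show "\<exists>c\<in>pol t d. x + y - c \<in> disc (w ^ i)"
    using disc_add[of "x - c" "w ^ i" "y - c'"]
    by (intro bexI[of _ "c + c'"]) (simp_all add: add_diff_add int_span_add)
qed (auto intro: disc_add)

lemma pol_closure_mult: "x \<in> pol_closure t d w \<Longrightarrow> y \<in> pol_closure t d w \<Longrightarrow> x * y \<in> pol_closure t d w"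
  unfolding pol_closure_def
proof (intro CollectI conjI allI)
  fix i assume *: "x \<in> {f \<in> disc 1. \<forall>i::nat. \<exists>c\<in>pol t d. f - c \<in> disc (w ^ i)}"
    "y \<in> {f \<in> disc 1. \<forall>i::nat. \<exists>c\<in>pol t d. f - c \<in> disc (w ^ i)}"
  then obtain c c' where c: "c \<in> pol t d" "x - c \<in> disc (w ^ i)" "c' \<in> pol t d" "y - c' \<in> disc (w ^ i)" by blast
  have "x * y - c * c' = x * (y - c') + c' * (x - c)" by (simp add: algebra_simps)
  also have "\<dots> \<in> disc (w ^ i)" using * c pol_disc[OF c(3) t] by (intro disc_add disc_mult1) auto
  finally show "\<exists>c\<in>pol t d. x * y - c \<in> disc (w ^ i)" using pol_mult c by blast
qed (auto intro: disc_mult1)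

lemma pol_closure_scale: "x \<in> pol_closure t d w \<Longrightarrow> av c \<le> 1 \<Longrightarrow> \<kappa> c * x \<in> pol_closure t d w"
  using pol_closure_mult[of "\<kappa> c * 1" x] pol_closure_pol[OF int_span_scale[OF pol_1]] by simp

lemma frac_hat: "x \<in> pol_closure t d w \<Longrightarrow> x \<in> frac t d w"
  unfolding frac_def by (intro CollectI exI[of _ 1]) (simp add: av_1 \<kappa>_1)

lemma frac_closed:
  assumes "x \<in> frac t d w" "y \<in> frac t d w"
  shows "x + y \<in> frac t d w" "x * y \<in> frac t d w" "- x \<in> frac t d w"
proof -
  obtain c d' where c: "c \<noteq> 0" "av c \<le> 1" "\<kappa> c * x \<in> pol_closure t d w"
    and d: "d' \<noteq> 0" "av d' \<le> 1" "\<kappa> d' * y \<in> pol_closure t d w" using assms unfolding frac_def by blast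
  have cd: "c * d' \<noteq> 0" "av (c * d') \<le> 1" using c d by (auto simp: av_mult av_nonneg mult_le_one)
  have "\<kappa> (c * d') * (x + y) = \<kappa> d' * (\<kappa> c * x) + \<kappa> c * (\<kappa> d' * y)"
    by (simp add: \<kappa>_mult algebra_simps)
  then have "\<kappa> (c * d') * (x + y) \<in> pol_closure t d w" using pol_closure_add pol_closure_scale c d by simp
  then show "x + y \<in> frac t d w" unfolding frac_def using cd by blast
  have "\<kappa> (c * d') * (x * y) = (\<kappa> c * x) * (\<kappa> d' * y)" by (simp add: \<kappa>_mult algebra_simps)
  then have "\<kappa> (c * d') * (x * y) \<in> pol_closure t d w" using pol_closure_mult c d by simp
  then show "x * y \<in> frac t d w" unfolding frac_def using cd by blast
  have "\<kappa> c * - x = \<kappa> (- 1) * (\<kappa> c * x)" by (simp add: \<kappa>_simps)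
  then have "\<kappa> c * - x \<in> pol_closure t d w" using pol_closure_scale[OF c(3), of "- 1"] by (simp add: av_minus av_1)
  then show "- x \<in> frac t d w" unfolding frac_def using c by blast
qed

lemma frac_alg: "frac t d w \<subseteq> alg"
proof
  fix s assume "s \<in> frac t d w"
  then obtain c where c: "c \<noteq> 0" "\<kappa> c * s \<in> disc 1" unfolding frac_def pol_closure_def by blast
  have "s = \<kappa> (inverse c) * (\<kappa> c * s)" using \<kappa>_inverse[OF c(1)] by (metis mult.commute mult.assoc mult_1)
  then show "s \<in> alg" using alg_mult[OF alg_const alg_disc[OF c(2)]] by metis
qed

text \<open>
Orders the terms by the module generator.
\<close>

lemma span_repr:
  assumes "y \<in> int_span {mon t d m * e | m e. e \<in> E}" "finite E"
  shows "\<exists>c. (\<forall>e. c e \<in> pol t d) \<and> y = (\<Sum>e\<in>E. c e * e)"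
proof -
  let ?Q = "{y. \<exists>c. (\<forall>e. c e \<in> pol t d) \<and> y = (\<Sum>e\<in>E. c e * e)}"
  have "y \<in> ?Q"
    using assms(1)
  proof (rule int_span_least)
    show "0 \<in> ?Q" by (auto intro!: exI[of _ "\<lambda>_. 0"] int_span_zero)
    show "x + y \<in> ?Q" if xy: "x \<in> ?Q" "y \<in> ?Q" for x y
    proof -
      obtain c c' where "\<forall>e. c e \<in> pol t d" "x = (\<Sum>e\<in>E. c e * e)" "\<forall>e. c' e \<in> pol t d" "y = (\<Sum>e\<in>E. c' e * e)"
        using xy by blast
      then show ?thesis
        by (intro CollectI exI[of _ "\<lambda>e. c e + c' e"]) (simp add: int_span_add distrib_right sum.distrib)
    qed
    show "\<kappa> k * x \<in> ?Q" if k: "av k \<le> 1" "x \<in> ?Q" for k x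
    proof -
      obtain c where "\<forall>e. c e \<in> pol t d" "x = (\<Sum>e\<in>E. c e * e)" using k by blast
      then show ?thesis
        using k by (intro CollectI exI[of _ "\<lambda>e. \<kappa> k * c e"]) (simp add: int_span_scale sum_distrib_left mult.assoc)
    qed
    show "{mon t d m * e | m e. e \<in> E} \<subseteq> ?Q"
    proof clarify
      fix m e assume e: "e \<in> E"
      have "(\<Sum>e'\<in>E. (if e' = e then mon t d m else 0) * e') = (\<Sum>e'\<in>E. if e' = e then mon t d m * e' else 0)"
        by (intro sum.cong) auto
      also have "\<dots> = mon t d m * e" using e assms(2) by simp
      finally show "\<exists>c. (\<forall>e. c e \<in> pol t d) \<and> mon t d m * e = (\<Sum>e\<in>E. c e * e)"
        by (intro exI[of _ "\<lambda>e'. if e' = e then mon t d m else 0"]) (auto intro: pol_mon int_span_zero)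
    qed
  qed
  then show ?thesis by blast
qed

text \<open>
Successive approximation: the error of an approximation is \<open>w\<close> times an element of the unit ball, to
which the approximation is applied again.  The coefficients of the members of \<open>E\<close> form convergent series.
\<close>

lemma pol_closure_generates:
  assumes E: "finite E" "E \<subseteq> disc 1" and gen: "generates t d w E" and x: "x \<in> disc 1"
  shows "\<exists>c. (\<forall>e. c e \<in> pol_closure t d w) \<and> x - (\<Sum>e\<in>E. c e * e) \<in> M"
proof -
  have "\<forall>x\<in>disc 1. \<exists>p. (\<forall>e. fst p e \<in> pol t d) \<and> snd p \<in> disc 1 \<and>
      x - (\<Sum>e\<in>E. fst p e * e) - \<kappa> w * snd p \<in> M"
  proof
    fix x assume "x \<in> disc 1"
    then obtain y where y: "y \<in> int_span {mon t d m * e | m e. e \<in> E}" "x - y \<in> disc w"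
      using gen unfolding generates_def by blast
    obtain c where c: "\<forall>e. c e \<in> pol t d" "y = (\<Sum>e\<in>E. c e * e)" using span_repr[OF y(1) E(1)] by blast
    obtain b m where "x - y = \<kappa> w * b + m" "b \<in> B" "m \<in> M" using y(2) unfolding disc_def by blast
    then show "\<exists>p. (\<forall>e. fst p e \<in> pol t d) \<and> snd p \<in> disc 1 \<and>
        x - (\<Sum>e\<in>E. fst p e * e) - \<kappa> w * snd p \<in> M"
      using c B_disc by (intro exI[of _ "(c, b)"]) simp
  qed
  from bchoice[OF this] obtain CX where CX0: "\<forall>x\<in>disc 1. (\<forall>e. fst (CX x) e \<in> pol t d) \<and>
      snd (CX x) \<in> disc 1 \<and> x - (\<Sum>e\<in>E. fst (CX x) e * e) - \<kappa> w * snd (CX x) \<in> M" ..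
  define C where "C x = fst (CX x)" for x
  define X where "X x = snd (CX x)" for x
  have CX: "C x e \<in> pol t d" "X x \<in> disc 1" "x - (\<Sum>e\<in>E. C x e * e) - \<kappa> w * X x \<in> M"
    if "x \<in> disc 1" for x e
    using CX0 that by (simp_all add: C_def X_def)
  \<comment> \<open>\<open>xs i\<close> is the error after \<open>i\<close> steps, divided by \<open>w ^ i\<close>.\<close>
  define xs where "xs i = (X ^^ i) x" for i
  define cs where "cs i e = C (xs i) e" for i e
  have xs: "xs i \<in> disc 1" for i by (induction i) (simp_all add: xs_def x CX)
  have cs: "cs i e \<in> pol t d" for i e unfolding cs_def using CX xs by blast
  have approx: "x - (\<Sum>j<i. \<kappa> w ^ j * (\<Sum>e\<in>E. cs j e * e)) - \<kappa> w ^ i * xs i \<in> M" for i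
  proof (induction i)
    case 0
    show ?case by (simp add: xs_def M_0)
  next
    case (Suc i)
    have "x - (\<Sum>j<Suc i. \<kappa> w ^ j * (\<Sum>e\<in>E. cs j e * e)) - \<kappa> w ^ Suc i * xs (Suc i) =
      (x - (\<Sum>j<i. \<kappa> w ^ j * (\<Sum>e\<in>E. cs j e * e)) - \<kappa> w ^ i * xs i) +
      \<kappa> (w ^ i) * (xs i - (\<Sum>e\<in>E. cs i e * e) - \<kappa> w * xs (Suc i))"
      by (simp add: algebra_simps \<kappa>_power)
    also have "\<dots> \<in> M" using Suc CX(3)[OF xs, of i] M_scale by (intro M_add) (simp_all add: cs_def xs_def)
    finally show ?case .
  qed
  have csd: "cs i e \<in> disc 1" for i e using pol_disc[OF cs t] .
  have "\<exists>f\<in>disc 1. \<forall>i. f - (\<Sum>j<i. \<kappa> w ^ j * cs j e) \<in> disc (w ^ i)" for e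
    using complete_disc[of w "\<lambda>i. cs i e", OF w csd] .
  then obtain f where f: "\<And>e. f e \<in> disc 1" "\<And>e i. f e - (\<Sum>j<i. \<kappa> w ^ j * cs j e) \<in> disc (w ^ i)"
    by metis
  have wpow: "av (w ^ j) \<le> 1" for j using w by (simp add: av_power power_le_one)
  have fhat: "f e \<in> pol_closure t d w" for e
    unfolding pol_closure_def
  proof (intro CollectI conjI allI f(1))
    fix i
    have "(\<Sum>j<i. \<kappa> (w ^ j) * cs j e) \<in> pol t d"
      using wpow by (intro int_span_sum int_span_scale cs)
    then show "\<exists>c\<in>pol t d. f e - c \<in> disc (w ^ i)" using f(2)[of e i] by (auto simp: \<kappa>_power)
  qed
  have "x - (\<Sum>e\<in>E. f e * e) \<in> disc (w ^ i)" for i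
  proof -
    have "(\<Sum>e\<in>E. (\<Sum>j<i. \<kappa> w ^ j * cs j e) * e) = (\<Sum>j<i. \<kappa> w ^ j * (\<Sum>e\<in>E. cs j e * e))"
      by (simp add: sum_distrib_left sum_distrib_right mult.assoc sum.swap[of _ E])
    then have "x - (\<Sum>e\<in>E. f e * e) = (x - (\<Sum>j<i. \<kappa> w ^ j * (\<Sum>e\<in>E. cs j e * e)) - \<kappa> w ^ i * xs i)
       + \<kappa> w ^ i * xs i - (\<Sum>e\<in>E. (f e - (\<Sum>j<i. \<kappa> w ^ j * cs j e)) * e)"
      by (simp add: left_diff_distrib sum_subtractf)
    also have "\<dots> \<in> disc (w ^ i)"
    proof (rule disc_diff[OF disc_add])
      show "x - (\<Sum>j<i. \<kappa> w ^ j * (\<Sum>e\<in>E. cs j e * e)) - \<kappa> w ^ i * xs i \<in> disc (w ^ i)"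
        by (intro M_disc approx)
      show "\<kappa> w ^ i * xs i \<in> disc (w ^ i)" using disc_scale[OF xs, of "w ^ i" i] by (simp add: \<kappa>_power)
      show "(\<Sum>e\<in>E. (f e - (\<Sum>j<i. \<kappa> w ^ j * cs j e)) * e) \<in> disc (w ^ i)"
      proof (rule disc_sum)
        show "(f e - (\<Sum>j<i. \<kappa> w ^ j * cs j e)) * e \<in> disc (w ^ i)" if "e \<in> E" for e
          using disc_mult1[OF _ f(2), of e] E(2) that by (auto simp: mult.commute)
      qed
    qed
    finally show ?thesis .
  qed
  then have "x - (\<Sum>e\<in>E. f e * e) \<in> M" using separated_discs[OF w(2)] by blast
  then show ?thesis using fhat by blast
qed

lemma frac_generates:
  assumes E: "finite E" "E \<subseteq> disc 1" and gen: "generates t d w E" and x: "x \<in> alg"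
  shows "\<exists>c. (\<forall>e. c e \<in> frac t d w) \<and> x - (\<Sum>e\<in>E. c e * e) \<in> M"
proof -
  obtain k where k: "k \<noteq> 0" "\<kappa> k * x \<in> disc 1" using alg_normalise[OF x] .
  obtain c where c: "\<And>e. c e \<in> pol_closure t d w" "\<kappa> k * x - (\<Sum>e\<in>E. c e * e) \<in> M"
    using pol_closure_generates[OF E gen k(2)] by blast
  have kf: "\<kappa> (inverse k) \<in> frac t d w"
  proof (cases "av k \<le> 1")
    case True
    then show ?thesis unfolding frac_def using k \<kappa>_inverse[OF k(1)] pol_closure_pol[OF pol_1]
      by (intro CollectI exI[of _ k]) simp
  next
    case False
    then have "av (inverse k) \<le> 1" by (simp add: av_inverse inverse_le_1_iff)
    then show ?thesis using frac_hat pol_closure_scale[OF pol_closure_pol[OF pol_1], of "inverse k"] by simp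
  qed
  have "x - (\<Sum>e\<in>E. \<kappa> (inverse k) * c e * e) = \<kappa> (inverse k) * (\<kappa> k * x - (\<Sum>e\<in>E. c e * e))"
  proof -
    have "x = \<kappa> (inverse k) * (\<kappa> k * x)"
      using \<kappa>_inverse[OF k(1)] by (metis mult.commute mult.assoc mult_1)
    then show ?thesis by (simp add: right_diff_distrib sum_distrib_left mult.assoc)
  qed
  then have "x - (\<Sum>e\<in>E. \<kappa> (inverse k) * c e * e) \<in> M" using M_scale[OF c(2)] by simp
  then show ?thesis using frac_closed(2)[OF kf frac_hat[OF c(1)]]
    by (intro exI[of _ "\<lambda>e. \<kappa> (inverse k) * c e"]) blast
qed

lemma frac_inverse:
  assumes E: "finite E" "E \<subseteq> disc 1" and gen: "generates t d w E" and s: "s \<in> frac t d w" "s \<notin> M"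
  shows "\<exists>s'\<in>frac t d w. s * s' - 1 \<in> M"
proof (rule subring_inverse_if_finite[OF _ _ _ _ frac_alg E(1) _ _ s])
  show "E \<subseteq> alg" using E(2) alg_disc by blast
  show "1 \<in> frac t d w" using frac_hat[OF pol_closure_pol[OF pol_1]] .
  show "\<exists>c. (\<forall>e. c e \<in> frac t d w) \<and> f - (\<Sum>e\<in>E. c e * e) \<in> M" if "f \<in> alg" for f
    using frac_generates[OF E gen that] .
qed (auto intro: frac_closed)

text \<open>
If a variable is present, then the \<open>t\<close> are nearly dependent: some polynomial whose largest coefficient has absolute value 1 is
small at \<open>t\<close>.  If \<open>t 0\<close> is not zero in \<open>K\<close>, it has an inverse \<open>s\<close> in the field of limits of polynomials, and after
approximation of \<open>s\<close> by a polynomial \<open>g\<close> the polynomial \<open>t 0 * g - c\<close> is much smaller than its constant term \<open>c\<close>.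
Dividing by the largest coefficient gives the claim.
\<close>

lemma relation_of_generators:
  assumes E: "finite E" "E \<subseteq> disc 1" and gen: "generates t d w E" and d: "0 < d"
  shows "\<exists>F a m0 w'. finite F \<and> F \<subseteq> {m. \<forall>i\<ge>d. m i = 0} \<and> m0 \<in> F \<and> (\<forall>m\<in>F. av (a m) \<le> 1) \<and> av (a m0) = 1 \<and>
           0 < av w' \<and> av w' < 1 \<and> (\<Sum>m\<in>F. \<kappa> (a m) * mon t d m) \<in> disc w'"
proof -
  define e0 :: "nat \<Rightarrow> nat" where "e0 i = (if i = 0 then 1 else 0)" for i
  have t0: "mon t d e0 = t 0"
    unfolding mon_def e0_def using d by (subst prod.remove[of _ 0]) (auto intro: prod.neutral)
  show ?thesis
  proof (cases "t 0 \<in> M")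
    case True
    then show ?thesis
      using d w M_disc
      by (intro exI[of _ "{e0}"] exI[of _ "\<lambda>_. 1"] exI[of _ e0] exI[of _ w]) (auto simp: t0 \<kappa>_1 av_1 e0_def)
  next
    case False
    have "t 0 \<in> frac t d w" using frac_hat pol_closure_pol pol_mon[of t d e0] unfolding t0 by blast
    then obtain s where s: "s \<in> frac t d w" "t 0 * s - 1 \<in> M" using frac_inverse[OF E gen _ False] by blast
    obtain c where c: "c \<noteq> 0" "av c \<le> 1" "\<kappa> c * s \<in> pol_closure t d w" using s(1) unfolding frac_def by blast
    obtain i where i: "av (w ^ i) < av c" using power_small[OF w(2) c(1)] by blast
    obtain g where g: "g \<in> pol t d" "\<kappa> c * s - g \<in> disc (w ^ i)" using c(3) unfolding pol_closure_def by blast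
    define Mon where "Mon = {m :: nat \<Rightarrow> nat. \<forall>i\<ge>d. m i = 0}"
    have "range (mon t d) = mon t d ` Mon"
    proof (intro equalityI subsetI)
      fix x assume "x \<in> range (mon t d)"
      then obtain m where "x = mon t d m" by blast
      moreover have "mon t d m = mon t d (\<lambda>i. if i < d then m i else 0)" by (simp add: mon_def)
      ultimately show "x \<in> mon t d ` Mon"
        by (intro image_eqI[of _ _ "\<lambda>i. if i < d then m i else 0"]) (simp_all add: Mon_def)
    qed auto
    then obtain F a where F: "finite F" "F \<subseteq> Mon" "\<And>m. av (a m) \<le> 1" "g = (\<Sum>m\<in>F. \<kappa> (a m) * mon t d m)"
      using int_span_image_repr[of g "mon t d" Mon] g(1) by metis
    define sh where "sh m = (\<lambda>i. e0 i + m i)" for m :: "nat \<Rightarrow> nat"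
    have sh_inj: "inj sh" by (rule injI) (auto simp: sh_def fun_eq_iff)
    \<comment> \<open>The coefficients of \<open>t 0 * g - c\<close>; the shift of exponents by \<open>e0\<close> is multiplication by \<open>t 0\<close>.\<close>
    define a' where "a' m = (if m = (\<lambda>_. 0) then - c else a (inv_into UNIV sh m))" for m
    let ?z = "\<lambda>_::nat. 0::nat"
    have sh_nz: "sh m \<noteq> ?z" for m
    proof
      assume "sh m = ?z"
      then have "sh m 0 = 0" by (simp only:)
      then show False by (simp add: sh_def e0_def)
    qed
    then have z: "?z \<notin> sh ` F" by (metis imageE)
    let ?F = "insert ?z (sh ` F)"
    have "(\<Sum>m\<in>?F. \<kappa> (a' m) * mon t d m) = \<kappa> (- c) + (\<Sum>m\<in>sh ` F. \<kappa> (a' m) * mon t d m)"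
      using z F(1) by (simp add: a'_def mon_0)
    also have "(\<Sum>m\<in>sh ` F. \<kappa> (a' m) * mon t d m) = (\<Sum>m\<in>F. \<kappa> (a m) * (mon t d e0 * mon t d m))"
      unfolding mon_mult using sh_nz sh_inj
      by (subst sum.reindex) (auto simp: a'_def sh_def[symmetric] inv_f_f intro: inj_on_subset intro!: sum.cong)
    also have "\<dots> = t 0 * g" unfolding t0 F(4) sum_distrib_left by (intro sum.cong) (simp_all add: algebra_simps)
    finally have sum: "(\<Sum>m\<in>?F. \<kappa> (a' m) * mon t d m) = t 0 * g - \<kappa> c" by (simp add: \<kappa>_minus)
    have "t 0 * g - \<kappa> c = \<kappa> c * (t 0 * s - 1) - t 0 * (\<kappa> c * s - g)" by (simp add: algebra_simps)
    also have "\<dots> \<in> disc (w ^ i)"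
      using M_scale[OF s(2)] disc_mult1[OF t[OF d] g(2)] by (intro disc_diff[OF M_disc])
    finally have in_disc: "(\<Sum>m\<in>?F. \<kappa> (a' m) * mon t d m) \<in> disc (w ^ i)" unfolding sum .
    define q where "q = Max ((\<lambda>m. av (a' m)) ` ?F)"
    have fin: "finite ?F" using F(1) by simp
    have "q \<in> (\<lambda>m. av (a' m)) ` ?F" unfolding q_def using fin by (intro Max_in) auto
    then obtain m0 where m0: "m0 \<in> ?F" "av (a' m0) = q" by blast
    have le_q: "av (a' m) \<le> q" if "m \<in> ?F" for m
      unfolding q_def using fin that by (intro Max_ge finite_imageI imageI)
    have "av c \<le> q" using le_q[of ?z] by (simp add: a'_def av_minus)
    then have q: "av (w ^ i) < q" "0 < q" using i av_pos[OF c(1)] by auto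
    then have a0: "a' m0 \<noteq> 0" using m0 av_0 by auto
    define a'' where "a'' m = a' m / a' m0" for m
    have "(\<Sum>m\<in>?F. \<kappa> (a'' m) * mon t d m) = \<kappa> (inverse (a' m0)) * (\<Sum>m\<in>?F. \<kappa> (a' m) * mon t d m)"
      unfolding sum_distrib_left by (intro sum.cong) (simp_all add: a''_def divide_inverse \<kappa>_mult algebra_simps)
    also have "\<dots> \<in> disc (inverse (a' m0) * w ^ i)" using disc_scale[OF in_disc] .
    finally have "(\<Sum>m\<in>?F. \<kappa> (a'' m) * mon t d m) \<in> disc (inverse (a' m0) * w ^ i)" .
    moreover have *: "av (inverse (a' m0) * w ^ i) = av w ^ i / q"
      by (simp only: av_mult av_inverse av_power m0(2) divide_inverse mult.commute)
    moreover have "0 < av (inverse (a' m0) * w ^ i)" "av (inverse (a' m0) * w ^ i) < 1"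
      unfolding * using q w by (simp_all add: av_power)
    moreover have "av (a'' m) \<le> 1" if "m \<in> ?F" for m
      using le_q[OF that] q m0 by (simp add: a''_def av_divide)
    moreover have "av (a'' m0) = 1" using m0 q a0 by (simp add: a''_def av_1)
    moreover have "?F \<subseteq> {m. \<forall>i\<ge>d. m i = 0}" using F(2) d by (auto simp: Mon_def sh_def e0_def)
    ultimately show ?thesis using fin m0(1)
      by (intro exI[of _ ?F] exI[of _ a''] exI[of _ m0] exI[of _ "inverse (a' m0) * w ^ i"] conjI ballI)
  qed
qed

end
end

context residue_field_of_complete_algebra
begin

text \<open>
Polynomials in \<open>x\<close> of degree less than \<open>N\<close> whose coefficients are integral polynomials in \<open>t\<close>.
\<close>

section \<open>Elimination of variables\<close>

definition below_degree :: "(nat \<Rightarrow> 'a) \<Rightarrow> nat \<Rightarrow> 'a \<Rightarrow> nat \<Rightarrow> 'a set" where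
  "below_degree t r x N = int_span {mon t r m * x ^ l | m l. l < N}"

lemma below_degree_mono: "y \<in> below_degree t r x N \<Longrightarrow> N \<le> N' \<Longrightarrow> y \<in> below_degree t r x N'"
  unfolding below_degree_def by (erule int_span_mono, intro subsetI int_span_base, use order_less_le_trans in blast)

lemma below_degree_mult:
  assumes "a \<in> below_degree t r x (Suc N)" "b \<in> below_degree t r x N'"
  shows "a * b \<in> below_degree t r x (N + N')"
  using assms unfolding below_degree_def
proof (rule int_span_mult)
  fix g h assume "g \<in> {mon t r m * x ^ l |m l. l < Suc N}" "h \<in> {mon t r m * x ^ l |m l. l < N'}"
  then obtain m l m' l' where *: "g = mon t r m * x ^ l" "l < Suc N" "h = mon t r m' * x ^ l'" "l' < N'" by blast
  have "g * h = mon t r (\<lambda>i. m i + m' i) * x ^ (l + l')"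
    by (simp add: *(1,3) mon_mult[symmetric] power_add algebra_simps)
  moreover have "l + l' < N + N'" using * by simp
  ultimately show "g * h \<in> int_span {mon t r m * x ^ l |m l. l < N + N'}" by (intro int_span_base) blast
qed

lemma below_degree_power: "x ^ k \<in> below_degree t r x (Suc k)"
  unfolding below_degree_def by (intro int_span_base CollectI exI[of _ "\<lambda>_. 0"] exI[of _ k]) (simp add: mon_0)

text \<open>
A value of a monic polynomial of degree \<open>N\<close> in \<open>x\<close>.
\<close>

definition monic :: "(nat \<Rightarrow> 'a) \<Rightarrow> nat \<Rightarrow> 'a \<Rightarrow> nat \<Rightarrow> 'a \<Rightarrow> bool" where
  "monic t r x N y \<longleftrightarrow> y - x ^ N \<in> below_degree t r x N"

lemma monic_low: "monic t r x N y \<Longrightarrow> y \<in> below_degree t r x (Suc N)"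
proof -
  assume "monic t r x N y"
  then have "y - x ^ N \<in> below_degree t r x (Suc N)" unfolding monic_def by (rule below_degree_mono) simp
  then have "(y - x ^ N) + x ^ N \<in> below_degree t r x (Suc N)"
    using below_degree_power[of x N t r] unfolding below_degree_def by (rule int_span_add)
  then show ?thesis by simp
qed

lemma monic_mult:
  assumes "monic t r x N y" "monic t r x N' y'" shows "monic t r x (N + N') (y * y')"
proof -
  have "y * y' - x ^ (N + N') = y * (y' - x ^ N') + x ^ N' * (y - x ^ N)"
    by (simp add: power_add algebra_simps)
  moreover have "y * (y' - x ^ N') \<in> below_degree t r x (N + N')"
    using below_degree_mult[OF monic_low[OF assms(1)]] assms(2) unfolding monic_def by blast
  moreover have "x ^ N' * (y - x ^ N) \<in> below_degree t r x (N' + N)"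
    using below_degree_mult[OF below_degree_power] assms(1) unfolding monic_def by blast
  ultimately show ?thesis unfolding monic_def below_degree_def by (simp add: add.commute int_span_add)
qed

lemma monic_1: "monic t r x 0 1" unfolding monic_def below_degree_def by (simp add: int_span_zero)

lemma monic_power: "monic t r x N y \<Longrightarrow> monic t r x (k * N) (y ^ k)"
  by (induction k) (auto simp: monic_1 intro: monic_mult)

lemma monic_prod:
  fixes n :: nat
  shows "(\<And>i. i < n \<Longrightarrow> monic t r x (N i) (y i)) \<Longrightarrow> monic t r x (\<Sum>i<n. N i) (\<Prod>i<n. y i)"
  by (induction n) (auto simp: monic_1 intro: monic_mult)

lemma mon_variable:
  assumes "i < r" shows "mon t r (\<lambda>j. if j = i then 1 else 0) = t i"
proof -
  have "mon t r (\<lambda>j. if j = i then 1 else 0) = (\<Prod>j<r. if j = i then t j else 1)"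
    unfolding mon_def by (intro prod.cong) auto
  then show ?thesis using assms by (simp add: prod.delta)
qed

text \<open>
Nagata's substitution, with \<open>x = t 0\<close> and \<open>t (i + 1) = t' i + x ^ (b ^ (i + 1))\<close>, turns the monomial with exponents \<open>m\<close>
into a monic polynomial in \<open>x\<close> of degree \<open>W m\<close>.  These degrees are different for the monomials whose coefficients have
absolute value 1.  So, up to small terms, the given relation expresses \<open>x ^ N\<close>, for the largest degree \<open>N\<close>, by lower powers of \<open>x\<close>;
therefore every polynomial in \<open>t\<close> is, up to small terms, of degree less than \<open>N\<close> in \<open>x\<close>.
\<close>

lemma elimination_of_variable:
  assumes t: "\<And>i. i < Suc r \<Longrightarrow> t i \<in> disc 1" and w: "0 < av w" "av w < 1"
    and E: "finite E" "E \<subseteq> disc 1" and gen: "generates t (Suc r) w E"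
    and F: "finite F" "F \<subseteq> {m. \<forall>i\<ge>Suc r. m i = 0}" "m0 \<in> F" "\<And>m. m \<in> F \<Longrightarrow> av (a m) \<le> 1" "av (a m0) = 1"
    and w': "0 < av w'" "av w' < 1" and rel: "(\<Sum>m\<in>F. \<kappa> (a m) * mon t (Suc r) m) \<in> disc w'"
  shows "\<exists>t' E' w2. (\<forall>i<r. t' i \<in> disc 1) \<and> 0 < av w2 \<and> av w2 < 1 \<and> finite E' \<and> E' \<subseteq> disc 1 \<and> generates t' r w2 E'"
proof -
  define x where "x = t 0"
  have xd: "x \<in> disc 1" unfolding x_def using t by simp
  \<comment> \<open>A base that exceeds all exponents.\<close>
  define b where "b = Suc (\<Sum>m\<in>F. \<Sum>i<Suc r. m i)"
  have b: "m i < b" if "m \<in> F" "i < Suc r" for m i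
  proof -
    have "m i \<le> (\<Sum>i<Suc r. m i)" using that by (intro member_le_sum) auto
    also have "\<dots> \<le> (\<Sum>m\<in>F. \<Sum>i<Suc r. m i)" using that F(1) by (intro member_le_sum[of m F "\<lambda>m. \<Sum>i<Suc r. m i"]) auto
    finally show ?thesis by (simp add: b_def)
  qed
  define t' where "t' i = t (Suc i) - x ^ (b ^ Suc i)" for i
  have t'd: "t' i \<in> disc 1" if "i < r" for i
    unfolding t'_def using t that xd by (intro disc_diff disc_power) auto
  define W where "W m = (\<Sum>i<Suc r. m i * b ^ i)" for m
  let ?below_degree = "below_degree t' r x"
  have "monic t' r x (b ^ i) (t i)" if "i < Suc r" for i
  proof (cases i)
    case 0
    then show ?thesis by (simp add: monic_def x_def below_degree_def int_span_zero)
  next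
    case (Suc j)
    then have "t i - x ^ (b ^ i) = mon t' r (\<lambda>l. if l = j then 1 else 0) * x ^ 0"
      using mon_variable[of j r t'] that by (simp add: t'_def)
    moreover have "0 < b ^ i" by (simp add: b_def)
    ultimately show ?thesis unfolding monic_def below_degree_def by (intro int_span_base) blast
  qed
  then have monic: "monic t' r x (W m) (mon t (Suc r) m)" for m
    unfolding W_def mon_def by (intro monic_prod monic_power)
  define F1 where "F1 = {m \<in> F. av (a m) = 1}"
  have F1: "finite F1" "m0 \<in> F1" using F by (auto simp: F1_def)
  have "Max (W ` F1) \<in> W ` F1" using F1 by (intro Max_in) auto
  then obtain m1 where m1: "m1 \<in> F1" "W m1 = Max (W ` F1)" by auto
  define N where "N = W m1"
  have W_less: "W m < N" if "m \<in> F1" "m \<noteq> m1" for m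
  proof -
    have "W m \<le> N" unfolding N_def m1(2) using that F1 by (intro Max_ge) auto
    moreover have "W m \<noteq> N"
    proof
      assume "W m = N"
      have "m i = m1 i" for i
      proof (cases "i < Suc r")
        case True
        then show ?thesis using digit_sum_inj[of "Suc r" m b m1 i] b \<open>W m = N\<close> that m1(1)
          unfolding N_def W_def F1_def by blast
      next
        case False
        moreover have "m \<in> {m. \<forall>i\<ge>Suc r. m i = 0}" "m1 \<in> {m. \<forall>i\<ge>Suc r. m i = 0}"
          using F(2) that m1(1) unfolding F1_def by blast+
        ultimately show ?thesis by simp
      qed
      then show False using that by auto
    qed
    ultimately show ?thesis by simp
  qed
  \<comment> \<open>The largest of the errors that occur becomes the new precision.\<close>
  let ?C = "insert w (insert w' (a ` {m \<in> F. av (a m) < 1}))"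
  have "Max (av ` ?C) \<in> av ` ?C" using F(1) by (intro Max_in) auto
  then obtain w2 where w2: "Max (av ` ?C) = av w2" "w2 \<in> ?C" by (rule imageE)
  have le_w2: "av c \<le> av w2" if "c \<in> ?C" for c
    unfolding w2(1)[symmetric] using F(1) that by (intro Max_ge) auto
  have w2': "0 < av w2" "av w2 < 1" using le_w2[of w] w w' w2(2) by auto
  define Q where "Q = {y. \<exists>z\<in>?below_degree N. y - z \<in> disc w2}"
  have Q_low: "y \<in> Q" if "y \<in> ?below_degree N" for y
    unfolding Q_def using that disc_0 by (intro CollectI bexI[of _ y]) auto
  have Q_disc: "y \<in> Q" if "y \<in> disc w2" for y
    unfolding Q_def below_degree_def using that by (intro CollectI bexI[of _ 0]) (auto intro: int_span_zero)
  have Q_add: "y + z \<in> Q" if yz: "y \<in> Q" "z \<in> Q" for y z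
  proof -
    obtain u v where "u \<in> ?below_degree N" "y - u \<in> disc w2" "v \<in> ?below_degree N" "z - v \<in> disc w2" using yz unfolding Q_def by blast
    then show ?thesis unfolding Q_def below_degree_def
      using disc_add[of "y - u" w2 "z - v"]
      by (intro CollectI bexI[of _ "u + v"]) (auto intro: int_span_add simp: add_diff_add)
  qed
  have Q_pol: "p * y \<in> Q" if p: "p \<in> pol t' r" "y \<in> Q" for p y
  proof -
    obtain u where u: "u \<in> ?below_degree N" "y - u \<in> disc w2" using p unfolding Q_def by blast
    have "p \<in> ?below_degree (Suc 0)"
      using p(1) unfolding below_degree_def by (rule int_span_mono) (auto intro!: int_span_base)
    then have "p * u \<in> ?below_degree N" using below_degree_mult[OF _ u(1), of p 0] by simp
    moreover have "p * y - p * u \<in> disc w2"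
      unfolding right_diff_distrib[symmetric] using pol_disc[OF p(1) t'd] u(2) by (intro disc_mult1) auto
    ultimately show ?thesis unfolding Q_def by blast
  qed
  have pol_const: "\<kappa> c \<in> pol t' r" if "av c \<le> 1" for c
    using int_span_scale[OF pol_1 that, of t' r] by simp
  have Q_scale: "\<kappa> c * y \<in> Q" if "av c \<le> 1" "y \<in> Q" for c y
    using Q_pol[OF pol_const] that by blast
  have Q_0: "0 \<in> Q" using Q_disc disc_0 by blast
  have Q_sum: "(\<Sum>i\<in>I. f i) \<in> Q" if "\<And>i. i \<in> I \<Longrightarrow> f i \<in> Q" for f :: "(nat \<Rightarrow> nat) \<Rightarrow> 'a" and I
    using that by (induction I rule: infinite_finite_induct) (auto simp: Q_0 Q_add)
  have Q_minus: "- y \<in> Q" if "y \<in> Q" for y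
    using Q_scale[of "- 1" y] that by (simp add: av_minus av_1 \<kappa>_simps)
  have xN: "x ^ N \<in> Q"
  proof -
    have m1F: "m1 \<in> F" "av (a m1) = 1" using m1(1) by (auto simp: F1_def)
    have rest: "\<kappa> (a m) * mon t (Suc r) m \<in> Q" if m: "m \<in> F - {m1}" for m
    proof (cases "av (a m) = 1")
      case True
      then have "W m < N" using W_less m by (auto simp: F1_def)
      then have "mon t (Suc r) m \<in> ?below_degree N" using below_degree_mono[OF monic_low[OF monic]] by simp
      then show ?thesis using Q_scale Q_low True by simp
    next
      case False
      then have "a m \<in> ?C" using F(4)[of m] m by force
      then have "\<kappa> (a m) * mon t (Suc r) m \<in> disc w2"
        using disc_mono[OF le_w2] disc_scale[OF mon_disc[OF t], where c = "a m"] by auto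
      then show ?thesis using Q_disc by blast
    qed
    have "(\<Sum>m\<in>F. \<kappa> (a m) * mon t (Suc r) m) \<in> Q"
      using Q_disc disc_mono[OF le_w2 rel] by simp
    moreover have "(\<Sum>m\<in>F. \<kappa> (a m) * mon t (Suc r) m) =
        \<kappa> (a m1) * mon t (Suc r) m1 + (\<Sum>m\<in>F - {m1}. \<kappa> (a m) * mon t (Suc r) m)"
      using F(1) m1F by (simp add: sum.remove)
    ultimately have all: "\<kappa> (a m1) * mon t (Suc r) m1 + (\<Sum>m\<in>F - {m1}. \<kappa> (a m) * mon t (Suc r) m) \<in> Q"
      by simp
    have "(\<Sum>m\<in>F - {m1}. \<kappa> (a m) * mon t (Suc r) m) \<in> Q" by (intro Q_sum rest)
    from Q_add[OF all Q_minus[OF this]]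
    have "\<kappa> (a m1) * mon t (Suc r) m1 \<in> Q" by simp
    moreover have "av (inverse (a m1)) \<le> 1" using m1F by (simp add: av_inverse)
    ultimately have "\<kappa> (inverse (a m1)) * (\<kappa> (a m1) * mon t (Suc r) m1) \<in> Q" using Q_scale by blast
    moreover have "a m1 \<noteq> 0" using m1F av_0 by auto
    ultimately have "mon t (Suc r) m1 \<in> Q"
      using \<kappa>_inverse[of "a m1"] by (metis mult.assoc mult.commute mult_1)
    moreover have "mon t (Suc r) m1 - x ^ N \<in> Q"
      using monic[of m1] Q_low unfolding monic_def N_def by blast
    ultimately have "mon t (Suc r) m1 + - (mon t (Suc r) m1 - x ^ N) \<in> Q" by (intro Q_add Q_minus)
    then show ?thesis by simp
  qed
  have below_degree_Suc: "y \<in> Q" if "y \<in> ?below_degree (Suc N)" for y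
    using that unfolding below_degree_def
  proof (rule int_span_least)
    show "{mon t' r m * x ^ l |m l. l < Suc N} \<subseteq> Q"
    proof clarify
      fix m l assume "l < Suc N"
      then consider "l < N" | "l = N" by linarith
      then show "mon t' r m * x ^ l \<in> Q"
      proof cases
        case 1
        then show ?thesis by (intro Q_low) (auto simp: below_degree_def intro!: int_span_base)
      qed (use Q_pol[OF pol_mon xN] in simp)
    qed
  qed (use Q_0 Q_add Q_scale in auto)
  have Q_x: "x * y \<in> Q" if y: "y \<in> Q" for y
  proof -
    obtain u where u: "u \<in> ?below_degree N" "y - u \<in> disc w2" using y unfolding Q_def by blast
    have "x \<in> ?below_degree (Suc 1)" using below_degree_power[of x 1] by simp
    then have "x * u \<in> Q" using below_degree_mult[OF _ u(1), of x 1] below_degree_Suc by simp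
    moreover have "x * (y - u) \<in> Q" using disc_mult1[OF xd u(2)] Q_disc by blast
    ultimately have "x * u + x * (y - u) \<in> Q" by (rule Q_add)
    then show ?thesis by (simp add: algebra_simps)
  qed
  have Q_pow: "x ^ k \<in> Q" for k
  proof (induction k)
    case 0
    show ?case using below_degree_Suc below_degree_mono[OF below_degree_power[of x 0 t' r], of "Suc N"] by simp
  qed (simp add: Q_x)
  have Q_mon: "mon t (Suc r) m \<in> Q" for m
    using monic_low[OF monic[of m]] unfolding below_degree_def
    by (rule int_span_least) (auto simp: Q_0 Q_add Q_scale intro!: Q_pol[OF pol_mon Q_pow])
  define E' where "E' = {x ^ l * e | l e. l < N \<and> e \<in> E}"
  have "E' = (\<lambda>(l, e). x ^ l * e) ` ({..<N} \<times> E)" by (auto simp: E'_def)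
  then have E'f: "finite E'" using E(1) by simp
  have E'd: "E' \<subseteq> disc 1" unfolding E'_def using E(2) xd by (auto intro!: disc_mult1 disc_power)
  let ?G = "{mon t' r m * e |m e. e \<in> E'}"
  have "generates t' r w2 E'"
    unfolding generates_def
  proof
    fix f assume "f \<in> disc 1"
    then obtain y where y: "y \<in> int_span {mon t (Suc r) m * e |m e. e \<in> E}" "f - y \<in> disc w"
      using gen unfolding generates_def by blast
    have "y \<in> {y. \<exists>z\<in>int_span ?G. y - z \<in> disc w2}"
      using y(1)
    proof (rule int_span_least)
      show "0 \<in> {y. \<exists>z\<in>int_span ?G. y - z \<in> disc w2}" using int_span_zero disc_0 by force
      show "u + v \<in> {y. \<exists>z\<in>int_span ?G. y - z \<in> disc w2}"
        if uv: "u \<in> {y. \<exists>z\<in>int_span ?G. y - z \<in> disc w2}" "v \<in> {y. \<exists>z\<in>int_span ?G. y - z \<in> disc w2}" for u v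
      proof -
        obtain u' v' where "u' \<in> int_span ?G" "u - u' \<in> disc w2" "v' \<in> int_span ?G" "v - v' \<in> disc w2" using uv by blast
        then show ?thesis using disc_add[of "u - u'" w2 "v - v'"]
          by (intro CollectI bexI[of _ "u' + v'"]) (simp_all add: add_diff_add int_span_add)
      qed
      show "\<kappa> c * u \<in> {y. \<exists>z\<in>int_span ?G. y - z \<in> disc w2}"
        if c: "av c \<le> 1" "u \<in> {y. \<exists>z\<in>int_span ?G. y - z \<in> disc w2}" for c u
      proof -
        obtain u' where "u' \<in> int_span ?G" "u - u' \<in> disc w2" using c by blast
        then show ?thesis using disc_scale1[OF c(1), of "u - u'" w2] int_span_scale[OF _ c(1)]
          by (intro CollectI bexI[of _ "\<kappa> c * u'"]) (simp_all add: right_diff_distrib)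
      qed
      show "{mon t (Suc r) m * e |m e. e \<in> E} \<subseteq> {y. \<exists>z\<in>int_span ?G. y - z \<in> disc w2}"
      proof clarify
        fix m e assume e: "e \<in> E"
        obtain u where u: "u \<in> ?below_degree N" "mon t (Suc r) m - u \<in> disc w2" using Q_mon unfolding Q_def by blast
        have "u * e \<in> int_span ?G"
        proof (rule int_span_mult[OF u(1)[unfolded below_degree_def] int_span_base[of e "{e}"]])
          fix g h assume "g \<in> {mon t' r m * x ^ l |m l. l < N}" "h \<in> {e}"
          then obtain m l where gh: "g = mon t' r m * x ^ l" "l < N" "h = e" by blast
          then have "x ^ l * e \<in> E'" using e unfolding E'_def by blast
          moreover have "g * h = mon t' r m * (x ^ l * e)" by (simp add: gh mult.assoc)
          ultimately show "g * h \<in> int_span ?G" by (intro int_span_base) blast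
        qed simp
        moreover have "mon t (Suc r) m * e - u * e \<in> disc w2"
          using disc_mult1[of e "mon t (Suc r) m - u" w2] e E(2) u(2) by (auto simp: algebra_simps)
        ultimately show "\<exists>z\<in>int_span ?G. mon t (Suc r) m * e - z \<in> disc w2" by blast
      qed
    qed
    then obtain z where z: "z \<in> int_span ?G" "y - z \<in> disc w2" by blast
    have "(f - y) + (y - z) \<in> disc w2" using z(2) disc_mono[OF le_w2 y(2)] by (intro disc_add) auto
    then show "\<exists>z\<in>int_span ?G. f - z \<in> disc w2" using z(1) by (intro bexI[of _ z]) simp
  qed
  then show ?thesis using t'd w2' E'f E'd by blast
qed

lemma generates_over_constants:
  assumes "\<And>i. i < d \<Longrightarrow> t i \<in> disc 1" "0 < av w" "av w < 1" "finite E" "E \<subseteq> disc 1" "generates t d w E"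
  shows "\<exists>t E w. 0 < av w \<and> av w < 1 \<and> finite E \<and> E \<subseteq> disc 1 \<and> generates t 0 w E"
  using assms
proof (induction d arbitrary: t E w)
  case 0
  then show ?case by blast
next
  case (Suc r)
  obtain F a m0 w' where F: "finite F" "F \<subseteq> {m. \<forall>i\<ge>Suc r. m i = 0}" "m0 \<in> F" "\<forall>m\<in>F. av (a m) \<le> 1"
    "av (a m0) = 1" "0 < av w'" "av w' < 1" "(\<Sum>m\<in>F. \<kappa> (a m) * mon t (Suc r) m) \<in> disc w'"
    using relation_of_generators[of "Suc r" t w E, OF Suc.prems] by (auto simp del: mem_Collect_eq)
  obtain t' E' w2 where "\<And>i. i < r \<Longrightarrow> t' i \<in> disc 1" "0 < av w2" "av w2 < 1" "finite E'" "E' \<subseteq> disc 1" "generates t' r w2 E'"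
    using elimination_of_variable[of r t w E F m0 a w', OF Suc.prems F(1-3) bspec[OF F(4)] F(5-8)] by blast
  then show ?case by (rule Suc.IH)
qed

end

locale residue_field_over_closed_field = residue_field_of_complete_algebra av \<kappa> B M
  for av :: "'k::field \<Rightarrow> real" and \<kappa> :: "'k \<Rightarrow> 'a::comm_ring_1" and B M :: "'a set" +
  assumes const_complete: "\<And>w c. 0 < av w \<Longrightarrow> av w < 1 \<Longrightarrow> (\<And>i::nat. av (c i) \<le> 1) \<Longrightarrow>
        \<exists>s. \<forall>i. av (s - (\<Sum>j<i. w ^ j * c j)) \<le> av w ^ i"
    and const_closed: "\<And>P :: 'k poly. 0 < degree P \<Longrightarrow> \<exists>x. poly P x = 0"
begin

text \<open>
Without variables the polynomials are the constants, which form a complete set.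
\<close>

lemma pol_closure_constants:
  assumes f: "f \<in> pol_closure t 0 w" and w: "0 < av w" "av w < 1"
  shows "\<exists>c. f - \<kappa> c \<in> M"
proof -
  have "\<exists>c. av c \<le> 1 \<and> x = \<kappa> c" if "x \<in> pol t 0" for x
  proof -
    have "x \<in> {x. \<exists>c. av c \<le> 1 \<and> x = \<kappa> c}"
      using that
    proof (rule int_span_least)
      show "u + v \<in> {x. \<exists>c. av c \<le> 1 \<and> x = \<kappa> c}"
        if "u \<in> {x. \<exists>c. av c \<le> 1 \<and> x = \<kappa> c}" "v \<in> {x. \<exists>c. av c \<le> 1 \<and> x = \<kappa> c}" for u v
        using that av_ultra by (smt (verit, best) \<kappa>_add mem_Collect_eq)
      show "\<kappa> c * u \<in> {x. \<exists>c. av c \<le> 1 \<and> x = \<kappa> c}"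
        if c: "av c \<le> 1" "u \<in> {x. \<exists>c. av c \<le> 1 \<and> x = \<kappa> c}" for c u
      proof -
        obtain d where "av d \<le> 1" "u = \<kappa> d" using c by blast
        then show ?thesis using c by (intro CollectI exI[of _ "c * d"]) (auto simp: \<kappa>_mult av_mult av_nonneg mult_le_one)
      qed
      show "0 \<in> {x. \<exists>c. av c \<le> 1 \<and> x = \<kappa> c}"
        by (intro CollectI exI[of _ 0]) (simp add: av_0 \<kappa>_0)
      have "1 \<in> {x. \<exists>c. av c \<le> 1 \<and> x = \<kappa> c}"
        by (intro CollectI exI[of _ 1]) (simp add: av_1 \<kappa>_1)
      then show "range (mon t 0) \<subseteq> {x. \<exists>c. av c \<le> 1 \<and> x = \<kappa> c}" by (auto simp: mon_def)
    qed
    then show ?thesis by blast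
  qed
  then have "\<forall>i. \<exists>c. av c \<le> 1 \<and> f - \<kappa> c \<in> disc (w ^ i)"
    using f unfolding pol_closure_def by blast
  then obtain c where c: "\<And>i. av (c i) \<le> 1" "\<And>i. f - \<kappa> (c i) \<in> disc (w ^ i)" by metis
  have w0: "w \<noteq> 0" using w av_0 by auto
  define d where "d i = (c (Suc i) - c i) / w ^ i" for i
  have "av (d i) \<le> 1" for i
  proof -
    have "av (w ^ Suc i) \<le> av (w ^ i)" using w by (simp add: av_mult av_power mult_left_le_one_le)
    then have "f - \<kappa> (c (Suc i)) \<in> disc (w ^ i)" using disc_mono c(2)[of "Suc i"] by blast
    then have "(f - \<kappa> (c i)) - (f - \<kappa> (c (Suc i))) \<in> disc (w ^ i)" using c(2)[of i] disc_diff by blast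
    then have "\<kappa> (c (Suc i) - c i) \<in> disc (w ^ i)" by (simp add: \<kappa>_diff)
    then have "av (c (Suc i) - c i) \<le> av (w ^ i)" unfolding const_in_disc_iff .
    then show ?thesis using w by (simp add: d_def av_divide av_power)
  qed
  then obtain s where s: "\<And>i. av (s - (\<Sum>j<i. w ^ j * d j)) \<le> av w ^ i" using const_complete[OF w] by blast
  have "f - \<kappa> (s + c 0) \<in> disc (w ^ i)" for i
  proof -
    have "(\<Sum>j<i. w ^ j * d j) = c i - c 0"
      using w0 by (induction i) (simp_all add: d_def)
    then have *: "s - (\<Sum>j<i. w ^ j * d j) = s + c 0 - c i" by simp
    have "\<kappa> (s + c 0 - c i) \<in> disc (w ^ i)" using s[of i] unfolding * const_in_disc_iff av_power .
    then have "(f - \<kappa> (c i)) - \<kappa> (s + c 0 - c i) \<in> disc (w ^ i)" using c(2) disc_diff by blast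
    moreover have "(f - \<kappa> (c i)) - \<kappa> (s + c 0 - c i) = f - \<kappa> (s + c 0)" by (simp add: \<kappa>_simps)
    ultimately show ?thesis by metis
  qed
  then show ?thesis using separated_discs[OF w(2)] by blast
qed

lemma frac_constants:
  assumes "s \<in> frac t 0 w" and w: "0 < av w" "av w < 1"
  shows "\<exists>c. s - \<kappa> c \<in> M"
proof -
  obtain d where d: "d \<noteq> 0" "\<kappa> d * s \<in> pol_closure t 0 w"
    using assms(1) unfolding frac_def by blast
  obtain c where c: "\<kappa> d * s - \<kappa> c \<in> M" using pol_closure_constants[OF d(2) w] by blast
  have "\<kappa> (inverse d) * (\<kappa> d * s - \<kappa> c) = s - \<kappa> (inverse d * c)"
    using \<kappa>_inverse[OF d(1)] by (simp add: right_diff_distrib \<kappa>_mult mult.assoc[symmetric] mult.commute[of "\<kappa> (inverse d)"])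
  then show ?thesis using M_scale[OF c] by metis
qed

definition ev :: "'a \<Rightarrow> 'k poly \<Rightarrow> 'a" where "ev f P = poly (map_poly \<kappa> P) f"

lemma ev_add: "ev f (P + Q) = ev f P + ev f Q"
proof -
  have "map_poly \<kappa> (P + Q) = map_poly \<kappa> P + map_poly \<kappa> Q"
    by (rule poly_eqI) (simp add: coeff_map_poly \<kappa>_simps)
  then show ?thesis by (simp add: ev_def)
qed

lemma ev_monom: "ev f (monom c i) = \<kappa> c * f ^ i"
proof -
  have "map_poly \<kappa> (monom c i) = monom (\<kappa> c) i"
    by (rule poly_eqI) (simp add: coeff_map_poly \<kappa>_simps)
  then show ?thesis by (simp add: ev_def poly_monom)
qed

lemma ev_sum: "ev f (\<Sum>i\<in>I. P i) = (\<Sum>i\<in>I. ev f (P i))"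
  by (induction I rule: infinite_finite_induct) (simp_all add: ev_add, simp_all add: ev_def)

lemma ev_linear_mult: "ev f ([:- c, 1:] * P) = (f - \<kappa> c) * ev f P"
proof -
  have *: "map_poly \<kappa> ([:- c, 1:] * P) = [:- \<kappa> c, 1:] * map_poly \<kappa> P"
    by (rule poly_eqI) (simp add: coeff_map_poly coeff_pCons \<kappa>_simps split: nat.split)
  show ?thesis unfolding ev_def * by (simp add: algebra_simps)
qed

lemma alg_ev: "f \<in> alg \<Longrightarrow> ev f P \<in> alg"
proof -
  assume f: "f \<in> alg"
  have "ev f (\<Sum>i\<le>degree P. monom (coeff P i) i) \<in> alg"
    unfolding ev_sum ev_monom using f by (intro alg_sum alg_mult alg_const alg_power)
  then show ?thesis by (simp add: poly_as_sum_of_monoms)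
qed

text \<open>
The polynomial splits into linear factors, and one of its factors has to vanish in \<open>K\<close>.
\<close>

lemma root_of_annihilator:
  assumes "f \<in> alg" "P \<noteq> 0" "ev f P \<in> M"
  shows "\<exists>c. f - \<kappa> c \<in> M"
  using assms(2,3)
proof (induction "degree P" arbitrary: P rule: less_induct)
  case less
  show ?case
  proof (cases "degree P = 0")
    case True
    then obtain c where c: "P = [:c:]" using degree_eq_zeroE by blast
    then have "\<kappa> c \<in> M" using less.prems(2) by (simp add: ev_def map_poly_pCons \<kappa>_0)
    moreover have "c \<noteq> 0" using c less.prems by simp
    ultimately have "1 \<in> M" using M_scale[of "\<kappa> c" "inverse c"] \<kappa>_inverse[of c] by (simp add: mult.commute)
    then show ?thesis using one_not_M by blast
  next
    case False
    then obtain c where "poly P c = 0" using const_closed[of P] by blast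
    then obtain Q where Q: "P = [:- c, 1:] * Q" by (meson dvdE poly_eq_0_iff_dvd)
    then have Q0: "Q \<noteq> 0" using less.prems by auto
    have deg: "degree Q < degree P" using Q0 unfolding Q by (simp add: degree_mult_eq del: mult_pCons_left)
    have PM: "(f - \<kappa> c) * ev f Q \<in> M" using less.prems(2) unfolding Q ev_linear_mult .
    show ?thesis
    proof (cases "f - \<kappa> c \<in> M")
      case False
      obtain y where y: "y \<in> alg" "(f - \<kappa> c) * y - 1 \<in> M"
        using alg_inverse[OF alg_diff[OF assms(1) alg_const] False] .
      have "ev f Q = y * ((f - \<kappa> c) * ev f Q) - ev f Q * ((f - \<kappa> c) * y - 1)" by (simp add: algebra_simps)
      also have "\<dots> \<in> M" using M_alg[OF y(1) PM] M_alg[OF alg_ev[OF assms(1)] y(2)] M_diff by blast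
      finally show ?thesis using less.hyps[OF deg Q0] by blast
    qed blast
  qed
qed

text \<open>
After the elimination of all variables \<open>K\<close> is spanned by finitely many elements over the ground field, so
sufficiently many powers of \<open>f\<close> are linearly dependent, and \<open>f\<close> is algebraic.
\<close>

theorem residue_field_is_constants:
  assumes t: "\<And>i. i < d \<Longrightarrow> t i \<in> disc 1" and w: "0 < av w" "av w < 1" and gen: "generates t d w {1}"
    and f: "f \<in> alg"
  shows "\<exists>c. f - \<kappa> c \<in> M"
proof -
  have "{1} \<subseteq> disc 1" using disc_const[of 1] by (simp add: \<kappa>_1)
  then obtain t' E w' where w': "0 < av w'" "av w' < 1" and E: "finite E" "E \<subseteq> disc 1" "generates t' 0 w' E"
    using generates_over_constants[of d t w "{1}"] t w gen by auto
  have fin: "\<exists>c. g - (\<Sum>e\<in>E. \<kappa> (c e) * e) \<in> M" if g: "g \<in> alg" for g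
  proof -
    obtain s where s: "\<And>e. s e \<in> frac t' 0 w'" "g - (\<Sum>e\<in>E. s e * e) \<in> M"
      using frac_generates[of 0 t' w' E g] w' E g by auto
    obtain c where c: "\<And>e. s e - \<kappa> (c e) \<in> M" using frac_constants[OF s(1) w'] by metis
    have "g - (\<Sum>e\<in>E. \<kappa> (c e) * e) = (g - (\<Sum>e\<in>E. s e * e)) + (\<Sum>e\<in>E. e * (s e - \<kappa> (c e)))"
      by (simp add: right_diff_distrib sum_subtractf mult.commute)
    also have "\<dots> \<in> M" using s(2) M_alg[OF _ c] E(2) alg_disc by (intro M_add M_sum) auto
    finally show ?thesis by blast
  qed
  obtain c where c: "\<And>i::nat. f ^ i - (\<Sum>e\<in>E. \<kappa> (c i e) * e) \<in> M"
    using fin[OF alg_power[OF f]] by metis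
  let ?I = "{..card E}"
  obtain x where x: "\<exists>i\<in>?I. x i \<noteq> 0" "\<And>e. e \<in> E \<Longrightarrow> (\<Sum>i\<in>?I. x i * c i e) = 0"
    using homogeneous_system_nontrivial_solution[of E ?I UNIV c] E(1) by auto
  let ?P = "\<Sum>i\<in>?I. monom (x i) i"
  have "coeff ?P j = (if j \<in> ?I then x j else 0)" for j
    by (simp add: coeff_sum if_distrib cong: if_cong)
  then have P0: "?P \<noteq> 0" using x(1) by (metis coeff_0)
  have "(\<Sum>i\<in>?I. \<kappa> (x i) * (\<Sum>e\<in>E. \<kappa> (c i e) * e)) = (\<Sum>e\<in>E. \<kappa> (\<Sum>i\<in>?I. x i * c i e) * e)"
    by (simp add: sum_distrib_left sum_distrib_right \<kappa>_sum \<kappa>_mult mult.assoc sum.swap[of _ ?I])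
  also have "\<dots> = 0" using x(2) by (simp add: \<kappa>_0)
  finally have "ev f ?P = (\<Sum>i\<in>?I. \<kappa> (x i) * (f ^ i - (\<Sum>e\<in>E. \<kappa> (c i e) * e)))"
    by (simp add: ev_sum ev_monom right_diff_distrib sum_subtractf)
  also have "\<dots> \<in> M" using c by (intro M_sum M_scale) auto
  finally show ?thesis using root_of_annihilator[OF f P0] by blast
qed

end

section \<open>The ground field\<close>

inductive_set field_span :: "'k::field set \<Rightarrow> 'k set \<Rightarrow> 'k set" for F G where
  field_span_zero: "0 \<in> field_span F G"
| field_span_step: "v \<in> field_span F G \<Longrightarrow> c \<in> F \<Longrightarrow> g \<in> G \<Longrightarrow> c * g + v \<in> field_span F G"

definition subfield_set :: "'k::field set \<Rightarrow> bool" where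
  "subfield_set F \<longleftrightarrow> 0 \<in> F \<and> 1 \<in> F \<and> (\<forall>x\<in>F. \<forall>y\<in>F. x + y \<in> F \<and> x * y \<in> F) \<and> (\<forall>x\<in>F. - x \<in> F \<and> inverse x \<in> F)"

definition algebraic_over :: "'k::field set \<Rightarrow> 'k \<Rightarrow> bool" where
  "algebraic_over F x \<longleftrightarrow> (\<exists>P. P \<noteq> 0 \<and> (\<forall>i. coeff P i \<in> F) \<and> poly P x = 0)"

context
  fixes F :: "'k::field set"
  assumes F: "subfield_set F"
begin

lemma F_closed: "0 \<in> F" "1 \<in> F" "x \<in> F \<Longrightarrow> y \<in> F \<Longrightarrow> x + y \<in> F" "x \<in> F \<Longrightarrow> y \<in> F \<Longrightarrow> x * y \<in> F"
  "x \<in> F \<Longrightarrow> - x \<in> F" "x \<in> F \<Longrightarrow> inverse x \<in> F"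
  using F unfolding subfield_set_def by auto

lemma field_span_base: "g \<in> G \<Longrightarrow> g \<in> field_span F G"
  using field_span_step[OF field_span_zero F_closed(2), of g G] by simp

lemma field_span_add: "x \<in> field_span F G \<Longrightarrow> y \<in> field_span F G \<Longrightarrow> x + y \<in> field_span F G"
  by (induction rule: field_span.induct) (auto simp: add.assoc intro: field_span_step)

lemma field_span_scale: "x \<in> field_span F G \<Longrightarrow> c \<in> F \<Longrightarrow> c * x \<in> field_span F G"
proof (induction rule: field_span.induct)
  case (field_span_step v d g)
  have "(c * d) * g + c * v \<in> field_span F G"
    using field_span_step F_closed by (intro field_span.field_span_step) auto
  then show ?case by (simp add: algebra_simps)
qed (simp add: field_span_zero)

lemma field_span_sum: "(\<And>i. i \<in> I \<Longrightarrow> f i \<in> field_span F G) \<Longrightarrow> (\<Sum>i\<in>I. f i) \<in> field_span F G"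
  by (induction I rule: infinite_finite_induct) (auto simp: field_span_zero field_span_add)

lemma field_span_mult_stable:
  assumes "v \<in> field_span F G" "\<And>g. g \<in> G \<Longrightarrow> z * g \<in> field_span F G"
  shows "z * v \<in> field_span F G"
  using assms(1)
proof (induction rule: field_span.induct)
  case (field_span_step v c g)
  have "z * (c * g + v) = c * (z * g) + z * v" by (simp add: algebra_simps)
  then show ?case using field_span_step assms(2) by (simp add: field_span_add field_span_scale)
qed (simp add: field_span_zero)

lemma field_span_repr:
  assumes "v \<in> field_span F G" "finite G"
  shows "\<exists>c. (\<forall>g. c g \<in> F) \<and> v = (\<Sum>g\<in>G. c g * g)"
  using assms(1)
proof (induction rule: field_span.induct)
  case field_span_zero
  show ?case by (intro exI[of _ "\<lambda>_. 0"]) (simp add: F_closed)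
next
  case (field_span_step v d g)
  then obtain c where c: "\<forall>g. c g \<in> F" "v = (\<Sum>g\<in>G. c g * g)" by blast
  have "d * g + v = (\<Sum>h\<in>G. (if h = g then d * h else 0) + c h * h)"
    using field_span_step assms(2) c by (simp add: sum.distrib)
  also have "\<dots> = (\<Sum>h\<in>G. (c(g := d + c g)) h * h)"
    by (intro sum.cong) (auto simp: algebra_simps)
  finally show ?case using c field_span_step F_closed by (intro exI[of _ "c(g := d + c g)"]) auto
qed

text \<open>
Multiplication by \<open>z\<close> preserves a space of finite dimension that contains 1.  So it contains all powers of \<open>z\<close>.
\<close>

lemma algebraic_if_stable:
  assumes G: "finite G" "1 \<in> field_span F G" and z: "\<And>g. g \<in> G \<Longrightarrow> z * g \<in> field_span F G"
  shows "algebraic_over F z"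
proof -
  have "z ^ i \<in> field_span F G" for i
    by (induction i) (auto simp: G(2) field_span_mult_stable z)
  then have "\<forall>i. \<exists>c. (\<forall>g. c g \<in> F) \<and> z ^ i = (\<Sum>g\<in>G. c g * g)"
    using field_span_repr[OF _ G(1)] by blast
  from choice[OF this] obtain c where c: "\<And>i g. c i g \<in> F" "\<And>i. z ^ i = (\<Sum>g\<in>G. c i g * g)"
    by blast
  let ?I = "{..card G}"
  have "\<exists>x. (\<forall>i. x i \<in> F) \<and> (\<exists>i\<in>?I. x i \<noteq> 0) \<and> (\<forall>g\<in>G. (\<Sum>i\<in>?I. x i * c i g) = 0)"
    by (rule homogeneous_system_nontrivial_solution) (simp_all add: G(1) F_closed c(1))
  then obtain x where x: "\<forall>i. x i \<in> F" "\<exists>i\<in>?I. x i \<noteq> 0" "\<And>g. g \<in> G \<Longrightarrow> (\<Sum>i\<in>?I. x i * c i g) = 0"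
    by blast
  let ?P = "\<Sum>i\<in>?I. monom (x i) i"
  have co: "coeff ?P j = (if j \<in> ?I then x j else 0)" for j
    by (simp add: coeff_sum if_distrib cong: if_cong)
  have "poly ?P z = (\<Sum>i\<in>?I. x i * z ^ i)" by (simp add: poly_sum poly_monom)
  also have "\<dots> = (\<Sum>g\<in>G. (\<Sum>i\<in>?I. x i * c i g) * g)"
    unfolding c(2) by (simp add: sum_distrib_left sum_distrib_right mult.assoc sum.swap[of _ ?I])
  also have "\<dots> = 0" using x(3) by simp
  finally have "poly ?P z = 0" .
  moreover have "?P \<noteq> 0" using x(2) co by (metis coeff_0)
  ultimately show ?thesis unfolding algebraic_over_def using co x(1) F_closed by (intro exI[of _ ?P]) auto
qed

lemma algebraic_power_reduction:
  assumes "algebraic_over F x"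
  obtains d b where "0 < d" "\<And>i. b i \<in> F" "x ^ d = (\<Sum>i<d. b i * x ^ i)"
proof -
  obtain P where P: "P \<noteq> 0" "\<And>i. coeff P i \<in> F" "poly P x = 0" using assms unfolding algebraic_over_def by blast
  let ?d = "degree P"
  have "?d \<noteq> 0" using P(1,3) by (metis degree_eq_zeroE mult_eq_0_iff pCons_eq_0_iff poly_0 poly_pCons add_0_right)
  define l where "l = inverse (lead_coeff P)"
  have "l * lead_coeff P = 1" using P(1) by (simp add: l_def)
  moreover have "0 = l * (lead_coeff P * x ^ ?d + (\<Sum>i<?d. coeff P i * x ^ i))"
    using P(3) unfolding poly_altdef by (simp add: lessThan_Suc_atMost[symmetric] add.commute)
  ultimately have "0 = x ^ ?d + l * (\<Sum>i<?d. coeff P i * x ^ i)"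
    by (simp only: distrib_left mult.assoc[symmetric] mult_1)
  then have "x ^ ?d = - (l * (\<Sum>i<?d. coeff P i * x ^ i))"
    by (simp only: eq_neg_iff_add_eq_0)
  also have "\<dots> = (\<Sum>i<?d. - (l * coeff P i) * x ^ i)"
    by (simp add: sum_distrib_left sum_negf mult.assoc)
  finally show thesis using that[of ?d "\<lambda>i. - (l * coeff P i)"] \<open>?d \<noteq> 0\<close> P(2) F_closed by (simp add: l_def)
qed

text \<open>
Both elements preserve the span of the products of their powers below the degrees of algebraic equations.
\<close>

lemma algebraic_closed:
  assumes "algebraic_over F x" "algebraic_over F y"
  shows "algebraic_over F (x + y)" "algebraic_over F (x * y)"
proof -
  obtain d b where d: "0 < d" "\<And>i. b i \<in> F" "x ^ d = (\<Sum>i<d. b i * x ^ i)"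
    using algebraic_power_reduction[OF assms(1)] by blast
  obtain d' b' where d': "0 < d'" "\<And>i. b' i \<in> F" "y ^ d' = (\<Sum>i<d'. b' i * y ^ i)"
    using algebraic_power_reduction[OF assms(2)] by blast
  let ?G = "(\<lambda>(i, j). x ^ i * y ^ j) ` ({..<d} \<times> {..<d'})"
  have fin: "finite ?G" by simp
  have base: "x ^ i * y ^ j \<in> field_span F ?G" if "i < d" "j < d'" for i j
    using that by (intro field_span_base) auto
  have one: "1 \<in> field_span F ?G" using base[of 0 0] d d' by simp
  have x: "x * g \<in> field_span F ?G" if g: "g \<in> ?G" for g
  proof -
    obtain i j where ij: "g = x ^ i * y ^ j" "i < d" "j < d'" using g by auto
    show ?thesis
    proof (cases "Suc i < d")
      case True
      then show ?thesis using base[of "Suc i" j] ij by (simp add: mult.assoc)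
    next
      case False
      then have "x * g = x ^ d * y ^ j" using ij by (cases d) (auto simp: mult.assoc less_Suc_eq)
      also have "\<dots> = (\<Sum>i<d. b i * (x ^ i * y ^ j))" by (simp add: d(3) sum_distrib_right mult.assoc)
      also have "\<dots> \<in> field_span F ?G" using ij d(2) by (intro field_span_sum field_span_scale[OF base]) auto
      finally show ?thesis .
    qed
  qed
  have y: "y * g \<in> field_span F ?G" if g: "g \<in> ?G" for g
  proof -
    obtain i j where ij: "g = x ^ i * y ^ j" "i < d" "j < d'" using g by auto
    show ?thesis
    proof (cases "Suc j < d'")
      case True
      then show ?thesis using base[of i "Suc j"] ij by (simp add: algebra_simps)
    next
      case False
      then have "y * g = x ^ i * y ^ d'" using ij by (cases d') (auto simp: algebra_simps less_Suc_eq)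
      also have "\<dots> = (\<Sum>j<d'. b' j * (x ^ i * y ^ j))" by (simp add: d'(3) sum_distrib_left algebra_simps)
      also have "\<dots> \<in> field_span F ?G" using ij d'(2) by (intro field_span_sum field_span_scale[OF base]) auto
      finally show ?thesis .
    qed
  qed
  show "algebraic_over F (x + y)"
    using x y by (intro algebraic_if_stable[OF fin one]) (simp add: distrib_right field_span_add)
  show "algebraic_over F (x * y)"
    using field_span_mult_stable[OF y x] by (intro algebraic_if_stable[OF fin one]) (simp add: mult.assoc)
qed

lemma algebraic_base: "c \<in> F \<Longrightarrow> algebraic_over F c"
  unfolding algebraic_over_def
  by (intro exI[of _ "[:- c, 1:]"]) (auto simp: coeff_pCons F_closed split: nat.split)

end

context
  fixes av :: "'k::field \<Rightarrow> real"
  assumes av: "nonarch_absolute_value av"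
begin

lemma av_metric: "Metric_space UNIV (\<lambda>x y. av (x - y))"
proof
  fix x y z :: 'k
  show "0 \<le> av (x - y)" by (rule av_nonneg[OF av])
  show "av (x - y) = av (y - x)" by (rule av_diff_commute[OF av])
  show "(av (x - y) = 0) = (x = y)" by (simp add: av_eq_0[OF av])
  have "av ((x - y) + (y - z)) \<le> max (av (x - y)) (av (y - z))" by (rule av_ultra[OF av])
  then show "av (x - z) \<le> av (x - y) + av (y - z)"
    using av_nonneg[OF av, of "x - y"] av_nonneg[OF av, of "y - z"] by simp
qed

lemma closure_of_av_iff: "x \<in> av_topology av closure_of S \<longleftrightarrow> (\<forall>e>0. \<exists>y\<in>S. av (x - y) < e)"
  using Metric_space.metric_closure_of[OF av_metric, of S] Metric_space.in_mball[OF av_metric] by auto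

lemma av_Cauchy_convergent:
  assumes c: "Metric_space.mcomplete UNIV (\<lambda>x y. av (x - y))"
    and \<sigma>: "\<And>e. 0 < e \<Longrightarrow> \<exists>N. \<forall>m\<ge>N. \<forall>n\<ge>N. av (\<sigma> m - \<sigma> n) < e"
  obtains l where "\<And>e. 0 < e \<Longrightarrow> \<exists>N::nat. \<forall>n\<ge>N. av (\<sigma> n - l) < e"
proof -
  have "Metric_space.MCauchy UNIV (\<lambda>x y. av (x - y)) \<sigma>"
    unfolding Metric_space.MCauchy_def[OF av_metric] using \<sigma> by auto
  then obtain l where l: "limitin (av_topology av) \<sigma> l sequentially"
    using c unfolding Metric_space.mcomplete_def[OF av_metric] by blast
  show thesis
    using that[of l] l unfolding Metric_space.limit_metric_sequentially[OF av_metric] by auto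
qed

text \<open>
The partial sums are Cauchy, and by the ultrametric inequality the error is at most the size of the first
omitted term.
\<close>

lemma av_series_complete:
  assumes c: "Metric_space.mcomplete UNIV (\<lambda>x y. av (x - y))"
    and w: "0 < av w" "av w < 1" and a: "\<And>i::nat. av (a i) \<le> 1"
  shows "\<exists>s. \<forall>i. av (s - (\<Sum>j<i. w ^ j * a j)) \<le> av w ^ i"
proof -
  define \<sigma> where "\<sigma> i = (\<Sum>j<i. w ^ j * a j)" for i
  have tail: "av (\<sigma> n - \<sigma> m) \<le> av w ^ m" if "m \<le> n" for m n
  proof -
    have "\<sigma> n - \<sigma> m = (\<Sum>j\<in>{m..<n}. w ^ j * a j)"
      unfolding \<sigma>_def using that by (simp add: lessThan_atLeast0 sum_diff_nat_ivl)
    also have "av \<dots> \<le> av w ^ m"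
    proof (rule av_sum_le[OF av])
      fix j assume "j \<in> {m..<n}"
      then have "av w ^ j \<le> av w ^ m" using w by (intro power_decreasing) auto
      then show "av (w ^ j * a j) \<le> av w ^ m"
        using mult_left_le[OF a[of j], of "av w ^ j"] zero_le_power[of "av w" j] w
        unfolding av_mult[OF av] av_power[OF av] by linarith
    qed (use w in simp)
    finally show ?thesis .
  qed
  have "\<exists>N. \<forall>m\<ge>N. \<forall>n\<ge>N. av (\<sigma> m - \<sigma> n) < e" if e: "0 < e" for e
  proof -
    obtain N where N: "av w ^ N < e" using real_arch_pow_inv[OF e w(2)] by blast
    have "av (\<sigma> m - \<sigma> n) < e" if "m \<ge> N" "n \<ge> N" for m n
    proof -
      have "av (\<sigma> m - \<sigma> n) \<le> max (av (\<sigma> m - \<sigma> N)) (av (\<sigma> n - \<sigma> N))"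
        using av_diff[OF av, of "\<sigma> m - \<sigma> N" "\<sigma> n - \<sigma> N"] by simp
      then show ?thesis using tail[OF that(1)] tail[OF that(2)] N by linarith
    qed
    then show ?thesis by blast
  qed
  then obtain l where l: "\<And>e. 0 < e \<Longrightarrow> \<exists>N::nat. \<forall>n\<ge>N. av (\<sigma> n - l) < e"
    using av_Cauchy_convergent[OF c, of \<sigma>] by blast
  have "av (l - \<sigma> i) \<le> av w ^ i" for i
  proof -
    obtain N where N: "\<And>n. n \<ge> N \<Longrightarrow> av (\<sigma> n - l) < av w ^ i" using l[of "av w ^ i"] w by auto
    have "av (l - \<sigma> i) \<le> max (av (\<sigma> (max N i) - \<sigma> i)) (av (\<sigma> (max N i) - l))"
      using av_diff[OF av, of "\<sigma> (max N i) - \<sigma> i" "\<sigma> (max N i) - l"] by simp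
    then show ?thesis using tail[of i "max N i"] N[of "max N i"] by simp
  qed
  then show ?thesis unfolding \<sigma>_def by blast
qed

lemma av_poly_bound:
  assumes "\<And>i. av (coeff P i) \<le> c" "av a \<le> r" "1 \<le> r" "degree P \<le> d"
  shows "av (poly P a) \<le> c * r ^ d"
proof -
  have c: "0 \<le> c" using assms(1)[of 0] av_nonneg[OF av, of "coeff P 0"] by linarith
  show ?thesis
    unfolding poly_altdef
  proof (rule av_sum_le[OF av])
    fix i assume i: "i \<in> {..degree P}"
    have "av a ^ i \<le> r ^ i" using assms(2) av_nonneg[OF av] by (rule power_mono)
    also have "\<dots> \<le> r ^ d" using assms(3,4) i by (intro power_increasing) auto
    finally show "av (coeff P i * a ^ i) \<le> c * r ^ d"
      unfolding av_mult[OF av] av_power[OF av]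
      using assms(1) c av_nonneg[OF av] by (intro mult_mono) auto
  qed (use c assms(3) in simp)
qed

lemma av_root_bound:
  assumes P: "lead_coeff P = 1" "poly P a = 0" "\<And>i. av (coeff P i) \<le> r" "1 \<le> r"
  shows "av a \<le> r"
proof (rule ccontr)
  assume "\<not> av a \<le> r"
  then have a: "r < av a" by simp
  have "degree P \<noteq> 0" using P(1,2) by (metis degree_eq_zeroE lead_coeff_pCons(2) one_neq_zero poly_pCons poly_0 mult_zero_right add_0_right)
  then obtain d where d: "degree P = Suc d" by (cases "degree P") auto
  have "a ^ Suc d + (\<Sum>i<Suc d. coeff P i * a ^ i) = 0"
    using P(1,2) unfolding poly_altdef d by (simp add: lessThan_Suc_atMost[symmetric] add.commute)
  then have "a ^ Suc d = - (\<Sum>i<Suc d. coeff P i * a ^ i)" by (simp only: eq_neg_iff_add_eq_0)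
  then have "av a ^ Suc d = av (\<Sum>i<Suc d. coeff P i * a ^ i)"
    by (metis av_minus[OF av] av_power[OF av])
  also have "\<dots> \<le> r * av a ^ d"
  proof (rule av_sum_le[OF av])
    fix i assume "i \<in> {..<Suc d}"
    then have "av a ^ i \<le> av a ^ d" using a P(4) by (intro power_increasing) auto
    then show "av (coeff P i * a ^ i) \<le> r * av a ^ d"
      unfolding av_mult[OF av] av_power[OF av]
      using P(3,4) av_nonneg[OF av] by (intro mult_mono) auto
  qed (use P(4) av_nonneg[OF av] in simp)
  also have "\<dots> < av a * av a ^ d" using a P(4) by (intro mult_strict_right_mono) auto
  finally show False by simp
qed

end

text \<open>
A monic polynomial is the product of the differences with its roots; if its value is small, one of the
differences is small.  The roots are split off one at a time, since only polynomials with
coefficients in \<open>S\<close> are known to have roots.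
\<close>

lemma root_near_almost_root:
  assumes av: "nonarch_absolute_value av"
    and S: "\<And>x y. x \<in> S \<Longrightarrow> y \<in> S \<Longrightarrow> x + y \<in> S" "\<And>x y. x \<in> S \<Longrightarrow> y \<in> S \<Longrightarrow> x * y \<in> S" "0 \<in> S"
    and root: "\<And>P. (\<And>i. coeff P i \<in> S) \<Longrightarrow> 0 < degree P \<Longrightarrow> \<exists>x\<in>S. poly P x = 0"
    and "lead_coeff Q = 1" "\<And>i. coeff Q i \<in> S" "0 < e" "av (poly Q a) < e ^ degree Q"
  shows "\<exists>b\<in>S. poly Q b = 0 \<and> av (a - b) < e"
  using assms(6,7,9)
proof (induction "degree Q" arbitrary: Q)
  case 0
  then obtain c where "Q = [:c:]" using degree_eq_zeroE by metis
  then have "poly Q a = 1" using 0 by simp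
  then show ?case using 0 by (simp add: av_1[OF av])
next
  case (Suc d)
  obtain b where b: "b \<in> S" "poly Q b = 0" using root[of Q] Suc by auto
  show ?case
  proof (cases "av (a - b) < e")
    case True
    then show ?thesis using b by blast
  next
    case False
    obtain R where R: "Q = [:- b, 1:] * R" using b(2) by (meson dvdE poly_eq_0_iff_dvd)
    have "Q \<noteq> 0" using Suc.prems(1) by auto
    then have R0: "R \<noteq> 0" using R by auto
    have deg: "degree Q = Suc (degree R)" using R0 unfolding R by (simp add: degree_mult_eq del: mult_pCons_left)
    have lc: "lead_coeff R = 1" using Suc.prems(1) unfolding R lead_coeff_mult by simp
    have co: "coeff R i = coeff Q (Suc i) + b * coeff R (Suc i)" for i by (simp add: R)
    have RS: "coeff R i \<in> S" for i
    proof (induction "degree R - i" arbitrary: i rule: less_induct)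
      case less
      show ?case
      proof (cases "i > degree R")
        case True
        then show ?thesis by (simp add: coeff_eq_0 S(3))
      next
        case False
        have "coeff R (Suc i) \<in> S"
        proof (cases "i = degree R")
          case True
          then show ?thesis by (simp add: coeff_eq_0 S(3))
        next
          case False
          then show ?thesis using \<open>\<not> i > degree R\<close> by (intro less) auto
        qed
        then show ?thesis using co[of i] Suc.prems(2) b S by auto
      qed
    qed
    have "av (a - b) * av (poly R a) < e * e ^ degree R"
      using Suc.prems(3) unfolding deg by (simp add: R av_mult[OF av, symmetric] algebra_simps)
    moreover have "e * av (poly R a) \<le> av (a - b) * av (poly R a)"
      using False av_nonneg[OF av] by (intro mult_right_mono) auto
    ultimately have "e * av (poly R a) < e * e ^ degree R" by linarith
    then have "av (poly R a) < e ^ degree R" using \<open>0 < e\<close> by simp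
    then obtain b' where "b' \<in> S" "poly R b' = 0" "av (a - b') < e"
      using Suc.hyps(1)[of R] Suc.hyps(2) deg lc RS by auto
    then show ?thesis by (intro bexI[of _ b']) (simp_all add: R)
  qed
qed

text \<open>
Approximate the polynomial by polynomials \<open>Q n\<close> with coefficients in \<open>S\<close>.  A root of \<open>Q n\<close> is nearly a root of \<open>Q (n + 1)\<close>, so
there is a root of \<open>Q (n + 1)\<close> near to it.  The sequence of roots obtained in this way converges to a root of the limit.
\<close>

lemma algebraically_closed_if_dense_closed_subring:
  fixes av :: "'k::field \<Rightarrow> real" and P :: "'k poly"
  assumes av: "nonarch_absolute_value av"
    and c: "Metric_space.mcomplete UNIV (\<lambda>x y. av (x - y))"
    and S: "\<And>x y. x \<in> S \<Longrightarrow> y \<in> S \<Longrightarrow> x + y \<in> S" "\<And>x y. x \<in> S \<Longrightarrow> y \<in> S \<Longrightarrow> x * y \<in> S" "0 \<in> S" "1 \<in> S"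
    and root: "\<And>P :: 'k poly. (\<And>i. coeff P i \<in> S) \<Longrightarrow> 0 < degree P \<Longrightarrow> \<exists>x\<in>S. poly P x = 0"
    and dense: "\<And>x e. 0 < e \<Longrightarrow> \<exists>y\<in>S. av (x - y) < e"
    and P: "0 < degree P"
  shows "\<exists>x. poly P x = 0"
proof -
  define d where "d = degree P"
  define P1 where "P1 = smult (inverse (lead_coeff P)) P"
  have P0: "P \<noteq> 0" using P by auto
  have P1: "degree P1 = d" "lead_coeff P1 = 1" using P0 by (simp_all add: P1_def d_def)
  have d: "0 < d" using P by (simp add: d_def)
  define r where "r = Max (insert 1 ((\<lambda>i. av (coeff P1 i)) ` {..d}))"
  have r1: "1 \<le> r" unfolding r_def by (intro Max_ge) auto
  have r: "av (coeff P1 i) \<le> r" for i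
  proof (cases "i \<le> d")
    case True
    then show ?thesis unfolding r_def by (intro Max_ge) auto
  next
    case False
    then show ?thesis using r1 P1 by (simp add: coeff_eq_0 av_0[OF av])
  qed
  have approx: "\<exists>Q. degree Q = d \<and> lead_coeff Q = 1 \<and> (\<forall>i. coeff Q i \<in> S \<and> av (coeff P1 i - coeff Q i) \<le> e)"
    if e: "0 < e" for e
  proof -
    have "\<forall>i. \<exists>q. q \<in> S \<and> av (coeff P1 i - q) < e" using dense[OF e] by blast
    from choice[OF this] obtain q where q: "\<And>i. q i \<in> S" "\<And>i. av (coeff P1 i - q i) < e" by blast
    define Q where "Q = monom 1 d + (\<Sum>i<d. monom (q i) i)"
    have "coeff (\<Sum>i<d. monom (q i) i) j = (if j < d then q j else 0)" for j
      by (simp add: coeff_sum)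
    then have co: "coeff Q i = (if i < d then q i else if i = d then 1 else 0)" for i
      unfolding Q_def by simp
    have "degree Q = d"
    proof (rule antisym)
      show "degree Q \<le> d" by (rule degree_le) (simp add: co)
      show "d \<le> degree Q" by (rule le_degree) (simp add: co)
    qed
    moreover have "coeff P1 d = 1" "\<And>i. d < i \<Longrightarrow> coeff P1 i = 0" using P1 by (auto simp: coeff_eq_0)
    ultimately show ?thesis using q e S(3,4)
      by (intro exI[of _ Q]) (auto simp: co av_0[OF av] less_imp_le not_less)
  qed
  \<comment> \<open>So close that values at points of absolute value at most \<open>r\<close> differ by less than \<open>(1/2) ^ (n * d)\<close>.\<close>
  define \<delta> where "\<delta> n = (1/2) ^ (n * d) / (2 * r ^ d)" for n :: nat
  have \<delta>0: "0 < \<delta> n" for n using r1 by (simp add: \<delta>_def)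
  have rd: "1 \<le> r ^ d" using r1 by simp
  have \<delta>r: "\<delta> n * r ^ d < ((1/2) ^ n) ^ d" for n using rd by (simp add: \<delta>_def power_mult)
  have \<delta>1: "\<delta> n \<le> 1" for n
  proof -
    have "(1/2::real) ^ (n * d) \<le> 1" by (simp add: power_le_one)
    then show ?thesis using rd by (simp add: \<delta>_def)
  qed
  have \<delta>dec: "\<delta> (Suc n) \<le> \<delta> n" for n
    using rd by (simp add: \<delta>_def divide_right_mono power_decreasing)
  obtain Q where Q: "\<And>n. degree (Q n) = d" "\<And>n. lead_coeff (Q n) = 1" "\<And>n i. coeff (Q n) i \<in> S"
    "\<And>n i. av (coeff P1 i - coeff (Q n) i) \<le> \<delta> n" using approx[OF \<delta>0] by metis
  have Qr: "av (coeff (Q n) i) \<le> r" for n i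
    using av_diff[OF av, of "coeff P1 i" "coeff P1 i - coeff (Q n) i"] Q(4)[of i n] \<delta>1[of n] r[of i] r1 by simp
  have Qroot: "av x \<le> r" if "poly (Q n) x = 0" for n x
    using av_root_bound[OF av Q(2) that Qr r1] .
  have QQ: "av (coeff (Q (Suc n) - Q n) i) \<le> \<delta> n" for n i
  proof -
    have "coeff (Q (Suc n) - Q n) i = (coeff P1 i - coeff (Q n) i) - (coeff P1 i - coeff (Q (Suc n)) i)" by simp
    also have "av \<dots> \<le> max (av (coeff P1 i - coeff (Q n) i)) (av (coeff P1 i - coeff (Q (Suc n)) i))"
      by (rule av_diff[OF av])
    also have "\<dots> \<le> \<delta> n" using Q(4)[of i n] Q(4)[of i "Suc n"] \<delta>dec[of n] by simp
    finally show ?thesis .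
  qed
  have "\<exists>a. \<forall>n. poly (Q n) (a n) = 0 \<and> av (a n - a (Suc n)) < (1/2) ^ n"
  proof (rule dependent_nat_choice[where P = "\<lambda>n x. poly (Q n) x = 0" and Q = "\<lambda>n x y. av (x - y) < (1/2) ^ n"])
    show "\<exists>x. poly (Q 0) x = 0" using root[of "Q 0"] Q d by auto
    fix x n assume x: "poly (Q n) x = 0"
    have "degree (Q (Suc n) - Q n) \<le> d" using degree_diff_le_max[of "Q (Suc n)" "Q n"] Q(1) by simp
    then have "av (poly (Q (Suc n) - Q n) x) \<le> \<delta> n * r ^ d"
      using av_poly_bound[OF av QQ Qroot[OF x] r1] by simp
    then have "av (poly (Q (Suc n)) x) < ((1/2) ^ n) ^ degree (Q (Suc n))"
      using \<delta>r[of n] x Q(1) by simp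
    then obtain b where "poly (Q (Suc n)) b = 0" "av (x - b) < (1/2) ^ n"
      using root_near_almost_root[OF av S(1,2,3) root, of "Q (Suc n)" "(1/2) ^ n" x] Q(2,3) by auto
    then show "\<exists>y. poly (Q (Suc n)) y = 0 \<and> av (x - y) < (1/2) ^ n" by blast
  qed
  then obtain a where a: "\<And>n. poly (Q n) (a n) = 0" "\<And>n. av (a n - a (Suc n)) < (1/2) ^ n" by blast
  have tail: "av (a n - a (n + k)) \<le> (1/2) ^ n" for n k
  proof (induction k)
    case (Suc k)
    have "av (a n - a (n + Suc k)) \<le> max (av (a n - a (n + k))) (av (a (n + k) - a (Suc (n + k))))"
      using av_ultra[OF av, of "a n - a (n + k)" "a (n + k) - a (Suc (n + k))"] by simp
    moreover have "(1/2::real) ^ (n + k) \<le> (1/2) ^ n" by (rule power_decreasing) auto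
    ultimately show ?case using Suc a(2)[of "n + k"] by linarith
  qed (simp add: av_0[OF av])
  have "\<exists>N. \<forall>m\<ge>N. \<forall>n\<ge>N. av (a m - a n) < e" if e: "0 < e" for e
  proof -
    obtain N where N: "(1/2) ^ N < e" using real_arch_pow_inv[OF e, of "1/2"] by auto
    have "av (a m - a n) < e" if mn: "m \<ge> N" "n \<ge> N" for m n
    proof -
      have "av (a m - a n) \<le> max (av (a N - a n)) (av (a N - a m))"
        using av_diff[OF av, of "a N - a n" "a N - a m"] by simp
      moreover have "av (a N - a m) < e" "av (a N - a n) < e"
        using tail[of N "m - N"] tail[of N "n - N"] mn N by auto
      ultimately show ?thesis by simp
    qed
    then show ?thesis by blast
  qed
  then obtain l where l: "\<And>e. 0 < e \<Longrightarrow> \<exists>N::nat. \<forall>n\<ge>N. av (a n - l) < e"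
    using av_Cauchy_convergent[OF av c, of a] by blast
  define R where "R = synthetic_div P1 l"
  have P1R: "poly P1 x = poly P1 l + (x - l) * poly R x" for x
    using arg_cong[OF synthetic_div_correct'[of l P1], of "\<lambda>p. poly p x"] by (simp add: R_def algebra_simps)
  define C where "C = Max (insert 1 ((\<lambda>i. av (coeff R i)) ` {..degree R})) * r ^ degree R"
  have "av (coeff R i) \<le> Max (insert 1 ((\<lambda>i. av (coeff R i)) ` {..degree R}))" for i
  proof (cases "i \<le> degree R")
    case True
    then show ?thesis by (intro Max_ge) auto
  next
    case False
    then have "av (coeff R i) \<le> 1" by (simp add: coeff_eq_0 av_0[OF av])
    also have "1 \<le> Max (insert 1 ((\<lambda>i. av (coeff R i)) ` {..degree R}))" by (intro Max_ge) auto
    finally show ?thesis .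
  qed
  then have C: "av (poly R (a n)) \<le> C" for n
    unfolding C_def using av_poly_bound[OF av _ Qroot[OF a(1)] r1] by blast
  have C0: "0 \<le> C" using C[of 0] av_nonneg[OF av, of "poly R (a 0)"] by linarith
  have "av (poly P1 l) \<le> 0"
  proof (rule field_le_epsilon)
    fix e :: real assume e: "0 < e"
    obtain N where N: "\<And>n. n \<ge> N \<Longrightarrow> av (a n - l) < e / (C + 1)" using l[of "e / (C + 1)"] e C0 by auto
    obtain N' where N': "(1/2) ^ N' < e" using real_arch_pow_inv[OF e, of "1/2"] by auto
    let ?n = "max N N'"
    have "degree (P1 - Q ?n) \<le> d" using degree_diff_le_max[of P1 "Q ?n"] Q(1) P1 by simp
    moreover have "av (coeff (P1 - Q ?n) i) \<le> \<delta> ?n" for i using Q(4)[of i ?n] by simp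
    ultimately have "av (poly (P1 - Q ?n) (a ?n)) \<le> \<delta> ?n * r ^ d"
      using av_poly_bound[OF av _ Qroot[OF a(1)] r1, of "P1 - Q ?n"] by blast
    moreover have "((1/2::real) ^ ?n) ^ d \<le> (1/2) ^ N'"
    proof -
      have "?n * 1 \<le> ?n * d" using d by (intro mult_le_mono2) simp
      then have "N' \<le> ?n * d" by linarith
      then show ?thesis unfolding power_mult[symmetric] by (intro power_decreasing) auto
    qed
    ultimately have 1: "av (poly P1 (a ?n)) < e" using \<delta>r[of ?n] N' a(1)[of ?n] by simp
    have "av ((a ?n - l) * poly R (a ?n)) \<le> e / (C + 1) * C"
      unfolding av_mult[OF av] using N[of ?n] C[of ?n] av_nonneg[OF av] e C0 by (intro mult_mono) (auto simp: less_imp_le)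
    also have "\<dots> \<le> e" using e C0 by (simp add: field_simps)
    finally have 2: "av ((a ?n - l) * poly R (a ?n)) \<le> e" .
    have "poly P1 l = poly P1 (a ?n) - (a ?n - l) * poly R (a ?n)" using P1R[of "a ?n"] by simp
    then have "av (poly P1 l) \<le> max (av (poly P1 (a ?n))) (av ((a ?n - l) * poly R (a ?n)))"
      using av_diff[OF av] by metis
    then show "av (poly P1 l) \<le> 0 + e" using 1 2 by simp
  qed
  then have "poly P1 l = 0" using av_nonneg[OF av, of "poly P1 l"] av_eq_0[OF av] by (metis antisym)
  then show ?thesis using P0 by (auto simp: P1_def)
qed


context
  fixes p :: nat and av :: "'k::field_char_0 \<Rightarrow> real"
  assumes p: "prime p" and Cp: "is_Cp p av"
begin

lemma Cp_av: "nonarch_absolute_value av"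
  and Cp_p: "av (of_nat p) = 1 / real p"
  and Cp_complete: "Metric_space.mcomplete UNIV (\<lambda>x y. av (x - y))"
  and Cp_root: "\<And>P. (\<And>i. coeff P i \<in> Qp_bar_of av) \<Longrightarrow> 0 < degree P \<Longrightarrow> \<exists>x\<in>Qp_bar_of av. poly P x = 0"
  and Cp_dense: "av_topology av closure_of Qp_bar_of av = UNIV"
  using Cp unfolding is_Cp_def by auto

lemma Qp_iff: "x \<in> Qp_of av \<longleftrightarrow> (\<forall>e>0. \<exists>q\<in>\<rat>. av (x - q) < e)"
  unfolding Qp_of_def by (rule closure_of_av_iff[OF Cp_av])

lemma subfield_Qp: "subfield_set (Qp_of av)"
proof -
  note av = Cp_av
  have Q: "q \<in> Qp_of av" if "q \<in> \<rat>" for q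
    unfolding Qp_iff using that by (auto intro!: bexI[of _ q] simp: av_0[OF av])
  have add: "x + y \<in> Qp_of av" if xy: "x \<in> Qp_of av" "y \<in> Qp_of av" for x y
    unfolding Qp_iff
  proof (intro allI impI)
    fix e :: real assume "0 < e"
    then obtain q q' where q: "q \<in> \<rat>" "av (x - q) < e" "q' \<in> \<rat>" "av (y - q') < e"
      using xy unfolding Qp_iff by blast
    have "av (x + y - (q + q')) \<le> max (av (x - q)) (av (y - q'))"
      using av_ultra[OF av, of "x - q" "y - q'"] by (simp add: algebra_simps)
    then show "\<exists>r\<in>\<rat>. av (x + y - r) < e" using q by (intro bexI[of _ "q + q'"]) auto
  qed
  have mult: "x * y \<in> Qp_of av" if xy: "x \<in> Qp_of av" "y \<in> Qp_of av" for x y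
    unfolding Qp_iff
  proof (intro allI impI)
    fix e :: real assume e: "0 < e"
    define C where "C = 1 + av x + av y"
    have C: "0 < C" "av x \<le> C" "av y \<le> C" "1 \<le> C"
      using av_nonneg[OF av, of x] av_nonneg[OF av, of y] by (auto simp: C_def)
    obtain q where q: "q \<in> \<rat>" "av (x - q) < e / C"
      using xy(1) divide_pos_pos[OF e C(1)] unfolding Qp_iff by blast
    have pos: "0 < C + av q + 1" using C av_nonneg[OF av, of q] by linarith
    then have "0 < e / (C + av q + 1)" using e by simp
    then obtain q' where q': "q' \<in> \<rat>" "av (y - q') < e / (C + av q + 1)"
      using xy(2) unfolding Qp_iff by blast
    have "x * y - q * q' = (x - q) * y + q * (y - q')" by (simp add: algebra_simps)
    then have "av (x * y - q * q') \<le> max (av (x - q) * av y) (av q * av (y - q'))"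
      using av_ultra[OF av] by (metis av_mult[OF av])
    moreover have "av (x - q) * av y < e"
    proof -
      have "av (x - q) * av y \<le> av (x - q) * C" using C av_nonneg[OF av] by (intro mult_left_mono)
      also have "\<dots> < e" using q(2) C by (simp add: field_simps)
      finally show ?thesis .
    qed
    moreover have "av q * av (y - q') < e"
    proof -
      have "av q * av (y - q') \<le> (C + av q + 1) * av (y - q')"
        using C av_nonneg[OF av] by (intro mult_right_mono) auto
      also have "\<dots> < e" using q'(2) pos by (simp add: field_simps)
      finally show ?thesis .
    qed
    ultimately show "\<exists>r\<in>\<rat>. av (x * y - r) < e" using q(1) q'(1) by (intro bexI[of _ "q * q'"]) auto
  qed
  have inv: "inverse x \<in> Qp_of av" if x: "x \<in> Qp_of av" for x
  proof (cases "x = 0")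
    case True
    then show ?thesis using Q[of 0] by simp
  next
    case False
    note ax = av_pos[OF av False]
    show ?thesis
      unfolding Qp_iff
    proof (intro allI impI)
      fix e :: real assume e: "0 < e"
      have "0 < min (av x) (e * (av x * av x))" using e ax by simp
      then obtain q where q: "q \<in> \<rat>" "av (x - q) < min (av x) (e * (av x * av x))"
        using x unfolding Qp_iff by blast
      have avq: "av q = av x"
        using av_dominant[OF av, of "q - x" x] q(2) by (simp add: av_diff_commute[OF av, of q x])
      then have q0: "q \<noteq> 0" using ax av_0[OF av] by auto
      have "inverse x - inverse q = (q - x) * (inverse x * inverse q)" using False q0 by (simp add: field_simps)
      then have "av (inverse x - inverse q) = av (x - q) / (av x * av x)"
        by (simp add: av_mult[OF av] av_inverse[OF av] avq av_diff_commute[OF av, of q x] divide_inverse)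
      also have "\<dots> < e" using q(2) ax by (simp add: field_simps)
      finally show "\<exists>r\<in>\<rat>. av (inverse x - r) < e" using q(1) by (intro bexI[of _ "inverse q"]) auto
    qed
  qed
  have "- x \<in> Qp_of av" if "x \<in> Qp_of av" for x
    using mult[OF Q[of "- 1"] that] by simp
  then show ?thesis unfolding subfield_set_def using Q add mult inv by auto
qed

lemma Qp_bar_iff: "x \<in> Qp_bar_of av \<longleftrightarrow> algebraic_over (Qp_of av) x"
  unfolding Qp_bar_of_def algebraic_over_def by simp

theorem Cp_algebraically_closed:
  assumes "0 < degree (P :: 'k poly)" shows "\<exists>x. poly P x = 0"
proof (rule algebraically_closed_if_dense_closed_subring[OF Cp_av Cp_complete _ _ _ _ Cp_root _ assms])
  note F = subfield_Qp
  show "x + y \<in> Qp_bar_of av" "x * y \<in> Qp_bar_of av" if "x \<in> Qp_bar_of av" "y \<in> Qp_bar_of av" for x y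
    using algebraic_closed[OF F] that unfolding Qp_bar_iff by auto
  show "0 \<in> Qp_bar_of av" "1 \<in> Qp_bar_of av"
    unfolding Qp_bar_iff using algebraic_base[OF F] F_closed[OF F] by auto
  show "\<exists>y\<in>Qp_bar_of av. av (x - y) < e" if "0 < e" for x e
    using Cp_dense closure_of_av_iff[OF Cp_av, of x "Qp_bar_of av"] that by auto
qed

text \<open>
The absolute value \<open>t\<close> of an \<open>N\<close>-th root of \<open>p\<close> is close to 1 for large \<open>N\<close>, and the powers of \<open>t\<close>, with
integral exponents, form a geometric progression with ratio \<open>t\<close>.
\<close>

theorem Cp_values_dense:
  assumes "0 < x" "x < y" shows "\<exists>c. x < av c \<and> av c < y"
proof -
  note av = Cp_av
  have p2: "2 \<le> p" using p by (rule prime_ge_2_nat)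
  have "x / y < 1" using assms by simp
  then obtain N0 where N0: "(x / y) ^ N0 < 1 / real p" using real_arch_pow_inv[of "1 / real p"] p2 by auto
  define N where "N = Suc N0"
  have "(x / y) ^ N \<le> (x / y) ^ N0" unfolding N_def using assms by (intro power_decreasing) auto
  then have N: "(x / y) ^ N < 1 / real p" using N0 by linarith
  have "degree (monom (1::'k) N - [:of_nat p:]) = degree (monom (1::'k) N)"
    unfolding diff_conv_add_uminus by (rule degree_add_eq_left) (simp add: degree_monom_eq N_def)
  then have "0 < degree (monom (1::'k) N - [:of_nat p:])" by (simp only:) (simp add: degree_monom_eq N_def)
  then obtain u :: 'k where "poly (monom 1 N - [:of_nat p:]) u = 0"
    using Cp_algebraically_closed by blast
  then have "u ^ N = of_nat p" by (simp add: poly_monom)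
  then have uN: "av u ^ N = 1 / real p" using Cp_p by (metis av_power[OF av])
  have u1: "av u < 1"
  proof (rule ccontr)
    assume "\<not> av u < 1"
    then have "1 \<le> av u ^ N" by (simp add: one_le_power)
    then show False using uN p2 by (simp add: field_simps)
  qed
  have "x / y < av u"
    using N unfolding uN[symmetric] by (rule power_less_imp_less_base) (rule av_nonneg[OF av])
  then have xu: "x < av u * y" using assms by (simp add: field_simps)
  have u0: "0 < av u" using \<open>x / y < av u\<close> assms by (meson divide_pos_pos less_trans)
  obtain i where i: "av u ^ i < 1 / y" using real_arch_pow_inv[of "1 / y" "av u"] u1 assms by auto
  define s where "s = 1 / av u ^ i"
  have s: "y < s" using i u0 assms by (simp add: s_def field_simps)
  obtain k0 where "av u ^ k0 < y / s" using real_arch_pow_inv[of "y / s" "av u"] u1 assms s by auto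
  then have "s * av u ^ k0 < y" using s assms by (simp add: field_simps)
  \<comment> \<open>The last step of the progression above \<open>y\<close> is at least \<open>y\<close>, so the next one is still above \<open>x\<close>.\<close>
  define k where "k = (LEAST k. s * av u ^ k < y)"
  have k: "s * av u ^ k < y" unfolding k_def by (rule LeastI) fact
  have "k \<noteq> 0" using k s by (cases k) auto
  then obtain j where j: "k = Suc j" by (cases k) auto
  have "\<not> s * av u ^ j < y" using not_less_Least[of j "\<lambda>k. s * av u ^ k < y"] by (simp add: k_def[symmetric] j)
  then have "av u * y \<le> av u * (s * av u ^ j)" using u0 by simp
  then have "x < s * av u ^ k" using xu by (simp add: j algebra_simps)
  moreover have "s * av u ^ k = av (u ^ k / u ^ i)"
    by (simp add: s_def av_divide[OF av] av_power[OF av])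
  ultimately show ?thesis using k by metis
qed

end

section \<open>Power series in several variables\<close>

text \<open>
Formal power series in the variables \<open>0, 1, 2, \<dots>\<close>.  The multiplication is the one of \<open>tate_algebra\<close>, so Tate algebras
become subrings of a type of class \<open>comm_ring_1\<close>.
\<close>

typedef 'k mps = "UNIV :: ((nat \<Rightarrow>\<^sub>0 nat) \<Rightarrow> 'k) set" morphisms mcoeff MPS ..

lemma mcoeff_MPS [simp]: "mcoeff (MPS a) = a" by (simp add: MPS_inverse)
lemma MPS_mcoeff [simp]: "MPS (mcoeff f) = f" by (simp add: mcoeff_inverse)
lemma mps_eqI: "(\<And>m. mcoeff f m = mcoeff g m) \<Longrightarrow> f = g" by (metis ext mcoeff_inject)

instantiation mps :: (comm_ring_1) comm_ring_1
begin

definition "0 = MPS (\<lambda>m. 0)"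
definition "1 = MPS (\<lambda>m. if m = 0 then 1 else 0)"
definition "f + g = MPS (\<lambda>m. mcoeff f m + mcoeff g m)"
definition "- f = MPS (\<lambda>m. - mcoeff f m)"
definition "f - g = MPS (\<lambda>m. mcoeff f m - mcoeff g m)"
definition "f * g = MPS (\<lambda>m. \<Sum>(i, j)\<in>{(i, j). i + j = m}. mcoeff f i * mcoeff g j)"

lemmas mps_defs = zero_mps_def one_mps_def plus_mps_def uminus_mps_def minus_mps_def times_mps_def

instance
proof
  fix a b c :: "'a mps"
  show "a * b = b * a"
    unfolding times_mps_def
    by (rule arg_cong[of _ _ MPS], rule ext, rule sum.reindex_bij_witness[of _ prod.swap prod.swap])
      (auto simp: add.commute mult.commute)
  show "a * b * c = a * (b * c)"
  proof (rule mps_eqI)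
    fix m
    let ?a = "mcoeff a" and ?b = "mcoeff b" and ?c = "mcoeff c"
    have "mcoeff (a * b * c) m =
        (\<Sum>q\<in>(SIGMA x:{(i, j). i + j = m}. {(k, l). k + l = fst x}). (case q of ((i, j), (k, l)) \<Rightarrow> ?a k * ?b l * ?c j))"
      by (subst sum.Sigma[symmetric])
        (auto simp: times_mps_def finite_multi_index_splits sum_distrib_right case_prod_beta intro!: sum.cong)
    also have "\<dots> = (\<Sum>q\<in>(SIGMA x:{(i, j). i + j = m}. {(k, l). k + l = snd x}). (case q of ((i, j), (k, l)) \<Rightarrow> ?a i * (?b k * ?c l)))"
      by (rule sum.reindex_bij_witness[of _ "\<lambda>((i, j), (k, l)). ((i + k, l), (i, k))" "\<lambda>((i, j), (k, l)). ((k, l + j), (l, j))"])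
        (auto simp: algebra_simps)
    also have "\<dots> = mcoeff (a * (b * c)) m"
      by (subst sum.Sigma[symmetric])
        (auto simp: times_mps_def finite_multi_index_splits sum_distrib_left case_prod_beta intro!: sum.cong)
    finally show "mcoeff (a * b * c) m = mcoeff (a * (b * c)) m" .
  qed
  show "1 * a = a"
  proof (rule mps_eqI)
    fix m
    have "(\<Sum>(i, j)\<in>{(0 :: nat \<Rightarrow>\<^sub>0 nat, m)}. (if i = 0 then 1 else 0) * mcoeff a j) = mcoeff (1 * a) m"
      unfolding times_mps_def one_mps_def mcoeff_MPS
      by (rule sum.mono_neutral_left[OF finite_multi_index_splits]) (auto split: if_splits)
    then show "mcoeff (1 * a) m = mcoeff a m" by simp
  qed
  show "(a + b) * c = a * c + b * c"
    by (rule mps_eqI) (simp add: times_mps_def plus_mps_def algebra_simps sum.distrib case_prod_beta)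
  have "mcoeff (0 :: 'a mps) 0 \<noteq> mcoeff 1 0" by (simp add: mps_defs)
  then show "(0 :: 'a mps) \<noteq> 1" by metis
qed (auto simp: mps_defs intro!: mps_eqI)

end

lemma mcoeff_simps [simp]:
  "mcoeff 0 m = 0" "mcoeff (f + g) m = mcoeff f m + mcoeff g m" "mcoeff (- f) m = - mcoeff f m"
  "mcoeff (f - g) m = mcoeff f m - mcoeff g m"
  by (simp_all add: mps_defs)

lemma mcoeff_sum: "mcoeff (\<Sum>i\<in>I. f i) m = (\<Sum>i\<in>I. mcoeff (f i) m)"
  by (induction I rule: infinite_finite_induct) simp_all

definition mconst :: "'k::comm_ring_1 \<Rightarrow> 'k mps" where
  "mconst c = MPS (\<lambda>m. if m = 0 then c else 0)"

lemma mcoeff_mconst_mult: "mcoeff (mconst c * f) m = c * mcoeff f m"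
proof -
  have "(\<Sum>(i, j)\<in>{(0 :: nat \<Rightarrow>\<^sub>0 nat, m)}. (if i = 0 then c else 0) * mcoeff f j) = mcoeff (mconst c * f) m"
    unfolding times_mps_def mconst_def mcoeff_MPS
    by (rule sum.mono_neutral_left[OF finite_multi_index_splits]) (auto split: if_splits)
  then show ?thesis by simp
qed

lemma mconst_hom: "mconst (c + d) = mconst c + mconst d" "mconst (c * d) = mconst c * mconst d" "mconst 1 = 1"
proof -
  show "mconst (c + d) = mconst c + mconst d" by (rule mps_eqI) (simp add: mconst_def)
  show "mconst (c * d) = mconst c * mconst d"
    by (rule mps_eqI) (simp add: mcoeff_mconst_mult, simp add: mconst_def)
  show "mconst 1 = 1" by (simp add: mconst_def one_mps_def)
qed

lemma mconst_power: "mconst c ^ i = mconst (c ^ i)"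
  by (induction i) (simp_all add: mconst_hom)

definition mmono :: "(nat \<Rightarrow>\<^sub>0 nat) \<Rightarrow> 'k::comm_ring_1 mps" where
  "mmono k = MPS (\<lambda>m. if m = k then 1 else 0)"

lemma mmono_0: "mmono 0 = 1" by (simp add: mmono_def one_mps_def)

lemma mmono_add: "mmono (k + l) = mmono k * mmono l"
proof (rule mps_eqI)
  fix m
  have "mcoeff (mmono k * mmono l :: 'a mps) m =
      (\<Sum>(i, j)\<in>{(i, j). i + j = m}. if (i, j) = (k, l) then 1 else 0)"
    unfolding times_mps_def mmono_def mcoeff_MPS by (intro sum.cong) auto
  also have "\<dots> = (\<Sum>x\<in>{(i, j). i + j = m}. if x = (k, l) then 1 else 0)"
    by (intro sum.cong) (auto split: if_splits)
  also have "\<dots> = (if k + l = m then 1 else 0)" by (subst sum.delta) (auto simp: finite_multi_index_splits)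
  finally show "mcoeff (mmono (k + l) :: 'a mps) m = mcoeff (mmono k * mmono l) m" by (auto simp: mmono_def)
qed

lemma mmono_power: "mmono (Poly_Mapping.single i 1) ^ k = mmono (Poly_Mapping.single i k)"
  by (induction k) (simp_all add: mmono_0 mmono_add[symmetric] single_add[symmetric])

lemma mmono_prod: "(\<Prod>i\<in>I. mmono (k i)) = mmono (\<Sum>i\<in>I. k i)"
  by (induction I rule: infinite_finite_induct) (simp_all add: mmono_0 mmono_add)

lemma multi_index_decomposition:
  fixes m :: "nat \<Rightarrow>\<^sub>0 nat"
  assumes "Poly_Mapping.keys m \<subseteq> {..<n}"
  shows "(\<Sum>i<n. Poly_Mapping.single i (Poly_Mapping.lookup m i)) = m"
proof (rule poly_mapping_eqI)
  fix j
  have "Poly_Mapping.lookup (\<Sum>i<n. Poly_Mapping.single i (Poly_Mapping.lookup m i)) j =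
      (\<Sum>i<n. if i = j then Poly_Mapping.lookup m i else 0)"
    by (simp add: lookup_sum lookup_single when_def)
  also have "\<dots> = Poly_Mapping.lookup m j" using assms by (auto simp: in_keys_iff)
  finally show "Poly_Mapping.lookup (\<Sum>i<n. Poly_Mapping.single i (Poly_Mapping.lookup m i)) j = Poly_Mapping.lookup m j" .
qed

section \<open>The Tate algebra\<close>

definition tate :: "('k::field \<Rightarrow> real) \<Rightarrow> nat \<Rightarrow> 'k mps set" where
  "tate av n = {f. (\<forall>m. \<not> Poly_Mapping.keys m \<subseteq> {..<n} \<longrightarrow> mcoeff f m = 0) \<and>
                   (\<forall>e>0. finite {m. e \<le> av (mcoeff f m)})}"

definition tate_ball :: "('k::field \<Rightarrow> real) \<Rightarrow> nat \<Rightarrow> 'k mps set" where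
  "tate_ball av n = {f \<in> tate av n. \<forall>m. av (mcoeff f m) \<le> 1}"

lemma tate_algebra_mps:
  "MPS a \<in> tate av n \<longleftrightarrow> a \<in> carrier (tate_algebra av n)"
  "a \<otimes>\<^bsub>tate_algebra av n\<^esub> b = mcoeff (MPS a * MPS b)"
  "a \<oplus>\<^bsub>tate_algebra av n\<^esub> b = mcoeff (MPS a + MPS b)"
  "\<one>\<^bsub>tate_algebra av n\<^esub> = mcoeff 1" "\<zero>\<^bsub>tate_algebra av n\<^esub> = mcoeff 0"
  by (simp_all add: tate_def tate_algebra_def mps_defs)

context
  fixes av :: "'k::field \<Rightarrow> real"
  assumes av: "nonarch_absolute_value av"
begin

lemma tate_closed:
  assumes "f \<in> tate av n" "g \<in> tate av n"
  shows "f + g \<in> tate av n" "f * g \<in> tate av n" "- f \<in> tate av n" "f - g \<in> tate av n"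
proof -
  interpret T: cring "tate_algebra av n" by (rule cring_tate_algebra[OF av])
  have c: "mcoeff f \<in> carrier (tate_algebra av n)" "mcoeff g \<in> carrier (tate_algebra av n)"
    using assms by (simp_all flip: tate_algebra_mps(1))
  show "f + g \<in> tate av n" "f * g \<in> tate av n"
    using T.a_closed[OF c] T.m_closed[OF c] by (simp_all add: tate_algebra_mps(2,3) flip: tate_algebra_mps(1))
  have neg: "- h \<in> tate av n" if "h \<in> tate av n" for h :: "'k mps"
    using that by (simp add: tate_def av_minus[OF av])
  show "- f \<in> tate av n" using assms neg by blast
  have "f + - g \<in> tate av n"
  proof -
    have c': "mcoeff (- g) \<in> carrier (tate_algebra av n)" using neg[OF assms(2)] by (simp flip: tate_algebra_mps(1))
    show ?thesis using T.a_closed[OF c(1) c'] by (simp add: tate_algebra_mps(3) flip: tate_algebra_mps(1))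
  qed
  then show "f - g \<in> tate av n" by simp
qed

lemma tate_mconst: "mconst c \<in> tate av n"
proof -
  have "{m :: nat \<Rightarrow>\<^sub>0 nat. e \<le> av (if m = 0 then c else 0)} \<subseteq> {0}" if "0 < e" for e
    using that by (auto simp: av_0[OF av] split: if_splits)
  then have "finite {m :: nat \<Rightarrow>\<^sub>0 nat. e \<le> av (if m = 0 then c else 0)}" if "0 < e" for e
    using that finite_subset by blast
  then show ?thesis by (auto simp: tate_def mconst_def)
qed

lemma tate_mmono: "Poly_Mapping.keys k \<subseteq> {..<n} \<Longrightarrow> mmono k \<in> tate av n"
proof -
  assume k: "Poly_Mapping.keys k \<subseteq> {..<n}"
  have "{m :: nat \<Rightarrow>\<^sub>0 nat. e \<le> av (if m = k then 1 else 0)} \<subseteq> {k}" if "0 < e" for e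
    using that by (auto simp: av_0[OF av] split: if_splits)
  then have "finite {m :: nat \<Rightarrow>\<^sub>0 nat. e \<le> av (if m = k then 1 else 0)}" if "0 < e" for e
    using that finite_subset by blast
  then show ?thesis using k by (auto simp: tate_def mmono_def)
qed

lemma tate_ball_add: "f \<in> tate_ball av n \<Longrightarrow> g \<in> tate_ball av n \<Longrightarrow> f + g \<in> tate_ball av n"
  unfolding tate_ball_def using tate_closed(1) by (auto intro!: order_trans[OF av_ultra[OF av]])

lemma tate_ball_mult: "f \<in> tate_ball av n \<Longrightarrow> g \<in> tate_ball av n \<Longrightarrow> f * g \<in> tate_ball av n"
proof -
  assume fg: "f \<in> tate_ball av n" "g \<in> tate_ball av n"
  have "av (mcoeff (f * g) m) \<le> 1" for m
    unfolding times_mps_def mcoeff_MPS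
    using fg av_nonneg[OF av]
    by (intro av_sum_le[OF av]) (auto simp: tate_ball_def av_mult[OF av] intro!: mult_le_one)
  then show ?thesis using fg tate_closed(2) by (simp add: tate_ball_def)
qed

lemma tate_ball_mconst: "av c \<le> 1 \<Longrightarrow> mconst c \<in> tate_ball av n"
  by (simp add: tate_ball_def tate_mconst) (simp add: mconst_def av_0[OF av])

text \<open>
The coefficients tend to zero, so the Gauss norm is attained.
\<close>

lemma tate_max_coeff:
  assumes "f \<in> tate av n"
  obtains k where "\<And>m. av (mcoeff f m) \<le> av (mcoeff f k)"
proof (cases "\<exists>m0. mcoeff f m0 \<noteq> 0")
  case False
  then show thesis using that[of 0] by simp
next
  case True
  then obtain m0 where m0: "mcoeff f m0 \<noteq> 0" by blast
  define K where "K = {m. av (mcoeff f m0) \<le> av (mcoeff f m)}"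
  have K: "finite K" "m0 \<in> K" using assms av_pos[OF av m0] by (auto simp: tate_def K_def)
  then have "Max ((\<lambda>m. av (mcoeff f m)) ` K) \<in> (\<lambda>m. av (mcoeff f m)) ` K" by (intro Max_in) auto
  then obtain k where k: "k \<in> K" "Max ((\<lambda>m. av (mcoeff f m)) ` K) = av (mcoeff f k)" by blast
  have max: "av (mcoeff f m) \<le> av (mcoeff f k)" if "m \<in> K" for m
    unfolding k(2)[symmetric] using K that by (intro Max_ge) auto
  have "av (mcoeff f m) \<le> av (mcoeff f k)" for m
  proof (cases "m \<in> K")
    case False
    then show ?thesis using max[OF K(2)] by (simp add: K_def)
  qed (rule max)
  then show thesis by (rule that)
qed

lemma tate_scaled_ball:
  assumes f: "f \<in> tate av n" and c: "c \<noteq> 0" "\<And>m. av (mcoeff f m) \<le> av c"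
  obtains b where "b \<in> tate_ball av n" "f = mconst c * b"
proof -
  let ?b = "mconst (inverse c) * f"
  have "?b \<in> tate av n" using tate_mconst f tate_closed by blast
  moreover have "av (mcoeff ?b m) \<le> 1" for m
    unfolding mcoeff_mconst_mult av_mult[OF av] av_inverse[OF av]
    using c(2)[of m] av_pos[OF av c(1)] by (simp add: field_simps)
  moreover have "mconst c * ?b = f" using c by (intro mps_eqI) (simp add: mcoeff_mconst_mult)
  ultimately show thesis using that[of ?b] by (simp add: tate_ball_def)
qed

lemma tate_scale_ball_subset: "b \<in> tate_ball av n \<Longrightarrow> mconst c * b \<in> tate av n"
  using tate_closed(2)[OF tate_mconst] by (auto simp: tate_ball_def)

lemma tate_iff_scaled_ball: "f \<in> tate av n \<longleftrightarrow> (\<exists>c. \<exists>b\<in>tate_ball av n. f = mconst c * b)"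
proof
  assume f: "f \<in> tate av n"
  obtain k where k: "\<And>m. av (mcoeff f m) \<le> av (mcoeff f k)" using tate_max_coeff[OF f] by blast
  show "\<exists>c. \<exists>b\<in>tate_ball av n. f = mconst c * b"
  proof (cases "mcoeff f k = 0")
    case True
    then have "f = mconst 1 * 0" using k av_nonneg[OF av] av_eq_0[OF av]
      by (intro mps_eqI) (metis antisym mcoeff_simps(1) mult_zero_right)
    moreover have "(0 :: 'k mps) \<in> tate_ball av n"
      using tate_ball_mconst[of 0 n] by (simp add: av_0[OF av] mconst_def zero_mps_def)
    ultimately show ?thesis by blast
  next
    case False
    then show ?thesis using tate_scaled_ball[OF f False k] by metis
  qed
qed (use tate_scale_ball_subset in blast)

text \<open>
The sum is formed for each coefficient separately; a large coefficient of the sum is a large coefficient of a partial sum,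
and there are finitely many of these.
\<close>

lemma tate_ball_complete:
  assumes c: "Metric_space.mcomplete UNIV (\<lambda>x y. av (x - y))"
    and w: "0 < av w" "av w < 1" and r: "\<And>i::nat. r i \<in> tate_ball av n"
  shows "\<exists>f\<in>tate_ball av n. \<forall>i. \<exists>b\<in>tate_ball av n. f - (\<Sum>j<i. mconst w ^ j * r j) = mconst w ^ i * b"
proof -
  have "\<forall>m. \<exists>s. \<forall>i. av (s - (\<Sum>j<i. w ^ j * mcoeff (r j) m)) \<le> av w ^ i"
    using r by (intro allI av_series_complete[OF av c w]) (auto simp: tate_ball_def)
  from choice[OF this] obtain s where s: "\<And>m i. av (s m - (\<Sum>j<i. w ^ j * mcoeff (r j) m)) \<le> av w ^ i" by blast
  let ?p = "\<lambda>i. \<Sum>j<i. mconst w ^ j * r j"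
  have p: "mcoeff (?p i) m = (\<Sum>j<i. w ^ j * mcoeff (r j) m)" for i m
    by (simp add: mcoeff_sum mconst_power mcoeff_mconst_mult)
  have s': "av (s m - mcoeff (?p i) m) \<le> av w ^ i" for m i unfolding p by (rule s)
  have rT: "r j \<in> tate av n" for j using r by (simp add: tate_ball_def)
  have "0 \<in> tate av n" using tate_mconst[of 0] by (simp add: mconst_def zero_mps_def)
  then have pT: "?p i \<in> tate av n" for i
  proof (induction i)
    case (Suc i)
    have "mconst w ^ i * r i \<in> tate av n"
      unfolding mconst_power by (rule tate_closed(2)[OF tate_mconst rT])
    with Suc show ?case using tate_closed(1) by simp
  qed simp
  have "MPS s \<in> tate av n"
    unfolding tate_def
  proof (intro CollectI conjI allI impI)
    fix m :: "nat \<Rightarrow>\<^sub>0 nat" assume m: "\<not> Poly_Mapping.keys m \<subseteq> {..<n}"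
    have "mcoeff (r j) m = 0" for j using rT[of j] m by (simp add: tate_def)
    then have le: "av (s m) \<le> av w ^ i" for i using s[of m i] by simp
    have "s m = 0"
    proof (rule ccontr)
      assume "s m \<noteq> 0"
      then obtain i where "av w ^ i < av (s m)" using real_arch_pow_inv[OF av_pos[OF av] w(2)] by blast
      then show False using le[of i] by simp
    qed
    then show "mcoeff (MPS s) m = 0" by simp
  next
    fix e :: real assume e: "0 < e"
    obtain i where i: "av w ^ i < e" using real_arch_pow_inv[OF e w(2)] by blast
    have "{m. e \<le> av (mcoeff (MPS s) m)} \<subseteq> {m. e \<le> av (mcoeff (?p i) m)}"
    proof
      fix m assume "m \<in> {m. e \<le> av (mcoeff (MPS s) m)}"
      then have "e \<le> av (s m)" by simp
      also have "av (s m) \<le> max (av (s m - mcoeff (?p i) m)) (av (mcoeff (?p i) m))"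
        using av_ultra[OF av, of "s m - mcoeff (?p i) m" "mcoeff (?p i) m"] by simp
      finally show "m \<in> {m. e \<le> av (mcoeff (?p i) m)}" using s'[of m i] i by auto
    qed
    moreover have "finite {m. e \<le> av (mcoeff (?p i) m)}" using pT[of i] e by (simp add: tate_def)
    ultimately show "finite {m. e \<le> av (mcoeff (MPS s) m)}" by (rule finite_subset)
  qed
  moreover have "av (s m) \<le> 1" for m using s[of m 0] by simp
  ultimately have sB: "MPS s \<in> tate_ball av n" by (simp add: tate_ball_def)
  have "\<exists>b\<in>tate_ball av n. MPS s - ?p i = mconst w ^ i * b" for i
  proof -
    have w0: "w ^ i \<noteq> 0" using w av_0[OF av] by auto
    have "MPS s - ?p i \<in> tate av n" using sB pT tate_closed(4) by (auto simp: tate_ball_def)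
    moreover have "av (mcoeff (MPS s - ?p i) m) \<le> av (w ^ i)" for m
      using s'[of m i] by (simp add: av_power[OF av])
    ultimately show ?thesis using tate_scaled_ball[OF _ w0, of "MPS s - ?p i" n] by (metis mconst_power)
  qed
  then show ?thesis using sB by blast
qed

text \<open>
The inverse is the sum of the geometric series.
\<close>

lemma tate_one_minus_invertible:
  assumes c: "Metric_space.mcomplete UNIV (\<lambda>x y. av (x - y))"
    and w: "av w < 1" and b: "b \<in> tate_ball av n"
  shows "\<exists>g\<in>tate av n. (1 - mconst w * b) * g = 1"
proof (cases "w = 0")
  case True
  then have "mconst w * b = 0" by (intro mps_eqI) (simp add: mcoeff_mconst_mult)
  then show ?thesis using tate_mconst[of 1] by (intro bexI[of _ 1]) (simp_all add: mconst_hom)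
next
  case False
  have w': "0 < av w" using av_pos[OF av False] .
  have pow: "b ^ i \<in> tate_ball av n" for i
    by (induction i) (use b tate_ball_mult tate_ball_mconst[of 1] in \<open>auto simp: mconst_hom av_1[OF av]\<close>)
  obtain g where g: "g \<in> tate_ball av n"
    "\<And>i. \<exists>b'\<in>tate_ball av n. g - (\<Sum>j<i. mconst w ^ j * b ^ j) = mconst w ^ i * b'"
    using tate_ball_complete[OF c w' w, of "\<lambda>i. b ^ i"] pow by blast
  let ?x = "mconst w * b"
  have small: "av (mcoeff ((1 - ?x) * g - 1) m) \<le> av w ^ i" for m i
  proof -
    obtain b' where b': "b' \<in> tate_ball av n" "g - (\<Sum>j<i. mconst w ^ j * b ^ j) = mconst w ^ i * b'" using g(2) by blast
    have g': "g = (\<Sum>j<i. ?x ^ j) + mconst w ^ i * b'" using b'(2) by (simp add: power_mult_distrib algebra_simps)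
    have "(1 - ?x) * (\<Sum>j<i. ?x ^ j) = 1 - ?x ^ i" by (simp add: one_diff_power_eq)
    then have "(1 - ?x) * g - 1 = mconst (w ^ i) * (b' - (b ^ i + ?x * b'))"
      unfolding g' by (simp add: distrib_left power_mult_distrib mconst_power algebra_simps)
    moreover have "av (mcoeff (b' - (b ^ i + ?x * b')) m) \<le> 1"
    proof -
      have "?x * b' \<in> tate_ball av n" using tate_ball_mconst[of w] w b b'(1) tate_ball_mult by simp
      then have "b ^ i + ?x * b' \<in> tate_ball av n" using pow tate_ball_add by blast
      then show ?thesis using b'(1) av_diff[OF av, of "mcoeff b' m" "mcoeff (b ^ i + ?x * b') m"]
        by (auto simp: tate_ball_def intro: order_trans)
    qed
    ultimately show ?thesis
      by (simp only: mcoeff_mconst_mult av_mult[OF av] av_power[OF av]) (use w' in \<open>simp add: mult_left_le\<close>)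
  qed
  have "(1 - ?x) * g - 1 = 0"
  proof (rule mps_eqI)
    fix m
    have "mcoeff ((1 - ?x) * g - 1) m = 0"
    proof (rule ccontr)
      assume "mcoeff ((1 - ?x) * g - 1) m \<noteq> 0"
      then obtain i where "av w ^ i < av (mcoeff ((1 - ?x) * g - 1) m)"
        using real_arch_pow_inv[OF av_pos[OF av] w] by blast
      then show False using small[of m i] by simp
    qed
    then show "mcoeff ((1 - ?x) * g - 1) m = mcoeff 0 m" by simp
  qed
  then show ?thesis using g(1) by (intro bexI[of _ g]) (simp_all add: tate_ball_def)
qed

end

text \<open>
The variables generate the Tate algebra topologically: an element of the unit ball is a polynomial up to
coefficients of absolute value at most \<open>|w|\<close>.
\<close>

theorem tate_nullstellensatz:
  fixes av :: "'k::field \<Rightarrow> real"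
  assumes av: "nonarch_absolute_value av"
    and c: "Metric_space.mcomplete UNIV (\<lambda>x y. av (x - y))"
    and closed: "\<And>P :: 'k poly. 0 < degree P \<Longrightarrow> \<exists>x. poly P x = 0"
    and w: "0 < av w" "av w < 1"
    and M: "M \<subseteq> tate av n" "0 \<in> M" "1 \<notin> M" "\<And>x y. x \<in> M \<Longrightarrow> y \<in> M \<Longrightarrow> x + y \<in> M"
      "\<And>f m. f \<in> tate av n \<Longrightarrow> m \<in> M \<Longrightarrow> f * m \<in> M"
      "\<And>f. f \<in> tate av n \<Longrightarrow> f \<notin> M \<Longrightarrow> \<exists>g\<in>tate av n. f * g - 1 \<in> M"
    and f: "f \<in> tate av n"
  shows "\<exists>c. f - mconst c \<in> M"
proof -
  interpret residue_field_over_closed_field av mconst "tate_ball av n" M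
  proof
    show "\<exists>c. \<exists>b\<in>tate_ball av n. m = mconst c * b" if "m \<in> M" for m
      using that M(1) tate_iff_scaled_ball[OF av, of m n] by blast
    show "mconst c * b * m \<in> M" if "b \<in> tate_ball av n" "m \<in> M" for c b m
      using M(5) tate_scale_ball_subset[OF av] that by blast
    show "\<exists>d. \<exists>b'\<in>tate_ball av n. mconst c * b * (mconst d * b') - 1 \<in> M"
      if b: "b \<in> tate_ball av n" "mconst c * b \<notin> M" for c b
    proof -
      obtain g where "g \<in> tate av n" "mconst c * b * g - 1 \<in> M"
        using M(6)[OF tate_scale_ball_subset[OF av b(1)] b(2)] by blast
      then show ?thesis using tate_iff_scaled_ball[OF av, of g n] by blast
    qed
    show "1 - mconst c * b \<notin> M" if b: "av c < 1" "b \<in> tate_ball av n" for c b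
    proof
      assume "1 - mconst c * b \<in> M"
      moreover obtain g where "g \<in> tate av n" "(1 - mconst c * b) * g = 1"
        using tate_one_minus_invertible[OF av assms(2) b] by blast
      ultimately show False using M(3,5) by (metis mult.commute)
    qed
    show "\<exists>f\<in>tate_ball av n. \<forall>i. \<exists>b\<in>tate_ball av n. f - (\<Sum>j<i. mconst w ^ j * r j) = mconst w ^ i * b"
      if "0 < av w" "av w < 1" "\<And>i::nat. r i \<in> tate_ball av n" for w r
      using tate_ball_complete[OF av assms(2) that] .
    show "\<exists>s. \<forall>i. av (s - (\<Sum>j<i. w ^ j * c j)) \<le> av w ^ i"
      if "0 < av w" "av w < 1" "\<And>i::nat. av (c i) \<le> 1" for w c
      using av_series_complete[OF av assms(2) that] .
  qed (use M closed in \<open>auto simp: av mconst_hom tate_ball_mconst[OF av] tate_ball_add[OF av] tate_ball_mult[OF av]\<close>)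
  define t where "t i = (mmono (Poly_Mapping.single i 1) :: 'k mps)" for i :: nat
  have mon: "mon t n (Poly_Mapping.lookup m) = mmono m" if "Poly_Mapping.keys m \<subseteq> {..<n}" for m :: "nat \<Rightarrow>\<^sub>0 nat"
    unfolding mon_def t_def mmono_power mmono_prod multi_index_decomposition[OF that] ..
  have "t i \<in> disc 1" if "i < n" for i
    using that tate_mmono[OF av, of "Poly_Mapping.single i 1" n]
    by (intro B_disc) (auto simp: tate_ball_def t_def mmono_def av_1 av_0)
  moreover have "generates t n w {1}"
    unfolding generates_def
  proof
    fix x assume "x \<in> disc 1"
    then obtain b m where x: "x = b + m" "b \<in> tate_ball av n" "m \<in> M"
      unfolding disc_def by (auto simp: mconst_hom)
    have bT: "b \<in> tate av n" using x(2) by (simp add: tate_ball_def)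
    define F where "F = {k. av w \<le> av (mcoeff b k)}"
    have F: "finite F" using bT w(1) by (simp add: F_def tate_def)
    have keys: "Poly_Mapping.keys k \<subseteq> {..<n}" if "k \<in> F" for k
    proof (rule ccontr)
      assume "\<not> Poly_Mapping.keys k \<subseteq> {..<n}"
      then have "mcoeff b k = 0" using bT by (simp add: tate_def)
      then show False using that w(1) by (simp add: F_def av_0)
    qed
    let ?y = "\<Sum>k\<in>F. mconst (mcoeff b k) * mmono k"
    let ?G = "{mon t n m * e | m e. e \<in> {1}}"
    have "?y \<in> int_span ?G"
    proof (rule int_span_sum, rule int_span_scale)
      fix k assume k: "k \<in> F"
      show "av (mcoeff b k) \<le> 1" using x(2) by (simp add: tate_ball_def)
      show "mmono k \<in> int_span ?G" unfolding mon[OF keys[OF k], symmetric] by (intro int_span_base) auto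
    qed
    have yco: "mcoeff ?y k = (if k \<in> F then mcoeff b k else 0)" for k
      using F by (simp add: mcoeff_sum mcoeff_mconst_mult mmono_def if_distrib cong: if_cong)
    have yT: "mconst (mcoeff b k) * mmono k \<in> tate av n" if "k \<in> F" for k
      using keys[OF that] tate_mconst[OF av] tate_mmono[OF av] tate_closed[OF av] by blast
    from F yT have "?y \<in> tate av n"
      by (induction F rule: finite_induct) (use M(1,2) in \<open>auto intro: tate_closed[OF av]\<close>)
    then have bT': "b - ?y \<in> tate av n" by (rule tate_closed(4)[OF av bT])
    have small: "av (mcoeff (b - ?y) k) \<le> av w" for k
      unfolding mcoeff_simps yco using w(1) by (auto simp: F_def av_0 less_imp_le)
    have "w \<noteq> 0" using w(1) av_0 by auto
    obtain b' where b': "b' \<in> tate_ball av n" "b - ?y = mconst w * b'"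
      using tate_scaled_ball[OF av bT' \<open>w \<noteq> 0\<close> small] .
    then have "(b - ?y) + m \<in> disc w" using x(3) unfolding b'(2) disc_def by blast
    then show "\<exists>y\<in>int_span ?G. x - y \<in> disc w"
      using \<open>?y \<in> int_span ?G\<close> by (intro bexI[of _ ?y]) (simp_all add: x(1) algebra_simps)
  qed
  moreover have "f \<in> alg"
    using f tate_iff_scaled_ball[OF av, of f n] alg_disc discI by metis
  ultimately show ?thesis using residue_field_is_constants[of n t w f] w by blast
qed

section \<open>Valuations as preorders\<close>

text \<open>
The relation \<open>|f| \<le> |g|\<close> of a valuation of arbitrary rank.  Two valuations are equivalent if and only if their relations are
equal, so these relations represent the points of valuation spectra without a value group.
\<close>

definition valuation_preorder :: "'a ring \<Rightarrow> ('a \<Rightarrow> 'a \<Rightarrow> bool) \<Rightarrow> bool" where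
  "valuation_preorder A leq \<longleftrightarrow>
     (\<forall>f\<in>carrier A. \<forall>g\<in>carrier A. leq f g \<or> leq g f) \<and>
     (\<forall>f\<in>carrier A. \<forall>g\<in>carrier A. \<forall>h\<in>carrier A. leq f g \<longrightarrow> leq g h \<longrightarrow> leq f h) \<and>
     (\<forall>f\<in>carrier A. \<forall>g\<in>carrier A. \<forall>h\<in>carrier A. leq f g \<longrightarrow> leq (f \<otimes>\<^bsub>A\<^esub> h) (g \<otimes>\<^bsub>A\<^esub> h)) \<and>
     (\<forall>f\<in>carrier A. \<forall>g\<in>carrier A. \<forall>h\<in>carrier A.
        leq (f \<otimes>\<^bsub>A\<^esub> h) (g \<otimes>\<^bsub>A\<^esub> h) \<longrightarrow> leq h \<zero>\<^bsub>A\<^esub> \<or> leq f g) \<and>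
     (\<forall>f\<in>carrier A. leq \<zero>\<^bsub>A\<^esub> f) \<and> \<not> leq \<one>\<^bsub>A\<^esub> \<zero>\<^bsub>A\<^esub> \<and>
     (\<forall>f\<in>carrier A. \<forall>g\<in>carrier A. leq (f \<oplus>\<^bsub>A\<^esub> g) f \<or> leq (f \<oplus>\<^bsub>A\<^esub> g) g)"

context ordered_abelian_group
begin

lemma val_le_total: "s \<in> insert None (Some ` carrier G) \<Longrightarrow> t \<in> insert None (Some ` carrier G) \<Longrightarrow> val_le G s t \<or> val_le G t s"
  using group_le_total[of "the s" "the t"] by auto

lemma val_le_trans:
  "s \<in> insert None (Some ` carrier G) \<Longrightarrow> t \<in> insert None (Some ` carrier G) \<Longrightarrow> u \<in> insert None (Some ` carrier G)
   \<Longrightarrow> val_le G s t \<Longrightarrow> val_le G t u \<Longrightarrow> val_le G s u"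
  using group_le_trans[of "the s" "the t" "the u"] by (cases s; cases t; cases u) auto

lemma val_le_mult:
  "s \<in> insert None (Some ` carrier G) \<Longrightarrow> t \<in> insert None (Some ` carrier G) \<Longrightarrow> u \<in> insert None (Some ` carrier G)
   \<Longrightarrow> val_le G s t \<Longrightarrow> val_le G (val_mult G s u) (val_mult G t u)"
  using group_le_mult[of "the s" "the t" "the u"] by (cases s; cases t; cases u) auto

lemma val_le_cancel:
  assumes "s \<in> insert None (Some ` carrier G)" "t \<in> insert None (Some ` carrier G)" "u \<in> insert None (Some ` carrier G)"
    "val_le G (val_mult G s u) (val_mult G t u)" "u \<noteq> None"
  shows "val_le G s t"
proof -
  have *: "group_le G x y" if "x \<in> carrier G" "y \<in> carrier G" "z \<in> carrier G" "group_le G (x \<otimes> z) (y \<otimes> z)" for x y z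
    using group_le_mult[of "x \<otimes> z" "y \<otimes> z" "inv z"] that by (simp add: m_assoc)
  show ?thesis using assms *[of "the s" "the t" "the u"] by (cases s; cases t; cases u) auto
qed

end

lemma valuation_preorder_of_valuation:
  assumes A: "ring A" and v: "is_valuation A G v"
  shows "valuation_preorder A (\<lambda>f g. val_le G (v f) (v g))"
proof -
  interpret A: ring A by fact
  interpret G: ordered_abelian_group G using v by (simp add: is_valuation_def)
  have cl: "v f \<in> insert None (Some ` carrier G)" if "f \<in> carrier A" for f
    using v that by (auto simp: is_valuation_def Pi_iff)
  have vm: "v (f \<otimes>\<^bsub>A\<^esub> g) = val_mult G (v f) (v g)" if "f \<in> carrier A" "g \<in> carrier A" for f g
    using v that by (simp add: is_valuation_def)
  have v0: "v \<zero>\<^bsub>A\<^esub> = None" "v \<one>\<^bsub>A\<^esub> = Some \<one>\<^bsub>G\<^esub>" using v by (simp_all add: is_valuation_def)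
  show ?thesis
    unfolding valuation_preorder_def
  proof (intro conjI ballI impI)
    fix f g h assume fgh: "f \<in> carrier A" "g \<in> carrier A" "h \<in> carrier A"
    show "val_le G (v f) (v h)" if "val_le G (v f) (v g)" "val_le G (v g) (v h)"
      using G.val_le_trans[OF cl cl cl] fgh that by blast
    show "val_le G (v (f \<otimes>\<^bsub>A\<^esub> h)) (v (g \<otimes>\<^bsub>A\<^esub> h))" if "val_le G (v f) (v g)"
      unfolding vm[OF fgh(1,3)] vm[OF fgh(2,3)] using fgh that by (intro G.val_le_mult cl)
    show "val_le G (v h) (v \<zero>\<^bsub>A\<^esub>) \<or> val_le G (v f) (v g)" if "val_le G (v (f \<otimes>\<^bsub>A\<^esub> h)) (v (g \<otimes>\<^bsub>A\<^esub> h))"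
    proof (cases "v h = None")
      case False
      then show ?thesis
        using G.val_le_cancel[OF cl[OF fgh(1)] cl[OF fgh(2)] cl[OF fgh(3)]] that
        unfolding vm[OF fgh(1,3)] vm[OF fgh(2,3)] by blast
    qed simp
  next
    fix f g assume fg: "f \<in> carrier A" "g \<in> carrier A"
    show "val_le G (v f) (v g) \<or> val_le G (v g) (v f)" using G.val_le_total[OF cl cl] fg by blast
    show "val_le G (v (f \<oplus>\<^bsub>A\<^esub> g)) (v f) \<or> val_le G (v (f \<oplus>\<^bsub>A\<^esub> g)) (v g)"
      using v fg by (simp add: is_valuation_def)
  qed (simp_all add: v0)
qed

text \<open>
The valuation is recovered from the relation: the value group consists of the classes of fractions \<open>f/g\<close> of
elements with nonzero values.
\<close>

locale preordered_ring = cring A for A :: "'a ring" (structure) +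
  fixes leq :: "'a \<Rightarrow> 'a \<Rightarrow> bool"
  assumes leq: "valuation_preorder A leq"
begin

lemmas le_axioms = leq[unfolded valuation_preorder_def]
lemmas le_total = le_axioms[THEN conjunct1, rule_format]
  and le_trans = le_axioms[THEN conjunct2, THEN conjunct1, rule_format]
  and le_mult = le_axioms[THEN conjunct2, THEN conjunct2, THEN conjunct1, rule_format]
  and le_cancel_or_null = le_axioms[THEN conjunct2, THEN conjunct2, THEN conjunct2, THEN conjunct1, rule_format]
  and le_0 = le_axioms[THEN conjunct2, THEN conjunct2, THEN conjunct2, THEN conjunct2, THEN conjunct1, rule_format]
  and not_le_1_0 = le_axioms[THEN conjunct2, THEN conjunct2, THEN conjunct2, THEN conjunct2, THEN conjunct2, THEN conjunct1]
  and le_add = le_axioms[THEN conjunct2, THEN conjunct2, THEN conjunct2, THEN conjunct2, THEN conjunct2, THEN conjunct2, rule_format]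

lemma le_cancel:
  "f \<in> carrier A \<Longrightarrow> g \<in> carrier A \<Longrightarrow> h \<in> carrier A \<Longrightarrow> leq (f \<otimes> h) (g \<otimes> h) \<Longrightarrow> \<not> leq h \<zero> \<Longrightarrow> leq f g"
  using le_cancel_or_null by blast

lemma le_refl: "f \<in> carrier A \<Longrightarrow> leq f f" using le_total by blast

lemma le_mult2:
  assumes "f \<in> carrier A" "g \<in> carrier A" "f' \<in> carrier A" "g' \<in> carrier A" "leq f g" "leq f' g'"
  shows "leq (f \<otimes> f') (g \<otimes> g')"
proof -
  have "leq (f \<otimes> f') (g \<otimes> f')" using assms le_mult by blast
  moreover have "leq (f' \<otimes> g) (g' \<otimes> g)" using assms le_mult by blast
  then have "leq (g \<otimes> f') (g \<otimes> g')" using assms by (simp add: m_comm)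
  ultimately show ?thesis using assms le_trans[of "f \<otimes> f'" "g \<otimes> f'" "g \<otimes> g'"] by simp
qed

definition S :: "'a set" where "S = {f \<in> carrier A. \<not> leq f \<zero>}"

lemma S_carrier: "f \<in> S \<Longrightarrow> f \<in> carrier A" by (simp add: S_def)

lemma S_1: "\<one> \<in> S" by (simp add: S_def not_le_1_0)

lemma S_mult: "f \<in> S \<Longrightarrow> g \<in> S \<Longrightarrow> f \<otimes> g \<in> S"
  using le_cancel[of f \<zero> g] by (auto simp: S_def)

lemma mult_null: "f \<in> carrier A \<Longrightarrow> g \<in> carrier A \<Longrightarrow> leq f \<zero> \<Longrightarrow> leq (f \<otimes> g) \<zero>"
  using le_mult[of f \<zero> g] by simp

text \<open>
The comparison \<open>f/g \<le> a/b\<close> of fractions.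
\<close>

definition fle :: "'a \<times> 'a \<Rightarrow> 'a \<times> 'a \<Rightarrow> bool" where
  "fle p q \<longleftrightarrow> leq (fst p \<otimes> snd q) (fst q \<otimes> snd p)"

definition cls :: "'a \<times> 'a \<Rightarrow> ('a \<times> 'a) set" where
  "cls p = {q \<in> S \<times> S. fle p q \<and> fle q p}"

definition fmult :: "'a \<times> 'a \<Rightarrow> 'a \<times> 'a \<Rightarrow> 'a \<times> 'a" where
  "fmult p q = (fst p \<otimes> fst q, snd p \<otimes> snd q)"

lemma fle_refl: "p \<in> S \<times> S \<Longrightarrow> fle p p"
  using le_refl by (auto simp: fle_def S_carrier)

lemma fle_total: "p \<in> S \<times> S \<Longrightarrow> q \<in> S \<times> S \<Longrightarrow> fle p q \<or> fle q p"
  using le_total[of "fst p \<otimes> snd q" "fst q \<otimes> snd p"] by (auto simp: fle_def S_carrier)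

lemma fle_trans:
  assumes "p \<in> S \<times> S" "q \<in> S \<times> S" "r \<in> S \<times> S" "fle p q" "fle q r"
  shows "fle p r"
proof -
  obtain f g a b c d where pqr: "p = (f, g)" "q = (a, b)" "r = (c, d)" by (metis surj_pair)
  then have cl: "f \<in> carrier A" "g \<in> carrier A" "a \<in> carrier A" "b \<in> carrier A" "c \<in> carrier A" "d \<in> carrier A"
    using assms by (auto simp: S_carrier)
  have 1: "leq (f \<otimes> b) (a \<otimes> g)" "leq (a \<otimes> d) (c \<otimes> b)" using assms pqr by (auto simp: fle_def)
  have "leq ((f \<otimes> b) \<otimes> d) ((a \<otimes> g) \<otimes> d)" "leq ((a \<otimes> d) \<otimes> g) ((c \<otimes> b) \<otimes> g)" using 1 cl le_mult by simp_all
  moreover have "(f \<otimes> b) \<otimes> d = (f \<otimes> d) \<otimes> b" "(a \<otimes> g) \<otimes> d = (a \<otimes> d) \<otimes> g" "(c \<otimes> b) \<otimes> g = (c \<otimes> g) \<otimes> b"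
    using cl by algebra+
  ultimately have "leq ((f \<otimes> d) \<otimes> b) ((c \<otimes> g) \<otimes> b)"
    using le_trans[of "(f \<otimes> d) \<otimes> b" "(a \<otimes> d) \<otimes> g" "(c \<otimes> g) \<otimes> b"] cl by simp
  moreover have "\<not> leq b \<zero>" using assms pqr by (auto simp: S_def)
  ultimately show ?thesis using le_cancel[of "f \<otimes> d" "c \<otimes> g" b] cl pqr by (simp add: fle_def)
qed

lemma fmult_S: "p \<in> S \<times> S \<Longrightarrow> q \<in> S \<times> S \<Longrightarrow> fmult p q \<in> S \<times> S"
  by (auto simp: fmult_def S_mult)

lemma fle_fmult:
  assumes "p \<in> S \<times> S" "q \<in> S \<times> S" "p' \<in> S \<times> S" "q' \<in> S \<times> S" "fle p q" "fle p' q'"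
  shows "fle (fmult p p') (fmult q q')"
proof -
  obtain f g a b f' g' a' b' where pq: "p = (f, g)" "q = (a, b)" "p' = (f', g')" "q' = (a', b')" by (metis surj_pair)
  then have cl: "f \<in> carrier A" "g \<in> carrier A" "a \<in> carrier A" "b \<in> carrier A"
    "f' \<in> carrier A" "g' \<in> carrier A" "a' \<in> carrier A" "b' \<in> carrier A"
    using assms by (auto simp: S_carrier)
  have "leq ((f \<otimes> b) \<otimes> (f' \<otimes> b')) ((a \<otimes> g) \<otimes> (a' \<otimes> g'))"
    using assms pq cl le_mult2[of "f \<otimes> b" "a \<otimes> g" "f' \<otimes> b'" "a' \<otimes> g'"] by (simp add: fle_def)
  moreover have "(f \<otimes> b) \<otimes> (f' \<otimes> b') = (f \<otimes> f') \<otimes> (b \<otimes> b')" "(a \<otimes> g) \<otimes> (a' \<otimes> g') = (a \<otimes> a') \<otimes> (g \<otimes> g')"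
    using cl by algebra+
  ultimately show ?thesis by (simp add: fle_def fmult_def pq)
qed

lemma cls_eq_iff: "p \<in> S \<times> S \<Longrightarrow> q \<in> S \<times> S \<Longrightarrow> cls p = cls q \<longleftrightarrow> fle p q \<and> fle q p"
proof
  assume p: "p \<in> S \<times> S" "q \<in> S \<times> S" and "cls p = cls q"
  moreover have "q \<in> cls q" using p fle_refl by (auto simp: cls_def)
  ultimately have "q \<in> cls p" by simp
  then show "fle p q \<and> fle q p" by (auto simp: cls_def)
next
  assume p: "p \<in> S \<times> S" "q \<in> S \<times> S" and pq: "fle p q \<and> fle q p"
  have "fle p r \<and> fle r p \<longleftrightarrow> fle q r \<and> fle r q" if "r \<in> S \<times> S" for r
    using fle_trans[OF p(1,2) that] fle_trans[OF p(2,1) that] fle_trans[OF that p] fle_trans[OF that p(2,1)] pq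
    by blast
  then show "cls p = cls q" unfolding cls_def by blast
qed

definition rep :: "('a \<times> 'a) set \<Rightarrow> 'a \<times> 'a" where "rep X = (SOME p. p \<in> X)"

lemma rep_cls:
  assumes "p \<in> S \<times> S" shows "rep (cls p) \<in> S \<times> S" "fle p (rep (cls p))" "fle (rep (cls p)) p"
proof -
  have "p \<in> cls p" using assms fle_refl by (simp add: cls_def)
  then have "rep (cls p) \<in> cls p" unfolding rep_def by (rule someI)
  then show "rep (cls p) \<in> S \<times> S" "fle p (rep (cls p))" "fle (rep (cls p)) p" by (auto simp: cls_def)
qed

definition G :: "('a \<times> 'a) set ordered_group" where
  "G = \<lparr> carrier = cls ` (S \<times> S), mult = (\<lambda>X Y. cls (fmult (rep X) (rep Y))), one = cls (\<one>, \<one>),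
         group_le = (\<lambda>X Y. fle (rep X) (rep Y)) \<rparr>"

lemma G_mult: "p \<in> S \<times> S \<Longrightarrow> q \<in> S \<times> S \<Longrightarrow> cls p \<otimes>\<^bsub>G\<^esub> cls q = cls (fmult p q)"
  using rep_cls[of p] rep_cls[of q] by (simp add: G_def cls_eq_iff fmult_S fle_fmult)

lemma G_le: "p \<in> S \<times> S \<Longrightarrow> q \<in> S \<times> S \<Longrightarrow> group_le G (cls p) (cls q) \<longleftrightarrow> fle p q"
proof -
  assume pq: "p \<in> S \<times> S" "q \<in> S \<times> S"
  note p' = rep_cls[OF pq(1)] and q' = rep_cls[OF pq(2)]
  have "fle (rep (cls p)) (rep (cls q)) \<longleftrightarrow> fle p q"
    using fle_trans[OF p'(1) pq(1) q'(1) p'(3)] fle_trans[OF pq q'(1) _ q'(2)]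
      fle_trans[OF pq(1) p'(1) q'(1) p'(2)] fle_trans[OF pq(1) q'(1) pq(2) _ q'(3)] by blast
  then show ?thesis by (simp add: G_def)
qed

lemma G_carrier: "carrier G = cls ` (S \<times> S)" and G_one: "\<one>\<^bsub>G\<^esub> = cls (\<one>, \<one>)"
  by (simp_all add: G_def)

lemma ordered_abelian_group_G: "ordered_abelian_group G"
proof -
  have one: "(\<one>, \<one>) \<in> S \<times> S" by (simp add: S_1)
  have fm: "fmult (fmult p q) r = fmult p (fmult q r)" "fmult p q = fmult q p" "fmult (\<one>, \<one>) p = p"
    if "p \<in> S \<times> S" "q \<in> S \<times> S" "r \<in> S \<times> S" for p q r
    using that by (auto simp: fmult_def S_carrier m_ac)
  have "Group.comm_group G"
  proof (rule comm_groupI)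
    fix X assume "X \<in> carrier G"
    then obtain f g where X: "f \<in> S" "g \<in> S" "X = cls (f, g)" by (auto simp: G_carrier)
    have "fle (fmult (g, f) (f, g)) (\<one>, \<one>)" "fle (\<one>, \<one>) (fmult (g, f) (f, g))"
      using X by (auto simp: fle_def fmult_def S_carrier m_comm intro!: le_refl)
    then have "cls (g, f) \<otimes>\<^bsub>G\<^esub> X = \<one>\<^bsub>G\<^esub>"
      using X one by (simp add: G_mult G_one cls_eq_iff fmult_S)
    then show "\<exists>Y\<in>carrier G. Y \<otimes>\<^bsub>G\<^esub> X = \<one>\<^bsub>G\<^esub>" using X by (auto simp: G_carrier)
  next
    fix X Y assume "X \<in> carrier G" "Y \<in> carrier G"
    then obtain p q where pq: "p \<in> S \<times> S" "q \<in> S \<times> S" "X = cls p" "Y = cls q" unfolding G_carrier by blast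
    show "X \<otimes>\<^bsub>G\<^esub> Y \<in> carrier G"
      unfolding pq(3,4) G_mult[OF pq(1,2)] G_carrier using fmult_S[OF pq(1,2)] by (rule imageI)
    show "X \<otimes>\<^bsub>G\<^esub> Y = Y \<otimes>\<^bsub>G\<^esub> X"
      unfolding pq(3,4) G_mult[OF pq(1,2)] G_mult[OF pq(2,1)] using fm(2)[OF pq(1,2) one] by simp
  next
    fix X Y Z assume "X \<in> carrier G" "Y \<in> carrier G" "Z \<in> carrier G"
    then obtain p q r where pq: "p \<in> S \<times> S" "q \<in> S \<times> S" "r \<in> S \<times> S" "X = cls p" "Y = cls q" "Z = cls r"
      unfolding G_carrier by (elim imageE) blast
    show "X \<otimes>\<^bsub>G\<^esub> Y \<otimes>\<^bsub>G\<^esub> Z = X \<otimes>\<^bsub>G\<^esub> (Y \<otimes>\<^bsub>G\<^esub> Z)"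
      unfolding pq(4-6) using fm(1)[OF pq(1-3)] pq(1-3) by (simp only: G_mult fmult_S)
  next
    fix X assume "X \<in> carrier G"
    then obtain p where p: "p \<in> S \<times> S" "X = cls p" unfolding G_carrier by blast
    show "\<one>\<^bsub>G\<^esub> \<otimes>\<^bsub>G\<^esub> X = X" unfolding p(2) G_one G_mult[OF one p(1)] using fm(3)[OF p(1) p(1) p(1)] by simp
  next
    show "\<one>\<^bsub>G\<^esub> \<in> carrier G" unfolding G_one G_carrier using one by (rule imageI)
  qed
  then show ?thesis
  proof (rule ordered_abelian_group.intro)
    show "ordered_abelian_group_axioms G"
    proof
      fix X Y assume "X \<in> carrier G" "Y \<in> carrier G"
      then obtain p q where pq: "p \<in> S \<times> S" "q \<in> S \<times> S" "X = cls p" "Y = cls q" unfolding G_carrier by blast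
      show "X = Y" if "group_le G X Y" "group_le G Y X"
        using that unfolding pq(3,4) G_le[OF pq(1,2)] G_le[OF pq(2,1)] cls_eq_iff[OF pq(1,2)] by blast
      show "group_le G X Y \<or> group_le G Y X"
        unfolding pq(3,4) G_le[OF pq(1,2)] G_le[OF pq(2,1)] by (rule fle_total[OF pq(1,2)])
    next
      fix X Y Z assume "X \<in> carrier G" "Y \<in> carrier G" "Z \<in> carrier G"
      then obtain p q r where pq: "p \<in> S \<times> S" "q \<in> S \<times> S" "r \<in> S \<times> S" "X = cls p" "Y = cls q" "Z = cls r"
        unfolding G_carrier by blast
      show "group_le G X Z" if "group_le G X Y" "group_le G Y Z"
        using that fle_trans[OF pq(1-3)] pq(1-3) unfolding pq(4-6) by (simp only: G_le)
      show "group_le G (X \<otimes>\<^bsub>G\<^esub> Z) (Y \<otimes>\<^bsub>G\<^esub> Z)" if "group_le G X Y"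
        using that fle_fmult[OF pq(1,2,3,3)] fle_refl[OF pq(3)] pq(1-3) unfolding pq(4-6)
        by (simp only: G_le G_mult fmult_S)
    qed
  qed
qed

definition v :: "'a \<Rightarrow> ('a \<times> 'a) set option" where
  "v f = (if f \<in> S then Some (cls (f, \<one>)) else None)"

lemma le_v_iff: "f \<in> carrier A \<Longrightarrow> g \<in> carrier A \<Longrightarrow> val_le G (v f) (v g) \<longleftrightarrow> leq f g"
proof -
  assume fg: "f \<in> carrier A" "g \<in> carrier A"
  consider "f \<in> S" "g \<in> S" | "f \<notin> S" | "f \<in> S" "g \<notin> S" by blast
  then show ?thesis
  proof cases
    case 1
    then show ?thesis using fg S_1 by (simp add: v_def G_le fle_def)
  next
    case 2
    then have "leq f g" using fg le_trans[of f \<zero> g] le_0 by (simp add: S_def)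
    then show ?thesis using 2 by (simp add: v_def)
  next
    case 3
    then have "\<not> leq f g" using fg le_trans[of f g \<zero>] by (auto simp: S_def)
    then show ?thesis using 3 by (simp add: v_def)
  qed
qed

lemma is_valuation_v: "is_valuation A G v"
  unfolding is_valuation_def
proof (intro conjI ballI)
  have S1: "(f, \<one>) \<in> S \<times> S" if "f \<in> S" for f using that S_1 by simp
  show "ordered_abelian_group G" by (rule ordered_abelian_group_G)
  show "v \<in> carrier A \<rightarrow> insert None (Some ` carrier G)"
    using S_1 by (auto simp: v_def G_carrier)
  show "v \<zero> = None" using le_refl[of \<zero>] by (simp add: v_def S_def)
  show "v \<one> = Some \<one>\<^bsub>G\<^esub>" using S_1 by (simp add: v_def G_one)
  fix f g assume fg: "f \<in> carrier A" "g \<in> carrier A"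
  show "val_le G (v (f \<oplus> g)) (v f) \<or> val_le G (v (f \<oplus> g)) (v g)"
    using le_v_iff fg le_add[OF fg] by simp
  show "v (f \<otimes> g) = val_mult G (v f) (v g)"
  proof (cases "f \<in> S \<and> g \<in> S")
    case True
    then show ?thesis using G_mult[OF S1 S1] S_mult by (simp add: v_def fmult_def)
  next
    case False
    then have "leq (f \<otimes> g) \<zero>" using fg mult_null[of f g] mult_null[of g f] by (auto simp: S_def m_comm)
    then show ?thesis using False by (auto simp: v_def S_def)
  qed
qed

text \<open>
Continuity is a condition on all elements of the value group; in terms of the relation, these are fractions.
\<close>

lemma value_le_iff:
  assumes "x \<in> carrier G"
  shows "\<exists>f\<in>S. \<exists>g\<in>S. \<forall>h\<in>carrier A. val_le G (Some x) (v h) \<longleftrightarrow> leq f (h \<otimes> g)"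
proof -
  obtain f g where fg: "f \<in> S" "g \<in> S" "x = cls (f, g)" using assms unfolding G_carrier by auto
  have "val_le G (Some x) (v h) \<longleftrightarrow> leq f (h \<otimes> g)" if h: "h \<in> carrier A" for h
  proof (cases "h \<in> S")
    case True
    then show ?thesis using fg S_1 by (simp add: v_def G_le fle_def S_carrier)
  next
    case False
    then have "leq (h \<otimes> g) \<zero>" using mult_null[of h g] h fg by (simp add: S_def)
    then have "\<not> leq f (h \<otimes> g)" using fg h le_trans[of f "h \<otimes> g" \<zero>] by (auto simp: S_def)
    then show ?thesis using False by (simp add: v_def)
  qed
  then show ?thesis using fg by blast
qed

end

section \<open>The adic space of a seminormed algebra\<close>

text \<open>
The properties of an affinoid algebra with its residue norm that enter the comparison of adic and Berkovich
spaces.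
\<close>

locale seminormed_algebra = cring A for A :: "'a ring" (structure) +
  fixes N :: "'a \<Rightarrow> real" and av :: "'k::field \<Rightarrow> real" and \<kappa> :: "'k \<Rightarrow> 'a"
  assumes av: "nonarch_absolute_value av"
    and values_dense: "\<And>x y. 0 < x \<Longrightarrow> x < y \<Longrightarrow> \<exists>c. x < av c \<and> av c < y"
    and \<kappa>_carrier [simp]: "\<And>c. \<kappa> c \<in> carrier A"
    and \<kappa>_mult: "\<And>c d. \<kappa> (c * d) = \<kappa> c \<otimes> \<kappa> d" and \<kappa>_1: "\<kappa> 1 = \<one>" and \<kappa>_0: "\<kappa> 0 = \<zero>"
    and N_nonneg: "\<And>f. f \<in> carrier A \<Longrightarrow> 0 \<le> N f"
    and N_\<kappa>: "\<And>c. N (\<kappa> c) \<le> av c"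
    and N_mult: "\<And>f g. f \<in> carrier A \<Longrightarrow> g \<in> carrier A \<Longrightarrow> N (f \<otimes> g) \<le> N f * N g"
begin

lemma N_scale: "f \<in> carrier A \<Longrightarrow> N (\<kappa> c \<otimes> f) \<le> av c * N f"
  using N_mult[of "\<kappa> c" f] N_\<kappa>[of c] N_nonneg[of f] mult_right_mono[of "N (\<kappa> c)" "av c" "N f"] by simp

lemma power_bounded_unit_ball: "f \<in> carrier A \<Longrightarrow> N f \<le> 1 \<Longrightarrow> f \<in> power_bounded A N"
proof -
  assume f: "f \<in> carrier A" "N f \<le> 1"
  have "N (f [^] k) \<le> 1" for k :: nat
  proof (induction k)
    case 0
    then show ?case using N_\<kappa>[of 1] by (simp add: \<kappa>_1 av_1[OF av])
  next
    case (Suc k)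
    have "N (f [^] k \<otimes> f) \<le> N (f [^] k) * N f" using f by (intro N_mult) auto
    also have "\<dots> \<le> 1" using Suc f N_nonneg by (intro mult_le_one) auto
    finally show ?case by simp
  qed
  then show ?thesis using f unfolding power_bounded_def by blast
qed

lemma \<kappa>_power_bounded: "av c \<le> 1 \<Longrightarrow> \<kappa> c \<in> power_bounded A N"
  using N_\<kappa>[of c] by (intro power_bounded_unit_ball) auto

lemma \<kappa>_inverse: "c \<noteq> 0 \<Longrightarrow> \<kappa> c \<otimes> \<kappa> (inverse c) = \<one>"
  by (simp add: \<kappa>_mult[symmetric] \<kappa>_1)

lemma small_const: "0 < e \<Longrightarrow> \<exists>c. c \<noteq> 0 \<and> av c < e"
  using values_dense[of "e / 2" e] av_0[OF av] by (metis field_sum_of_halves half_gt_zero less_add_same_cancel1 less_irrefl less_trans)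

text \<open>
The points of the adic space as preorders.  The last condition is continuity: a nonzero value is larger than
the value of some nonzero constant.
\<close>

definition adic_preorder :: "('a \<Rightarrow> 'a \<Rightarrow> bool) \<Rightarrow> bool" where
  "adic_preorder leq \<longleftrightarrow> valuation_preorder A leq \<and> (\<forall>f\<in>power_bounded A N. leq f \<one>) \<and>
     (\<forall>f\<in>carrier A. \<not> leq f \<zero> \<longrightarrow> (\<exists>c. c \<noteq> 0 \<and> \<not> leq f (\<kappa> c)))"

lemma huber_equivD:
  "((G, v), (H, w)) \<in> huber_equiv A N \<Longrightarrow> f \<in> carrier A \<Longrightarrow> g \<in> carrier A \<Longrightarrow> val_le G (v f) (v g) \<longleftrightarrow> val_le H (w f) (w g)"
  by (simp add: huber_equiv_def)

lemma adic_space_repr: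
  assumes "x \<in> adic_space A N"
  obtains G v where "(G, v) \<in> huber_valuations A N" "x = huber_equiv A N `` {(G, v)}"
    "\<forall>f\<in>carrier A. \<forall>g\<in>carrier A. ad_le x f g \<longleftrightarrow> val_le G (v f) (v g)"
proof -
  obtain q where q: "q \<in> huber_valuations A N" "x = huber_equiv A N `` {q}"
    using assms unfolding adic_space_def by (rule quotientE)
  obtain G v where Gv: "q = (G, v)" by (cases q)
  have mem: "(G, v) \<in> x" using q unfolding Gv by (auto simp: huber_equiv_def)
  have "ad_le x f g \<longleftrightarrow> val_le G (v f) (v g)" if fg: "f \<in> carrier A" "g \<in> carrier A" for f g
  proof
    assume "ad_le x f g"
    then obtain H w where Hw: "(H, w) \<in> x" "val_le H (w f) (w g)" unfolding ad_le_def by blast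
    then have "((G, v), (H, w)) \<in> huber_equiv A N" unfolding q(2) Gv by blast
    then show "val_le G (v f) (v g)" using huber_equivD fg Hw(2) by blast
  next
    assume "val_le G (v f) (v g)"
    then show "ad_le x f g" using mem unfolding ad_le_def by blast
  qed
  then show thesis using that q Gv by blast
qed

lemma adic_space_ext:
  assumes x: "x \<in> adic_space A N" and y: "y \<in> adic_space A N"
    and eq: "\<And>f g. f \<in> carrier A \<Longrightarrow> g \<in> carrier A \<Longrightarrow> ad_le x f g \<longleftrightarrow> ad_le y f g"
  shows "x = y"
proof -
  obtain G v where G: "(G, v) \<in> huber_valuations A N" "x = huber_equiv A N `` {(G, v)}"
    "\<forall>f\<in>carrier A. \<forall>g\<in>carrier A. ad_le x f g \<longleftrightarrow> val_le G (v f) (v g)"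
    using adic_space_repr[OF x] by blast
  obtain H w where H: "(H, w) \<in> huber_valuations A N" "y = huber_equiv A N `` {(H, w)}"
    "\<forall>f\<in>carrier A. \<forall>g\<in>carrier A. ad_le y f g \<longleftrightarrow> val_le H (w f) (w g)"
    using adic_space_repr[OF y] by blast
  have "val_le G (v f) (v g) \<longleftrightarrow> val_le H (w f) (w g)" if "f \<in> carrier A" "g \<in> carrier A" for f g
    using G(3) H(3) eq[OF that] that by simp
  then show ?thesis unfolding G(2) H(2) using G(1) H(1) by (auto simp: huber_equiv_def)
qed

lemma adic_preorder_ad_le:
  assumes x: "x \<in> adic_space A N" shows "adic_preorder (ad_le x)"
proof -
  obtain G v where G: "(G, v) \<in> huber_valuations A N" "x = huber_equiv A N `` {(G, v)}"
    "\<forall>f\<in>carrier A. \<forall>g\<in>carrier A. ad_le x f g \<longleftrightarrow> val_le G (v f) (v g)"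
    using adic_space_repr[OF x] by blast
  have val: "is_valuation A G v"
    and cont: "\<And>s. s \<in> value_group A G v \<Longrightarrow> norm_open A N {f \<in> carrier A. \<not> val_le G (Some s) (v f)}"
    and pb: "\<And>f. f \<in> power_bounded A N \<Longrightarrow> val_le G (v f) (Some \<one>\<^bsub>G\<^esub>)"
    using G(1) by (auto simp: huber_valuations_def continuous_valuation_def)
  have v01: "v \<zero> = None" "v \<one> = Some \<one>\<^bsub>G\<^esub>" using val by (simp_all add: is_valuation_def)
  have "valuation_preorder A (\<lambda>f g. val_le G (v f) (v g))"
    by (rule valuation_preorder_of_valuation[OF ring_axioms val])
  then interpret P: preordered_ring A "\<lambda>f g. val_le G (v f) (v g)"
    by unfold_locales
  have eq: "ad_le x f g \<longleftrightarrow> val_le G (v f) (v g)" if "f \<in> carrier A" "g \<in> carrier A" for f g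
    using G(3) that by blast
  have "valuation_preorder A (ad_le x)"
    unfolding valuation_preorder_def
  proof (intro conjI ballI impI)
    fix f g h assume fgh: "f \<in> carrier A" "g \<in> carrier A" "h \<in> carrier A"
    show "ad_le x f h" if "ad_le x f g" "ad_le x g h" using P.le_trans[OF fgh] that fgh by (simp add: eq)
    show "ad_le x (f \<otimes> h) (g \<otimes> h)" if "ad_le x f g" using P.le_mult[OF fgh] that fgh by (simp add: eq)
    show "ad_le x h \<zero> \<or> ad_le x f g" if "ad_le x (f \<otimes> h) (g \<otimes> h)"
      using P.le_cancel_or_null[OF fgh] that fgh by (simp add: eq)
  next
    fix f g assume fg: "f \<in> carrier A" "g \<in> carrier A"
    show "ad_le x f g \<or> ad_le x g f" using P.le_total[OF fg] fg by (simp add: eq)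
    show "ad_le x (f \<oplus> g) f \<or> ad_le x (f \<oplus> g) g" using P.le_add[OF fg] fg by (simp add: eq)
  qed (use P.le_0 P.not_le_1_0 in \<open>simp_all add: eq\<close>)
  moreover have "ad_le x f \<one>" if "f \<in> power_bounded A N" for f
    using that pb[OF that] G(3) v01 by (simp add: power_bounded_def)
  moreover have "\<exists>c. c \<noteq> 0 \<and> \<not> ad_le x f (\<kappa> c)" if f: "f \<in> carrier A" "\<not> ad_le x f \<zero>" for f
  proof -
    obtain s where s: "v f = Some s" using f G(3) v01 by (cases "v f") auto
    then have "s \<in> value_group A G v" unfolding value_group_def using f by (intro generate.incl) auto
    then have "norm_open A N {h \<in> carrier A. \<not> val_le G (Some s) (v h)}" by (rule cont)
    note bspec[OF conjunct2[OF this[unfolded norm_open_def]], of \<zero>]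
    moreover have "\<zero> \<in> {h \<in> carrier A. \<not> val_le G (Some s) (v h)}" using v01 by simp
    ultimately obtain e where "0 < e \<and> (\<forall>h\<in>carrier A. N (h \<ominus> \<zero>) < e \<longrightarrow> h \<in> {h \<in> carrier A. \<not> val_le G (Some s) (v h)})"
      by (elim meta_impE exE)
    then have e: "0 < e" "\<And>h. h \<in> carrier A \<Longrightarrow> N (h \<ominus> \<zero>) < e \<Longrightarrow> \<not> val_le G (Some s) (v h)" by simp_all
    obtain c where c: "c \<noteq> 0" "av c < e" using small_const[OF e(1)] by blast
    have "N (\<kappa> c \<ominus> \<zero>) < e" using N_\<kappa>[of c] c by (simp add: minus_eq)
    then show ?thesis using e(2)[of "\<kappa> c"] c f s G(3) by auto
  qed
  ultimately show ?thesis unfolding adic_preorder_def by blast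
qed

context
  fixes leq assumes leq: "adic_preorder leq"
begin

lemma preordered: "preordered_ring A leq"
  using leq cring_axioms by (simp add: preordered_ring_def preordered_ring_axioms_def adic_preorder_def)

interpretation P: preordered_ring A leq by (rule preordered)

lemma const_le: "av c \<le> av d \<Longrightarrow> leq (\<kappa> c) (\<kappa> d)"
proof (cases "d = 0")
  case True
  moreover assume "av c \<le> av d"
  ultimately have "c = 0" using av_nonneg[OF av, of c] av_eq_0[OF av] av_0[OF av] by (metis antisym)
  then show ?thesis using True P.le_refl by simp
next
  case False
  assume "av c \<le> av d"
  then have "leq (\<kappa> (c / d)) \<one>"
    using leq \<kappa>_power_bounded[of "c / d"] av_pos[OF av False] by (simp add: adic_preorder_def av_divide[OF av])
  then have "leq (\<kappa> (c / d) \<otimes> \<kappa> d) (\<one> \<otimes> \<kappa> d)" by (intro P.le_mult) auto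
  then show ?thesis using False by (simp add: \<kappa>_mult[symmetric])
qed

text \<open>
Constants cannot lose their strict order: otherwise \<open>|e| \<ge> 1\<close> for a constant \<open>e\<close> of absolute value less than 1, so all its powers would be
at least 1, which contradicts continuity.
\<close>

lemma const_less: "av c < av d \<Longrightarrow> \<not> leq (\<kappa> d) (\<kappa> c)"
proof
  assume cd: "av c < av d" and *: "leq (\<kappa> d) (\<kappa> c)"
  have d: "d \<noteq> 0" using cd av_nonneg[OF av, of c] av_0[OF av] by auto
  have "leq (\<kappa> d \<otimes> \<kappa> (inverse d)) (\<kappa> c \<otimes> \<kappa> (inverse d))" using * by (intro P.le_mult) auto
  then have le1: "leq \<one> (\<kappa> (c / d))" using d by (simp add: \<kappa>_inverse \<kappa>_mult divide_inverse)
  have pow: "leq \<one> (\<kappa> ((c / d) ^ n))" for n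
  proof (induction n)
    case (Suc n)
    then have "leq (\<one> \<otimes> \<one>) (\<kappa> (c / d) \<otimes> \<kappa> ((c / d) ^ n))" using le1 by (intro P.le_mult2) auto
    then show ?case by (simp add: \<kappa>_mult[symmetric])
  qed (simp add: \<kappa>_1 P.le_refl)
  obtain e where e: "e \<noteq> 0" "\<not> leq \<one> (\<kappa> e)" using leq P.not_le_1_0 unfolding adic_preorder_def by blast
  have "av (c / d) < 1" using cd av_pos[OF av d] by (simp add: av_divide[OF av])
  then obtain n where "av (c / d) ^ n < av e" using real_arch_pow_inv[OF av_pos[OF av e(1)]] by blast
  then have "leq (\<kappa> ((c / d) ^ n)) (\<kappa> e)" by (intro const_le) (simp add: av_power[OF av])
  then show False using pow[of n] e(2) P.le_trans[of \<one> "\<kappa> ((c / d) ^ n)" "\<kappa> e"] by simp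
qed

lemma const_le_iff: "leq (\<kappa> c) (\<kappa> d) \<longleftrightarrow> av c \<le> av d"
  using const_le const_less not_less by blast

lemma le_const_if_norm_le: "f \<in> carrier A \<Longrightarrow> N f \<le> av c \<Longrightarrow> c \<noteq> 0 \<Longrightarrow> leq f (\<kappa> c)"
proof -
  assume f: "f \<in> carrier A" "N f \<le> av c" and c: "c \<noteq> 0"
  have "N (\<kappa> (inverse c) \<otimes> f) \<le> av (inverse c) * N f" using f by (intro N_scale)
  also have "\<dots> \<le> 1" unfolding av_inverse[OF av] using f av_pos[OF av c] by (simp add: field_simps)
  finally have "\<kappa> (inverse c) \<otimes> f \<in> power_bounded A N" using f by (intro power_bounded_unit_ball) auto
  then have "leq (\<kappa> (inverse c) \<otimes> f) \<one>" using leq by (simp add: adic_preorder_def)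
  then have "leq (\<kappa> (inverse c) \<otimes> f \<otimes> \<kappa> c) (\<one> \<otimes> \<kappa> c)" using f by (intro P.le_mult) auto
  moreover have "\<kappa> (inverse c) \<otimes> f \<otimes> \<kappa> c = f \<otimes> (\<kappa> c \<otimes> \<kappa> (inverse c))" using f \<kappa>_carrier by algebra
  ultimately show ?thesis using f c by (simp add: \<kappa>_inverse)
qed

text \<open>
For a fraction \<open>f/g\<close> the set of the \<open>h\<close> with \<open>|h| < |f/g|\<close> is open: if \<open>|c| < |f|\<close> for a nonzero constant \<open>c\<close>, then
\<open>|d * g| \<le> |c|\<close> for all \<open>d\<close> of sufficiently small norm, and adding such a \<open>d\<close> to \<open>h\<close> does not violate \<open>|h * g| < |f|\<close>.
\<close>

lemma adic_space_of_preorder: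
  "\<exists>x\<in>adic_space A N. \<forall>f\<in>carrier A. \<forall>g\<in>carrier A. ad_le x f g \<longleftrightarrow> leq f g"
proof -
  have one: "P.v \<one> = Some \<one>\<^bsub>P.G\<^esub>" using P.is_valuation_v by (simp add: is_valuation_def)
  have "norm_open A N {f \<in> carrier A. \<not> val_le P.G (Some s) (P.v f)}" if "s \<in> value_group A P.G P.v" for s
  proof -
    interpret G: ordered_abelian_group P.G by (rule P.ordered_abelian_group_G)
    have "value_group A P.G P.v \<subseteq> carrier P.G"
      unfolding value_group_def using P.is_valuation_v
      by (intro G.generate_incl) (force simp: is_valuation_def Pi_iff)
    then have "s \<in> carrier P.G" using that by blast
    then obtain f g where fg: "f \<in> P.S" "g \<in> P.S" "\<And>h. h \<in> carrier A \<Longrightarrow> val_le P.G (Some s) (P.v h) \<longleftrightarrow> leq f (h \<otimes> g)"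
      using P.value_le_iff by blast
    have cl: "f \<in> carrier A" "g \<in> carrier A" "\<not> leq f \<zero>" using fg by (auto simp: P.S_def)
    obtain c where c: "c \<noteq> 0" "\<not> leq f (\<kappa> c)" using leq cl unfolding adic_preorder_def by blast
    have cf: "leq (\<kappa> c) f" using c cl P.le_total[of f "\<kappa> c"] by auto
    show ?thesis
      unfolding norm_open_def
    proof (intro conjI ballI)
      fix h0 assume "h0 \<in> {f \<in> carrier A. \<not> val_le P.G (Some s) (P.v f)}"
      then have h0: "h0 \<in> carrier A" "\<not> leq f (h0 \<otimes> g)" using fg by auto
      \<comment> \<open>If the norm of \<open>d\<close> is less than \<open>e\<close>, then that of \<open>d * g\<close> is at most \<open>|c|\<close>.\<close>
      define e where "e = av c / (N g + 1)"
      have Ng: "0 \<le> N g" using N_nonneg cl by simp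
      have e0: "0 < e" using av_pos[OF av c(1)] Ng by (simp add: e_def)
      have "h \<in> {f \<in> carrier A. \<not> val_le P.G (Some s) (P.v f)}" if h: "h \<in> carrier A" "N (h \<ominus> h0) < e" for h
      proof -
        let ?d = "h \<ominus> h0"
        have d: "?d \<in> carrier A" using h h0 by simp
        have "N (?d \<otimes> g) \<le> N ?d * N g" using d cl by (intro N_mult)
        also have "\<dots> \<le> e * (N g + 1)" using h Ng e0 N_nonneg[OF d] by (intro mult_mono) auto
        also have "\<dots> = av c" using Ng by (simp add: e_def)
        finally have "leq (?d \<otimes> g) (\<kappa> c)" using d cl c by (intro le_const_if_norm_le) auto
        then have dg: "\<not> leq f (?d \<otimes> g)" using c(2) P.le_trans[of f "?d \<otimes> g" "\<kappa> c"] cl d by auto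
        have "h \<otimes> g = h0 \<otimes> g \<oplus> ?d \<otimes> g" using h h0 cl by algebra
        then have "leq (h \<otimes> g) (h0 \<otimes> g) \<or> leq (h \<otimes> g) (?d \<otimes> g)"
          using P.le_add[of "h0 \<otimes> g" "?d \<otimes> g"] h0 d cl by simp
        then have "\<not> leq f (h \<otimes> g)"
          using dg h0 h d cl P.le_trans[of f "h \<otimes> g" "h0 \<otimes> g"] P.le_trans[of f "h \<otimes> g" "?d \<otimes> g"] by auto
        then show ?thesis using fg h by simp
      qed
      then show "\<exists>e>0. \<forall>h\<in>carrier A. N (h \<ominus> h0) < e \<longrightarrow> h \<in> {f \<in> carrier A. \<not> val_le P.G (Some s) (P.v f)}"
        using e0 by blast
    qed blast
  qed
  then have cv: "continuous_valuation A N P.G P.v"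
    unfolding continuous_valuation_def using P.is_valuation_v by blast
  have pb: "\<forall>f\<in>power_bounded A N. val_le P.G (P.v f) (Some \<one>\<^bsub>P.G\<^esub>)"
    using leq P.le_v_iff[of _ \<one>] one by (auto simp: adic_preorder_def power_bounded_def)
  let ?x = "{(H, w) \<in> huber_valuations A N. \<forall>f\<in>carrier A. \<forall>g\<in>carrier A. val_le H (w f) (w g) \<longleftrightarrow> val_le P.G (P.v f) (P.v g)}"
  have x: "?x \<in> adic_space A N" by (rule huber_valuation_any_type[OF ring_axioms cv pb])
  have "(P.G, P.v) \<in> ?x" using cv pb by (simp add: huber_valuations_def)
  then have "ad_le ?x f g \<longleftrightarrow> leq f g" if "f \<in> carrier A" "g \<in> carrier A" for f g
    unfolding ad_le_def using that P.le_v_iff by blast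
  then show ?thesis using x by blast
qed

end

end

section \<open>Quasi-compactness of rational domains\<close>

context seminormed_algebra
begin

definition \<pi> :: 'k where "\<pi> = (SOME c. 0 < av c \<and> av c < 1)"

lemma \<pi>: "0 < av \<pi>" "av \<pi> < 1"
proof -
  have "\<exists>c. 0 < av c \<and> av c < 1" using values_dense[of "1/2" 1] by force
  then have "0 < av \<pi> \<and> av \<pi> < 1" unfolding \<pi>_def by (rule someI_ex)
  then show "0 < av \<pi>" "av \<pi> < 1" by auto
qed

lemma \<pi>_nz: "\<pi> \<noteq> 0" using \<pi> av_0[OF av] by auto

text \<open>
Valuations that satisfy all conditions on points of the adic space except continuity.  Of the latter, only the closed condition \<open>|\<pi>| < 1\<close> is
kept.
\<close>

definition candidates :: "('a \<times> 'a \<Rightarrow> bool) set" where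
  "candidates = {l. valuation_preorder A (\<lambda>f g. l (f, g)) \<and> (\<forall>f\<in>power_bounded A N. l (f, \<one>)) \<and> \<not> l (\<one>, \<kappa> \<pi>)}"

lemma open_coordinate: "open {l :: 'c \<Rightarrow> bool. l p}" and closed_coordinate: "closed {l :: 'c \<Rightarrow> bool. l p}"
proof -
  have c: "continuous_on UNIV (\<lambda>l :: 'c \<Rightarrow> bool. l p)" by (rule continuous_on_product_coordinates)
  have eq: "{l :: 'c \<Rightarrow> bool. l p} = (\<lambda>l. l p) -` {True}" by auto
  show "open {l :: 'c \<Rightarrow> bool. l p}" unfolding eq using c by (intro open_vimage) (simp_all add: open_discrete)
  show "closed {l :: 'c \<Rightarrow> bool. l p}" unfolding eq using c by (intro closed_vimage) (simp_all add: closed_def open_discrete)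
qed

lemma compact_UNIV_predicates: "compact (UNIV :: ('c \<Rightarrow> bool) set)"
proof -
  have "compact_space (euclidean :: bool topology)"
    unfolding compact_space_def by (rule finite_imp_compactin) auto
  then have "compact_space (product_topology (\<lambda>_ :: 'c. euclidean :: bool topology) UNIV)"
    by (simp only: compact_space_product_topology) simp
  then show ?thesis by (simp add: euclidean_product_topology compact_space_def)
qed

text \<open>
Each of the conditions involves finitely many coordinates, for a given choice of ring elements.
\<close>

lemma compact_candidates: "compact candidates"
proof -
  have "closed candidates"
    unfolding candidates_def valuation_preorder_def Ball_def
    by (intro closed_Collect_conj closed_Collect_all closed_Collect_imp closed_Collect_disj
        closed_Collect_neg open_Collect_imp open_Collect_const closed_Collect_const open_coordinate closed_coordinate)
  then show ?thesis using compact_UNIV_predicates by (metis compact_Int_closed inf_top_left)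
qed

text \<open>
The value is not smaller than all powers of \<open>|\<pi>|\<close>.
\<close>

definition big :: "('a \<times> 'a \<Rightarrow> bool) \<Rightarrow> 'a \<Rightarrow> bool" where
  "big l f \<longleftrightarrow> (\<exists>n::nat. l (\<kappa> (\<pi> ^ n), f))"

text \<open>
The relation of the valuation in which the values that are smaller than all powers of \<open>|\<pi>|\<close> have been replaced by zero.
\<close>

definition truncated_le :: "('a \<times> 'a \<Rightarrow> bool) \<Rightarrow> 'a \<Rightarrow> 'a \<Rightarrow> bool" where
  "truncated_le l f g \<longleftrightarrow> \<not> big l f \<or> l (f, g)"

context
  fixes l assumes l: "l \<in> candidates"
begin

interpretation P: preordered_ring A "\<lambda>f g. l (f, g)"
  using l by unfold_locales (simp add: candidates_def)

lemma big_\<pi>: "big l (\<kappa> (\<pi> ^ n))" unfolding big_def by (intro exI[of _ n] P.le_refl) simp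

lemma big_1: "big l \<one>" using big_\<pi>[of 0] by (simp add: \<kappa>_1)

lemma big_mono: "f \<in> carrier A \<Longrightarrow> g \<in> carrier A \<Longrightarrow> big l f \<Longrightarrow> l (f, g) \<Longrightarrow> big l g"
  unfolding big_def using P.le_trans by (meson \<kappa>_carrier)

text \<open>
Large powers of \<open>\<pi>\<close> bring every element into the unit ball; so no value exceeds all powers of \<open>1/|\<pi>|\<close>.
\<close>

lemma bounded_multiple: "f \<in> carrier A \<Longrightarrow> \<exists>m. l (\<kappa> (\<pi> ^ m) \<otimes> f, \<one>)"
proof -
  assume f: "f \<in> carrier A"
  obtain m where m: "av \<pi> ^ m < 1 / (N f + 1)"
    using real_arch_pow_inv[of "1 / (N f + 1)" "av \<pi>"] \<pi> N_nonneg[OF f] by auto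
  have "N (\<kappa> (\<pi> ^ m) \<otimes> f) \<le> av (\<pi> ^ m) * N f" using f by (rule N_scale)
  also have "\<dots> \<le> 1 / (N f + 1) * (N f + 1)"
    using m N_nonneg[OF f] by (intro mult_mono) (auto simp: av_power[OF av])
  also have "\<dots> = 1" using N_nonneg[OF f] by simp
  finally have "\<kappa> (\<pi> ^ m) \<otimes> f \<in> power_bounded A N" using f by (intro power_bounded_unit_ball) auto
  then show ?thesis using l by (auto simp: candidates_def)
qed

text \<open>
Since \<open>|h|\<close> is at most a power of \<open>1/|\<pi>|\<close>, the elements with negligible values form an ideal.
\<close>

lemma big_factor:
  assumes f: "f \<in> carrier A" and h: "h \<in> carrier A" and big: "big l (f \<otimes> h)"
  shows "big l f"
proof -
  obtain n where n: "l (\<kappa> (\<pi> ^ n), f \<otimes> h)" using big unfolding big_def by blast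
  obtain m where m: "l (\<kappa> (\<pi> ^ m) \<otimes> h, \<one>)" using bounded_multiple[OF h] by blast
  have "l (\<kappa> (\<pi> ^ n) \<otimes> \<kappa> (\<pi> ^ m), (f \<otimes> h) \<otimes> \<kappa> (\<pi> ^ m))"
    using n f h by (intro P.le_mult) auto
  moreover have "l ((\<kappa> (\<pi> ^ m) \<otimes> h) \<otimes> f, \<one> \<otimes> f)" using m f h by (intro P.le_mult) auto
  moreover have "(\<kappa> (\<pi> ^ m) \<otimes> h) \<otimes> f = (f \<otimes> h) \<otimes> \<kappa> (\<pi> ^ m)" using f h \<kappa>_carrier by algebra
  ultimately have "l (\<kappa> (\<pi> ^ n) \<otimes> \<kappa> (\<pi> ^ m), f)"
    using P.le_trans[of "\<kappa> (\<pi> ^ n) \<otimes> \<kappa> (\<pi> ^ m)" "(f \<otimes> h) \<otimes> \<kappa> (\<pi> ^ m)" f] f h by simp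
  then have "l (\<kappa> (\<pi> ^ (n + m)), f)" by (simp add: power_add \<kappa>_mult)
  then show ?thesis unfolding big_def by blast
qed

lemma small_add:
  assumes "f \<in> carrier A" "g \<in> carrier A" "\<not> big l f" "\<not> big l g" shows "\<not> big l (f \<oplus> g)"
  using assms P.le_add[OF assms(1,2)] big_mono by blast

lemma small_0: "\<not> big l \<zero>"
proof
  assume "big l \<zero>"
  then obtain n where n: "l (\<kappa> (\<pi> ^ n), \<zero>)" unfolding big_def by blast
  then have "l (\<kappa> (\<pi> ^ n) \<otimes> \<kappa> (inverse (\<pi> ^ n)), \<zero> \<otimes> \<kappa> (inverse (\<pi> ^ n)))" by (intro P.le_mult) auto
  then show False using P.not_le_1_0 \<pi>_nz by (simp add: \<kappa>_inverse)
qed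

lemma \<pi>_not_null: "\<not> l (\<kappa> (\<pi> ^ n), \<zero>)"
  using small_0 unfolding big_def by blast

lemma \<pi>_less: "\<not> l (\<kappa> (\<pi> ^ n), \<kappa> (\<pi> ^ Suc n))"
proof
  assume "l (\<kappa> (\<pi> ^ n), \<kappa> (\<pi> ^ Suc n))"
  then have "l (\<one> \<otimes> \<kappa> (\<pi> ^ n), \<kappa> \<pi> \<otimes> \<kappa> (\<pi> ^ n))" by (simp add: \<kappa>_mult)
  then have "l (\<one>, \<kappa> \<pi>)" using \<pi>_not_null P.le_cancel[of \<one> "\<kappa> \<pi>" "\<kappa> (\<pi> ^ n)"] by simp
  then show False using l by (simp add: candidates_def)
qed

lemma adic_preorder_vle: "adic_preorder (truncated_le l)"
  unfolding adic_preorder_def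
proof (intro conjI ballI impI)
  show "valuation_preorder A (truncated_le l)"
    unfolding valuation_preorder_def
  proof (intro conjI ballI impI)
    fix f g h assume fgh: "f \<in> carrier A" "g \<in> carrier A" "h \<in> carrier A"
    show "truncated_le l f h" if "truncated_le l f g" "truncated_le l g h"
      using that big_mono[OF fgh(1,2)] P.le_trans[OF fgh] by (auto simp: truncated_le_def)
    show "truncated_le l (f \<otimes> h) (g \<otimes> h)" if "truncated_le l f g"
      using that big_factor[OF fgh(1,3)] P.le_mult[OF fgh] by (auto simp: truncated_le_def)
    show "truncated_le l h \<zero> \<or> truncated_le l f g" if fg: "truncated_le l (f \<otimes> h) (g \<otimes> h)"
    proof (rule disjCI)
      assume "\<not> truncated_le l f g"
      then have f: "big l f" "\<not> l (f, g)" by (auto simp: truncated_le_def)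
      show "truncated_le l h \<zero>"
      proof (rule ccontr)
        assume "\<not> truncated_le l h \<zero>"
        then have h: "big l h" "\<not> l (h, \<zero>)" by (auto simp: truncated_le_def)
        obtain n m where "l (\<kappa> (\<pi> ^ n), f)" "l (\<kappa> (\<pi> ^ m), h)" using f h unfolding big_def by blast
        then have "l (\<kappa> (\<pi> ^ n) \<otimes> \<kappa> (\<pi> ^ m), f \<otimes> h)" using fgh by (intro P.le_mult2) auto
        then have "big l (f \<otimes> h)" unfolding big_def \<kappa>_mult[symmetric] power_add[symmetric] by blast
        then have "l (f \<otimes> h, g \<otimes> h)" using fg by (simp add: truncated_le_def)
        then show False using P.le_cancel[OF fgh] h f by blast
      qed
    qed
  next
    fix f g assume fg: "f \<in> carrier A" "g \<in> carrier A"
    show "truncated_le l f g \<or> truncated_le l g f" using P.le_total[OF fg] by (auto simp: truncated_le_def)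
    show "truncated_le l (f \<oplus> g) f \<or> truncated_le l (f \<oplus> g) g" using P.le_add[OF fg] by (auto simp: truncated_le_def)
  qed (use P.le_0 P.not_le_1_0 big_1 in \<open>auto simp: truncated_le_def\<close>)
next
  show "truncated_le l f \<one>" if "f \<in> power_bounded A N" for f
    using that l by (simp add: truncated_le_def candidates_def)
next
  fix f assume f: "f \<in> carrier A" "\<not> truncated_le l f \<zero>"
  then obtain n where n: "l (\<kappa> (\<pi> ^ n), f)" unfolding truncated_le_def big_def by blast
  then have "\<not> l (f, \<kappa> (\<pi> ^ Suc n))"
    using P.le_trans[of "\<kappa> (\<pi> ^ n)" f "\<kappa> (\<pi> ^ Suc n)"] \<pi>_less[of n] f by auto
  then have "\<not> truncated_le l f (\<kappa> (\<pi> ^ Suc n))" using f by (simp add: truncated_le_def)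
  then show "\<exists>c. c \<noteq> 0 \<and> \<not> truncated_le l f (\<kappa> c)" using \<pi>_nz by (intro exI[of _ "\<pi> ^ Suc n"]) auto
qed

text \<open>
The elements with negligible values form a proper ideal, so it does not contain \<open>F\<close>.  As the value of
\<open>g\<close> is at least that of an element of \<open>F\<close> outside this ideal, it is not negligible either, and the truncation does not affect comparisons with \<open>g\<close>.
\<close>

lemma truncated_le_rational:
  assumes F: "F \<subseteq> carrier A" "Idl F = carrier A" and g: "g \<in> carrier A"
  shows "(\<forall>f\<in>F. truncated_le l f g) \<longleftrightarrow> (\<forall>f\<in>F. l (f, g))"
proof
  assume *: "\<forall>f\<in>F. truncated_le l f g"
  let ?I = "{f \<in> carrier A. \<not> big l f}"
  have "ideal ?I A"
  proof (rule idealI)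
    show "subgroup ?I (add_monoid A)"
    proof (rule add.subgroupI)
      fix f assume f: "f \<in> ?I"
      show "\<ominus> f \<in> ?I" using f big_factor[of f "\<ominus> \<one>"] by (auto simp: r_minus)
    qed (use small_0 small_add in auto)
    show "x \<otimes> f \<in> ?I" "f \<otimes> x \<in> ?I" if "f \<in> ?I" "x \<in> carrier A" for f x
      using that big_factor[of f x] by (auto simp: m_comm)
  qed (rule ring_axioms)
  moreover have "\<not> Idl F \<subseteq> ?I" using F big_1 by auto
  ultimately have "\<not> F \<subseteq> ?I" using genideal_minimal by blast
  then obtain f0 where f0: "f0 \<in> F" "big l f0" using F by blast
  then have "big l g" using * big_mono[of f0 g] F g by (auto simp: truncated_le_def)
  then obtain n where n: "l (\<kappa> (\<pi> ^ n), g)" unfolding big_def by blast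
  show "\<forall>f\<in>F. l (f, g)"
  proof
    fix f assume f: "f \<in> F"
    then have fc: "f \<in> carrier A" using F by blast
    show "l (f, g)"
    proof (cases "big l f")
      case True
      then show ?thesis using * f by (simp add: truncated_le_def)
    next
      case False
      then have "l (f, \<kappa> (\<pi> ^ n))" using P.le_total[OF fc, of "\<kappa> (\<pi> ^ n)"] unfolding big_def by auto
      then show ?thesis using n P.le_trans[of f "\<kappa> (\<pi> ^ n)" g] fc g by simp
    qed
  qed
qed (simp add: truncated_le_def)

end

definition truncation :: "('a \<times> 'a \<Rightarrow> bool) \<Rightarrow> 'a valuation set" where
  "truncation l = (SOME x. x \<in> adic_space A N \<and> (\<forall>f\<in>carrier A. \<forall>g\<in>carrier A. ad_le x f g \<longleftrightarrow> truncated_le l f g))"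

lemma truncation:
  assumes "l \<in> candidates"
  shows "truncation l \<in> adic_space A N"
    "f \<in> carrier A \<Longrightarrow> g \<in> carrier A \<Longrightarrow> ad_le (truncation l) f g \<longleftrightarrow> truncated_le l f g"
proof -
  have "\<exists>x. x \<in> adic_space A N \<and> (\<forall>f\<in>carrier A. \<forall>g\<in>carrier A. ad_le x f g \<longleftrightarrow> truncated_le l f g)"
    using adic_space_of_preorder[OF adic_preorder_vle[OF assms]] by blast
  from someI_ex[OF this]
  have "truncation l \<in> adic_space A N \<and> (\<forall>f\<in>carrier A. \<forall>g\<in>carrier A. ad_le (truncation l) f g \<longleftrightarrow> truncated_le l f g)"
    unfolding truncation_def .
  then show "truncation l \<in> adic_space A N"
    "f \<in> carrier A \<Longrightarrow> g \<in> carrier A \<Longrightarrow> ad_le (truncation l) f g \<longleftrightarrow> truncated_le l f g" by auto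
qed

lemma rational_domainE:
  assumes "U \<in> rational_domains A N"
  obtains F g where "finite F" "F \<subseteq> carrier A" "g \<in> carrier A" "Idl F = carrier A"
    "U = {x \<in> adic_space A N. \<forall>f\<in>F. ad_le x f g}"
  using assms unfolding rational_domains_def by blast

lemma truncation_vimage:
  assumes F: "F \<subseteq> carrier A" "g \<in> carrier A" "Idl F = carrier A"
  shows "truncation -` {x \<in> adic_space A N. \<forall>f\<in>F. ad_le x f g} \<inter> candidates = {l \<in> candidates. \<forall>f\<in>F. l (f, g)}"
proof -
  have "(\<forall>f\<in>F. ad_le (truncation l) f g) \<longleftrightarrow> (\<forall>f\<in>F. l (f, g))" if l: "l \<in> candidates" for l
    using truncated_le_rational[OF l F(1,3,2)] truncation(2)[OF l _ F(2)] F(1) by blast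
  then show ?thesis using truncation(1) by auto
qed

lemma continuous_truncation:
  "continuous_map (top_of_set candidates) (adic_topology A N) truncation"
  unfolding adic_topology_def
proof (rule continuous_on_generated_topo)
  fix U assume "U \<in> rational_domains A N"
  then obtain F g where F: "finite F" "F \<subseteq> carrier A" "g \<in> carrier A" "Idl F = carrier A"
    and U: "U = {x \<in> adic_space A N. \<forall>f\<in>F. ad_le x f g}" by (rule rational_domainE)
  have "open {l :: 'a \<times> 'a \<Rightarrow> bool. \<forall>f\<in>F. l (f, g)}"
    using F(1) by (induction F rule: finite_induct) (auto simp: Collect_conj_eq intro: open_Int open_coordinate)
  then have "openin (top_of_set candidates) (candidates \<inter> {l. \<forall>f\<in>F. l (f, g)})" by (rule openin_open_Int)
  moreover have "truncation -` U \<inter> topspace (top_of_set candidates) = candidates \<inter> {l. \<forall>f\<in>F. l (f, g)}"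
    unfolding U using truncation_vimage[OF F(2-4)] by auto
  ultimately show "openin (top_of_set candidates) (truncation -` U \<inter> topspace (top_of_set candidates))"
    by simp
next
  show "truncation ` topspace (top_of_set candidates) \<subseteq> \<Union> (rational_domains A N)"
    using truncation(1) adic_space_rational[OF ring_axioms] by auto
qed

text \<open>
A continuous valuation has no negligible nonzero values, so the truncation does not change it.
\<close>

lemma truncation_surj:
  assumes x: "x \<in> adic_space A N"
  shows "(\<lambda>(f, g). ad_le x f g) \<in> candidates" "truncation (\<lambda>(f, g). ad_le x f g) = x"
proof -
  have p: "adic_preorder (ad_le x)" using x by (rule adic_preorder_ad_le)
  interpret P: preordered_ring A "ad_le x" by (rule preordered[OF p])
  show l: "(\<lambda>(f, g). ad_le x f g) \<in> candidates"
    using p const_less[OF p, of \<pi> 1] \<pi> by (simp add: candidates_def adic_preorder_def av_1[OF av] \<kappa>_1)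
  have "truncated_le (\<lambda>(f, g). ad_le x f g) f g \<longleftrightarrow> ad_le x f g" if fg: "f \<in> carrier A" "g \<in> carrier A" for f g
  proof -
    have "ad_le x f g" if small: "\<not> big (\<lambda>(f, g). ad_le x f g) f"
    proof -
      have "ad_le x f \<zero>"
      proof (rule ccontr)
        assume "\<not> ad_le x f \<zero>"
        then obtain c where c: "c \<noteq> 0" "\<not> ad_le x f (\<kappa> c)" using p fg unfolding adic_preorder_def by blast
        obtain n where "av \<pi> ^ n < av c" using real_arch_pow_inv[OF av_pos[OF av c(1)] \<pi>(2)] by blast
        then have "ad_le x (\<kappa> (\<pi> ^ n)) (\<kappa> c)" by (simp add: const_le_iff[OF p] av_power[OF av])
        moreover have "ad_le x (\<kappa> c) f" using c P.le_total[OF fg(1), of "\<kappa> c"] by auto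
        ultimately have "ad_le x (\<kappa> (\<pi> ^ n)) f" using P.le_trans[of "\<kappa> (\<pi> ^ n)" "\<kappa> c" f] fg by simp
        then show False using small unfolding big_def by auto
      qed
      then show ?thesis using P.le_trans[of f \<zero> g] P.le_0 fg by simp
    qed
    then show ?thesis unfolding truncated_le_def by auto
  qed
  then show "truncation (\<lambda>(f, g). ad_le x f g) = x"
    using truncation[OF l] x by (intro adic_space_ext) auto
qed

text \<open>
By \<open>truncated_le_rational\<close> the rational domain is the image of the set of candidates that satisfy the same inequalities, which is closed.
\<close>

theorem compactin_rational_domain:
  assumes U: "U \<in> rational_domains A N"
  shows "compactin (adic_topology A N) U"
proof -
  obtain F g where F: "finite F" "F \<subseteq> carrier A" "g \<in> carrier A" "Idl F = carrier A"
    and U: "U = {x \<in> adic_space A N. \<forall>f\<in>F. ad_le x f g}" using U by (rule rational_domainE)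
  let ?K = "{l \<in> candidates. \<forall>f\<in>F. l (f, g)}"
  have "closed {l :: 'a \<times> 'a \<Rightarrow> bool. \<forall>f\<in>F. l (f, g)}"
    unfolding Ball_def by (intro closed_Collect_all closed_Collect_imp open_Collect_const closed_coordinate)
  then have "compact (candidates \<inter> {l. \<forall>f\<in>F. l (f, g)})" using compact_candidates by (rule compact_Int_closed[rotated])
  then have "compactin (top_of_set candidates) ?K"
    by (auto simp: compactin_subtopology Int_def)
  then have "compactin (adic_topology A N) (truncation ` ?K)"
    using continuous_truncation by (rule image_compactin)
  moreover have "truncation ` ?K = U"
  proof (intro equalityI subsetI)
    fix x assume "x \<in> U"
    then have x: "x \<in> adic_space A N" "\<forall>f\<in>F. ad_le x f g" unfolding U by auto
    then have "(\<lambda>(f, g). ad_le x f g) \<in> ?K" using truncation_surj(1) by simp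
    then have "truncation (\<lambda>(f, g). ad_le x f g) \<in> truncation ` ?K" by (rule imageI)
    then show "x \<in> truncation ` ?K" unfolding truncation_surj(2)[OF x(1)] .
  next
    fix x assume "x \<in> truncation ` ?K"
    then show "x \<in> U" unfolding U truncation_vimage[OF F(2-4), symmetric] by auto
  qed
  ultimately show ?thesis by simp
qed

end

section \<open>The Berkovich space\<close>

text \<open>
Compare the growth of the powers of \<open>a/b\<close>.  This removes constants from bounds of multiplicative seminorms.
\<close>

lemma le_of_power_bound:
  fixes a b C :: real
  assumes "0 \<le> a" "0 \<le> b" "\<And>k::nat. a ^ k \<le> C * b ^ k"
  shows "a \<le> b"
proof (rule ccontr)
  assume "\<not> a \<le> b"
  then have ab: "b < a" by simp
  show False
  proof (cases "b = 0")
    case True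
    then show ?thesis using assms(3)[of 1] ab by simp
  next
    case False
    then have b: "0 < b" using assms by simp
    then have "1 < a / b" using ab by simp
    then obtain k where "C < (a / b) ^ k" using real_arch_pow by blast
    then have "C * b ^ k < a ^ k" using b by (simp add: power_divide field_simps)
    then show ?thesis using assms(3)[of k] by simp
  qed
qed

context seminormed_algebra
begin

context
  fixes y assumes y: "y \<in> berkovich_space A N"
begin

lemma ber_nonneg: "f \<in> carrier A \<Longrightarrow> 0 \<le> y f" and ber_0: "y \<zero> = 0" and ber_1: "y \<one> = 1"
  and ber_mult: "f \<in> carrier A \<Longrightarrow> g \<in> carrier A \<Longrightarrow> y (f \<otimes> g) = y f * y g"
  and ber_add: "f \<in> carrier A \<Longrightarrow> g \<in> carrier A \<Longrightarrow> y (f \<oplus> g) \<le> max (y f) (y g)"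
  and ber_ext: "y \<in> extensional (carrier A)"
  using y by (simp_all add: berkovich_space_def)

lemma ber_bounded: "\<exists>C. \<forall>f\<in>carrier A. y f \<le> C * N f"
  using y by (simp add: berkovich_space_def)

lemma ber_power: "f \<in> carrier A \<Longrightarrow> y (f [^] (k::nat)) = y f ^ k"
  by (induction k) (simp_all add: ber_1 ber_mult)

lemma N_power: "f \<in> carrier A \<Longrightarrow> N (f [^] (k::nat)) \<le> N f ^ k"
proof (induction k)
  case 0
  then show ?case using N_\<kappa>[of 1] by (simp add: \<kappa>_1 av_1[OF av])
next
  case (Suc k)
  have "N (f [^] k \<otimes> f) \<le> N (f [^] k) * N f" using Suc by (intro N_mult) auto
  also have "\<dots> \<le> N f ^ k * N f" using Suc N_nonneg by (intro mult_right_mono) auto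
  finally show ?case by (simp add: mult.commute)
qed

lemma ber_le_N: "f \<in> carrier A \<Longrightarrow> y f \<le> N f"
proof -
  assume f: "f \<in> carrier A"
  obtain C where C: "\<And>f. f \<in> carrier A \<Longrightarrow> y f \<le> C * N f" using ber_bounded by blast
  have C1: "0 \<le> C"
  proof (rule ccontr)
    assume "\<not> 0 \<le> C"
    then have "C * N \<one> \<le> 0" using N_nonneg[of \<one>] by (simp add: mult_nonpos_nonneg)
    then show False using C[of \<one>] ber_1 by simp
  qed
  have "y f ^ k \<le> C * N f ^ k" for k
  proof -
    have "y f ^ k \<le> C * N (f [^] k)" using C[of "f [^] k"] f by (simp add: ber_power)
    also have "\<dots> \<le> C * N f ^ k" using N_power[OF f] C1 by (intro mult_left_mono) auto
    finally show ?thesis .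
  qed
  then show ?thesis using le_of_power_bound ber_nonneg[OF f] N_nonneg[OF f] by blast
qed

lemma ber_\<kappa>: "y (\<kappa> c) = av c"
proof (rule antisym)
  show le: "y (\<kappa> c) \<le> av c" using ber_le_N[of "\<kappa> c"] N_\<kappa>[of c] by simp
  show "av c \<le> y (\<kappa> c)"
  proof (cases "c = 0")
    case True
    then show ?thesis using ber_nonneg[of "\<kappa> c"] by (simp add: av_0[OF av])
  next
    case False
    have "y (\<kappa> c) * y (\<kappa> (inverse c)) = 1"
      using ber_mult[of "\<kappa> c" "\<kappa> (inverse c)"] by (simp add: \<kappa>_inverse[OF False] ber_1)
    moreover have "y (\<kappa> (inverse c)) \<le> inverse (av c)"
      using ber_le_N[of "\<kappa> (inverse c)"] N_\<kappa>[of "inverse c"] by (simp add: av_inverse[OF av])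
    then have "y (\<kappa> c) * y (\<kappa> (inverse c)) \<le> y (\<kappa> c) * inverse (av c)"
      using ber_nonneg[of "\<kappa> c"] by (intro mult_left_mono) auto
    ultimately show ?thesis using av_pos[OF av False] by (simp add: field_simps)
  qed
qed

lemma adic_preorder_ber: "adic_preorder (\<lambda>f g. y f \<le> y g)"
  unfolding adic_preorder_def
proof (intro conjI ballI impI)
  show "valuation_preorder A (\<lambda>f g. y f \<le> y g)"
    unfolding valuation_preorder_def
  proof (intro conjI ballI impI)
    fix f g h assume fgh: "f \<in> carrier A" "g \<in> carrier A" "h \<in> carrier A"
    show "y (f \<otimes> h) \<le> y (g \<otimes> h)" if "y f \<le> y g"
      using that fgh by (simp add: ber_mult ber_nonneg mult_right_mono)
    show "y h \<le> y \<zero> \<or> y f \<le> y g" if "y (f \<otimes> h) \<le> y (g \<otimes> h)"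
      using that fgh ber_nonneg[of h] by (auto simp: ber_mult ber_0 mult_le_cancel_right)
  next
    fix f g assume fg: "f \<in> carrier A" "g \<in> carrier A"
    show "y (f \<oplus> g) \<le> y f \<or> y (f \<oplus> g) \<le> y g" using ber_add[OF fg] by linarith
  qed (auto simp: ber_0 ber_1 ber_nonneg)
next
  fix f assume "f \<in> power_bounded A N"
  then obtain D where f: "f \<in> carrier A" and D: "\<And>k::nat. N (f [^] k) \<le> D" unfolding power_bounded_def by blast
  have "y f ^ k \<le> D * 1 ^ k" for k
    using ber_le_N[of "f [^] k"] D[of k] f by (simp add: ber_power)
  then have "y f \<le> 1" using le_of_power_bound[of "y f" 1 D] ber_nonneg[OF f] by simp
  then show "y f \<le> y \<one>" by (simp add: ber_1)
next
  fix f assume "f \<in> carrier A" "\<not> y f \<le> y \<zero>"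
  then show "\<exists>c. c \<noteq> 0 \<and> \<not> y f \<le> y (\<kappa> c)"
    using small_const[of "y f"] by (auto simp: ber_0 ber_\<kappa> not_le)
qed

lemma an_to_ad_point:
  "an_to_ad A N y \<in> adic_space A N"
  "f \<in> carrier A \<Longrightarrow> g \<in> carrier A \<Longrightarrow> ad_le (an_to_ad A N y) f g \<longleftrightarrow> y f \<le> y g"
proof -
  obtain x where x: "x \<in> adic_space A N" "\<And>f g. f \<in> carrier A \<Longrightarrow> g \<in> carrier A \<Longrightarrow> ad_le x f g \<longleftrightarrow> y f \<le> y g"
    using adic_space_of_preorder[OF adic_preorder_ber] by blast
  obtain G v where G: "(G, v) \<in> huber_valuations A N" "x = huber_equiv A N `` {(G, v)}"
    "\<forall>f\<in>carrier A. \<forall>g\<in>carrier A. ad_le x f g \<longleftrightarrow> val_le G (v f) (v g)"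
    using adic_space_repr[OF x(1)] by blast
  have v: "val_le G (v f) (v g) \<longleftrightarrow> y f \<le> y g" if "f \<in> carrier A" "g \<in> carrier A" for f g
    using G(3) x(2)[OF that] that by simp
  have "an_to_ad A N y = x"
    unfolding an_to_ad_def G(2) huber_equiv_def using G(1) v by auto
  then show "an_to_ad A N y \<in> adic_space A N"
    "f \<in> carrier A \<Longrightarrow> g \<in> carrier A \<Longrightarrow> ad_le (an_to_ad A N y) f g \<longleftrightarrow> y f \<le> y g"
    using x by simp_all
qed

end

text \<open>
The value at \<open>f\<close> of the retraction, for the point with the relation \<open>leq\<close>.
\<close>

definition rank_one_value :: "('a \<Rightarrow> 'a \<Rightarrow> bool) \<Rightarrow> 'a \<Rightarrow> real" where
  "rank_one_value leq f = (INF c\<in>{c. leq f (\<kappa> c)}. av c)"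

lemma ad_to_an_eq: "ad_to_an A av \<kappa> x = (\<lambda>f\<in>carrier A. rank_one_value (ad_le x) f)"
  by (simp add: ad_to_an_def rank_one_value_def)

context
  fixes leq assumes leq: "adic_preorder leq"
begin

interpretation P: preordered_ring A leq by (rule preordered[OF leq])

abbreviation val :: "'a \<Rightarrow> real" where "val \<equiv> rank_one_value leq"

lemma le_const_of_norm_less: "f \<in> carrier A \<Longrightarrow> N f < av c \<Longrightarrow> leq f (\<kappa> c)"
  using N_nonneg[of f] av_0[OF av] by (intro le_const_if_norm_le[OF leq]) auto

lemma bounds_nonempty: "f \<in> carrier A \<Longrightarrow> \<exists>c. leq f (\<kappa> c)"
proof -
  assume f: "f \<in> carrier A"
  obtain c where "N f + 1 < av c" using values_dense[of "N f + 1" "N f + 2"] N_nonneg[OF f] by auto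
  then have "N f < av c" by simp
  then show ?thesis using le_const_of_norm_less f by blast
qed

lemma bdd_below_av: "bdd_below (av ` X)"
  using av_nonneg[OF av] by (intro bdd_belowI[of _ 0]) auto

lemma val_le: "leq f (\<kappa> c) \<Longrightarrow> val f \<le> av c"
  unfolding rank_one_value_def by (intro cINF_lower bdd_below_av) simp

lemma val_greatest: "f \<in> carrier A \<Longrightarrow> (\<And>c. leq f (\<kappa> c) \<Longrightarrow> t \<le> av c) \<Longrightarrow> t \<le> val f"
  unfolding rank_one_value_def using bounds_nonempty[of f] by (intro cINF_greatest) auto

lemma val_nonneg: "f \<in> carrier A \<Longrightarrow> 0 \<le> val f"
  using av_nonneg[OF av] by (intro val_greatest) auto

lemma leq_if_val_less: "f \<in> carrier A \<Longrightarrow> val f < av c \<Longrightarrow> leq f (\<kappa> c)"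
proof (rule ccontr)
  assume f: "f \<in> carrier A" "val f < av c" "\<not> leq f (\<kappa> c)"
  have "av c \<le> val f"
  proof (rule val_greatest[OF f(1)])
    fix d assume d: "leq f (\<kappa> d)"
    show "av c \<le> av d"
    proof (rule ccontr)
      assume "\<not> av c \<le> av d"
      then have "leq (\<kappa> d) (\<kappa> c)" by (simp add: const_le_iff[OF leq])
      then show False using P.le_trans[of f "\<kappa> d" "\<kappa> c"] d f by simp
    qed
  qed
  then show False using f by simp
qed

lemma val_const: "val (\<kappa> c) = av c"
  by (intro antisym val_le val_greatest) (simp_all add: const_le_iff[OF leq])

lemma val_mono: "f \<in> carrier A \<Longrightarrow> g \<in> carrier A \<Longrightarrow> leq f g \<Longrightarrow> val f \<le> val g"
  using P.le_trans[of f g] by (intro val_greatest val_le) auto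

lemma val_le_N: "f \<in> carrier A \<Longrightarrow> val f \<le> N f"
proof (rule dense_ge)
  fix t assume f: "f \<in> carrier A" and t: "N f < t"
  have "max (N f) (t / 2) < t" "0 < max (N f) (t / 2)" using t N_nonneg[OF f] by auto
  then obtain c where "max (N f) (t / 2) < av c" "av c < t" using values_dense by blast
  then show "val f \<le> t" using val_le le_const_of_norm_less[OF f, of c] by fastforce
qed

lemma val_add: "f \<in> carrier A \<Longrightarrow> g \<in> carrier A \<Longrightarrow> val (f \<oplus> g) \<le> max (val f) (val g)"
  using P.le_add[of f g] val_mono[of "f \<oplus> g" f] val_mono[of "f \<oplus> g" g] by (auto simp: le_max_iff_disj)

text \<open>
Strict inequalities can be improved to inequalities with constants by the density of the absolute values of constants, and on
constants the relation is that of the absolute value.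
\<close>

lemma val_mult:
  assumes f: "f \<in> carrier A" and g: "g \<in> carrier A"
  shows "val (f \<otimes> g) = val f * val g"
proof (rule antisym)
  show "val (f \<otimes> g) \<le> val f * val g"
  proof (rule ccontr)
    assume "\<not> val (f \<otimes> g) \<le> val f * val g"
    then have less: "val f * val g < val (f \<otimes> g)" by simp
    have "\<exists>e>0. (val f + e) * (val g + e) < val (f \<otimes> g)"
    proof -
      define d where "d = val (f \<otimes> g) - val f * val g"
      define e where "e = min 1 (d / (2 * (val f + val g + 1)))"
      have pos: "0 < val f + val g + 1" using val_nonneg f g by (simp add: add_nonneg_pos)
      have e: "0 < e" "e \<le> 1" "e \<le> d / (2 * (val f + val g + 1))" using less pos by (auto simp: e_def d_def)
      have "(val f + e) * (val g + e) = val f * val g + e * (val f + val g + e)" by (simp add: algebra_simps)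
      also have "e * (val f + val g + e) \<le> e * (val f + val g + 1)" using e by simp
      also have "\<dots> \<le> d / (2 * (val f + val g + 1)) * (val f + val g + 1)" using e pos by (intro mult_right_mono) auto
      also have "\<dots> = d / 2" using pos by (simp add: field_simps)
      finally have "(val f + e) * (val g + e) \<le> val f * val g + d / 2" by simp
      also have "\<dots> < val (f \<otimes> g)" using less by (simp add: d_def field_simps)
      finally show ?thesis using e(1) by blast
    qed
    then obtain e where e: "0 < e" "(val f + e) * (val g + e) < val (f \<otimes> g)" by blast
    have "\<exists>c. val h < av c \<and> av c < val h + e" if h: "h \<in> carrier A" for h
    proof -
      obtain c where "val h + e / 2 < av c" "av c < val h + e"
        using values_dense[of "val h + e / 2" "val h + e"] val_nonneg[OF h] e by auto
      then show ?thesis using e by (intro exI[of _ c]) auto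
    qed
    then obtain c d where c: "val f < av c" "av c < val f + e" and d: "val g < av d" "av d < val g + e"
      using f g by metis
    have "leq (f \<otimes> g) (\<kappa> c \<otimes> \<kappa> d)" using f g c d by (intro P.le_mult2 leq_if_val_less) auto
    then have "val (f \<otimes> g) \<le> av (c * d)" by (intro val_le) (simp add: \<kappa>_mult)
    also have "\<dots> \<le> (val f + e) * (val g + e)"
      unfolding av_mult[OF av] using c d av_nonneg[OF av] by (intro mult_mono) (auto intro: order_trans less_imp_le)
    finally show False using e by simp
  qed
next
  show "val f * val g \<le> val (f \<otimes> g)"
  proof (rule val_greatest)
    fix e assume e: "leq (f \<otimes> g) (\<kappa> e)"
    show "val f * val g \<le> av e"
    proof (rule ccontr)
      assume "\<not> val f * val g \<le> av e"
      then have less: "av e < val f * val g" by simp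
      have pos: "0 < val f" "0 < val g"
        using less av_nonneg[OF av, of e] val_nonneg[OF f] val_nonneg[OF g] by (metis le_less less_le_trans mult_zero_left mult_zero_right not_less)+
      have "av e / val g < val f" using less pos by (simp add: field_simps)
      then have "0 < max (av e / val g) (val f / 2)" "max (av e / val g) (val f / 2) < val f" using pos by auto
      then obtain c where c: "max (av e / val g) (val f / 2) < av c" "av c < val f" using values_dense by blast
      have c0: "0 < av c" using c pos by auto
      have "av e < av c * val g" using c pos by (simp add: field_simps)
      then have "av e / av c < val g" using c0 by (simp add: field_simps)
      then have "0 < max (av e / av c) (val g / 2)" "max (av e / av c) (val g / 2) < val g" using pos by auto
      then obtain d where d: "max (av e / av c) (val g / 2) < av d" "av d < val g" using values_dense by blast
      have "av e < av (c * d)" using d c0 by (simp add: av_mult[OF av] field_simps)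
      moreover have "leq (\<kappa> c) f" "leq (\<kappa> d) g"
        using P.le_total[of f "\<kappa> c"] P.le_total[of g "\<kappa> d"] val_le[of f c] val_le[of g d] c d f g by auto
      then have "leq (\<kappa> c \<otimes> \<kappa> d) (f \<otimes> g)" using f g by (intro P.le_mult2) auto
      then have "leq (\<kappa> (c * d)) (\<kappa> e)"
        using P.le_trans[of "\<kappa> (c * d)" "f \<otimes> g" "\<kappa> e"] e f g by (simp add: \<kappa>_mult)
      ultimately show False by (simp add: const_le_iff[OF leq])
    qed
  qed (use f g in simp)
qed

lemma berkovich_rank_one_value: "(\<lambda>f\<in>carrier A. val f) \<in> berkovich_space A N"
  unfolding berkovich_space_def
  using val_nonneg val_mult val_add val_le_N val_const[of 0] val_const[of 1]
  by (auto simp: \<kappa>_0 \<kappa>_1 av_0[OF av] av_1[OF av] intro: exI[of _ 1])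

end

lemma ad_to_an_berkovich: "x \<in> adic_space A N \<Longrightarrow> ad_to_an A av \<kappa> x \<in> berkovich_space A N"
  unfolding ad_to_an_eq by (intro berkovich_rank_one_value adic_preorder_ad_le)

lemma retraction_an_to_ad:
  assumes y: "y \<in> berkovich_space A N"
  shows "ad_to_an A av \<kappa> (an_to_ad A N y) = y"
proof (rule extensionalityI[OF _ ber_ext[OF y]])
  show "ad_to_an A av \<kappa> (an_to_ad A N y) \<in> extensional (carrier A)" by (simp add: ad_to_an_def)
  fix f assume f: "f \<in> carrier A"
  have set: "{c. ad_le (an_to_ad A N y) f (\<kappa> c)} = {c. y f \<le> av c}"
    using an_to_ad_point(2)[OF y f] by (simp add: ber_\<kappa>[OF y])
  have "(INF c\<in>{c. y f \<le> av c}. av c) = y f"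
  proof (rule cInf_eq)
    show "y f \<le> t" if "t \<in> av ` {c. y f \<le> av c}" for t using that by auto
    fix t assume t: "\<And>s. s \<in> av ` {c. y f \<le> av c} \<Longrightarrow> t \<le> s"
    show "t \<le> y f"
    proof (rule dense_ge)
      fix s assume s: "y f < s"
      have "max (y f) (s / 2) < s" "0 < max (y f) (s / 2)" using s ber_nonneg[OF y f] by auto
      then obtain c where "max (y f) (s / 2) < av c" "av c < s" using values_dense by blast
      then show "t \<le> s" using t[of "av c"] by fastforce
    qed
  qed
  then show "ad_to_an A av \<kappa> (an_to_ad A N y) f = y f" using f by (simp add: ad_to_an_def set)
qed

lemma genideal_const: "c \<noteq> 0 \<Longrightarrow> F \<subseteq> carrier A \<Longrightarrow> \<kappa> c \<in> F \<Longrightarrow> Idl F = carrier A"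
proof -
  assume c: "c \<noteq> 0" "F \<subseteq> carrier A" "\<kappa> c \<in> F"
  then have I: "ideal (Idl F) A" "\<kappa> c \<in> Idl F" using genideal_ideal genideal_self by blast+
  then have "\<kappa> c \<otimes> \<kappa> (inverse c) \<in> Idl F" by (intro ideal.I_r_closed) auto
  then have "\<one> \<in> Idl F" using c by (simp add: \<kappa>_inverse)
  then show ?thesis using ideal.one_imp_carrier[OF I(1)] by blast
qed

lemma topspace_adic: "topspace (adic_topology A N) = adic_space A N"
  by (rule topspace_adic_topology[OF ring_axioms])

lemma openin_rational: "U \<in> rational_domains A N \<Longrightarrow> openin (adic_topology A N) U"
  unfolding adic_topology_def by (rule topology_generated_by_Basis)

lemma openin_le_const: "f \<in> carrier A \<Longrightarrow> c \<noteq> 0 \<Longrightarrow> openin (adic_topology A N) {x \<in> adic_space A N. ad_le x f (\<kappa> c)}"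
proof -
  assume f: "f \<in> carrier A" and c: "c \<noteq> 0"
  have "ad_le x (\<kappa> c) (\<kappa> c)" if "x \<in> adic_space A N" for x
    using const_le_iff[OF adic_preorder_ad_le[OF that]] by simp
  then have "{x \<in> adic_space A N. ad_le x f (\<kappa> c)} = {x \<in> adic_space A N. \<forall>h\<in>{f, \<kappa> c}. ad_le x h (\<kappa> c)}" by auto
  moreover have "Idl {f, \<kappa> c} = carrier A" using f c by (intro genideal_const[of c]) auto
  ultimately have "{x \<in> adic_space A N. ad_le x f (\<kappa> c)} \<in> rational_domains A N"
    unfolding rational_domains_def using f
    by (intro CollectI exI[of _ "{f, \<kappa> c}"] exI[of _ "\<kappa> c"]) simp
  then show ?thesis by (rule openin_rational)
qed

lemma openin_const_le: "f \<in> carrier A \<Longrightarrow> c \<noteq> 0 \<Longrightarrow> openin (adic_topology A N) {x \<in> adic_space A N. ad_le x (\<kappa> c) f}"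
proof -
  assume f: "f \<in> carrier A" and c: "c \<noteq> 0"
  have "Idl {\<kappa> c} = carrier A" using c by (intro genideal_const[of c]) auto
  then have "{x \<in> adic_space A N. ad_le x (\<kappa> c) f} \<in> rational_domains A N"
    unfolding rational_domains_def using f
    by (intro CollectI exI[of _ "{\<kappa> c}"] exI[of _ f]) simp
  then show ?thesis by (rule openin_rational)
qed

text \<open>
Semicontinuity from both sides: \<open>val f < a\<close> if and only if \<open>|f| \<le> |c|\<close> for some constant with \<open>|c| < a\<close>, and \<open>a < val f\<close> if and
only if \<open>|c| \<le> |f|\<close> for some constant with \<open>a < |c|\<close>.  Both conditions describe rational domains, because nonzero constants are units.
\<close>

lemma continuous_rank_one_value:
  assumes f: "f \<in> carrier A"
  shows "continuous_map (adic_topology A N) euclideanreal (\<lambda>x. rank_one_value (ad_le x) f)"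
  unfolding continuous_map_upper_lower_semicontinuous_lt topspace_adic
proof (intro conjI allI)
  fix a
  note p = adic_preorder_ad_le
  have "{x \<in> adic_space A N. rank_one_value (ad_le x) f < a} =
      (\<Union>c\<in>{c. c \<noteq> 0 \<and> av c < a}. {x \<in> adic_space A N. ad_le x f (\<kappa> c)})"
  proof (intro equalityI subsetI)
    fix x assume "x \<in> {x \<in> adic_space A N. rank_one_value (ad_le x) f < a}"
    then have x: "x \<in> adic_space A N" "rank_one_value (ad_le x) f < a" by auto
    have "0 < max (rank_one_value (ad_le x) f) (a / 2)" "max (rank_one_value (ad_le x) f) (a / 2) < a"
      using x val_nonneg[OF p[OF x(1)] f] by auto
    then obtain c where c: "max (rank_one_value (ad_le x) f) (a / 2) < av c" "av c < a" using values_dense by blast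
    then have "ad_le x f (\<kappa> c)" by (intro leq_if_val_less[OF p[OF x(1)] f]) simp
    moreover have "c \<noteq> 0" using c x val_nonneg[OF p[OF x(1)] f] by (auto simp: av_0[OF av])
    ultimately show "x \<in> (\<Union>c\<in>{c. c \<noteq> 0 \<and> av c < a}. {x \<in> adic_space A N. ad_le x f (\<kappa> c)})" using x c by blast
  next
    fix x assume "x \<in> (\<Union>c\<in>{c. c \<noteq> 0 \<and> av c < a}. {x \<in> adic_space A N. ad_le x f (\<kappa> c)})"
    then obtain c where "x \<in> adic_space A N" "av c < a" "ad_le x f (\<kappa> c)" by blast
    then show "x \<in> {x \<in> adic_space A N. rank_one_value (ad_le x) f < a}" using val_le[OF p] by fastforce
  qed
  then show "openin (adic_topology A N) {x \<in> adic_space A N. rank_one_value (ad_le x) f < a}"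
    using openin_le_const[OF f] by (auto intro!: openin_Union)
  show "openin (adic_topology A N) {x \<in> adic_space A N. a < rank_one_value (ad_le x) f}"
  proof (cases "a < 0")
    case True
    then have "{x \<in> adic_space A N. a < rank_one_value (ad_le x) f} = topspace (adic_topology A N)"
      using val_nonneg[OF p f] by (force simp: topspace_adic)
    then show ?thesis by simp
  next
    case False
    have "{x \<in> adic_space A N. a < rank_one_value (ad_le x) f} =
        (\<Union>c\<in>{c. a < av c}. {x \<in> adic_space A N. ad_le x (\<kappa> c) f})"
    proof (intro equalityI subsetI)
      fix x assume "x \<in> {x \<in> adic_space A N. a < rank_one_value (ad_le x) f}"
      then have x: "x \<in> adic_space A N" "a < rank_one_value (ad_le x) f" by auto
      interpret P: preordered_ring A "ad_le x" by (rule preordered[OF p[OF x(1)]])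
      let ?b = "(a + rank_one_value (ad_le x) f) / 2"
      have "0 < ?b" "?b < rank_one_value (ad_le x) f" using x False by auto
      then obtain c where c: "?b < av c" "av c < rank_one_value (ad_le x) f" using values_dense by blast
      then have "\<not> ad_le x f (\<kappa> c)" using val_le[OF p[OF x(1)], of f c] by auto
      then have "ad_le x (\<kappa> c) f" using P.le_total[OF f, of "\<kappa> c"] by simp
      moreover have "a < av c" using c x by simp
      ultimately show "x \<in> (\<Union>c\<in>{c. a < av c}. {x \<in> adic_space A N. ad_le x (\<kappa> c) f})" using x by blast
    next
      fix x assume "x \<in> (\<Union>c\<in>{c. a < av c}. {x \<in> adic_space A N. ad_le x (\<kappa> c) f})"
      then obtain c where c: "x \<in> adic_space A N" "a < av c" "ad_le x (\<kappa> c) f" by blast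
      then have "av c \<le> rank_one_value (ad_le x) f"
        using val_mono[OF p[OF c(1)] _ f c(3)] val_const[OF p[OF c(1)], of c] by simp
      then show "x \<in> {x \<in> adic_space A N. a < rank_one_value (ad_le x) f}" using c by simp
    qed
    moreover have "openin (adic_topology A N) (\<Union>c\<in>{c. a < av c}. {x \<in> adic_space A N. ad_le x (\<kappa> c) f})"
    proof (intro openin_Union ballI)
      fix U assume "U \<in> (\<lambda>c. {x \<in> adic_space A N. ad_le x (\<kappa> c) f}) ` {c. a < av c}"
      then obtain c where "a < av c" "U = {x \<in> adic_space A N. ad_le x (\<kappa> c) f}" by blast
      moreover from this have "c \<noteq> 0" using False by (auto simp: av_0[OF av])
      ultimately show "openin (adic_topology A N) U" using openin_const_le[OF f] by simp
    qed
    ultimately show ?thesis by simp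
  qed
qed

lemma continuous_ad_to_an: "continuous_map (adic_topology A N) (berkovich_topology A N) (ad_to_an A av \<kappa>)"
  unfolding berkovich_topology_def continuous_map_in_subtopology continuous_map_componentwise
proof (intro conjI ballI)
  show "ad_to_an A av \<kappa> ` topspace (adic_topology A N) \<subseteq> extensional (carrier A)"
    by (auto simp: ad_to_an_def)
  show "continuous_map (adic_topology A N) euclideanreal (\<lambda>x. ad_to_an A av \<kappa> x f)" if "f \<in> carrier A" for f
    using continuous_rank_one_value[OF that] that by (simp add: ad_to_an_eq)
  show "ad_to_an A av \<kappa> \<in> topspace (adic_topology A N) \<rightarrow> berkovich_space A N"
    unfolding topspace_adic using ad_to_an_berkovich by blast
qed

text \<open>
A closed subset of the product of the intervals from 0 to \<open>N f\<close>, which is compact by Tychonoff's theorem.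
\<close>

lemma compact_berkovich: "compact_space (berkovich_topology A N)"
proof -
  let ?P = "product_topology (\<lambda>_ :: 'a. euclideanreal) (carrier A)"
  let ?K = "PiE (carrier A) (\<lambda>f. {0..N f})"
  have K: "compactin ?P ?K" unfolding compactin_PiE by simp
  have coord: "continuous_map ?P euclideanreal (\<lambda>y. y f)" if "f \<in> carrier A" for f
    using that by (rule continuous_map_product_projection)
  have eq: "closedin ?P {y \<in> topspace ?P. g y = h y}" if "continuous_map ?P euclideanreal g" "continuous_map ?P euclideanreal h" for g h
    using that by (intro closedin_continuous_maps_eq) auto
  have le: "closedin ?P {y \<in> topspace ?P. g y \<le> h y}"
    if gh: "continuous_map ?P euclideanreal g" "continuous_map ?P euclideanreal h" for g h
  proof -
    have "closedin ?P {y \<in> topspace ?P. g y - h y \<in> {..0}}"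
      using gh by (intro closedin_continuous_map_preimage[where Y = euclideanreal] continuous_map_diff) auto
    then show ?thesis by simp
  qed
  define Z where "Z = {y \<in> topspace ?P. y \<zero> = 0}"
  define I where "I = {y \<in> topspace ?P. y \<one> = 1}"
  define T where "T f g = {y \<in> topspace ?P. y (f \<otimes> g) = y f * y g}" for f g
  define U where "U f g = {y \<in> topspace ?P. y (f \<oplus> g) \<le> max (y f) (y g)}" for f g
  define conds where "conds = {Z, I} \<union> (\<Union>f\<in>carrier A. \<Union>g\<in>carrier A. {T f g, U f g})"
  have "closedin ?P Z" "closedin ?P I" unfolding Z_def I_def by (intro eq coord; simp)+
  moreover have "closedin ?P (T f g)" "closedin ?P (U f g)" if "f \<in> carrier A" "g \<in> carrier A" for f g
    unfolding T_def U_def using that by (intro eq le coord continuous_map_real_mult continuous_map_real_max; simp)+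
  ultimately have closed: "closedin ?P C" if "C \<in> conds" for C
    using that unfolding conds_def by blast
  have mem: "Z \<in> conds" "I \<in> conds"
    "\<And>f g. f \<in> carrier A \<Longrightarrow> g \<in> carrier A \<Longrightarrow> T f g \<in> conds"
    "\<And>f g. f \<in> carrier A \<Longrightarrow> g \<in> carrier A \<Longrightarrow> U f g \<in> conds"
    unfolding conds_def by blast+
  have conv: "berkovich_space A N = ?K \<inter> \<Inter> conds"
  proof (intro equalityI subsetI)
    fix y assume y: "y \<in> berkovich_space A N"
    have "y \<in> ?K" using ber_nonneg[OF y] ber_le_N[OF y] ber_ext[OF y] by (auto simp: PiE_def)
    moreover have top: "y \<in> topspace ?P" using ber_ext[OF y] by (auto simp: PiE_def)
    have "y \<in> Z" "y \<in> I" using top ber_0[OF y] ber_1[OF y] unfolding Z_def I_def by blast+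
    moreover have "y \<in> T f g" "y \<in> U f g" if "f \<in> carrier A" "g \<in> carrier A" for f g
      using top ber_mult[OF y that] ber_add[OF y that] unfolding T_def U_def by blast+
    ultimately show "y \<in> ?K \<inter> \<Inter> conds" unfolding conds_def by blast
  next
    fix y assume y: "y \<in> ?K \<inter> \<Inter> conds"
    then have yC: "y \<in> C" if "C \<in> conds" for C using that by blast
    have "y \<zero> = 0" "y \<one> = 1" using yC[OF mem(1)] yC[OF mem(2)] unfolding Z_def I_def by simp_all
    moreover have "y (f \<otimes> g) = y f * y g" "y (f \<oplus> g) \<le> max (y f) (y g)"
      if "f \<in> carrier A" "g \<in> carrier A" for f g
      using yC[OF mem(3)[OF that]] yC[OF mem(4)[OF that]] unfolding T_def U_def by simp_all
    moreover have "0 \<le> y f" "y f \<le> 1 * N f" if "f \<in> carrier A" for f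
      using y that by (auto simp: PiE_def Pi_iff)
    moreover have "y \<in> extensional (carrier A)" using y by (simp add: PiE_def)
    ultimately show "y \<in> berkovich_space A N"
      unfolding berkovich_space_def by (intro CollectI conjI ballI exI[of _ 1])
  qed
  have "closedin ?P (\<Inter> conds)" using closed mem(1) by (intro closedin_Inter) auto
  then have "compactin ?P (berkovich_space A N)" unfolding conv using K by (intro compact_Int_closedin)
  then show ?thesis unfolding berkovich_topology_def by (simp add: compact_space_subtopology)
qed

end

section \<open>The uniformity of pointwise convergence\<close>

definition pointwise_uniformity :: "('c \<Rightarrow> real) set \<Rightarrow> 'c set \<Rightarrow> (('c \<Rightarrow> real) \<times> ('c \<Rightarrow> real)) filter" where
  "pointwise_uniformity Y I = (INF (i, e)\<in>I \<times> {0<..}. principal {(y, z). y \<in> Y \<and> z \<in> Y \<and> \<bar>y i - z i\<bar> < e})"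

lemma eventually_pointwise_uniformity:
  assumes "I \<noteq> {}"
  shows "eventually P (pointwise_uniformity Y I) \<longleftrightarrow>
    (\<exists>J e. finite J \<and> J \<subseteq> I \<and> 0 < e \<and> (\<forall>y\<in>Y. \<forall>z\<in>Y. (\<forall>i\<in>J. \<bar>y i - z i\<bar> < e) \<longrightarrow> P (y, z)))"
proof
  let ?D = "\<lambda>(i, e). {(y, z). y \<in> Y \<and> z \<in> Y \<and> \<bar>y i - z i\<bar> < e}"
  assume "eventually P (pointwise_uniformity Y I)"
  then obtain X where X: "X \<subseteq> I \<times> {0<..}" "finite X" "eventually P (INF p\<in>X. principal (?D p))"
    unfolding pointwise_uniformity_def eventually_INF[of _ _ "I \<times> {0<..}"] by (auto simp: case_prod_beta)
  then have P: "\<And>q. (\<forall>p\<in>X. q \<in> ?D p) \<Longrightarrow> P q"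
    by (auto simp: INF_principal_finite eventually_principal)
  obtain i0 where i0: "i0 \<in> I" using assms by blast
  let ?J = "insert i0 (fst ` X)" and ?e = "Min (insert 1 (snd ` X))"
  have e: "0 < ?e" using X by (subst Min_gr_iff) auto
  have "P (y, z)" if yz: "y \<in> Y" "z \<in> Y" "\<forall>i\<in>?J. \<bar>y i - z i\<bar> < ?e" for y z
  proof (rule P, rule ballI)
    fix p assume p: "p \<in> X"
    have "?e \<le> snd p" using X p by (intro Min_le) auto
    moreover have "\<bar>y (fst p) - z (fst p)\<bar> < ?e" using yz(3) p by blast
    ultimately show "(y, z) \<in> ?D p" using yz by (auto simp: case_prod_beta)
  qed
  then show "\<exists>J e. finite J \<and> J \<subseteq> I \<and> 0 < e \<and> (\<forall>y\<in>Y. \<forall>z\<in>Y. (\<forall>i\<in>J. \<bar>y i - z i\<bar> < e) \<longrightarrow> P (y, z))"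
    using X e i0 by (intro exI[of _ ?J] exI[of _ ?e]) auto
next
  let ?D = "\<lambda>(i, e). {(y, z). y \<in> Y \<and> z \<in> Y \<and> \<bar>y i - z i\<bar> < e}"
  assume "\<exists>J e. finite J \<and> J \<subseteq> I \<and> 0 < e \<and> (\<forall>y\<in>Y. \<forall>z\<in>Y. (\<forall>i\<in>J. \<bar>y i - z i\<bar> < e) \<longrightarrow> P (y, z))"
  then obtain J e where J: "finite J" "J \<subseteq> I" "0 < e"
    and P: "\<And>y z. y \<in> Y \<Longrightarrow> z \<in> Y \<Longrightarrow> (\<forall>i\<in>J. \<bar>y i - z i\<bar> < e) \<Longrightarrow> P (y, z)" by blast
  obtain i0 where i0: "i0 \<in> I" using assms by blast
  let ?X = "(\<lambda>i. (i, e)) ` insert i0 J"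
  have X: "?X \<subseteq> I \<times> {0<..}" "finite ?X" using J i0 by auto
  have "eventually P (INF p\<in>?X. principal (?D p))"
    unfolding INF_principal_finite[OF X(2)] eventually_principal
  proof
    fix q assume "q \<in> (\<Inter>p\<in>?X. ?D p)"
    then show "P q" using P[of "fst q" "snd q"] by (cases q) auto
  qed
  then show "eventually P (pointwise_uniformity Y I)"
    unfolding pointwise_uniformity_def eventually_INF[of _ _ "I \<times> {0<..}"]
    using X by (intro exI[of _ ?X]) (simp add: case_prod_beta)
qed

lemma entourages_pointwise_uniformity:
  assumes "I \<noteq> {}"
  shows "E \<in> entourages Y (pointwise_uniformity Y I) \<longleftrightarrow> E \<subseteq> Y \<times> Y \<and>
    (\<exists>J e. finite J \<and> J \<subseteq> I \<and> 0 < e \<and> (\<forall>y\<in>Y. \<forall>z\<in>Y. (\<forall>i\<in>J. \<bar>y i - z i\<bar> < e) \<longrightarrow> (y, z) \<in> E))"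
  unfolding entourages_def mem_Collect_eq eventually_pointwise_uniformity[OF assms] ..

lemma is_uniformity_pointwise:
  assumes I: "I \<noteq> {}"
  shows "is_uniformity_on Y (pointwise_uniformity Y I)"
  unfolding is_uniformity_on_def quasi_uniformity_on_def
proof (intro conjI ballI allI)
  show "pointwise_uniformity Y I \<le> principal (Y \<times> Y)"
    unfolding le_principal eventually_pointwise_uniformity[OF I]
    by (intro exI[of _ "{}"] exI[of _ 1]) auto
next
  fix E assume "E \<in> entourages Y (pointwise_uniformity Y I)"
  then obtain J e where J: "finite J" "J \<subseteq> I" "0 < e"
    and E: "\<And>y z. y \<in> Y \<Longrightarrow> z \<in> Y \<Longrightarrow> (\<forall>i\<in>J. \<bar>y i - z i\<bar> < e) \<Longrightarrow> (y, z) \<in> E"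
    unfolding entourages_pointwise_uniformity[OF I] by blast
  show "Id_on Y \<subseteq> E" using E J(3) by auto
  let ?E = "{(y, z). y \<in> Y \<and> z \<in> Y \<and> (\<forall>i\<in>J. \<bar>y i - z i\<bar> < e / 2)}"
  have "?E \<in> entourages Y (pointwise_uniformity Y I)"
    unfolding entourages_pointwise_uniformity[OF I] using J
    by (intro conjI exI[of _ J] exI[of _ "e / 2"]) auto
  moreover have "?E O ?E \<subseteq> E"
  proof clarify
    fix a b c assume *: "a \<in> Y" "b \<in> Y" "c \<in> Y" "\<forall>i\<in>J. \<bar>a i - b i\<bar> < e / 2" "\<forall>i\<in>J. \<bar>b i - c i\<bar> < e / 2"
    have "\<forall>i\<in>J. \<bar>a i - c i\<bar> < e"
    proof
      fix i assume "i \<in> J"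
      then have "\<bar>a i - b i\<bar> < e / 2" "\<bar>b i - c i\<bar> < e / 2" using * by auto
      then show "\<bar>a i - c i\<bar> < e" by linarith
    qed
    then show "(a, c) \<in> E" using E * by blast
  qed
  ultimately show "\<exists>E'\<in>entourages Y (pointwise_uniformity Y I). E' O E' \<subseteq> E" by blast
next
  have *: "E\<inverse> \<in> entourages Y (pointwise_uniformity Y I)" if E0: "E \<in> entourages Y (pointwise_uniformity Y I)" for E
  proof -
    obtain J e where J: "finite J" "J \<subseteq> I" "0 < e" and EY: "E \<subseteq> Y \<times> Y"
      and E: "\<And>y z. y \<in> Y \<Longrightarrow> z \<in> Y \<Longrightarrow> (\<forall>i\<in>J. \<bar>y i - z i\<bar> < e) \<Longrightarrow> (y, z) \<in> E"
      using E0 unfolding entourages_pointwise_uniformity[OF I] by blast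
    have "(y, z) \<in> E\<inverse>" if "y \<in> Y" "z \<in> Y" "\<forall>i\<in>J. \<bar>y i - z i\<bar> < e" for y z
      using E[of z y] that by (simp add: abs_minus_commute)
    moreover have "E\<inverse> \<subseteq> Y \<times> Y" using EY by blast
    ultimately show ?thesis
      unfolding entourages_pointwise_uniformity[OF I] using J by (intro conjI exI[of _ J] exI[of _ e]) simp_all
  qed
  show "E \<in> entourages Y (pointwise_uniformity Y I) \<longleftrightarrow> E\<inverse> \<in> entourages Y (pointwise_uniformity Y I)" for E
    using *[of E] *[of "E\<inverse>"] by auto
qed

text \<open>
Basic open sets of the product topology restrict finitely many coordinates.
\<close>

lemma compatible_pointwise_uniformity:
  assumes I: "I \<noteq> {}" and Y: "Y \<subseteq> extensional I"
  shows "compatible_with (subtopology (product_topology (\<lambda>_. euclideanreal) I) Y) (pointwise_uniformity Y I)"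
proof -
  let ?P = "product_topology (\<lambda>_. euclideanreal) I"
  have top: "topspace (subtopology ?P Y) = Y" using Y by (auto simp: PiE_def)
  show ?thesis
    unfolding compatible_with_def top
  proof (intro ballI allI impI iffI)
    fix x N assume x: "x \<in> Y" and "N \<subseteq> Y" and "\<exists>V. openin (subtopology ?P Y) V \<and> x \<in> V \<and> V \<subseteq> N"
    then obtain V where V: "openin ?P V" "x \<in> V" "V \<inter> Y \<subseteq> N" by (auto simp: openin_subtopology)
    have "\<forall>x\<in>V. \<exists>U. finite {i \<in> I. U i \<noteq> topspace euclideanreal} \<and> (\<forall>i\<in>I. openin euclideanreal (U i)) \<and>
        x \<in> PiE I U \<and> PiE I U \<subseteq> V"
      using V(1) by (simp only: openin_product_topology_alt)
    from bspec[OF this V(2)] obtain U where U: "finite {i \<in> I. U i \<noteq> topspace euclideanreal}"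
      "\<forall>i\<in>I. openin euclideanreal (U i)" "x \<in> PiE I U" "PiE I U \<subseteq> V"
      by (elim exE conjE)
    let ?J = "{i \<in> I. U i \<noteq> topspace euclideanreal}"
    have "\<forall>i\<in>?J. \<exists>e>0. \<forall>t. \<bar>x i - t\<bar> < e \<longrightarrow> t \<in> U i"
    proof
      fix i assume i: "i \<in> ?J"
      then have "open (U i)" "x i \<in> U i" using U(2,3) by (auto simp: PiE_def Pi_iff)
      then obtain e where "0 < e" "\<And>t. dist t (x i) < e \<Longrightarrow> t \<in> U i" unfolding open_dist by blast
      then show "\<exists>e>0. \<forall>t. \<bar>x i - t\<bar> < e \<longrightarrow> t \<in> U i" by (intro exI[of _ e]) (auto simp: dist_real_def abs_minus_commute)
    qed
    from bchoice[OF this] obtain e where e: "\<forall>i\<in>?J. 0 < e i \<and> (\<forall>t. \<bar>x i - t\<bar> < e i \<longrightarrow> t \<in> U i)" ..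
    let ?e = "Min (insert 1 (e ` ?J))"
    have e0: "0 < ?e" using U(1) e by (subst Min_gr_iff) auto
    let ?E = "{(y, z). y \<in> Y \<and> z \<in> Y \<and> (\<forall>i\<in>?J. \<bar>y i - z i\<bar> < ?e)}"
    have "?E \<in> entourages Y (pointwise_uniformity Y I)"
      unfolding entourages_pointwise_uniformity[OF I] using U(1) e0
      by (intro conjI exI[of _ ?J] exI[of _ ?e]) auto
    moreover have "?E `` {x} \<subseteq> N"
    proof
      fix z assume "z \<in> ?E `` {x}"
      then have z: "z \<in> Y" "\<forall>i\<in>?J. \<bar>x i - z i\<bar> < ?e" by auto
      have "z i \<in> U i" if i: "i \<in> I" for i
      proof (cases "i \<in> ?J")
        case True
        have "?e \<le> e i" using U(1) True by (intro Min_le) auto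
        then have "\<bar>x i - z i\<bar> < e i" using z(2) True by fastforce
        then show ?thesis using e True by blast
      qed (use i in auto)
      then have "z \<in> PiE I U" using z(1) Y by (auto simp: PiE_def)
      then show "z \<in> N" using U(4) V(3) z(1) by blast
    qed
    ultimately show "\<exists>E\<in>entourages Y (pointwise_uniformity Y I). E `` {x} \<subseteq> N" by blast
  next
    fix x N assume x: "x \<in> Y" and N: "N \<subseteq> Y" and "\<exists>E\<in>entourages Y (pointwise_uniformity Y I). E `` {x} \<subseteq> N"
    then obtain E where E: "E \<in> entourages Y (pointwise_uniformity Y I)" "E `` {x} \<subseteq> N" by blast
    then obtain J e where J: "finite J" "J \<subseteq> I" "0 < e"
      and JE: "\<And>y z. y \<in> Y \<Longrightarrow> z \<in> Y \<Longrightarrow> (\<forall>i\<in>J. \<bar>y i - z i\<bar> < e) \<Longrightarrow> (y, z) \<in> E"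
      unfolding entourages_pointwise_uniformity[OF I] by blast
    let ?V = "topspace ?P \<inter> \<Inter> ((\<lambda>i. {z \<in> topspace ?P. z i \<in> {x i - e<..<x i + e}}) ` J)"
    have "openin ?P ?V"
    proof (rule finite_Inter_openin)
      fix U assume "U \<in> (\<lambda>i. {z \<in> topspace ?P. z i \<in> {x i - e<..<x i + e}}) ` J"
      then obtain i where "i \<in> J" "U = {z \<in> topspace ?P. z i \<in> {x i - e<..<x i + e}}" by blast
      moreover have "openin ?P {z \<in> topspace ?P. z i \<in> {x i - e<..<x i + e}}" if "i \<in> I" for i
        using continuous_map_product_projection[OF that]
        by (rule openin_continuous_map_preimage) simp
      ultimately show "openin ?P U" using J(2) by blast
    qed (use J(1) in simp)
    then have "openin (subtopology ?P Y) (?V \<inter> Y)" by (rule openin_subtopology_Int)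
    moreover have "x \<in> ?V \<inter> Y" using x Y J(3) by (auto simp: PiE_def)
    moreover have "?V \<inter> Y \<subseteq> N"
    proof
      fix z assume z: "z \<in> ?V \<inter> Y"
      then have "\<forall>i\<in>J. \<bar>x i - z i\<bar> < e" by (auto simp: abs_less_iff)
      then have "(x, z) \<in> E" using JE x z by blast
      then show "z \<in> N" using E(2) by blast
    qed
    ultimately show "\<exists>V. openin (subtopology ?P Y) V \<and> x \<in> V \<and> V \<subseteq> N" by blast
  qed
qed

context seminormed_algebra
begin

section \<open>Quasi-uniformities on the adic space and the Berkovich space\<close>

lemma adic_quasi_uniformity_pervin: "adic_quasi_uniformity A N = pervin (adic_space A N) (rational_domains A N)"
  by (simp add: adic_quasi_uniformity_def pervin_def rational_entourage_def implication_entourage_def)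

lemma rational_domain_subset: "U \<in> rational_domains A N \<Longrightarrow> U \<subseteq> adic_space A N"
  unfolding rational_domains_def by blast

lemma compact_adic: "compact_space (adic_topology A N)"
  using compactin_rational_domain[OF adic_space_rational[OF ring_axioms]] by (simp add: compact_space_def topspace_adic)

theorem adic_quasi_uniformity_coarsest:
  "coarsest_compatible_quasi_uniformity (adic_topology A N) (adic_quasi_uniformity A N)"
  unfolding adic_quasi_uniformity_pervin adic_topology_def
  using adic_space_rational[OF ring_axioms] rational_domain_subset compactin_rational_domain[unfolded adic_topology_def]
  by (rule pervin_coarsest_compatible)

theorem adic_quasi_uniformity_complete: "complete_on (adic_space A N) (adic_quasi_uniformity A N)"
  using compatible_with_compact_complete[OF _ _ compact_adic, of "adic_quasi_uniformity A N"] adic_quasi_uniformity_coarsest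
  by (simp add: coarsest_compatible_quasi_uniformity_def topspace_adic)

theorem berkovich_uniformity_exists_unique:
  "\<exists>!W. is_uniformity_on (berkovich_space A N) W \<and> compatible_with (berkovich_topology A N) W"
proof (rule ex_ex1I)
  have ne: "carrier A \<noteq> {}" by auto
  show "\<exists>W. is_uniformity_on (berkovich_space A N) W \<and> compatible_with (berkovich_topology A N) W"
    unfolding berkovich_topology_def
    using is_uniformity_pointwise[OF ne] compatible_pointwise_uniformity[OF ne, of "berkovich_space A N"]
    by (auto simp: berkovich_space_def)
  show "W = W'" if "is_uniformity_on (berkovich_space A N) W \<and> compatible_with (berkovich_topology A N) W"
    "is_uniformity_on (berkovich_space A N) W' \<and> compatible_with (berkovich_topology A N) W'" for W W'
    using compact_uniformity_unique[OF compact_berkovich] that by (simp add: topspace_berkovich_topology)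
qed

theorem ad_to_an_uniformly_continuous:
  assumes "is_uniformity_on (berkovich_space A N) W" "compatible_with (berkovich_topology A N) W"
  shows "quasi_uniformly_continuous (adic_space A N) (adic_quasi_uniformity A N) (berkovich_space A N) W (ad_to_an A av \<kappa>)"
  using continuous_map_quasi_uniformly_continuous[OF _ _ compact_adic _ _ continuous_ad_to_an, of "adic_quasi_uniformity A N" W]
    adic_quasi_uniformity_coarsest assms
  by (simp add: coarsest_compatible_quasi_uniformity_def topspace_adic topspace_berkovich_topology)

theorem precompact_if_into_berkovich:
  assumes "\<And>x. x \<in> X \<Longrightarrow> i x \<in> berkovich_space A N"
  shows "precompact_on X (induced_quasi_uniformity X (\<lambda>x. an_to_ad A N (i x)) (adic_quasi_uniformity A N))"
  unfolding adic_quasi_uniformity_pervin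
  using an_to_ad_point(1) assms by (intro precompact_on_induced_pervin) blast

end

section \<open>Affinoid algebras\<close>

text \<open>
The ideal generated by \<open>I\<close> and \<open>a\<close> contains 1.
\<close>

lemma (in cring) maximalideal_inverse:
  assumes I: "maximalideal I R" and a: "a \<in> carrier R" "a \<notin> I"
  shows "\<exists>b\<in>carrier R. a \<otimes> b \<ominus> \<one> \<in> I"
proof -
  interpret I: maximalideal I R by fact
  let ?J = "I <+>\<^bsub>R\<^esub> PIdl a"
  have P: "ideal (PIdl a) R" using a(1) by (rule cgenideal_ideal)
  have J: "ideal ?J R" using I.is_ideal P by (rule add_ideals)
  have IJ: "I \<subseteq> ?J"
  proof
    fix x assume x: "x \<in> I"
    then have "x \<oplus> \<zero> \<in> ?J"
      unfolding set_add_def' using additive_subgroup.zero_closed[OF ideal.axioms(1)[OF P]] by blast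
    then show "x \<in> ?J" using I.Icarr[OF x] by simp
  qed
  have "\<zero> \<oplus> a \<in> ?J" unfolding set_add_def' using cgenideal_self[OF a(1)] I.zero_closed by blast
  then have aJ: "a \<in> ?J" using a by simp
  have "?J \<subseteq> carrier R" using ideal.Icarr[OF J] by blast
  then have "?J = carrier R" using I.I_maximal[OF J IJ] aJ a(2) by blast
  then have "\<one> \<in> ?J" by simp
  then obtain x b where xb: "x \<in> I" "b \<in> carrier R" "\<one> = x \<oplus> b \<otimes> a"
    unfolding set_add_def' cgenideal_def by blast
  have x: "x \<in> carrier R" using xb I.Icarr by blast
  have "a \<otimes> b \<ominus> \<one> = a \<otimes> b \<ominus> (x \<oplus> b \<otimes> a)" using xb(3) by simp
  also have "\<dots> = \<ominus> x" using x xb(2) a(1) by algebra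
  finally show ?thesis using xb(2) I.a_inv_closed[OF xb(1)] by (intro bexI[of _ b]) simp_all
qed

lemma le_mult_Inf:
  fixes u :: "'c \<Rightarrow> real" and v :: "'d \<Rightarrow> real"
  assumes "X \<noteq> {}" "Y \<noteq> {}" "\<And>x. 0 \<le> u x" "\<And>y. 0 \<le> v y" "\<And>x y. x \<in> X \<Longrightarrow> y \<in> Y \<Longrightarrow> t \<le> u x * v y"
  shows "t \<le> (INF x\<in>X. u x) * (INF y\<in>Y. v y)"
proof -
  have aux: "t \<le> (INF x\<in>X. u x) * s" if "0 \<le> s" "\<And>x. x \<in> X \<Longrightarrow> t \<le> u x * s" for s :: real
  proof (cases "s = 0")
    case True
    then show ?thesis using that(2) assms(1) by fastforce
  next
    case False
    then have s: "0 < s" using that by simp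
    have "t / s \<le> (INF x\<in>X. u x)" using that(2) s assms(1) by (intro cINF_greatest) (auto simp: field_simps)
    then show ?thesis using s by (simp add: field_simps)
  qed
  have "t \<le> u x * (INF y\<in>Y. v y)" if "x \<in> X" for x
  proof (cases "u x = 0")
    case True
    then show ?thesis using assms(2,5) that by fastforce
  next
    case False
    then have s: "0 < u x" using assms(3)[of x] by simp
    have "t / u x \<le> (INF y\<in>Y. v y)" using assms(2,5) that s by (intro cINF_greatest) (auto simp: field_simps)
    then show ?thesis using s by (simp add: field_simps)
  qed
  moreover have "0 \<le> (INF y\<in>Y. v y)" using assms(2,4) by (intro cINF_greatest) auto
  ultimately show ?thesis by (intro aux)
qed

context
  fixes av :: "'k::field \<Rightarrow> real" and n :: nat and I :: "((nat \<Rightarrow>\<^sub>0 nat) \<Rightarrow> 'k) set"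
  assumes av: "nonarch_absolute_value av" and I: "ideal I (tate_algebra av n)"
begin

abbreviation (input) "\<T> \<equiv> tate_algebra av n"
abbreviation (input) "\<A> \<equiv> affinoid_algebra av n I"

interpretation T: cring \<T> by (rule cring_tate_algebra[OF av])
interpretation I: ideal I \<T> by (rule I)
interpretation A: cring \<A> by (rule cring_affinoid_algebra[OF av I])

text \<open>
The projection to the quotient, from the type of power series.
\<close>

definition proj :: "'k mps \<Rightarrow> ((nat \<Rightarrow>\<^sub>0 nat) \<Rightarrow> 'k) set" where "proj F = I +>\<^bsub>\<T>\<^esub> mcoeff F"

lemma mcoeff_carrier: "F \<in> tate av n \<Longrightarrow> mcoeff F \<in> carrier \<T>"
  by (simp flip: tate_algebra_mps(1))

lemma proj_hom:
  "F \<in> tate av n \<Longrightarrow> proj F \<in> carrier \<A>"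
  "F \<in> tate av n \<Longrightarrow> G \<in> tate av n \<Longrightarrow> proj (F + G) = proj F \<oplus>\<^bsub>\<A>\<^esub> proj G"
  "F \<in> tate av n \<Longrightarrow> G \<in> tate av n \<Longrightarrow> proj (F * G) = proj F \<otimes>\<^bsub>\<A>\<^esub> proj G"
  "proj 1 = \<one>\<^bsub>\<A>\<^esub>"
  using ring_hom_closed[OF I.rcos_ring_hom, of "mcoeff F"] ring_hom_add[OF I.rcos_ring_hom, of "mcoeff F" "mcoeff G"]
    ring_hom_mult[OF I.rcos_ring_hom, of "mcoeff F" "mcoeff G"] ring_hom_one[OF I.rcos_ring_hom]
    mcoeff_carrier[of F] mcoeff_carrier[of G]
  by (simp_all add: proj_def affinoid_algebra_def tate_algebra_mps)

lemma proj_0: "proj 0 = \<zero>\<^bsub>\<A>\<^esub>"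
proof -
  have "(0 :: 'k mps) \<in> tate av n" using tate_mconst[OF av, of 0 n] by (simp add: mconst_def zero_mps_def)
  then have "proj 0 \<in> carrier \<A>" "proj 0 \<oplus>\<^bsub>\<A>\<^esub> proj 0 = proj 0" using proj_hom(1)[of 0] proj_hom(2)[of 0 0] by simp_all
  then show ?thesis by (metis A.add.r_cancel_one)
qed

lemma proj_mconst: "proj (mconst c) = affinoid_const av n I c"
  by (simp add: proj_def affinoid_const_def mconst_def)

lemma proj_surj: "f \<in> carrier \<A> \<Longrightarrow> \<exists>F\<in>tate av n. f = proj F"
proof -
  assume "f \<in> carrier \<A>"
  then obtain a where a: "a \<in> carrier \<T>" "f = I +>\<^bsub>\<T>\<^esub> a"
    unfolding affinoid_algebra_def FactRing_def A_RCOSETS_def' by auto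
  then show ?thesis by (intro bexI[of _ "MPS a"]) (simp_all add: proj_def tate_algebra_mps(1))
qed

lemma proj_member: "f \<in> carrier \<A> \<Longrightarrow> a \<in> f \<Longrightarrow> MPS a \<in> tate av n \<and> f = proj (MPS a)"
proof -
  assume f: "f \<in> carrier \<A>" and a: "a \<in> f"
  obtain F where F: "F \<in> tate av n" "f = I +>\<^bsub>\<T>\<^esub> mcoeff F" using proj_surj[OF f] unfolding proj_def by blast
  have "a \<in> carrier \<T>" using I.a_elemrcos_carrier[OF mcoeff_carrier[OF F(1)]] a F by blast
  moreover have "f = I +>\<^bsub>\<T>\<^esub> a" using I.a_repr_independence'[of a "mcoeff F"] a mcoeff_carrier[OF F(1)] F(2) by simp
  ultimately show ?thesis by (simp add: proj_def tate_algebra_mps(1))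
qed

lemma proj_self: "F \<in> tate av n \<Longrightarrow> mcoeff F \<in> proj F"
  unfolding proj_def by (intro I.a_rcos_self mcoeff_carrier)

lemma coeff_le_gauss: "F \<in> tate av n \<Longrightarrow> av (mcoeff F m) \<le> gauss_norm av (mcoeff F)"
proof -
  assume "F \<in> tate av n"
  then obtain k where k: "\<And>m. av (mcoeff F m) \<le> av (mcoeff F k)" using tate_max_coeff[OF av] by blast
  show ?thesis unfolding gauss_norm_def using k by (intro cSUP_upper bdd_aboveI[of _ "av (mcoeff F k)"]) auto
qed

lemma gauss_le: "(\<And>m. av (a m) \<le> t) \<Longrightarrow> gauss_norm av a \<le> t"
  unfolding gauss_norm_def by (intro cSUP_least) auto

lemma gauss_nonneg: "F \<in> tate av n \<Longrightarrow> 0 \<le> gauss_norm av (mcoeff F)"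
  using coeff_le_gauss[of F 0] av_nonneg[OF av, of "mcoeff F 0"] by linarith

lemma gauss_mult:
  assumes F: "F \<in> tate av n" "G \<in> tate av n"
  shows "gauss_norm av (mcoeff (F * G)) \<le> gauss_norm av (mcoeff F) * gauss_norm av (mcoeff G)"
proof (rule gauss_le)
  fix m
  show "av (mcoeff (F * G) m) \<le> gauss_norm av (mcoeff F) * gauss_norm av (mcoeff G)"
    unfolding times_mps_def mcoeff_MPS
    using F coeff_le_gauss gauss_nonneg av_nonneg[OF av]
    by (intro av_sum_le[OF av]) (auto simp: av_mult[OF av] intro!: mult_mono)
qed

lemma residue_norm_le: "F \<in> tate av n \<Longrightarrow> residue_norm av (proj F) \<le> gauss_norm av (mcoeff F)"
  unfolding residue_norm_def
proof (rule cINF_lower)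
  assume F: "F \<in> tate av n"
  show "bdd_below (gauss_norm av ` proj F)"
  proof (rule bdd_belowI)
    fix x assume "x \<in> gauss_norm av ` proj F"
    then obtain a where "a \<in> proj F" "x = gauss_norm av a" by blast
    then show "0 \<le> x" using proj_member[OF proj_hom(1)[OF F]] gauss_nonneg[of "MPS a"] by simp
  qed
qed (rule proj_self)

lemma residue_norm_greatest:
  assumes "f \<in> carrier \<A>" "\<And>F. F \<in> tate av n \<Longrightarrow> f = proj F \<Longrightarrow> t \<le> gauss_norm av (mcoeff F)"
  shows "t \<le> residue_norm av f"
  unfolding residue_norm_def
proof (rule cINF_greatest)
  show "f \<noteq> {}" using proj_surj[OF assms(1)] proj_self by blast
  show "t \<le> gauss_norm av a" if "a \<in> f" for a
    using proj_member[OF assms(1) that] assms(2)[of "MPS a"] by simp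
qed

lemma residue_norm_mult:
  assumes f: "f \<in> carrier \<A>" and g: "g \<in> carrier \<A>"
  shows "residue_norm av (f \<otimes>\<^bsub>\<A>\<^esub> g) \<le> residue_norm av f * residue_norm av g"
proof -
  have "residue_norm av (f \<otimes>\<^bsub>\<A>\<^esub> g) \<le> (INF a\<in>f. max 0 (gauss_norm av a)) * (INF b\<in>g. max 0 (gauss_norm av b))"
  proof (rule le_mult_Inf)
    show "f \<noteq> {}" "g \<noteq> {}" using proj_surj f g proj_self by blast+
    fix a b assume ab: "a \<in> f" "b \<in> g"
    have F: "MPS a \<in> tate av n" "f = proj (MPS a)" "MPS b \<in> tate av n" "g = proj (MPS b)"
      using proj_member f g ab by auto
    have "f \<otimes>\<^bsub>\<A>\<^esub> g = proj (MPS a * MPS b)" using F proj_hom(3)[OF F(1,3)] by simp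
    then have "residue_norm av (f \<otimes>\<^bsub>\<A>\<^esub> g) \<le> gauss_norm av (mcoeff (MPS a * MPS b))"
      using residue_norm_le[OF tate_closed(2)[OF av F(1,3)]] by simp
    also have "\<dots> \<le> gauss_norm av a * gauss_norm av b" using gauss_mult[OF F(1,3)] by simp
    finally show "residue_norm av (f \<otimes>\<^bsub>\<A>\<^esub> g) \<le> max 0 (gauss_norm av a) * max 0 (gauss_norm av b)"
      using gauss_nonneg[OF F(1)] gauss_nonneg[OF F(3)] by (simp add: max_absorb2)
  qed auto
  moreover have "(INF a\<in>h. max 0 (gauss_norm av a)) = residue_norm av h" if "h \<in> carrier \<A>" for h
    unfolding residue_norm_def
  proof (rule INF_cong)
    fix a assume "a \<in> h"
    then have "MPS a \<in> tate av n" using proj_member that by blast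
    then show "max 0 (gauss_norm av a) = gauss_norm av a" using gauss_nonneg[of "MPS a"] by simp
  qed simp
  ultimately show ?thesis using f g by simp
qed

lemma affinoid_seminormed:
  assumes dense: "\<And>x y. 0 < x \<Longrightarrow> x < y \<Longrightarrow> \<exists>c. x < av c \<and> av c < y"
  shows "seminormed_algebra \<A> (residue_norm av) av (affinoid_const av n I)"
proof
  show "\<exists>c. x < av c \<and> av c < y" if "0 < x" "x < y" for x y using dense that .
  note m = tate_mconst[OF av]
  show "affinoid_const av n I c \<in> carrier \<A>" for c
    unfolding proj_mconst[symmetric] by (rule proj_hom(1)[OF m])
  show "affinoid_const av n I (c * d) = affinoid_const av n I c \<otimes>\<^bsub>\<A>\<^esub> affinoid_const av n I d" for c d
    unfolding proj_mconst[symmetric] mconst_hom by (rule proj_hom(3)[OF m m])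
  show "affinoid_const av n I 1 = \<one>\<^bsub>\<A>\<^esub>" unfolding proj_mconst[symmetric] mconst_hom by (rule proj_hom(4))
  have "mconst (0 :: 'k) = 0" by (simp add: mconst_def zero_mps_def)
  then show "affinoid_const av n I 0 = \<zero>\<^bsub>\<A>\<^esub>" using proj_mconst[of 0] proj_0 by simp
  show "0 \<le> residue_norm av f" if "f \<in> carrier \<A>" for f
    using that by (rule residue_norm_greatest) (rule gauss_nonneg)
  show "residue_norm av (affinoid_const av n I c) \<le> av c" for c
  proof -
    have "gauss_norm av (mcoeff (mconst c)) \<le> av c"
      by (rule gauss_le) (simp add: mconst_def av_0[OF av] av_nonneg[OF av])
    then show ?thesis using residue_norm_le[OF m[of c]] unfolding proj_mconst by linarith
  qed
  show "residue_norm av (f \<otimes>\<^bsub>\<A>\<^esub> g) \<le> residue_norm av f * residue_norm av g" if "f \<in> carrier \<A>" "g \<in> carrier \<A>" for f g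
    using that by (rule residue_norm_mult)
qed (rule av)

text \<open>
By the Nullstellensatz evaluation at \<open>M\<close> is a ring homomorphism \<open>\<theta>\<close> to the ground field.  It is bounded by the residue
norm: if a representative \<open>F\<close> of \<open>f\<close> had Gauss norm less than \<open>|\<theta> f|\<close>, then \<open>1 - F/\<theta> f\<close> would be a unit, by the geometric
series, although it vanishes at \<open>M\<close>.
\<close>

lemma spm_to_an_berkovich:
  assumes c: "Metric_space.mcomplete UNIV (\<lambda>x y. av (x - y))"
    and closed: "\<And>P :: 'k poly. 0 < degree P \<Longrightarrow> \<exists>x. poly P x = 0"
    and dense: "\<And>x y. 0 < x \<Longrightarrow> x < y \<Longrightarrow> \<exists>c. x < av c \<and> av c < y"
    and M: "M \<in> Spm \<A>"
  shows "spm_to_an \<A> av (affinoid_const av n I) M \<in> berkovich_space \<A> (residue_norm av)"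
proof -
  interpret S: seminormed_algebra \<A> "residue_norm av" av "affinoid_const av n I"
    using dense by (rule affinoid_seminormed)
  let ?\<kappa> = "affinoid_const av n I"
  have max: "maximalideal M \<A>" using M by (simp add: Spm_def)
  interpret M: maximalideal M \<A> by (rule max)
  define K where "K = {F \<in> tate av n. proj F \<in> M}"
  have oneM: "\<one>\<^bsub>\<A>\<^esub> \<notin> M" using M.I_notcarr M.one_imp_carrier by blast
  have zeroT: "(0 :: 'k mps) \<in> tate av n" using tate_mconst[OF av, of 0 n] by (simp add: mconst_def zero_mps_def)
  have oneT: "(1 :: 'k mps) \<in> tate av n" using tate_mconst[OF av, of 1 n] by (simp add: mconst_hom)
  have minus: "proj (F - G) = proj F \<ominus>\<^bsub>\<A>\<^esub> proj G" if "F \<in> tate av n" "G \<in> tate av n" for F G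
  proof -
    have "F - G \<in> tate av n" using tate_closed[OF av that] by simp
    then have "proj (F - G) \<in> carrier \<A>" "proj F = proj (F - G) \<oplus>\<^bsub>\<A>\<^esub> proj G"
      using proj_hom(1) proj_hom(2)[of "F - G" G] that by simp_all
    moreover have "proj G \<in> carrier \<A>" using proj_hom(1) that by blast
    ultimately show ?thesis by (simp add: A.minus_eq A.add.m_assoc A.r_neg)
  qed
  obtain w where w: "0 < av w" "av w < 1" using dense[of "1/2" 1] by force
  have K1: "1 \<notin> K" using oneM by (simp add: K_def proj_hom(4))
  have Kadd: "F + G \<in> K" if "F \<in> K" "G \<in> K" for F G
    using that tate_closed[OF av] by (simp add: K_def proj_hom(2) M.a_closed)
  have Kmult: "F * G \<in> K" if "F \<in> tate av n" "G \<in> K" for F G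
    using that tate_closed[OF av] M.I_l_closed proj_hom(1)[of F] by (simp add: K_def proj_hom(3))
  have Kinv: "\<exists>G\<in>tate av n. F * G - 1 \<in> K" if F: "F \<in> tate av n" "F \<notin> K" for F
  proof -
    have "proj F \<in> carrier \<A>" "proj F \<notin> M" using F proj_hom(1) by (auto simp: K_def)
    then obtain b where b: "b \<in> carrier \<A>" "proj F \<otimes>\<^bsub>\<A>\<^esub> b \<ominus>\<^bsub>\<A>\<^esub> \<one>\<^bsub>\<A>\<^esub> \<in> M"
      using A.maximalideal_inverse[OF max] by blast
    obtain G where G: "G \<in> tate av n" "b = proj G" using proj_surj[OF b(1)] by blast
    have FG: "F * G \<in> tate av n" using tate_closed(2)[OF av F(1) G(1)] .
    have "proj (F * G - 1) \<in> M"
      using b(2) unfolding minus[OF FG oneT] proj_hom(3)[OF F(1) G(1)] proj_hom(4) G(2) .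
    then show ?thesis using G(1) tate_closed(4)[OF av FG oneT] by (auto simp: K_def)
  qed
  have K0: "0 \<in> K" using zeroT by (simp add: K_def proj_0)
  have null: "\<exists>c. F - mconst c \<in> K" if F: "F \<in> tate av n" for F
  proof (rule tate_nullstellensatz[OF av c closed w _ K0 K1 Kadd Kmult Kinv F])
    show "K \<subseteq> tate av n" by (auto simp: K_def)
  qed
  define \<theta> where "\<theta> f = spm_eval \<A> ?\<kappa> f M" for f
  have uniq: "c = d" if fcd: "f \<in> carrier \<A>" "f \<ominus>\<^bsub>\<A>\<^esub> ?\<kappa> c \<in> M" "f \<ominus>\<^bsub>\<A>\<^esub> ?\<kappa> d \<in> M" for f c d
  proof (rule ccontr)
    assume "c \<noteq> d"
    obtain F where F: "F \<in> tate av n" "f = proj F" using proj_surj[OF fcd(1)] by blast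
    note m = tate_mconst[OF av]
    have "F - mconst c \<in> K" "F - mconst d \<in> K"
      using fcd(2,3) F tate_closed(4)[OF av F(1) m] minus[OF F(1) m] by (simp_all add: K_def proj_mconst)
    moreover have "mconst (inverse (c - d)) * (- 1) \<in> tate av n" "mconst (inverse (c - d)) * 1 \<in> tate av n"
      using m oneT tate_closed[OF av] by blast+
    ultimately have "mconst (inverse (c - d)) * (- 1) * (F - mconst c) + mconst (inverse (c - d)) * 1 * (F - mconst d) \<in> K"
      using Kadd Kmult by blast
    moreover have "mconst (inverse (c - d)) * (- 1) * (F - mconst c) + mconst (inverse (c - d)) * 1 * (F - mconst d)
      = mconst (inverse (c - d)) * (mconst c - mconst d)" by (simp add: algebra_simps)
    moreover have "\<dots> = mconst (inverse (c - d)) * mconst (c - d)"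
    proof -
      have "mconst c = mconst (c - d) + mconst d" by (simp add: mconst_hom(1)[symmetric])
      then show ?thesis by simp
    qed
    moreover have "\<dots> = 1" using \<open>c \<noteq> d\<close> by (simp add: mconst_hom(2)[symmetric] mconst_hom(3))
    ultimately show False using K1 by simp
  qed
  have \<theta>: "\<theta> f = c" if "f \<in> carrier \<A>" "f \<ominus>\<^bsub>\<A>\<^esub> ?\<kappa> c \<in> M" for f c
    unfolding \<theta>_def spm_eval_def using uniq[OF that(1)] that by blast
  have \<theta>_proj: "\<theta> (proj F) = c" if "F \<in> tate av n" "F - mconst c \<in> K" for F c
    using that \<theta>[OF proj_hom(1)[OF that(1)], of c] minus[OF that(1) tate_mconst[OF av]]
    by (simp add: K_def proj_mconst)
  have repr: "\<exists>F\<in>tate av n. \<exists>c. f = proj F \<and> F - mconst c \<in> K \<and> \<theta> f = c" if "f \<in> carrier \<A>" for f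
    using proj_surj[OF that] null \<theta>_proj by metis
  have ev_const: "\<theta> (proj (mconst c)) = c" for c using K0 \<theta>_proj[OF tate_mconst[OF av], of c c] by simp
  have \<theta>_mult: "\<theta> (f \<otimes>\<^bsub>\<A>\<^esub> g) = \<theta> f * \<theta> g" and \<theta>_add: "\<theta> (f \<oplus>\<^bsub>\<A>\<^esub> g) = \<theta> f + \<theta> g"
    if fg: "f \<in> carrier \<A>" "g \<in> carrier \<A>" for f g
  proof -
    obtain F c where F: "F \<in> tate av n" "f = proj F" "F - mconst c \<in> K" "\<theta> f = c" using repr[OF fg(1)] by blast
    obtain G d where G: "G \<in> tate av n" "g = proj G" "G - mconst d \<in> K" "\<theta> g = d" using repr[OF fg(2)] by blast
    have "G * (F - mconst c) + mconst c * (G - mconst d) \<in> K"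
      using Kadd Kmult F G tate_mconst[OF av] by blast
    moreover have "G * (F - mconst c) + mconst c * (G - mconst d) = F * G - mconst (c * d)"
      by (simp add: mconst_hom algebra_simps)
    ultimately have "\<theta> (proj (F * G)) = c * d" using \<theta>_proj[OF tate_closed(2)[OF av F(1) G(1)]] by simp
    then show "\<theta> (f \<otimes>\<^bsub>\<A>\<^esub> g) = \<theta> f * \<theta> g" using F G proj_hom(3)[OF F(1) G(1)] by simp
    have "(F - mconst c) + (G - mconst d) \<in> K" using Kadd F G by blast
    moreover have "(F - mconst c) + (G - mconst d) = (F + G) - mconst (c + d)" by (simp add: mconst_hom)
    ultimately have "\<theta> (proj (F + G)) = c + d" using \<theta>_proj[OF tate_closed(1)[OF av F(1) G(1)]] by simp
    then show "\<theta> (f \<oplus>\<^bsub>\<A>\<^esub> g) = \<theta> f + \<theta> g" using F G proj_hom(2)[OF F(1) G(1)] by simp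
  qed
  have bound: "av (\<theta> f) \<le> residue_norm av f" if f: "f \<in> carrier \<A>" for f
  proof (rule residue_norm_greatest[OF f], rule ccontr)
    fix F assume F: "F \<in> tate av n" "f = proj F" and "\<not> av (\<theta> f) \<le> gauss_norm av (mcoeff F)"
    then have less: "gauss_norm av (mcoeff F) < av (\<theta> f)" by simp
    let ?c = "\<theta> f"
    have c0: "?c \<noteq> 0" using less gauss_nonneg[OF F(1)] av_0[OF av] by auto
    obtain c' where "F - mconst c' \<in> K" using null[OF F(1)] by blast
    then have FK: "F - mconst ?c \<in> K" using \<theta>_proj[OF F(1)] F(2) by metis
    obtain k where k: "\<And>m. av (mcoeff F m) \<le> av (mcoeff F k)" using tate_max_coeff[OF av F(1)] by blast
    define u where "u = mcoeff F k / ?c"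
    have u1: "av u < 1" using coeff_le_gauss[OF F(1), of k] less av_pos[OF av c0] by (simp add: u_def av_divide[OF av])
    let ?F = "mconst (inverse ?c) * F"
    have FT: "?F \<in> tate av n" using tate_closed(2)[OF av tate_mconst[OF av] F(1)] .
    have co: "av (mcoeff ?F m) \<le> av u" for m
      using k[of m] av_pos[OF av c0]
      by (simp only: mcoeff_mconst_mult av_mult[OF av] av_inverse[OF av] u_def av_divide[OF av]) (simp add: field_simps)
    have "\<exists>b\<in>tate_ball av n. ?F = mconst u * b"
    proof (cases "u = 0")
      case True
      have "mcoeff ?F m = 0" for m
        using co[of m] av_nonneg[OF av, of "mcoeff ?F m"] av_eq_0[OF av, of "mcoeff ?F m"] by (simp add: True av_0[OF av])
      then have "?F = mconst u * 0" by (intro mps_eqI) simp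
      moreover have "(0 :: 'k mps) \<in> tate_ball av n" using zeroT by (simp add: tate_ball_def av_0[OF av])
      ultimately show ?thesis by blast
    next
      case False
      show ?thesis using tate_scaled_ball[OF av FT False co] by blast
    qed
    then obtain b where b: "b \<in> tate_ball av n" "?F = mconst u * b" by blast
    obtain g where g: "g \<in> tate av n" "(1 - ?F) * g = 1" using tate_one_minus_invertible[OF av c u1 b(1)] b(2) by metis
    have inv: "mconst (inverse ?c) * mconst ?c = 1" using c0 by (simp add: mconst_hom(2)[symmetric] mconst_hom(3))
    have gT: "g * mconst (inverse ?c) \<in> tate av n" by (rule tate_closed(2)[OF av g(1) tate_mconst[OF av]])
    then have "- (g * mconst (inverse ?c)) \<in> tate av n" by (rule tate_closed(3)[OF av _ gT])
    then have "- (g * mconst (inverse ?c)) * (F - mconst ?c) \<in> K" using Kmult FK by blast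
    moreover have "- (g * mconst (inverse ?c)) * (F - mconst ?c) = g * (mconst (inverse ?c) * mconst ?c) - g * ?F"
      by (simp add: algebra_simps)
    moreover have "\<dots> = (1 - ?F) * g" unfolding inv by (simp add: algebra_simps)
    ultimately have "1 \<in> K" using g(2) by simp
    then show False using K1 by simp
  qed
  have an: "spm_to_an \<A> av ?\<kappa> M = (\<lambda>f\<in>carrier \<A>. av (\<theta> f))" by (simp add: spm_to_an_def \<theta>_def)
  have z: "\<theta> \<zero>\<^bsub>\<A>\<^esub> = 0" using ev_const[of 0] proj_0 by (simp add: mconst_def zero_mps_def)
  have o: "\<theta> \<one>\<^bsub>\<A>\<^esub> = 1" using ev_const[of 1] by (simp add: mconst_hom proj_hom(4))
  show ?thesis
    unfolding berkovich_space_def an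
  proof (intro CollectI conjI ballI exI[of _ 1])
    show "(\<lambda>f\<in>carrier \<A>. av (\<theta> f)) \<in> extensional (carrier \<A>)" by simp
  qed (simp_all add: z o av_0[OF av] av_1[OF av] av_nonneg[OF av] \<theta>_mult \<theta>_add av_mult[OF av] av_ultra[OF av] bound)
qed

end

theorem proposition2p4p1:
  fixes p n :: nat
    and av :: "'k::field_char_0 \<Rightarrow> real"
    and I :: "((nat \<Rightarrow>\<^sub>0 nat) \<Rightarrow> 'k) set"
  assumes "prime p" and "is_Cp p av" and "ideal I (tate_algebra av n)"
  shows
    "let A = affinoid_algebra av n I; N = residue_norm av; \<kappa> = affinoid_const av n I;
         Xad = adic_space A N; U = adic_quasi_uniformity A N;
         Xan = berkovich_space A N; r = ad_to_an A av \<kappa>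
     in coarsest_compatible_quasi_uniformity (adic_topology A N) U \<and>
        complete_on Xad U \<and>
        (continuous_map (adic_topology A N) (berkovich_topology A N) r \<and>
         (\<forall>y\<in>Xan. an_to_ad A N y \<in> Xad \<and> r (an_to_ad A N y) = y) \<and>
         (\<exists>!W. is_uniformity_on Xan W \<and> compatible_with (berkovich_topology A N) W) \<and>
         (\<forall>W. is_uniformity_on Xan W \<and> compatible_with (berkovich_topology A N) W \<longrightarrow>
              quasi_uniformly_continuous Xad U Xan W r)) \<and>
        precompact_on (Spm A) (induced_quasi_uniformity (Spm A) (spm_to_ad A N av \<kappa>) U)"
proof -
  note av = Cp_av[OF assms(1,2)] and dense = Cp_values_dense[OF assms(1,2)]
  interpret S: seminormed_algebra "affinoid_algebra av n I" "residue_norm av" av "affinoid_const av n I"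
    using av assms(3) dense by (rule affinoid_seminormed)
  have spm: "spm_to_an (affinoid_algebra av n I) av (affinoid_const av n I) M
      \<in> berkovich_space (affinoid_algebra av n I) (residue_norm av)" if "M \<in> Spm (affinoid_algebra av n I)" for M
    using av assms(3) Cp_complete[OF assms(1,2)] Cp_algebraically_closed[OF assms(1,2)] dense that
    by (rule spm_to_an_berkovich)
  have "spm_to_ad (affinoid_algebra av n I) (residue_norm av) av (affinoid_const av n I) =
      (\<lambda>M. an_to_ad (affinoid_algebra av n I) (residue_norm av) (spm_to_an (affinoid_algebra av n I) av (affinoid_const av n I) M))"
    by (simp add: spm_to_ad_def fun_eq_iff)
  then have "precompact_on (Spm (affinoid_algebra av n I)) (induced_quasi_uniformity (Spm (affinoid_algebra av n I))
      (spm_to_ad (affinoid_algebra av n I) (residue_norm av) av (affinoid_const av n I))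
      (adic_quasi_uniformity (affinoid_algebra av n I) (residue_norm av)))"
    using S.precompact_if_into_berkovich[of "Spm (affinoid_algebra av n I)", OF spm] by simp
  then show ?thesis
    unfolding Let_def
    using S.adic_quasi_uniformity_coarsest S.adic_quasi_uniformity_complete S.continuous_ad_to_an
      S.an_to_ad_point(1) S.retraction_an_to_ad S.berkovich_uniformity_exists_unique S.ad_to_an_uniformly_continuous
    by blast
qed

end
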